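(* Let $d\ge1$, $\alpha\in(0,2)$, let $\dot W^\alpha$ be a symmetric $\alpha$-stable Lévy white noise on $\mathbb{R}_+\times\mathbb{R}^d$, and consider the stochastic wave equation $$\frac{\partial^2u}{\partial t^2}-\sum_{i=1}^d\frac{\partial^2u}{\partial x_i^2}=\dot W^\alpha,\qquad u(0,\cdot)=0,\qquad\frac{\partial u}{\partial t}(0,\cdot)=0,$$ with $\rho_d^{\mathcal{O}}$ the fundamental solution of the wave operator with support in the forward light cone. The generalized solution $u_{\text{gen}}$, defined by $\langle u_{\text{gen}},\varphi\rangle:=\langle\dot W^\alpha,\varphi*\check\rho_d^{\mathcal{O}}\rangle$ for all $\varphi\in\mathcal{D}(\mathbb{R}^{d+1})$, always exists. The mild solution $u_{\text{mild}}$, defined by $u_{\text{mild}}(t,x):=\langle\dot W^\alpha,\rho_d^{\mathcal{O}}(t-\cdot,x-\cdot)\rangle$, exists if and only if $d\le2$. Furthermore, a random field representation $Y$ of the generalized solution exists if and only if $d\le2$, and in this case, for almost all $(t,x)\in\mathbb{R}_+\times\mathbb{R}^d$, $$Y_{t,x}=\langle\dot W^\alpha,\rho_d^{\mathcal{O}}(t-\cdot,x-\cdot)\rangle=u_{\text{mild}}(t,x)\qquad\text{a.s.}$$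
   Context: The fundamental solution $\rho_d^{\mathcal{O}}\in\mathcal{D}'(\mathbb{R}^{d+1})$ of $\mathcal{O}=\frac{\partial^2}{\partial t^2}-\sum_{i=1}^d\frac{\partial^2}{\partial x_i^2}$ with support in the forward light cone $\{(t,x):|x|\le t\}$ is $$\rho_1^{\mathcal{O}}(t,x)=\tfrac12\mathbf{1}_{|x|\le t},\qquad\rho_2^{\mathcal{O}}(t,x)=\frac1{2\pi}\frac{1}{\sqrt{t^2-|x|^2}}\mathbf{1}_{|x|<t},$$ and for $d\ge3$ it is a distribution that is not a function, characterized by its Fourier transform in the space variable, $\xi\mapsto\frac{\sin(t|\xi|)}{|\xi|}\mathbf{1}_{t>0}$. Put $S=\mathbb{R}_+\times\mathbb{R}^d\subset\mathbb{R}^{d+1}$. $\mathcal{D}(\mathbb{R}^{d+1})$ is the space of (real-valued) $C^\infty$ compactly supported functions on $\mathbb{R}^{d+1}$. For a distribution $\rho$ on $\mathbb{R}^{d+1}$ and $\varphi\in\mathcal{D}(\mathbb{R}^{d+1})$, $(\varphi*\check\rho)(t,x)=\langle\rho,\varphi((t,x)+\cdot)\rangle$, a $C^\infty$ function. For $\alpha\in(0,2)$, $L^\alpha(S)$ is the set of measurable $f$ with $\int_S|f|^\alpha<\infty$. Symmetric $\alpha$-stable Lévy white noise on $S$: $\dot W^\alpha$ is an independently scattered symmetric $\alpha$-stable random measure on $S$ with $\mathbb{E}(e^{iu\dot W^\alpha(A)})=\exp(-\mathrm{Leb}(A)|u|^\alpha)$, $u\in\mathbb{R}$, for Borel $A\subset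 S$ of finite Lebesgue measure. A deterministic measurable function $f$ is integrable with respect to $\dot W^\alpha$ iff $f\in L^\alpha(S)$; the integral $\langle\dot W^\alpha,f\rangle$ is a.s. linear in $f$ with $\mathbb{E}(e^{i\langle\dot W^\alpha,f\rangle})=\exp(-\int_S|f|^\alpha)$. "The generalized solution exists" means that $\varphi*\check\rho_d^{\mathcal{O}}\in L^\alpha(S)$ for all $\varphi\in\mathcal{D}(\mathbb{R}^{d+1})$. "The mild solution exists" means that $\rho_d^{\mathcal{O}}$ is (represented by) a function and $\rho_d^{\mathcal{O}}(t-\cdot,x-\cdot)\in L^\alpha(S)$ for all $(t,x)$. A random field representation of a generalized stochastic process $u$ (a linear map $\mathcal{D}(\mathbb{R}^{d+1})\to L^0(\Omega)$) is a jointly measurable random field $(Y_{t,x})_{(t,x)\in\mathbb{R}^{d+1}}$ with almost surely locally integrable sample paths such that, for every $\varphi\in\mathcal{D}(\mathbb{R}^{d+1})$, $\langle u,\varphi\rangle=\int_{\mathbb{R}^{d+1}}Y_{t,x}\varphi(t,x)\,\mathrm{d}t\,\mathrm{d}x$ a.s. *)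

theory Defs
  imports "HOL-Probability.Probability"
begin

section \<open>Test functions and distributions\<close>

definition pderiv_dir :: "'a::euclidean_space \<Rightarrow> ('a \<Rightarrow> real) \<Rightarrow> 'a \<Rightarrow> real" where
  "pderiv_dir v f = (\<lambda>z. frechet_derivative f (at z) v)"

text \<open>Total differentiability of every iterated partial derivative makes each of them
  continuous, so the following is the usual class of infinitely differentiable functions.\<close>

definition smooth :: "('a::euclidean_space \<Rightarrow> real) \<Rightarrow> bool" where
  "smooth f \<longleftrightarrow> (\<forall>vs. set vs \<subseteq> Basis \<longrightarrow> (\<forall>z. foldr pderiv_dir vs f differentiable (at z)))"

definition fun_supp :: "('a::euclidean_space \<Rightarrow> real) \<Rightarrow> 'a set" where
  "fun_supp f = closure {z. f z \<noteq> 0}"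

definition test_functions :: "('a::euclidean_space \<Rightarrow> real) set" where
  "test_functions = {f. smooth f \<and> compact (fun_supp f)}"

text \<open>A distribution is a functional of which only the values on test functions matter.
  Continuity is the usual seminorm estimate on each compact set: the bound \<open>B\<close> ranges over the
  upper bounds of all sup norms of the partial derivatives of order at most \<open>N\<close>.\<close>

definition distribution :: "(('a::euclidean_space \<Rightarrow> real) \<Rightarrow> real) \<Rightarrow> bool" where
  "distribution \<rho> \<longleftrightarrow>
     (\<forall>\<phi>\<in>test_functions. \<forall>\<psi>\<in>test_functions. \<rho> (\<lambda>z. \<phi> z + \<psi> z) = \<rho> \<phi> + \<rho> \<psi>) \<and>
     (\<forall>\<phi>\<in>test_functions. \<forall>c. \<rho> (\<lambda>z. c * \<phi> z) = c * \<rho> \<phi>) \<and>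
     (\<forall>K. compact K \<longrightarrow> (\<exists>(N::nat) C. \<forall>\<phi>\<in>test_functions. fun_supp \<phi> \<subseteq> K \<longrightarrow>
        (\<forall>B. (\<forall>vs. set vs \<subseteq> Basis \<and> length vs \<le> N \<longrightarrow> (\<forall>z. \<bar>foldr pderiv_dir vs \<phi> z\<bar> \<le> B))
             \<longrightarrow> \<bar>\<rho> \<phi>\<bar> \<le> C * B)))"

text \<open>For closed \<open>A\<close>: the support of \<open>\<rho>\<close> is contained in \<open>A\<close>.\<close>

definition dist_supported_in ::
    "(('a::euclidean_space \<Rightarrow> real) \<Rightarrow> real) \<Rightarrow> 'a set \<Rightarrow> bool" where
  "dist_supported_in \<rho> A \<longleftrightarrow>
     (\<forall>\<phi>\<in>test_functions. fun_supp \<phi> \<inter> A = {} \<longrightarrow> \<rho> \<phi> = 0)"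

definition locally_integrable :: "('a::euclidean_space \<Rightarrow> real) \<Rightarrow> bool" where
  "locally_integrable f \<longleftrightarrow>
     f \<in> borel_measurable borel \<and> (\<forall>K. compact K \<longrightarrow> set_integrable lborel K f)"

definition represented_by ::
    "(('a::euclidean_space \<Rightarrow> real) \<Rightarrow> real) \<Rightarrow> ('a \<Rightarrow> real) \<Rightarrow> bool" where
  "represented_by \<rho> f \<longleftrightarrow>
     locally_integrable f \<and> (\<forall>\<phi>\<in>test_functions. \<rho> \<phi> = (\<integral>z. f z * \<phi> z \<partial>lborel))"

definition conv_check ::
    "('a::euclidean_space \<Rightarrow> real) \<Rightarrow> (('a \<Rightarrow> real) \<Rightarrow> real) \<Rightarrow> 'a \<Rightarrow> real" where
  "conv_check \<phi> \<rho> = (\<lambda>z. \<rho> (\<lambda>w. \<phi> (z + w)))"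

section \<open>The wave operator\<close>

definition wave_op :: "(real \<times> (real^'n) \<Rightarrow> real) \<Rightarrow> real \<times> (real^'n) \<Rightarrow> real" where
  "wave_op \<phi> z =
     pderiv_dir (1, 0) (pderiv_dir (1, 0) \<phi>) z
     - (\<Sum>i\<in>UNIV. pderiv_dir (0, axis i 1) (pderiv_dir (0, axis i 1) \<phi>) z)"

text \<open>Derivatives of distributions are defined by duality and the wave operator only has terms of
  order two, so \<open>\<rho> (wave_op \<phi>)\<close> is the value at \<open>\<phi>\<close> of the wave operator applied to \<open>\<rho>\<close>, and
  the second condition says that this distribution is the Dirac mass at the origin.
  The three conditions determine \<open>\<rho>\<close> uniquely on test functions.\<close>

definition wave_fundamental_solution :: "((real \<times> (real^'n) \<Rightarrow> real) \<Rightarrow> real) \<Rightarrow> bool" where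
  "wave_fundamental_solution \<rho> \<longleftrightarrow>
     distribution \<rho> \<and>
     (\<forall>\<phi>\<in>test_functions. \<rho> (wave_op \<phi>) = \<phi> 0) \<and>
     dist_supported_in \<rho> {(t, x). norm x \<le> t}"

section \<open>Symmetric stable white noise and its stochastic integral\<close>

definition half_space :: "(real \<times> (real^'n)) set" where
  "half_space = {0..} \<times> UNIV"

definition finite_borel :: "(real \<times> (real^'n)) set set" where
  "finite_borel = {A \<in> sets borel. A \<subseteq> half_space \<and> emeasure lborel A < \<infinity>}"

definition L_space :: "real \<Rightarrow> (real \<times> (real^'n) \<Rightarrow> real) set" where
  "L_space \<alpha> = {f \<in> borel_measurable (restrict_space lborel half_space).
     (\<integral>\<^sup>+ z. ennreal (\<bar>f z\<bar> powr \<alpha>) \<partial>restrict_space lborel half_space) < \<infinity>}"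

definition stable_white_noise ::
    "'w measure \<Rightarrow> real \<Rightarrow> ((real \<times> (real^'n)) set \<Rightarrow> 'w \<Rightarrow> real) \<Rightarrow> bool" where
  "stable_white_noise M \<alpha> W \<longleftrightarrow>
     (\<forall>A\<in>finite_borel. W A \<in> borel_measurable M) \<and>
     (\<forall>A :: nat \<Rightarrow> _. range A \<subseteq> finite_borel \<and> disjoint_family A \<longrightarrow>
        prob_space.indep_vars M (\<lambda>_. borel) (\<lambda>n. W (A n)) UNIV) \<and>
     (\<forall>A :: nat \<Rightarrow> _. range A \<subseteq> finite_borel \<and> disjoint_family A \<and> (\<Union>n. A n) \<in> finite_borel \<longrightarrow>
        (AE \<omega> in M. (\<lambda>n. W (A n) \<omega>) sums W (\<Union>n. A n) \<omega>)) \<and>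
     (\<forall>A\<in>finite_borel. \<forall>u::real.
        char (distr M borel (W A)) u
          = complex_of_real (exp (- measure lborel A * \<bar>u\<bar> powr \<alpha>)))"

definition simple_stoch_integral ::
    "((real \<times> (real^'n)) set \<Rightarrow> 'w \<Rightarrow> real) \<Rightarrow> (real \<times> (real^'n) \<Rightarrow> real) \<Rightarrow> 'w \<Rightarrow> real" where
  "simple_stoch_integral W s = (\<lambda>\<omega>. \<Sum>y\<in>s ` half_space - {0}. y * W {z\<in>half_space. s z = y} \<omega>)"

text \<open>The integral of \<open>f\<close> is the limit in probability of the integrals of simple functions that
  approximate \<open>f\<close> in \<open>L_space \<alpha>\<close>.\<close>

definition has_stoch_integral ::
    "'w measure \<Rightarrow> real \<Rightarrow> ((real \<times> (real^'n)) set \<Rightarrow> 'w \<Rightarrow> real) \<Rightarrow>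
     (real \<times> (real^'n) \<Rightarrow> real) \<Rightarrow> ('w \<Rightarrow> real) \<Rightarrow> bool" where
  "has_stoch_integral M \<alpha> W f X \<longleftrightarrow>
     f \<in> L_space \<alpha> \<and> X \<in> borel_measurable M \<and>
     (\<exists>s :: nat \<Rightarrow> _.
        (\<forall>n. simple_function (restrict_space lborel half_space) (s n) \<and> s n \<in> L_space \<alpha>) \<and>
        (\<lambda>n. \<integral>\<^sup>+ z. ennreal (\<bar>f z - s n z\<bar> powr \<alpha>) \<partial>restrict_space lborel half_space)
           \<longlonglongrightarrow> 0 \<and>
        (\<forall>\<epsilon>>0. (\<lambda>n. measure M {\<omega>\<in>space M. \<bar>simple_stoch_integral W (s n) \<omega> - X \<omega>\<bar> > \<epsilon>})
           \<longlonglongrightarrow> 0))"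

text \<open>The integral is determined up to almost sure equality only.\<close>

definition stoch_integral ::
    "'w measure \<Rightarrow> real \<Rightarrow> ((real \<times> (real^'n)) set \<Rightarrow> 'w \<Rightarrow> real) \<Rightarrow>
     (real \<times> (real^'n) \<Rightarrow> real) \<Rightarrow> 'w \<Rightarrow> real" where
  "stoch_integral M \<alpha> W f = (SOME X. has_stoch_integral M \<alpha> W f X)"

section \<open>Generalized and mild solutions\<close>

definition generalized_solution_exists ::
    "real \<Rightarrow> ((real \<times> (real^'n) \<Rightarrow> real) \<Rightarrow> real) \<Rightarrow> bool" where
  "generalized_solution_exists \<alpha> \<rho> \<longleftrightarrow> (\<forall>\<phi>\<in>test_functions. conv_check \<phi> \<rho> \<in> L_space \<alpha>)"

definition u_gen ::
    "'w measure \<Rightarrow> real \<Rightarrow> ((real \<times> (real^'n)) set \<Rightarrow> 'w \<Rightarrow> real) \<Rightarrow>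
     ((real \<times> (real^'n) \<Rightarrow> real) \<Rightarrow> real) \<Rightarrow> (real \<times> (real^'n) \<Rightarrow> real) \<Rightarrow> 'w \<Rightarrow> real" where
  "u_gen M \<alpha> W \<rho> \<phi> = stoch_integral M \<alpha> W (conv_check \<phi> \<rho>)"

definition mild_solution_exists ::
    "real \<Rightarrow> ((real \<times> (real^'n) \<Rightarrow> real) \<Rightarrow> real) \<Rightarrow> bool" where
  "mild_solution_exists \<alpha> \<rho> \<longleftrightarrow>
     (\<exists>f. represented_by \<rho> f \<and> (\<forall>t x. (\<lambda>(s, y). f (t - s, x - y)) \<in> L_space \<alpha>))"

text \<open>The argument \<open>f\<close> is a function that represents the fundamental solution; two such functions
  agree almost everywhere and give almost surely the same value.\<close>

definition u_mild ::
    "'w measure \<Rightarrow> real \<Rightarrow> ((real \<times> (real^'n)) set \<Rightarrow> 'w \<Rightarrow> real) \<Rightarrow>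
     (real \<times> (real^'n) \<Rightarrow> real) \<Rightarrow> real \<times> (real^'n) \<Rightarrow> 'w \<Rightarrow> real" where
  "u_mild M \<alpha> W f = (\<lambda>(t, x). stoch_integral M \<alpha> W (\<lambda>(s, y). f (t - s, x - y)))"

definition random_field_representation ::
    "'w measure \<Rightarrow> (('a::euclidean_space \<Rightarrow> real) \<Rightarrow> 'w \<Rightarrow> real) \<Rightarrow> ('a \<Rightarrow> 'w \<Rightarrow> real) \<Rightarrow> bool" where
  "random_field_representation M u Y \<longleftrightarrow>
     (\<lambda>(z, \<omega>). Y z \<omega>) \<in> borel_measurable (borel \<Otimes>\<^sub>M M) \<and>
     (AE \<omega> in M. locally_integrable (\<lambda>z. Y z \<omega>)) \<and>
     (\<forall>\<phi>\<in>test_functions. AE \<omega> in M. u \<phi> \<omega> = (\<integral>z. Y z \<omega> * \<phi> z \<partial>lborel))"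

end

theory Submission
  imports Defs
begin

text \<open>For \<open>d \<le> 2\<close> the fundamental solution is an explicit function \<open>E\<close>, found as the limit of
  solutions that are regularized by a complex time shift, and \<open>E\<close> is locally \<open>p\<close>-integrable for
  all \<open>p < 2\<close>. The field \<open>Y\<close> is the limit of the stochastic integrals of step kernels that
  approximate \<open>E (z - w)\<close>. These converge locally in \<open>L\<^sup>1\<close>, almost surely along a suitable
  sequence, because after truncation of the noise the von Bahr--Esseen inequality bounds their
  moments of an order \<open>p > \<alpha>\<close>, \<open>p \<ge> 1\<close>. A locally integrable field is determined by countably
  many test functions, which gives the uniqueness.

  For \<open>d \<ge> 3\<close> there are uniformly bounded sources with fixed support that tend to zero almost
  everywhere and whose potentials focus to the value 1 at a point. Hence no locally integrable
  function represents the fundamental solution. If \<open>Y\<close> represented the generalized solution, the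
  pairings of \<open>Y\<close> with all translates of such sources would tend to zero uniformly. But finitely
  many of these potentials suffice for one of them to be at least \<open>1 / 2\<close> at each point of a given
  ball, and then, by the symmetry of the noise, the largest of their stochastic integrals is of the
  order of the largest jump of the noise in that ball with a probability that is bounded below.\<close>

section \<open>Smooth functions and test functions\<close>

text \<open>For d \<le> 2 the obstacle is a lack of moments on both sides: a nonzero stable variable
  has absolute moments of orders below \<alpha> only, and for d = 2 the kernel is locally in L^p for
  p < 2 only. Truncating the noise of each cell gives moments of every order p > \<alpha>, so a p
  strictly between max(1, \<alpha>) and 2 suits the noise and the kernel at once. Truncation is
  stable under refinement, since the tail of the noise of a cell is bounded by a multiple of its
  measure: the chance that some cell of a bounded region is affected has a bound independent of the
  partition.

  For d \<ge> 3 the number of translates that cover the ball may grow with the source, so a union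
  bound over them is useless. The lower bound for the maximum therefore has constants that depend
  only on the noise and the ball, and the upper bound is a single random variable, the integral of
  the excess of |Y| over a level, which controls all translates simultaneously.

  That every fundamental solution is the explicit one for d \<le> 2 is part of the proof.\<close>

lemma pderiv_dir_eqI:
  assumes "(f has_derivative D) (at z)"
  shows "pderiv_dir v f z = D v" using assms unfolding pderiv_dir_def by (metis frechet_derivative_at)

text \<open>\<open>foldr\<close> applies the head of the list last, so the derivative taken first is
  the last entry and is split off by \<open>rev_cases\<close>. This recursive form is the basis of
  the closure proofs below.\<close>

lemma smooth_iff:
  "smooth f \<longleftrightarrow> (\<forall>z. f differentiable (at z)) \<and> (\<forall>b\<in>Basis. smooth (pderiv_dir b f))"
proof
  assume s: "smooth f"
  have "smooth (pderiv_dir b f)" if "b \<in> Basis" for b unfolding smooth_def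
  proof (intro allI impI)
    fix vs z assume "set vs \<subseteq> (Basis::'a set)"
    then have "foldr pderiv_dir (vs @ [b]) f differentiable (at z)"
      using s that unfolding smooth_def by (metis Un_subset_iff empty_subsetI insert_subset list.set set_append)
    then show "foldr pderiv_dir vs (pderiv_dir b f) differentiable (at z)" by simp
  qed
  moreover have "\<forall>z. f differentiable (at z)" using s unfolding smooth_def by (metis empty_subsetI foldr_Nil id_apply list.set(1))
  ultimately show "(\<forall>z. f differentiable (at z)) \<and> (\<forall>b\<in>Basis. smooth (pderiv_dir b f))" by blast
next
  assume s: "(\<forall>z. f differentiable (at z)) \<and> (\<forall>b\<in>Basis. smooth (pderiv_dir b f))"
  show "smooth f" unfolding smooth_def
  proof (intro allI impI)
    fix vs z assume vs: "set vs \<subseteq> (Basis::'a set)"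
    show "foldr pderiv_dir vs f differentiable (at z)"
    proof (cases vs rule: rev_cases)
      case Nil then show ?thesis using s by simp
    next
      case (snoc ys y)
      then show ?thesis using s vs unfolding smooth_def by auto
    qed
  qed
qed

text \<open>Replaces Leibniz and chain formulas of arbitrary order: one only has to exhibit a class
  of differentiable functions that is not left by taking a coordinate derivative.\<close>

lemma smooth_coinduct:
  assumes "P f"
    and diff: "\<And>g z. P g ==> g differentiable (at z)"
    and step: "\<And>g b. P g ==> b \<in> Basis ==> P (pderiv_dir b g)"
  shows "smooth f"
proof -
  have "P (foldr pderiv_dir vs f)" if "set vs \<subseteq> Basis" for vs using that by (induction vs) (auto simp: assms(1) step)
  then show ?thesis unfolding smooth_def using diff by blast
qed

lemma smooth_differentiable: "smooth f ==> f differentiable (at z)" using smooth_iff by blast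

lemma smooth_has_derivative:
  "smooth f ==> (f has_derivative (\<lambda>v. pderiv_dir v f z)) (at z)" unfolding pderiv_dir_def
  by (metis (no_types, lifting) eta_contract_eq frechet_derivative_works smooth_differentiable)

lemma smooth_pderiv_Basis: "smooth f ==> b \<in> Basis ==> smooth (pderiv_dir b f)" using smooth_iff by blast

lemma smooth_foldr: "smooth f ==> set vs \<subseteq> Basis ==> smooth (foldr pderiv_dir vs f)" by (induction vs) (auto intro: smooth_pderiv_Basis)

text \<open>A family of smooth functions closed under the operations by which all test functions below
  are built: products, reciprocals, and outer composition with a function of one real variable,
  which is given together with all its derivatives \<open>h 1, h 2, ...\<close>.\<close>

inductive smooth_alg :: "('a::euclidean_space => real) => bool" where
  base: "smooth f ==> smooth_alg f"
| add: "smooth_alg f ==> smooth_alg g ==> smooth_alg (\<lambda>z. f z + g z)"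
| mult: "smooth_alg f ==> smooth_alg g ==> smooth_alg (\<lambda>z. f z * g z)"
| inv: "smooth_alg f ==> (\<And>z. f z \<noteq> 0) ==> smooth_alg (\<lambda>z. inverse (f z))"
| tower: "(\<And>n x. (h n has_real_derivative h (Suc n) x) (at x)) ==> smooth_alg f ==>
     smooth_alg (\<lambda>z. h (0::nat) (f z))"

lemma has_derivative_pderivI:
  assumes "f differentiable (at z)"
  shows "(f has_derivative (\<lambda>v. pderiv_dir v f z)) (at z)" unfolding pderiv_dir_def using assms frechet_derivative_works by auto

lemma smooth_const [simp, intro]: "smooth (\<lambda>z::'a::euclidean_space. c)"
proof -
  have d: "((\<lambda>z::'a. c) has_derivative (\<lambda>_. 0)) (at z)" for c and z by simp
  have *: "pderiv_dir v (\<lambda>z::'a. c) = (\<lambda>z. 0)" for v and c using pderiv_dir_eqI[OF d[of c]] by auto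
  show ?thesis by (rule smooth_coinduct[where P="\<lambda>f. \<exists>c. f = (\<lambda>z::'a. c)"]) (auto simp: *)
qed

lemma smooth_linear:
  assumes "bounded_linear f" shows "smooth f"
proof -
  have d: "(f has_derivative f) (at z)" for z using assms by (rule bounded_linear_imp_has_derivative)
  have "pderiv_dir v f = (\<lambda>z. f v)" for v by (intro ext pderiv_dir_eqI[OF d])
  then show ?thesis by (subst smooth_iff) (auto intro: differentiableI d)
qed

text \<open>The derivative of each constructor is again an expression in the constructors, so
  \<open>smooth_alg\<close> is a class as \<open>smooth_coinduct\<close> wants it. For
  \<open>tower\<close> the outer derivative belongs to the shifted family
  \<open>\<lambda>n. h (Suc n)\<close>, which is why the tower has to carry all derivatives.\<close>

lemma smooth_alg_step:
  assumes "smooth_alg f"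
  shows "(\<forall>z. f differentiable (at z)) \<and> (\<forall>b\<in>Basis. smooth_alg (pderiv_dir b f))" using assms
proof induction
  case (base f)
  then show ?case using smooth_iff[of f] smooth_alg.base by blast
next
  case (add f g)
  have d: "((\<lambda>z. f z + g z) has_derivative (\<lambda>v. pderiv_dir v f z + pderiv_dir v g z)) (at z)" for z
    using add.IH by (intro derivative_intros has_derivative_pderivI) auto
  have "pderiv_dir b (\<lambda>z. f z + g z) = (\<lambda>z. pderiv_dir b f z + pderiv_dir b g z)" for b using pderiv_dir_eqI[OF d] by auto
  then show ?case using add d by (auto intro: smooth_alg.add)
next
  case (mult f g)
  have d: "((\<lambda>z. f z * g z) has_derivative (\<lambda>v. f z * pderiv_dir v g z + pderiv_dir v f z * g z)) (at z)" for z
    using mult.IH by (intro derivative_intros has_derivative_pderivI) auto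
  have "pderiv_dir b (\<lambda>z. f z * g z) = (\<lambda>z. f z * pderiv_dir b g z + pderiv_dir b f z * g z)" for b using pderiv_dir_eqI[OF d] by auto
  moreover have "smooth_alg (\<lambda>z. f z * pderiv_dir b g z + pderiv_dir b f z * g z)" if "b \<in> Basis" for b
    using mult that by (intro smooth_alg.add smooth_alg.mult) auto
  ultimately show ?case using d by (auto intro!: differentiableI)
next
  case (inv f)
  have d: "((\<lambda>z. inverse (f z)) has_derivative (\<lambda>v. - (inverse (f z) * pderiv_dir v f z * inverse (f z)))) (at z)" for z
    using inv by (intro Deriv.has_derivative_inverse[OF _ has_derivative_pderivI]) auto
  have "pderiv_dir b (\<lambda>z. inverse (f z)) = (\<lambda>z. (-1) * (inverse (f z) * pderiv_dir b f z * inverse (f z)))" for b using pderiv_dir_eqI[OF d] by auto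
  moreover have "smooth_alg (\<lambda>z. (-1) * (inverse (f z) * pderiv_dir b f z * inverse (f z)))" if "b \<in> Basis" for b
    using inv that by (intro smooth_alg.mult smooth_alg.inv) (auto intro: smooth_alg.base)
  ultimately show ?case using inv d by simp
next
  case (tower h f)
  have d: "((\<lambda>z. h n (f z)) has_derivative (\<lambda>v. pderiv_dir v f z * h (Suc n) (f z))) (at z)" for z n
    using tower has_derivative_compose[OF has_derivative_pderivI tower(1)[unfolded has_field_derivative_def], of f z n] by (simp add: mult.commute)
  have "pderiv_dir b (\<lambda>z. h 0 (f z)) = (\<lambda>z. pderiv_dir b f z * h (Suc 0) (f z))" for b using pderiv_dir_eqI[OF d] by auto
  moreover have "smooth_alg (\<lambda>z. h (Suc 0) (f z))" using tower(1) tower(2) smooth_alg.tower[of "\<lambda>n. h (Suc n)" f] by simp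
  ultimately show ?case using tower d by (auto intro!: differentiableI smooth_alg.mult)
qed

lemma smooth_alg_smooth: "smooth_alg f ==> smooth f" by (rule smooth_coinduct[of smooth_alg]) (auto dest: smooth_alg_step)

lemma smooth_add [intro]: "smooth f ==> smooth g ==> smooth (\<lambda>z. f z + g z)"
  by (rule smooth_alg_smooth, rule smooth_alg.add) (auto intro: smooth_alg.base)
lemma smooth_mult [intro]: "smooth f ==> smooth g ==> smooth (\<lambda>z. f z * g z)"
  by (rule smooth_alg_smooth, rule smooth_alg.mult) (auto intro: smooth_alg.base)
lemma smooth_cmult [intro]: "smooth f ==> smooth (\<lambda>z. c * f z)" by auto
lemma smooth_diff [intro]: "smooth f ==> smooth g ==> smooth (\<lambda>z. f z - g z)" using smooth_add[of f "\<lambda>z. (-1) * g z"] smooth_cmult[of g "-1"] by simp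
lemma smooth_inverse: "smooth f ==> (\<And>z. f z \<noteq> 0) ==> smooth (\<lambda>z. inverse (f z))"
  by (rule smooth_alg_smooth, rule smooth_alg.inv) (auto intro: smooth_alg.base)
lemma smooth_divide: "smooth f ==> smooth g ==> (\<And>z. g z \<noteq> 0) ==> smooth (\<lambda>z. f z / g z)" unfolding divide_inverse by (intro smooth_mult smooth_inverse)
lemma smooth_sum [intro]: "(\<And>i. i \<in> I ==> smooth (f i)) ==> smooth (\<lambda>z. \<Sum>i\<in>I. f i z)" by (induction I rule: infinite_finite_induct) auto
lemma smooth_prod [intro]: "(\<And>i. i \<in> I ==> smooth (f i)) ==> smooth (\<lambda>z. \<Prod>i\<in>I. f i z)" by (induction I rule: infinite_finite_induct) auto
lemma smooth_power [intro]: "smooth f ==> smooth (\<lambda>z. f z ^ n)" by (induction n) auto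
lemma smooth_tower:
  "(\<And>n x. (h n has_real_derivative h (Suc n) x) (at x)) ==> smooth f ==> smooth (\<lambda>z. h 0 (f z))"
  by (rule smooth_alg_smooth, rule smooth_alg.tower) (auto intro: smooth_alg.base)

lemma pderiv_dir_mult:
  "smooth f ==> smooth g ==>
    pderiv_dir v (\<lambda>z. f z * g z) z = f z * pderiv_dir v g z + pderiv_dir v f z * g z"
  by (rule pderiv_dir_eqI) (intro derivative_intros smooth_has_derivative)
lemma pderiv_dir_add:
  "smooth f ==> smooth g ==> pderiv_dir v (\<lambda>z. f z + g z) z = pderiv_dir v f z + pderiv_dir v g z"
  by (rule pderiv_dir_eqI) (intro derivative_intros smooth_has_derivative)
lemma pderiv_dir_diff:
  "smooth f ==> smooth g ==> pderiv_dir v (\<lambda>z. f z - g z) z = pderiv_dir v f z - pderiv_dir v g z"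
  by (rule pderiv_dir_eqI) (intro derivative_intros smooth_has_derivative)
lemma pderiv_dir_cong_open:
  assumes "open U" "z \<in> U" "\<And>y. y \<in> U ==> f y = g y"
  shows "pderiv_dir v f z = pderiv_dir v g z"
proof -
  have "(f has_derivative D) (at z) \<longleftrightarrow> (g has_derivative D) (at z)" for D using assms by (metis has_derivative_transform_within_open)
  then show ?thesis unfolding pderiv_dir_def frechet_derivative_def by simp
qed

lemma pderiv_dir_DERIV:
  assumes "smooth f"
  shows "((\<lambda>h. f (z + h *\<^sub>R v)) has_real_derivative pderiv_dir v f (z + h *\<^sub>R v)) (at h)"
proof -
  have "((\<lambda>h. z + h *\<^sub>R v) has_derivative (\<lambda>k. k *\<^sub>R v)) (at h)" by (auto intro!: derivative_eq_intros)
  from has_derivative_compose[OF this smooth_has_derivative[OF assms]]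
  have "((\<lambda>h. f (z + h *\<^sub>R v)) has_derivative (\<lambda>k. pderiv_dir (k *\<^sub>R v) f (z + h *\<^sub>R v))) (at h)" .
  moreover have "pderiv_dir (k *\<^sub>R v) f y = k * pderiv_dir v f y" for k y
    using linear_scale[OF has_derivative_linear[OF smooth_has_derivative[OF assms, of y]], of k v] by simp
  ultimately show ?thesis unfolding has_field_derivative_def by (simp add: mult_commute_abs)
qed

text \<open>Once smoothness is known, a derivative in one real variable along a line determines the
  directional derivative. The focusing waves are differentiated in this way, through complex-valued
  functions of one real parameter.\<close>

lemma pderiv_dir_unique:
  assumes "smooth f" "((\<lambda>h. f (z + h *\<^sub>R v)) has_real_derivative D) (at 0)"
  shows "pderiv_dir v f z = D" using DERIV_unique[OF assms(2) pderiv_dir_DERIV[OF assms(1), of z v 0]] by simp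

lemma pderiv_dir_Basis_sum:
  assumes "smooth f"
  shows "pderiv_dir v f z = (\<Sum>b\<in>Basis. (v \<bullet> b) * pderiv_dir b f z)"
  using Linear_Algebra.linear_componentwise[OF has_derivative_linear[OF smooth_has_derivative[OF assms, of z]], of v 1] by simp

lemma smooth_continuous_on [intro]: "smooth f ==> continuous_on S f"
  by (meson continuous_at_imp_continuous_on differentiable_imp_continuous_within smooth_differentiable)

lemma smooth_borel [measurable_dest]: "smooth f ==> f \<in> borel_measurable borel" by (intro borel_measurable_continuous_onI smooth_continuous_on)

lemma has_derivative_shift_iff:
  "((\<lambda>z. f (a + z)) has_derivative D) (at z) \<longleftrightarrow> (f has_derivative D) (at (a + z))"
proof -
  have 1: "((\<lambda>z. b + z) has_derivative (\<lambda>v. v)) (at y)" for b y by (auto intro!: derivative_eq_intros)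
  have "((\<lambda>z. f (a + z)) has_derivative D) (at z)" if "(f has_derivative D) (at (a + z))" using has_derivative_compose[OF 1 that] .
  moreover have "(f has_derivative D) (at (a + z))" if "((\<lambda>z. f (a + z)) has_derivative D) (at z)"
    using has_derivative_compose[OF 1[of "-a" "a + z"], of "\<lambda>z. f (a + z)" D] that by simp
  ultimately show ?thesis by blast
qed

lemma pderiv_dir_shift: "pderiv_dir v (\<lambda>z. f (a + z)) = (\<lambda>z. pderiv_dir v f (a + z))"
  unfolding pderiv_dir_def frechet_derivative_def has_derivative_shift_iff ..

lemma foldr_pderiv_shift: "foldr pderiv_dir vs (\<lambda>z. f (a + z)) = (\<lambda>z. foldr pderiv_dir vs f (a + z))" by (induction vs) (auto simp: pderiv_dir_shift)

lemma smooth_shift [intro]: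
  assumes "smooth f" shows "smooth (\<lambda>z. f (a + z))"
proof (rule smooth_coinduct[where P="\<lambda>f. \<exists>g. smooth g \<and> f = (\<lambda>z. g (a + z))"])
  show "\<exists>g. smooth g \<and> (\<lambda>z. f (a + z)) = (\<lambda>z. g (a + z))" using assms by blast
next
  fix f and z assume "\<exists>g. smooth g \<and> f = (\<lambda>z. g (a + z))"
  then obtain g where g: "smooth g" and f: "f = (\<lambda>z. g (a + z))" by blast
  have "((\<lambda>z. a + z) has_derivative (\<lambda>v. v)) (at z)" by (auto intro!: derivative_eq_intros)
  from has_derivative_compose[OF this smooth_has_derivative[OF g]]
  show "f differentiable (at z)" unfolding f by (rule differentiableI)
next
  fix f and b :: 'a
  assume "\<exists>g. smooth g \<and> f = (\<lambda>z. g (a + z))" "b \<in> Basis"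
  then show "\<exists>g. smooth g \<and> pderiv_dir b f = (\<lambda>z. g (a + z))" by (metis pderiv_dir_shift smooth_pderiv_Basis)
qed

section \<open>Flat functions and smooth steps\<close>

primrec flat_poly :: "nat => real poly" where
  "flat_poly 0 = 1"
| "flat_poly (Suc n) = [:0, 0, 1:] * (flat_poly n - pderiv (flat_poly n))"

text \<open>The n-th derivative of exp(-1/x), extended by 0. In y = 1/x, where dy/dx = -y^2,
  differentiation sends q(y) exp(-y) to y^2 (q - q')(y) exp(-y); this is the recursion of
  \<open>flat_poly\<close>.\<close>

definition flat_deriv :: "nat => real => real" where
  "flat_deriv n x = (if x > 0 then poly (flat_poly n) (inverse x) * exp (- inverse x) else 0)"

abbreviation flat :: "real => real" where "flat \<equiv> flat_deriv 0"

lemma poly_exp_tendsto_0: "((\<lambda>y::real. poly p y * exp (- y)) \<longlongrightarrow> 0) at_top"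
proof -
  have "((\<lambda>y::real. \<Sum>i\<le>degree p. coeff p i * (y ^ i / exp y)) \<longlongrightarrow> (\<Sum>i\<le>degree p. coeff p i * 0)) at_top"
    by (intro tendsto_intros tendsto_power_div_exp_0)
  then show ?thesis by (simp add: poly_altdef sum_distrib_right exp_minus divide_inverse mult.assoc)
qed

lemma flat_deriv_has_derivative: "(flat_deriv n has_real_derivative flat_deriv (Suc n) x) (at x)"
proof -
  consider "x > 0" | "x < 0" | "x = 0" by linarith
  then show ?thesis
  proof cases
    case 1
    have "((\<lambda>x. poly (flat_poly n) (inverse x) * exp (- inverse x)) has_real_derivative flat_deriv (Suc n) x) (at x)"
      using 1 by (auto intro!: derivative_eq_intros simp: flat_deriv_def field_simps)
    then show ?thesis by (rule has_field_derivative_transform_within_open[where S="{0<..}"]) (use 1 in \<open>auto simp: flat_deriv_def\<close>)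
  next
    case 2
    show ?thesis by (rule has_field_derivative_transform_within_open[where S="{..<0}"]) (use 2 in \<open>auto simp: flat_deriv_def\<close>)
  next
    case 3
    have r: "((\<lambda>h. flat_deriv n h / h) \<longlongrightarrow> 0) (at_right 0)"
    proof -
      \<comment> \<open>With y = 1/h the difference quotient at 0 is y q(y) exp(-y); the division by
        h is the extra factor \<open>[:0,1:]\<close>.\<close>
      have "((\<lambda>y::real. poly ([:0,1:] * flat_poly n) y * exp (- y)) \<longlongrightarrow> 0) at_top" by (rule poly_exp_tendsto_0)
      from filterlim_compose[OF this filterlim_inverse_at_top_right]
      have "((\<lambda>h::real. poly ([:0,1:] * flat_poly n) (inverse h) * exp (- inverse h)) \<longlongrightarrow> 0) (at_right 0)" .
      then show ?thesis
        by (rule Lim_transform_eventually) (auto simp: flat_deriv_def field_simps intro!: eventually_mono[OF eventually_at_right_less])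
    qed
    have l: "((\<lambda>h. flat_deriv n h / h) \<longlongrightarrow> 0) (at_left 0)" by (rule Lim_transform_eventually[OF tendsto_const])
         (auto simp: eventually_at_left_field flat_deriv_def intro!: exI[of _ "-1"])
    show ?thesis unfolding DERIV_def 3 using filterlim_split_at[OF l r] by (simp add: flat_deriv_def)
  qed
qed

lemma smooth_flat: "smooth f ==> smooth (\<lambda>z. flat (f z))" by (rule smooth_tower[of flat_deriv]) (rule flat_deriv_has_derivative)

lemma flat_pos_iff: "flat x > 0 \<longleftrightarrow> x > 0" and flat_nonneg: "flat x \<ge> 0" and flat_zero_iff: "flat x = 0 \<longleftrightarrow> x \<le> 0" by (auto simp: flat_deriv_def)

definition smooth_step :: "real => real => real => real" where
  "smooth_step a b x = flat (b - x) / (flat (b - x) + flat (x - a))"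

lemma smooth_step_denom_pos: "a < b ==> flat (b - x) + flat (x - a) > 0"
  using flat_nonneg[of "b-x"] flat_nonneg[of "x-a"] flat_pos_iff[of "b-x"] flat_pos_iff[of "x-a"] by auto

lemma smooth_smooth_step: "a < b ==> smooth f ==> smooth (\<lambda>z. smooth_step a b (f z))"
  unfolding smooth_step_def using smooth_step_denom_pos[of a b] by (intro smooth_divide smooth_add smooth_flat) (auto simp: less_le)

lemma smooth_step_1: "a < b ==> x \<le> a ==> smooth_step a b x = 1"
  and smooth_step_0: "a < b ==> b \<le> x ==> smooth_step a b x = 0"
  unfolding smooth_step_def using flat_zero_iff[of "b - x"] flat_zero_iff[of "x - a"] by auto

lemma smooth_step_bounds: "a < b ==> 0 \<le> smooth_step a b x \<and> smooth_step a b x \<le> 1"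
  unfolding smooth_step_def using flat_nonneg[of "b - x"] flat_nonneg[of "x - a"] by (auto simp: divide_simps)

section \<open>Supports and operations on test functions\<close>

lemma fun_supp_subset: "closed C ==> (\<And>z. f z \<noteq> 0 ==> z \<in> C) ==> fun_supp f \<subseteq> C" unfolding fun_supp_def by (intro closure_minimal) auto

lemma not_fun_supp_eq_0: "z \<notin> fun_supp f ==> f z = 0" unfolding fun_supp_def using closure_subset[of "{z. f z \<noteq> 0}"] by auto

lemma pderiv_dir_zero_open:
  assumes "open U" "z \<in> U" "\<And>y. y \<in> U ==> f y = 0" shows "pderiv_dir v f z = 0"
proof -
  have "pderiv_dir v f z = pderiv_dir v (\<lambda>_. 0) z" using assms by (intro pderiv_dir_cong_open)
  also have "... = 0" by (rule pderiv_dir_eqI[of _ "\<lambda>_. 0"]) simp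
  finally show ?thesis .
qed

lemma fun_supp_pderiv: "fun_supp (pderiv_dir v f) \<subseteq> fun_supp f"
proof (rule fun_supp_subset)
  show "closed (fun_supp f)" unfolding fun_supp_def by simp
  fix z assume nz: "pderiv_dir v f z \<noteq> 0"
  have "pderiv_dir v f z = 0" if "z \<notin> fun_supp f"
  proof (rule pderiv_dir_zero_open)
    show "open (- fun_supp f)" unfolding fun_supp_def by auto
  qed (use that not_fun_supp_eq_0 in auto)
  then show "z \<in> fun_supp f" using nz by blast
qed

lemma test_functions_iff: "f \<in> test_functions \<longleftrightarrow> smooth f \<and> (\<exists>R. \<forall>z. f z \<noteq> 0 --> norm z \<le> R)"
proof -
  have "compact (fun_supp f) \<longleftrightarrow> (\<exists>R. \<forall>z. f z \<noteq> 0 --> norm z \<le> R)"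
  proof
    assume "compact (fun_supp f)"
    then have "bounded (fun_supp f)" by (rule compact_imp_bounded)
    then obtain R where "\<forall>z\<in>fun_supp f. norm z \<le> R" unfolding bounded_iff by blast
    then show "\<exists>R. \<forall>z. f z \<noteq> 0 --> norm z \<le> R" using not_fun_supp_eq_0 by metis
  next
    assume "\<exists>R. \<forall>z. f z \<noteq> 0 --> norm z \<le> R"
    then obtain R where "\<forall>z. f z \<noteq> 0 --> norm z \<le> R" by blast
    then have "fun_supp f \<subseteq> cball 0 R" by (intro fun_supp_subset) auto
    then show "compact (fun_supp f)" unfolding fun_supp_def by (metis bounded_cball bounded_subset closed_closure compact_eq_bounded_closed)
  qed
  then show ?thesis unfolding test_functions_def by auto
qed

lemma test_functions_smooth: "f \<in> test_functions ==> smooth f"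
  and test_functions_compact: "f \<in> test_functions ==> compact (fun_supp f)" unfolding test_functions_def by auto

lemma test_functions_pderiv:
  assumes "f \<in> test_functions" "b \<in> Basis" shows "pderiv_dir b f \<in> test_functions"
proof -
  have "compact (fun_supp f \<inter> fun_supp (pderiv_dir b f))"
    using test_functions_compact[OF assms(1)] unfolding fun_supp_def[of "pderiv_dir b f"] by auto
  also have "fun_supp f \<inter> fun_supp (pderiv_dir b f) = fun_supp (pderiv_dir b f)" using fun_supp_pderiv[of b f] by auto
  finally show ?thesis using assms unfolding test_functions_def by (simp add: smooth_pderiv_Basis)
qed

lemma test_functions_foldr: "f \<in> test_functions ==> set vs \<subseteq> Basis ==> foldr pderiv_dir vs f \<in> test_functions"
  by (induction vs) (auto intro: test_functions_pderiv)

lemma test_functions_mult: "f \<in> test_functions ==> smooth g ==> (\<lambda>z. f z * g z) \<in> test_functions" unfolding test_functions_iff by auto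

lemma test_functions_mult2: "f \<in> test_functions ==> smooth g ==> (\<lambda>z. g z * f z) \<in> test_functions" unfolding test_functions_iff by auto

lemma test_functions_cmult: "f \<in> test_functions ==> (\<lambda>z. c * f z) \<in> test_functions" using test_functions_mult2[OF _ smooth_const] .

lemma test_functions_add:
  assumes "f \<in> test_functions" "g \<in> test_functions" shows "(\<lambda>z. f z + g z) \<in> test_functions"
proof -
  obtain R S where "\<And>z. f z \<noteq> 0 ==> norm z \<le> R" "\<And>z. g z \<noteq> 0 ==> norm z \<le> S" using assms unfolding test_functions_iff by blast
  then have "\<And>z. f z + g z \<noteq> 0 ==> norm z \<le> max R S" by (metis add_0 le_max_iff_disj)
  then show ?thesis using assms unfolding test_functions_iff by auto
qed

lemma test_functions_diff: "f \<in> test_functions ==> g \<in> test_functions ==> (\<lambda>z. f z - g z) \<in> test_functions"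
  using test_functions_add[of f "\<lambda>z. (-1) * g z"] test_functions_cmult[of g "-1"] by simp

lemma test_functions_zero: "(\<lambda>_. 0) \<in> test_functions" unfolding test_functions_iff by auto

lemma test_functions_sum: "(\<And>i. i \<in> I ==> f i \<in> test_functions) ==> (\<lambda>z. \<Sum>i\<in>I. f i z) \<in> test_functions"
  by (induction I rule: infinite_finite_induct) (auto intro: test_functions_add test_functions_zero)

lemma test_functions_shift:
  assumes "f \<in> test_functions" shows "(\<lambda>z. f (a + z)) \<in> test_functions"
proof -
  obtain R where R: "\<And>z. f z \<noteq> 0 ==> norm z \<le> R" using assms unfolding test_functions_iff by blast
  have "f (a + z) \<noteq> 0 ==> norm z \<le> R + norm a" for z using R[of "a + z"] norm_triangle_ineq2[of z "-a"] by (simp add: add.commute)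
  then show ?thesis using assms unfolding test_functions_iff by auto
qed

lemma test_functions_bounded:
  assumes "f \<in> test_functions" obtains B where "B > 0" "\<And>z. \<bar>f z\<bar> \<le> B"
proof -
  have "compact (f ` fun_supp f)" using assms by (intro compact_continuous_image) (auto simp: test_functions_def)
  then obtain B where B: "B > 0" "\<forall>y\<in>f ` fun_supp f. norm y \<le> B" using bounded_pos compact_imp_bounded by blast
  have "\<bar>f z\<bar> \<le> B" for z by (cases "z \<in> fun_supp f") (use B not_fun_supp_eq_0[of z f] in auto)
  then show thesis using B(1) that by blast
qed

lemma test_functions_lipschitz:
  assumes "f \<in> test_functions" obtains L where "L \<ge> 0" "\<And>z w. \<bar>f z - f w\<bar> \<le> L * norm (z - w)"
proof -
  have "\<forall>b\<in>Basis. \<exists>B. \<forall>z. \<bar>pderiv_dir b f z\<bar> \<le> B" by (metis test_functions_bounded test_functions_pderiv assms)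
  then obtain B where B: "\<And>b z. b \<in> Basis ==> \<bar>pderiv_dir b f z\<bar> \<le> B b" by metis
  define L where "L = (\<Sum>b\<in>Basis. B b)"
  have s: "smooth f" using assms test_functions_smooth by blast
  have "onorm (\<lambda>v. pderiv_dir v f z) \<le> L" for z
  proof (rule onorm_le)
    fix v
    have "norm (pderiv_dir v f z) \<le> (\<Sum>b\<in>Basis. \<bar>v \<bullet> b\<bar> * \<bar>pderiv_dir b f z\<bar>)"
      unfolding pderiv_dir_Basis_sum[OF s, of v] by (simp add: order_trans[OF sum_abs] abs_mult)
    also have "... \<le> (\<Sum>b\<in>Basis. norm v * B b)" by (intro sum_mono mult_mono B) (auto simp: Basis_le_norm)
    finally show "norm (pderiv_dir v f z) \<le> L * norm v" unfolding L_def by (simp add: mult.commute[of "norm v"] sum_distrib_right)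
  qed
  then have "norm (f z - f w) \<le> L * norm (z - w)" for z w
    by (intro differentiable_bound[of UNIV f "\<lambda>z v. pderiv_dir v f z"]) (auto intro: smooth_has_derivative[OF s])
  moreover have "L \<ge> 0" unfolding L_def by (intro sum_nonneg) (meson B abs_ge_zero order_trans)
  ultimately show thesis using that by auto
qed

lemma test_functions_borel: "f \<in> test_functions ==> f \<in> borel_measurable borel" by (intro smooth_borel test_functions_smooth)

lemma test_functions_locally_integrable_mult:
  assumes "locally_integrable g" "f \<in> test_functions" shows "integrable lborel (\<lambda>z. g z * f z)"
proof -
  have b: "f \<in> borel_measurable borel" using assms test_functions_borel by blast
  obtain B where B: "\<And>z. \<bar>f z\<bar> \<le> B" by (metis test_functions_bounded assms(2))
  have "set_integrable lborel (fun_supp f) g" using assms unfolding locally_integrable_def test_functions_def by blast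
  then have i: "integrable lborel (\<lambda>z. B * (indicator (fun_supp f) z *\<^sub>R g z))" unfolding set_integrable_def by simp
  show ?thesis
  proof (rule Bochner_Integration.integrable_bound[OF i])
    show "(\<lambda>z. g z * f z) \<in> borel_measurable lborel" using assms(1) b unfolding locally_integrable_def by auto
    show "AE z in lborel. norm (g z * f z) \<le> norm (B * (indicator (fun_supp f) z *\<^sub>R g z))"
    proof (intro AE_I2)
      fix z
      have "\<bar>f z\<bar> * \<bar>g z\<bar> \<le> \<bar>B\<bar> * \<bar>g z\<bar>" using B[of z] by (intro mult_right_mono) auto
      then show "norm (g z * f z) \<le> norm (B * (indicator (fun_supp f) z *\<^sub>R g z))"
        using not_fun_supp_eq_0[of z f] by (cases "z \<in> fun_supp f") (auto simp: abs_mult mult.commute)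
    qed
  qed
qed

lemma locally_integrable_const: "locally_integrable (\<lambda>z::'a::euclidean_space. c)"
  unfolding locally_integrable_def set_integrable_def by (auto intro!: finite_imp_compact emeasure_compact_finite simp: compact_imp_closed borel_closed)

lemma test_functions_integrable: "f \<in> test_functions ==> integrable lborel f"
  using test_functions_locally_integrable_mult[OF locally_integrable_const[of 1]] by simp

text \<open>\<open>c\<close> is a steepness: at a point of the box the argument of the step passes 1
  for large \<open>c\<close>, and each factor is then exactly 1. With rational corners and natural
  numbers \<open>c\<close> these bumps are the countable family of test functions on which the
  uniqueness of the random field rests.\<close>

definition box_bump :: "'a::euclidean_space => 'a => real => 'a => real" where
  "box_bump l u c z = (\<Prod>b\<in>Basis. 1 - smooth_step 0 1 (c * flat (z \<bullet> b - l \<bullet> b) * flat (u \<bullet> b - z \<bullet> b)))"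

lemma smooth_inner [intro]: "smooth (\<lambda>z. z \<bullet> b)" by (intro smooth_linear bounded_linear_inner_left)

lemma smooth_box_bump: "smooth (box_bump l u c)"
  unfolding box_bump_def by (intro smooth_prod smooth_diff smooth_smooth_step smooth_mult smooth_flat) auto

lemma box_bump_bounds: "0 \<le> box_bump l u c z" "box_bump l u c z \<le> 1"
  unfolding box_bump_def using smooth_step_bounds[of 0 1] by (auto intro!: prod_nonneg prod_le_1)

lemma box_bump_zero:
  assumes "z \<notin> box l u" shows "box_bump l u c z = 0"
proof -
  obtain b where "b \<in> Basis" "\<not> (l \<bullet> b < z \<bullet> b \<and> z \<bullet> b < u \<bullet> b)" using assms by (auto simp: mem_box)
  then have "flat (z \<bullet> b - l \<bullet> b) * flat (u \<bullet> b - z \<bullet> b) = 0" using flat_zero_iff[of "z \<bullet> b - l \<bullet> b"] flat_zero_iff[of "u \<bullet> b - z \<bullet> b"] by auto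
  then show ?thesis using \<open>b \<in> Basis\<close> smooth_step_1[of 0 1 0] unfolding box_bump_def by force
qed

lemma box_bump_test: "box_bump l u c \<in> test_functions" unfolding test_functions_iff
proof (intro conjI smooth_box_bump)
  obtain R where "\<forall>x\<in>box l u. norm x \<le> R" using bounded_box bounded_iff by blast
  then show "\<exists>R. \<forall>z. box_bump l u c z \<noteq> 0 --> norm z \<le> R" using box_bump_zero by metis
qed

lemma box_bump_tendsto: "(\<lambda>n. box_bump l u (real n) z) \<longlonglongrightarrow> indicator (box l u) z"
proof (cases "z \<in> box l u")
  case False then show ?thesis by (simp add: box_bump_zero[OF False])
next
  case True
  have "\<forall>\<^sub>F n in sequentially. 1 - smooth_step 0 1 (real n * flat (z \<bullet> b - l \<bullet> b) * flat (u \<bullet> b - z \<bullet> b)) = 1" if "b \<in> Basis" for b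
  proof -
    define q where "q = flat (z \<bullet> b - l \<bullet> b) * flat (u \<bullet> b - z \<bullet> b)"
    have q: "q > 0" using True that unfolding q_def by (auto simp: mem_box flat_pos_iff)
    have "\<forall>\<^sub>F n in sequentially. real n > 1 / q" by (rule eventually_gt_at_top[THEN filterlim_real_sequentially[unfolded filterlim_iff, rule_format]])
    then show ?thesis by eventually_elim (use q in \<open>simp add: mult.assoc q_def[symmetric] pos_divide_less_eq smooth_step_0\<close>)
  qed
  then have "\<forall>\<^sub>F n in sequentially. \<forall>b\<in>Basis. 1 - smooth_step 0 1 (real n * flat (z \<bullet> b - l \<bullet> b) * flat (u \<bullet> b - z \<bullet> b)) = 1"
    by (intro eventually_ball_finite) auto
  then have "\<forall>\<^sub>F n in sequentially. box_bump l u (real n) z = 1" by eventually_elim (simp add: box_bump_def)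
  then show ?thesis using True by (simp add: tendsto_eventually)
qed

section \<open>The generalized solution\<close>

text \<open>There are finitely many derivatives of order at most \<open>N\<close>, so one Lipschitz
  constant serves them all. It makes the difference of two translates small in the seminorms that
  control a distribution.\<close>

lemma test_functions_bounded_upto:
  assumes "f \<in> test_functions"
  obtains L where "L \<ge> 0"
    "\<And>vs z w. set vs \<subseteq> Basis ==> length vs \<le> N ==>
       \<bar>foldr pderiv_dir vs f z - foldr pderiv_dir vs f w\<bar> \<le> L * norm (z - w)"
proof -
  define V where "V = {vs. set vs \<subseteq> (Basis::'a set) \<and> length vs \<le> N}"
  have V: "finite V" unfolding V_def by (rule finite_lists_length_le) simp
  have "\<forall>vs\<in>V. \<exists>L. L \<ge> 0 \<and> (\<forall>z w. \<bar>foldr pderiv_dir vs f z - foldr pderiv_dir vs f w\<bar> \<le> L * norm (z - w))"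
    unfolding V_def using test_functions_lipschitz[OF test_functions_foldr[OF assms]] by (metis (no_types, lifting) mem_Collect_eq)
  then obtain L where L: "\<And>vs. vs \<in> V ==> L vs \<ge> 0"
    "\<And>vs z w. vs \<in> V ==> \<bar>foldr pderiv_dir vs f z - foldr pderiv_dir vs f w\<bar> \<le> L vs * norm (z - w)" by metis
  show thesis
  proof
    show "(\<Sum>vs\<in>V. L vs) \<ge> 0" using L by (intro sum_nonneg)
    fix vs z w assume "set vs \<subseteq> (Basis::'a set)" "length vs \<le> N"
    then have vs: "vs \<in> V" unfolding V_def by blast
    have "L vs \<le> (\<Sum>vs\<in>V. L vs)" using L(1) V vs by (intro member_le_sum) auto
    then show "\<bar>foldr pderiv_dir vs f z - foldr pderiv_dir vs f w\<bar> \<le> (\<Sum>vs\<in>V. L vs) * norm (z - w)"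
      using L(2)[OF vs, of z w] by (meson mult_right_mono norm_ge_zero order_trans)
  qed
qed

lemma foldr_pderiv_diff:
  assumes "smooth f" "smooth g" "set vs \<subseteq> Basis"
  shows "foldr pderiv_dir vs (\<lambda>z. f z - g z) = (\<lambda>z. foldr pderiv_dir vs f z - foldr pderiv_dir vs g z)" using assms(3)
proof (induction vs)
  case (Cons v vs)
  then show ?case using assms by (auto intro!: pderiv_dir_diff smooth_foldr)
qed simp

lemma distribution_add:
  "distribution \<rho> ==> f \<in> test_functions ==> g \<in> test_functions ==> \<rho> (\<lambda>z. f z + g z) = \<rho> f + \<rho> g"
  and distribution_cmult: "distribution \<rho> ==> f \<in> test_functions ==> \<rho> (\<lambda>z. c * f z) = c * \<rho> f" unfolding distribution_def by metis+

lemma distribution_diff: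
  assumes "distribution \<rho>" "f \<in> test_functions" "g \<in> test_functions"
  shows "\<rho> (\<lambda>z. f z - g z) = \<rho> f - \<rho> g" using distribution_add[OF assms(1,2) test_functions_cmult[OF assms(3), of "-1"]]
    distribution_cmult[OF assms(1,3), of "-1"] by simp

text \<open>The seminorm estimate is applied to the difference of two translates of
  \<open>f\<close>. For |y - z| < 1 the supports stay in one compact set, and all derivatives that
  enter are at most L |y - z|.\<close>

lemma conv_check_continuous:
  fixes \<rho> :: "('a::euclidean_space => real) => real"
  assumes \<rho>: "distribution \<rho>" and f: "f \<in> test_functions"
  shows "continuous_on UNIV (conv_check f \<rho>)"
proof -
  obtain R where R: "\<And>z. f z \<noteq> 0 ==> norm z \<le> R" using f unfolding test_functions_iff by blast
  have "isCont (conv_check f \<rho>) z" for z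
  proof -
    have "compact (cball (0::'a) (R + norm z + 1))" by simp
    then obtain N C where NC: "\<And>g B. g \<in> test_functions ==> fun_supp g \<subseteq> cball 0 (R + norm z + 1) ==>
        (\<And>vs y. set vs \<subseteq> Basis ==> length vs \<le> N ==> \<bar>foldr pderiv_dir vs g y\<bar> \<le> B) ==> \<bar>\<rho> g\<bar> \<le> C * B" using \<rho> unfolding distribution_def by meson
    obtain L where L: "L \<ge> 0" "\<And>vs z w. set vs \<subseteq> Basis ==> length vs \<le> N ==>
       \<bar>foldr pderiv_dir vs f z - foldr pderiv_dir vs f w\<bar> \<le> L * norm (z - w)" using test_functions_bounded_upto[OF f] by blast
    have *: "\<bar>conv_check f \<rho> y - conv_check f \<rho> z\<bar> \<le> C * (L * norm (y - z))" if y: "norm (y - z) < 1" for y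
    proof -
      have t: "(\<lambda>w. f (y + w)) \<in> test_functions" "(\<lambda>w. f (z + w)) \<in> test_functions" by (intro test_functions_shift f)+
      have "\<bar>\<rho> (\<lambda>w. f (y + w) - f (z + w))\<bar> \<le> C * (L * norm (y - z))"
      proof (rule NC)
        show "(\<lambda>w. f (y + w) - f (z + w)) \<in> test_functions" using t by (rule test_functions_diff)
        show "fun_supp (\<lambda>w. f (y + w) - f (z + w)) \<subseteq> cball 0 (R + norm z + 1)"
        proof (rule fun_supp_subset)
          fix w assume "f (y + w) - f (z + w) \<noteq> 0"
          then have "f (y + w) \<noteq> 0 \<or> f (z + w) \<noteq> 0" by auto
          then consider "norm (y + w) \<le> R" | "norm (z + w) \<le> R" using R by blast
          then have "norm w \<le> R + norm z + 1"
          proof cases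
            case 1
            have "norm w \<le> norm (y + w) + norm y" using norm_triangle_ineq4[of "y + w" y] by simp
            moreover have "norm y \<le> norm z + 1" using norm_triangle_ineq[of z "y - z"] y by simp
            ultimately show ?thesis using 1 by linarith
          next
            case 2
            have "norm w \<le> norm (z + w) + norm z" using norm_triangle_ineq4[of "z + w" z] by simp
            then show ?thesis using 2 by linarith
          qed
          then show "w \<in> cball 0 (R + norm z + 1)" by simp
        qed simp
        fix vs w assume vs: "set vs \<subseteq> (Basis::'a set)" "length vs \<le> N"
        have "\<bar>foldr pderiv_dir vs f (y + w) - foldr pderiv_dir vs f (z + w)\<bar> \<le> L * norm (y - z)" using L(2)[OF vs, of "y + w" "z + w"] by simp
        then show "\<bar>foldr pderiv_dir vs (\<lambda>w. f (y + w) - f (z + w)) w\<bar> \<le> L * norm (y - z)"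
          using foldr_pderiv_diff[of "\<lambda>w. f (y + w)" "\<lambda>w. f (z + w)" vs] t vs by (simp add: foldr_pderiv_shift test_functions_smooth)
      qed
      then show ?thesis unfolding conv_check_def using distribution_diff[OF \<rho> t] by simp
    qed
    have "((\<lambda>y. C * (L * norm (y - z))) \<longlongrightarrow> C * (L * norm (z - z))) (at z)" by (intro tendsto_intros)
    then have "((\<lambda>y. C * (L * norm (y - z))) \<longlongrightarrow> 0) (at z)" by simp
    then have "((\<lambda>y. conv_check f \<rho> y - conv_check f \<rho> z) \<longlongrightarrow> 0) (at z)" by (rule Lim_null_comparison[rotated])
        (use * in \<open>auto simp: eventually_at dist_norm intro!: exI[of _ 1]\<close>)
    then show ?thesis unfolding isCont_def using LIM_zero_iff by blast
  qed
  then show ?thesis by (intro continuous_at_imp_continuous_on) auto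
qed

lemma half_space_closed [simp]: "closed (half_space :: (real \<times> (real^'n)) set)" unfolding half_space_def by (intro closed_Times) auto

lemma half_space_borel [measurable, simp]: "(half_space :: (real \<times> (real^'n)) set) \<in> sets borel" by simp

lemma nn_integral_half_space:
  "(\<integral>\<^sup>+ z. f z \<partial>restrict_space lborel half_space) = (\<integral>\<^sup>+ z. f z * indicator half_space z \<partial>lborel)" by (intro nn_integral_restrict_space) simp

lemma L_space_borel:
  assumes [measurable]: "f \<in> borel_measurable borel"
  shows "f \<in> L_space \<alpha> \<longleftrightarrow> (\<integral>\<^sup>+ z. ennreal (\<bar>f z\<bar> powr \<alpha>) * indicator half_space z \<partial>lborel) < \<infinity>"
  unfolding L_space_def by (simp add: nn_integral_half_space measurable_restrict_space1)

lemma L_space_bounded_support: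
  fixes f :: "real \<times> (real^'n) => real"
  assumes [measurable]: "f \<in> borel_measurable borel" and \<alpha>: "0 < \<alpha>"
    and B: "\<And>z. z \<in> half_space ==> norm z \<le> R ==> \<bar>f z\<bar> \<le> B"
    and R: "\<And>z. z \<in> half_space ==> f z \<noteq> 0 ==> norm z \<le> R"
  shows "f \<in> L_space \<alpha>"
proof -
  have "(\<integral>\<^sup>+ z. ennreal (\<bar>f z\<bar> powr \<alpha>) * indicator half_space z \<partial>lborel)
      \<le> (\<integral>\<^sup>+ z. ennreal (\<bar>B\<bar> powr \<alpha>) * indicator (cball 0 R) z \<partial>(lborel :: (real \<times> (real^'n)) measure))"
  proof (intro nn_integral_mono)
    fix z
    show "ennreal (\<bar>f z\<bar> powr \<alpha>) * indicator half_space z \<le> ennreal (\<bar>B\<bar> powr \<alpha>) * indicator (cball 0 R) z"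
    proof (cases "z \<in> half_space \<and> f z \<noteq> 0")
      case True
      then have "norm z \<le> R" "\<bar>f z\<bar> \<le> B" using B R by auto
      then show ?thesis using \<alpha> True by (auto intro!: powr_mono2)
    qed auto
  qed
  also have "... < \<infinity>" using emeasure_compact_finite[of "cball 0 R"] by (subst nn_integral_cmult_indicator) (auto simp: ennreal_mult_less_top)
  finally show ?thesis by (simp add: L_space_borel)
qed

text \<open>\<open>conv_check\<close> at z sees \<open>f\<close> on z plus the forward cone. At a
  time t \<ge> 0 this set meets the bounded support of \<open>f\<close> only for bounded z: if z + w
  has norm at most \<open>R\<close> and w lies in the cone, then t \<le> R, the time of w is at most
  R, and |x| \<le> 2 R. Towards negative times no such bound holds.\<close>

lemma conv_check_bounded_support:
  fixes \<rho> :: "(real \<times> (real^'n) => real) => real"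
  assumes "dist_supported_in \<rho> {(t, x). norm x \<le> t}" and f: "f \<in> test_functions"
  obtains R where "\<And>z. z \<in> half_space ==> conv_check f \<rho> z \<noteq> 0 ==> norm z \<le> R"
proof -
  obtain R where R: "\<And>z. f z \<noteq> 0 ==> norm z \<le> R" using f unfolding test_functions_iff by blast
  have "norm z \<le> 3 * R" if z: "z \<in> half_space" "conv_check f \<rho> z \<noteq> 0" for z
  proof -
    have "fun_supp (\<lambda>w. f (z + w)) \<inter> {(t, x). norm x \<le> t} \<noteq> {}"
      using assms(1) test_functions_shift[OF f] z(2) unfolding dist_supported_in_def conv_check_def by blast
    then obtain w where w: "w \<in> fun_supp (\<lambda>w. f (z + w))" "norm (snd w) \<le> fst w" by auto
    have "fun_supp (\<lambda>w. f (z + w)) \<subseteq> {w. norm (z + w) \<le> R}" by (intro fun_supp_subset closed_Collect_le continuous_intros) (use R in auto)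
    then have "norm (z + w) \<le> R" using w by auto
    then have "fst z + fst w \<le> R" "norm (snd z + snd w) \<le> R"
      using norm_fst_le[of "fst (z+w)" "snd (z+w)"] norm_snd_le[of "snd (z+w)" "fst (z+w)"] by (simp_all del: fst_add snd_add add: fst_add[symmetric] snd_add[symmetric])
    moreover have "norm (snd z) \<le> norm (snd z + snd w) + norm (snd w)" using norm_triangle_ineq4[of "snd z + snd w" "snd w"] by simp
    moreover have "fst z \<ge> 0" using z(1) unfolding half_space_def by auto
    moreover have "norm z \<le> \<bar>fst z\<bar> + norm (snd z)" by (metis norm_Pair_le prod.collapse real_norm_def)
    ultimately show ?thesis using w(2) norm_ge_zero[of "snd w"] by linarith
  qed
  then show thesis using that by blast
qed

text \<open>Boundedness on a bounded support within \<open>half_space\<close> makes every positive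
  power integrable, in every dimension.\<close>

lemma wave_generalized_solution_exists:
  fixes \<rho> :: "(real \<times> (real^'n) => real) => real"
  assumes "wave_fundamental_solution \<rho>" "0 < \<alpha>"
  shows "generalized_solution_exists \<alpha> \<rho>" unfolding generalized_solution_exists_def
proof
  fix f :: "real \<times> (real^'n) => real" assume f: "f \<in> test_functions"
  have \<rho>: "distribution \<rho>" "dist_supported_in \<rho> {(t, x). norm x \<le> t}" using assms(1) unfolding wave_fundamental_solution_def by auto
  obtain R where R: "\<And>z. z \<in> half_space ==> conv_check f \<rho> z \<noteq> 0 ==> norm z \<le> R" using conv_check_bounded_support[OF \<rho>(2) f] by blast
  have c: "continuous_on UNIV (conv_check f \<rho>)" by (rule conv_check_continuous[OF \<rho>(1) f])
  have "compact (conv_check f \<rho> ` cball 0 R)" by (intro compact_continuous_image continuous_on_subset[OF c]) auto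
  then obtain B where B: "\<forall>y\<in>conv_check f \<rho> ` cball 0 R. norm y \<le> B" using compact_imp_bounded bounded_iff by metis
  show "conv_check f \<rho> \<in> L_space \<alpha>" by (rule L_space_bounded_support[of _ _ R B]) (use R B assms borel_measurable_continuous_onI[OF c] in auto)
qed

section \<open>Waves focusing at a point\<close>

lemma Basis_prod_wave:
  "Basis = insert (1, 0) (range (\<lambda>i. (0, axis i 1)) :: (real \<times> (real^'n)) set)" by (auto simp: Basis_prod_def Basis_vec_def)

lemma time_Basis [simp, intro]: "(1, 0) \<in> (Basis :: (real \<times> (real^'n)) set)"
  and space_Basis [simp, intro]: "(0, axis i 1) \<in> (Basis :: (real \<times> (real^'n)) set)" by (auto simp: Basis_prod_wave)

lemma wave_op_shift: "wave_op (\<lambda>w. g (z + w)) = (\<lambda>w. wave_op g (z + w))" unfolding wave_op_def by (simp add: pderiv_dir_shift)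

lemma wave_op_cong_open:
  assumes "open U" "z \<in> U" "\<And>y. y \<in> U ==> f y = g y"
  shows "wave_op f z = wave_op g z"
proof -
  have *: "pderiv_dir v f y = pderiv_dir v g y" if "y \<in> U" for v y by (rule pderiv_dir_cong_open[OF assms(1) that assms(3)])
  have "pderiv_dir v (pderiv_dir v f) z = pderiv_dir v (pderiv_dir v g) z" for v by (rule pderiv_dir_cong_open[OF assms(1,2) *])
  then show ?thesis unfolding wave_op_def by simp
qed

lemma wave_op_zero:
  fixes z :: "real \<times> (real^'n)" shows "wave_op (\<lambda>_. 0) z = 0"
proof -
  have "pderiv_dir v (\<lambda>_::real \<times> (real^'n). 0) = (\<lambda>_. 0)" for v by (intro ext pderiv_dir_eqI[of _ "\<lambda>_. 0"]) simp
  then show ?thesis unfolding wave_op_def by simp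
qed

lemma test_functions_wave_op: "f \<in> test_functions ==> wave_op f \<in> test_functions"
  unfolding wave_op_def by (intro test_functions_diff test_functions_sum test_functions_pderiv) auto

text \<open>The square of the distance to the light cone after the complex time shift \<open>t \<mapsto> t - i e\<close>,
  restricted to the coordinates in \<open>T\<close>. Suitable functions of it solve the wave equation and are
  regular on all of space-time.\<close>

definition cphase :: "'n set => real => real \<times> (real^'n) => complex" where
  "cphase T e z = of_real (\<Sum>i\<in>T. (snd z $ i)\<^sup>2) - (of_real (fst z) - \<i> * of_real e)\<^sup>2"

lemma Re_cphase: "Re (cphase T e z) = (\<Sum>i\<in>T. (snd z $ i)\<^sup>2) - (fst z)\<^sup>2 + e\<^sup>2"
  and Im_cphase: "Im (cphase T e z) = 2 * fst z * e" unfolding cphase_def by (simp_all add: power2_eq_square algebra_simps)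

text \<open>At time 0 the real part is at least e^2 > 0, and at any other time the imaginary part
  does not vanish. Thus the principal branches of \<open>Ln\<close> and \<open>csqrt\<close> can be
  applied to the phase without ever meeting their cut.\<close>

lemma cphase_nonpos_Reals:
  assumes "e > 0" shows "cphase T e z \<notin> \<real>\<^sub>\<le>\<^sub>0"
proof
  assume "cphase T e z \<in> \<real>\<^sub>\<le>\<^sub>0"
  then have *: "Re (cphase T e z) \<le> 0" "Im (cphase T e z) = 0" by (auto simp: complex_nonpos_Reals_iff)
  then have "fst z = 0" using assms by (simp add: Im_cphase)
  moreover have "(\<Sum>i\<in>T. (snd z $ i)\<^sup>2) \<ge> 0" by (intro sum_nonneg) auto
  ultimately show False using * assms by (auto simp: Re_cphase) (smt (verit) zero_less_power2)
qed

lemma cphase_nonzero: "e > 0 ==> cphase T e z \<noteq> 0" using cphase_nonpos_Reals[of e T z] by auto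

lemma cphase_time_derivative:
  "((\<lambda>h. cphase T e (z + h *\<^sub>R (1, 0))) has_vector_derivative (-2 * (of_real (fst z) - \<i> * of_real e))) (at 0)"
proof -
  have "((\<lambda>h. of_real (\<Sum>i\<in>T. (snd z $ i)\<^sup>2) - (of_real (fst z + h) - \<i> * of_real e)\<^sup>2) has_vector_derivative
      (0 - (2 * (of_real (fst z) - \<i> * of_real e)))) (at 0)" unfolding power2_eq_square by (auto intro!: derivative_eq_intros)
  then show ?thesis by (simp add: cphase_def)
qed

lemma cphase_space_derivative:
  fixes T :: "'n::finite set"
  shows "((\<lambda>h. cphase T e (z + h *\<^sub>R (0, axis i 1))) has_vector_derivative
     (if i \<in> T then 2 * of_real (snd z $ i) else 0)) (at 0)"
proof -
  have "((\<lambda>h. \<Sum>j\<in>T. (snd z $ j + h * axis i 1 $ j)\<^sup>2) has_real_derivative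
      (\<Sum>j\<in>T. 2 * (snd z $ j) * axis i 1 $ j)) (at 0)" by (auto intro!: derivative_eq_intros sum.cong)
  also have "(\<Sum>j\<in>T. 2 * (snd z $ j) * axis i 1 $ j) = (\<Sum>j\<in>T. if j = i then 2 * (snd z $ j) else 0)" by (intro sum.cong) (auto simp: axis_def)
  also have "... = (if i \<in> T then 2 * snd z $ i else 0)" by simp
  finally have "((\<lambda>h. of_real (\<Sum>j\<in>T. (snd z $ j + h * axis i 1 $ j)\<^sup>2) - (of_real (fst z) - \<i> * of_real e)\<^sup>2) has_vector_derivative
      (of_real (if i \<in> T then 2 * snd z $ i else 0) - 0)) (at 0)"
    by (intro has_vector_derivative_diff has_vector_derivative_const has_vector_derivative_of_real)
  then show ?thesis by (auto simp: cphase_def)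
qed

lemma cphase_chain:
  assumes "(g has_field_derivative g') (at (cphase T e z))"
    and "((\<lambda>h. cphase T e (z + h *\<^sub>R v)) has_vector_derivative D) (at 0)"
  shows "((\<lambda>h. g (cphase T e (z + h *\<^sub>R v))) has_vector_derivative (D * g')) (at 0)"
  using field_vector_diff_chain_at[OF assms(2), of g g'] assms(1) by (simp add: o_def)

lemma has_real_derivative_Re:
  "(f has_vector_derivative D) (at x) ==> ((\<lambda>x. Re (f x)) has_real_derivative Re D) (at x)"
  and has_real_derivative_Im:
  "(f has_vector_derivative D) (at x) ==> ((\<lambda>x. Im (f x)) has_real_derivative Im D) (at x)" unfolding has_real_derivative_iff_has_vector_derivative
  by (rule bounded_linear.has_vector_derivative[OF bounded_linear_Re] bounded_linear.has_vector_derivative[OF bounded_linear_Im]; assumption)+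

lemma cphase_wave_derivatives:
  fixes T :: "'n::finite set"
  assumes g: "\<And>z. (g has_field_derivative g1 (cphase T e z)) (at (cphase T e z))"
    and g1: "\<And>z. (g1 has_field_derivative g2 (cphase T e z)) (at (cphase T e z))"
  shows "((\<lambda>h. g (cphase T e (z + h *\<^sub>R (1, 0)))) has_vector_derivative
      (-2 * (of_real (fst z) - \<i> * of_real e) * g1 (cphase T e z))) (at 0)" (is ?t)
    and "((\<lambda>h. -2 * (of_real (fst (z + h *\<^sub>R (1, 0))) - \<i> * of_real e) * g1 (cphase T e (z + h *\<^sub>R (1, 0)))) has_vector_derivative
      (-2 * g1 (cphase T e z) + 4 * (of_real (fst z) - \<i> * of_real e)\<^sup>2 * g2 (cphase T e z))) (at 0)" (is ?tt)
    and "((\<lambda>h. g (cphase T e (z + h *\<^sub>R (0, axis i 1)))) has_vector_derivative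
      (if i \<in> T then 2 * of_real (snd z $ i) * g1 (cphase T e z) else 0)) (at 0)" (is ?x)
    and "((\<lambda>h. if i \<in> T then 2 * of_real (snd (z + h *\<^sub>R (0, axis i 1)) $ i) * g1 (cphase T e (z + h *\<^sub>R (0, axis i 1))) else 0) has_vector_derivative
      (if i \<in> T then 2 * g1 (cphase T e z) + 4 * of_real ((snd z $ i)\<^sup>2) * g2 (cphase T e z) else 0)) (at 0)" (is ?xx)
proof -
  show ?t using cphase_chain[OF g cphase_time_derivative] .
  show ?x using cphase_chain[OF g cphase_space_derivative, of z i] by auto
  have "((\<lambda>h. -2 * (of_real (fst z + h) - \<i> * of_real e)) has_vector_derivative -2) (at 0)" by (auto intro!: derivative_eq_intros)
  from has_vector_derivative_mult[OF this cphase_chain[OF g1 cphase_time_derivative, of z]]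
  show ?tt by (simp add: algebra_simps power2_eq_square zero_prod_def[symmetric])
  have "((\<lambda>h. 2 * of_real (snd z $ i + h)) has_vector_derivative (2::complex)) (at 0)" by (auto intro!: derivative_eq_intros)
  from has_vector_derivative_mult[OF this cphase_chain[OF g1 cphase_space_derivative, of z i]]
  show ?xx by (cases "i \<in> T") (simp_all add: algebra_simps power2_eq_square zero_prod_def[symmetric])
qed

text \<open>For a function g of the phase the wave equation becomes the ordinary differential
  equation (k + 1) g' = -2 y g'' with k = \<open>card T\<close>; \<open>a\<close> and
  \<open>b\<close> stand for g' and g''. Up to additive constants its solutions are the multiples of
  y^((1 - k) / 2), and of log y if k = 1. Hence 1 / y for the focusing wave with k = 3, and
  \<open>Ln\<close> and 1 / \<open>csqrt\<close> for the fundamental solutions with k = 1 and k =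
  2.\<close>

lemma cphase_wave_equation:
  fixes T :: "'n::finite set"
  assumes "of_nat (card T + 1) * a = - 2 * cphase T e z * b"
  shows "(-2 * a + 4 * (of_real (fst z) - \<i> * of_real e)\<^sup>2 * b) =
     (\<Sum>i\<in>UNIV. if i \<in> T then 2 * a + 4 * of_real ((snd z $ i)\<^sup>2) * b else 0)"
proof -
  have "(\<Sum>i\<in>UNIV. if i \<in> T then 2 * a + 4 * of_real ((snd z $ i)\<^sup>2) * b else 0)
      = (\<Sum>i\<in>T. 2 * a + 4 * of_real ((snd z $ i)\<^sup>2) * b)" by (simp add: sum.If_cases)
  also have "... = 2 * of_nat (card T) * a + 4 * of_real (\<Sum>i\<in>T. (snd z $ i)\<^sup>2) * b" by (simp add: sum.distrib sum_distrib_left sum_distrib_right)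
  also have "of_real (\<Sum>i\<in>T. (snd z $ i)\<^sup>2) = cphase T e z + (of_real (fst z) - \<i> * of_real e)\<^sup>2" unfolding cphase_def by simp
  finally have *: "(\<Sum>i\<in>UNIV. if i \<in> T then 2 * a + 4 * of_real ((snd z $ i)\<^sup>2) * b else 0) =
    2 * of_nat (card T) * a + 4 * (cphase T e z + (of_real (fst z) - \<i> * of_real e)\<^sup>2) * b" .
  show ?thesis using assms[unfolded of_nat_add of_nat_1] unfolding * by algebra
qed

lemma smooth_fst: "smooth (\<lambda>z::real \<times> (real^'n). fst z)" by (intro smooth_linear bounded_linear_fst)

lemma smooth_snd_nth: "smooth (\<lambda>z::real \<times> (real^'n). snd z $ i)"
  by (intro smooth_linear bounded_linear_compose[OF bounded_linear_vec_nth bounded_linear_snd])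

text \<open>For \<open>card T = 3\<close> this is a spherical wave focusing at the origin at time 0, in the three
  coordinates of \<open>T\<close> and constant in the others. Its value at the origin is 1, while off the light cone
  it and its time derivative tend to 0 with \<open>e\<close> and stay bounded for times of order 1.\<close>

definition focus_wave :: "'n set => real => real \<times> (real^'n) => real" where
  "focus_wave T e z = e\<^sup>2 * Re (inverse (cphase T e z))"

lemma focus_wave_origin: "e > 0 ==> focus_wave T e 0 = 1" by (simp add: focus_wave_def cphase_def power2_eq_square)

text \<open>The real part of 1 / c is Re c / |c|^2, here a quotient of polynomials in the
  coordinates whose denominator has no zeros.\<close>

lemma smooth_focus_wave:
  fixes T :: "'n::finite set"
  assumes "e > 0" shows "smooth (focus_wave T e)"
proof -
  let ?q = "\<lambda>z::real \<times> (real^'n). \<Sum>i\<in>T. (snd z $ i)\<^sup>2"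
  have "(?q z - (fst z)\<^sup>2 + e\<^sup>2)\<^sup>2 + (2 * e * fst z)\<^sup>2 \<noteq> 0" for z
    using cphase_nonzero[OF assms, of T z] by (simp add: complex_eq_iff Re_cphase Im_cphase)
  then have "smooth (\<lambda>z. e\<^sup>2 * ((?q z - (fst z)\<^sup>2 + e\<^sup>2) / ((?q z - (fst z)\<^sup>2 + e\<^sup>2)\<^sup>2 + (2 * e * fst z)\<^sup>2)))"
    by (intro smooth_mult smooth_divide smooth_add smooth_diff smooth_power smooth_sum smooth_const smooth_fst smooth_snd_nth)
  also have "(\<lambda>z. e\<^sup>2 * ((?q z - (fst z)\<^sup>2 + e\<^sup>2) / ((?q z - (fst z)\<^sup>2 + e\<^sup>2)\<^sup>2 + (2 * e * fst z)\<^sup>2))) = focus_wave T e"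
    by (intro ext) (simp add: focus_wave_def Re_cphase Im_cphase mult_ac)
  finally show ?thesis .
qed

lemma focus_wave_derivatives:
  fixes T :: "'n::finite set"
  assumes d: "d > 0"
  shows focus_wave_time: "pderiv_dir (1, 0) (focus_wave T d) =
      (\<lambda>z. d\<^sup>2 * Re (2 * (of_real (fst z) - \<i> * of_real d) / (cphase T d z)\<^sup>2))" (is ?t)
    and "card T = 3 ==> wave_op (focus_wave T d) z = 0"
proof -
  let ?g = "\<lambda>u::complex. inverse u" and ?g1 = "\<lambda>u::complex. - 1 / u\<^sup>2" and ?g2 = "\<lambda>u::complex. 2 / u ^ 3"
  have g: "(?g has_field_derivative ?g1 (cphase T d z)) (at (cphase T d z))"
    and g1: "(?g1 has_field_derivative ?g2 (cphase T d z)) (at (cphase T d z))" for z using cphase_nonzero[OF d, of T z]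
    by (auto intro!: derivative_eq_intros simp: power2_eq_square power3_eq_cube field_simps)
  note D = cphase_wave_derivatives[of ?g ?g1 T d ?g2, OF g g1]
  have s: "smooth (focus_wave T d)" using smooth_focus_wave[OF d] .
  have t: "pderiv_dir (1, 0) (focus_wave T d) z = d\<^sup>2 * Re (- 2 * (of_real (fst z) - \<i> * of_real d) * ?g1 (cphase T d z))" for z
    by (rule pderiv_dir_unique[OF s], unfold focus_wave_def, intro DERIV_cmult has_real_derivative_Re D(1))
  have e: "- 2 * a * (- 1 / b) = 2 * a / b" for a b :: complex by simp
  show ?t unfolding t e by simp
  have x: "pderiv_dir (0, axis i 1) (focus_wave T d) z = d\<^sup>2 * Re (if i \<in> T then 2 * of_real (snd z $ i) * ?g1 (cphase T d z) else 0)" for i z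
    by (rule pderiv_dir_unique[OF s], unfold focus_wave_def, intro DERIV_cmult has_real_derivative_Re D(3))
  have tt: "pderiv_dir (1, 0) (pderiv_dir (1, 0) (focus_wave T d)) z = d\<^sup>2 * Re (- 2 * ?g1 (cphase T d z) + 4 * (of_real (fst z) - \<i> * of_real d)\<^sup>2 * ?g2 (cphase T d z))" for z
    by (rule pderiv_dir_unique[OF smooth_pderiv_Basis[OF s time_Basis]], unfold t, intro DERIV_cmult has_real_derivative_Re D(2))
  have xx: "pderiv_dir (0, axis i 1) (pderiv_dir (0, axis i 1) (focus_wave T d)) z = d\<^sup>2 * Re (if i \<in> T then 2 * ?g1 (cphase T d z) + 4 * of_real ((snd z $ i)\<^sup>2) * ?g2 (cphase T d z) else 0)" for i z
    by (rule pderiv_dir_unique[OF smooth_pderiv_Basis[OF s space_Basis]], unfold x, intro DERIV_cmult has_real_derivative_Re D(4))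
  assume "card T = 3"
  then have "of_nat (card T + 1) * ?g1 (cphase T d z) = - 2 * cphase T d z * ?g2 (cphase T d z)" by (simp add: power2_eq_square power3_eq_cube)
  note eq = cphase_wave_equation[OF this]
  have "(\<Sum>i\<in>(UNIV::'n set). d\<^sup>2 * Re (f i)) = d\<^sup>2 * Re (\<Sum>i\<in>UNIV. f i)" for f by (simp only: sum_distrib_left Re_sum)
  then show "wave_op (focus_wave T d) z = 0" unfolding wave_op_def tt xx eq by simp
qed

lemma norm_cphase_ge: "norm (cphase T e z) \<ge> 2 * \<bar>fst z\<bar> * \<bar>e\<bar>" using abs_Im_le_cmod[of "cphase T e z"] by (simp add: Im_cphase)

text \<open>Between times 1 and 2 the phase is at least 2 e in modulus. The factor e^2, which
  normalizes the value at the origin, just compensates for the time derivative, which is of the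
  order of the inverse square of the phase.\<close>

lemma focus_wave_bounds:
  assumes e: "e > 0" "e \<le> 1" and z: "1 \<le> fst z" "fst z \<le> 2"
  shows "\<bar>focus_wave T e z\<bar> \<le> 1" "\<bar>e\<^sup>2 * Re (2 * (of_real (fst z) - \<i> * of_real e) / (cphase T e z)\<^sup>2)\<bar> \<le> 2"
proof -
  have n: "norm (cphase T e z) \<ge> 2 * e"
  proof -
    have "2 * 1 * e \<le> 2 * \<bar>fst z\<bar> * \<bar>e\<bar>" using e z by simp
    then show ?thesis using norm_cphase_ge[of z e T] by simp
  qed
  have "\<bar>focus_wave T e z\<bar> \<le> e\<^sup>2 * norm (inverse (cphase T e z))"
    unfolding focus_wave_def by (simp add: abs_mult mult_left_mono abs_Re_le_cmod del: inverse_complex.sel)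
  also have "... \<le> e\<^sup>2 * inverse (2 * e)" unfolding norm_inverse using n e by (intro mult_left_mono le_imp_inverse_le) auto
  also have "... \<le> 1" using e by (simp add: power2_eq_square field_simps)
  finally show "\<bar>focus_wave T e z\<bar> \<le> 1" .
  have 3: "norm (of_real (fst z) - \<i> * of_real e) \<le> 3"
    using norm_triangle_ineq4[of "of_real (fst z)" "\<i> * of_real e :: complex"] e z by (simp add: norm_mult)
  have "\<bar>e\<^sup>2 * Re (2 * (of_real (fst z) - \<i> * of_real e) / (cphase T e z)\<^sup>2)\<bar>
    \<le> e\<^sup>2 * norm (2 * (of_real (fst z) - \<i> * of_real e) / (cphase T e z)\<^sup>2)"
    using mult_left_mono[OF abs_Re_le_cmod, of "e\<^sup>2"] by (simp only: abs_mult) simp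
  also have "... \<le> e\<^sup>2 * ((2 * 3) / (2 * e)\<^sup>2)" unfolding norm_divide norm_mult norm_power using n e 3 by (intro frac_le mult_mono power_mono) auto
  also have "... \<le> 2" by simp
  finally show "\<bar>e\<^sup>2 * Re (2 * (of_real (fst z) - \<i> * of_real e) / (cphase T e z)\<^sup>2)\<bar> \<le> 2" .
qed

lemma focus_wave_tendsto:
  assumes "(\<Sum>i\<in>T. (snd z $ i)\<^sup>2) \<noteq> (fst z)\<^sup>2"
  shows "((\<lambda>e. focus_wave T e z) \<longlongrightarrow> 0) (at_right 0)"
    "((\<lambda>e. e\<^sup>2 * Re (2 * (of_real (fst z) - \<i> * of_real e) / (cphase T e z)\<^sup>2)) \<longlongrightarrow> 0) (at_right 0)"
proof -
  have "((\<lambda>e. cphase T e z) \<longlongrightarrow> cphase T 0 z) (at_right 0)" unfolding cphase_def by (intro tendsto_intros)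
  moreover have nz: "cphase T 0 z \<noteq> 0" using assms by (auto simp: complex_eq_iff Re_cphase)
  ultimately have "((\<lambda>e. e\<^sup>2 * Re (inverse (cphase T e z))) \<longlongrightarrow> 0\<^sup>2 * Re (inverse (cphase T 0 z))) (at_right 0)"
    "((\<lambda>e. e\<^sup>2 * Re (2 * (of_real (fst z) - \<i> * of_real e) / (cphase T e z)\<^sup>2)) \<longlongrightarrow>
      0\<^sup>2 * Re (2 * (of_real (fst z) - \<i> * of_real 0) / (cphase T 0 z)\<^sup>2)) (at_right 0)" by (intro tendsto_intros; simp)+
  then show "((\<lambda>e. focus_wave T e z) \<longlongrightarrow> 0) (at_right 0)"
    "((\<lambda>e. e\<^sup>2 * Re (2 * (of_real (fst z) - \<i> * of_real e) / (cphase T e z)\<^sup>2)) \<longlongrightarrow> 0) (at_right 0)" unfolding focus_wave_def by auto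
qed

text \<open>For fixed x at most two times are excluded, and Fubini's theorem is applied in this
  order. If \<open>T\<close> is not \<open>UNIV\<close>, the exceptional set is the light cone in
  the coordinates of \<open>T\<close> only.\<close>

lemma AE_off_light_cone:
  "AE z in lborel. (\<Sum>i\<in>T. (snd (z :: real \<times> (real^'n)) $ i)\<^sup>2) \<noteq> (fst z)\<^sup>2"
proof -
  let ?P = "\<lambda>(t::real) x. (\<Sum>i\<in>T. (x $ i)\<^sup>2) \<noteq> t\<^sup>2"
  have "AE t in lborel. ?P t x" for x
  proof -
    have "{t. t\<^sup>2 = (\<Sum>i\<in>T. (x $ i)\<^sup>2)} \<subseteq> {sqrt (\<Sum>i\<in>T. (x $ i)\<^sup>2), - sqrt (\<Sum>i\<in>T. (x $ i)\<^sup>2)}" by (auto dest!: arg_cong[of "_\<^sup>2" _ sqrt])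
    then have "finite {t. t\<^sup>2 = (\<Sum>i\<in>T. (x $ i)\<^sup>2)}" by (rule finite_subset) simp
    then have "{t. t\<^sup>2 = (\<Sum>i\<in>T. (x $ i)\<^sup>2)} \<in> null_sets lborel" by (rule finite_imp_null_set_lborel)
    from AE_not_in[OF this] show ?thesis by eventually_elim auto
  qed
  then have 2: "AE x in lborel. AE t in lborel. ?P t x" by simp
  have "open {z::real \<times> (real^'n). (\<Sum>i\<in>T. (snd z $ i)\<^sup>2) \<noteq> (fst z)\<^sup>2}" by (intro open_Collect_neq continuous_intros)
  then have m: "{z \<in> space (lborel \<Otimes>\<^sub>M lborel). ?P (fst z) (snd z)} \<in> sets (lborel \<Otimes>\<^sub>M lborel)" unfolding lborel_prod by simp
  have "AE t in lborel. AE x in lborel. ?P t x" using 2 lborel_pair.AE_commute[of ?P, OF m] by blast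
  then have "AE z in lborel \<Otimes>\<^sub>M lborel. ?P (fst z) (snd z)" by (intro lborel_pair.AE_pair_measure[OF m]) (simp only: fst_conv snd_conv)
  then show ?thesis unfolding lborel_prod by simp
qed

text \<open>The commutator of the wave operator with a function of time contains only its first two
  time derivatives. Hence a solution that is switched off by a time cut-off has a source only where
  the cut-off varies.\<close>

lemma wave_op_mult_time:
  fixes X w :: "real \<times> (real^'n) => real"
  assumes X: "smooth X" and w: "smooth w"
    and Xi: "\<And>i z. pderiv_dir (0, axis i 1) X z = 0"
  shows "wave_op (\<lambda>z. X z * w z) z = X z * wave_op w z
     + pderiv_dir (1, 0) (pderiv_dir (1, 0) X) z * w z + 2 * pderiv_dir (1, 0) X z * pderiv_dir (1, 0) w z"
proof -
  have 1: "pderiv_dir v (\<lambda>z. X z * w z) = (\<lambda>z. X z * pderiv_dir v w z + pderiv_dir v X z * w z)" for v by (intro ext pderiv_dir_mult X w)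
  have 2: "pderiv_dir v (pderiv_dir v (\<lambda>z. X z * w z)) z =
     X z * pderiv_dir v (pderiv_dir v w) z + 2 * pderiv_dir v X z * pderiv_dir v w z + pderiv_dir v (pderiv_dir v X) z * w z" if "v \<in> Basis" for v
    unfolding 1 using X w smooth_pderiv_Basis[OF X that] smooth_pderiv_Basis[OF w that] by (subst pderiv_dir_add) (auto simp: pderiv_dir_mult)
  have Xi0: "pderiv_dir (0, axis i 1) X = (\<lambda>_. 0)" for i using Xi by blast
  have 0: "pderiv_dir v (\<lambda>_::real \<times> (real^'n). 0) z = 0" for v by (rule pderiv_dir_eqI[of _ "\<lambda>_. 0"]) simp
  have 3: "pderiv_dir (0, axis i 1) (pderiv_dir (0, axis i 1) (\<lambda>z. X z * w z)) z = X z * pderiv_dir (0, axis i 1) (pderiv_dir (0, axis i 1) w) z" for i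
    using 2[OF space_Basis, of i] unfolding Xi0 0 by simp
  show ?thesis unfolding wave_op_def 2[OF time_Basis] 3 by (simp add: algebra_simps sum_distrib_left)
qed

lemma smooth_time_step:
  assumes "a < b" shows "smooth (\<lambda>z::real \<times> (real^'n). smooth_step a b (fst z))" by (intro smooth_smooth_step assms smooth_fst)

lemma time_step_space_deriv:
  assumes "a < b"
  shows "pderiv_dir (0, axis i 1) (\<lambda>z::real \<times> (real^'n). smooth_step a b (fst z)) z = 0"
  by (rule pderiv_dir_unique[OF smooth_time_step[OF assms]]) simp

lemma smooth_norm_square: "smooth (\<lambda>z::'a::euclidean_space. (norm z)\<^sup>2)"
proof -
  have "(\<lambda>z::'a. (norm z)\<^sup>2) = (\<lambda>z. \<Sum>b\<in>Basis. (z \<bullet> b) * (z \<bullet> b))" by (intro ext, subst power2_norm_eq_inner, subst euclidean_inner, rule refl)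
  then show ?thesis by force
qed

definition ball_cutoff :: "real => 'a::euclidean_space => real" where
  "ball_cutoff r z = smooth_step (r\<^sup>2) ((r + 1)\<^sup>2) ((norm z)\<^sup>2)"

lemma ball_cutoff_1: "r \<ge> 0 ==> norm z \<le> r ==> ball_cutoff r z = 1"
  and ball_cutoff_0: "r \<ge> 0 ==> norm z \<ge> r + 1 ==> ball_cutoff r z = 0"
  unfolding ball_cutoff_def by (auto intro!: smooth_step_1 smooth_step_0 power_strict_mono)

lemma ball_cutoff_test:
  assumes "r \<ge> 0" shows "ball_cutoff r \<in> test_functions" unfolding test_functions_iff
proof
  have "r\<^sup>2 < (r + 1)\<^sup>2" using assms by (intro power_strict_mono) auto
  from smooth_smooth_step[OF this smooth_norm_square] show "smooth (ball_cutoff r :: 'a => real)" unfolding ball_cutoff_def .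
  have "norm z \<le> r + 1" if "ball_cutoff r z \<noteq> 0" for z using ball_cutoff_0[OF assms, of z] that by linarith
  then show "\<exists>R. \<forall>z::'a. ball_cutoff r z \<noteq> 0 --> norm z \<le> R" by blast
qed

text \<open>The potential at z depends on the source in z plus the forward cone only. So
  \<open>h\<close> has to solve the equation just on an open set \<open>V\<close> containing the
  cones that issue from \<open>U\<close>; elsewhere \<open>h\<close> may have been cut off at will,
  and the discrepancy of the sources is invisible to \<rho>.\<close>

lemma wave_potential_local:
  fixes \<rho> :: "(real \<times> (real^'n) => real) => real"
  assumes \<rho>: "wave_fundamental_solution \<rho>" and g: "g \<in> test_functions" and h: "h \<in> test_functions"
    and eq: "\<And>y w. y \<in> U ==> norm (snd w) \<le> fst w ==> y + w \<in> V"
    and V: "open V" "\<And>z. z \<in> V ==> wave_op h z = g z"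
    and z: "z \<in> U"
  shows "conv_check g \<rho> z = h z"
proof -
  have d: "distribution \<rho>" and s: "dist_supported_in \<rho> {(t, x). norm x \<le> t}" and f: "\<And>g. g \<in> test_functions ==> \<rho> (wave_op g) = g 0"
    using \<rho> unfolding wave_fundamental_solution_def by auto
  have t: "(\<lambda>w. h (z + w)) \<in> test_functions" "(\<lambda>w. g (z + w)) \<in> test_functions" "(\<lambda>w. wave_op h (z + w)) \<in> test_functions"
    by (intro test_functions_shift g h test_functions_wave_op)+
  have "fun_supp (\<lambda>w. wave_op h (z + w) - g (z + w)) \<subseteq> (\<lambda>w. z + w) -` (- V)"
  proof (rule fun_supp_subset)
    show "closed ((\<lambda>w. z + w) -` (- V))" using V(1) by (intro continuous_closed_vimage) auto
    fix w assume "wave_op h (z + w) - g (z + w) \<noteq> 0"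
    then show "w \<in> (\<lambda>w. z + w) -` (- V)" using V(2)[of "z + w"] by auto
  qed
  then have "fun_supp (\<lambda>w. wave_op h (z + w) - g (z + w)) \<inter> {(t, x). norm x \<le> t} = {}" using eq[OF z] by force
  then have "\<rho> (\<lambda>w. wave_op h (z + w) - g (z + w)) = 0" using s test_functions_diff[OF t(3,2)] unfolding dist_supported_in_def by blast
  then have "\<rho> (\<lambda>w. g (z + w)) = \<rho> (wave_op (\<lambda>w. h (z + w)))" using distribution_diff[OF d t(3,2)] by (simp add: wave_op_shift)
  also have "... = h z" using f[OF t(1)] by simp
  finally show ?thesis unfolding conv_check_def .
qed

text \<open>In dimension at least 3, bounded sources that tend to zero almost everywhere can have
  potentials equal to 1 at the origin, for the waves that they emit may focus there.\<close>

lemma focusing_sources: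
  assumes n: "CARD('n::finite) \<ge> 3"
  obtains f w :: "nat => real \<times> (real^'n) => real" and C :: real
  where "\<And>n. f n \<in> test_functions" "C \<ge> 0" "\<And>n z. \<bar>f n z\<bar> \<le> C * indicator (cball 0 11) z"
    "AE z in lborel. (\<lambda>n. f n z) \<longlonglongrightarrow> 0"
    "\<And>n. continuous_on UNIV (w n)" "\<And>n. w n 0 = 1"
    "\<And>\<rho> n z. wave_fundamental_solution \<rho> ==> norm z \<le> 1 ==> conv_check (f n) \<rho> z = w n z"
proof -
  obtain T :: "'n set" where T: "card T = 3" using obtain_subset_with_card_n[OF n] by metis
  define e where "e n = inverse (real (Suc n))" for n
  have e: "e n > 0" "e n \<le> 1" for n unfolding e_def by (auto simp: inverse_le_1_iff)
  \<comment> \<open>The potential looks into the future: the wave is switched off after time 2, and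
    its source, at times between 1 and 2, produces the unaltered wave before time 1.\<close>
  define X where "X = (\<lambda>z::real \<times> (real^'n). smooth_step 1 2 (fst z))"
  define \<kappa> where "\<kappa> = (ball_cutoff 10 :: real \<times> (real^'n) => real)"
  define w where "w n = focus_wave T (e n)" for n
  define Xt where "Xt = pderiv_dir (1, 0) X"
  define Xtt where "Xtt = pderiv_dir (1, 0) Xt"
  \<comment> \<open>The wave operator of \<open>X * w n\<close>, multiplied by the cut-off \<kappa>;
    the term with the wave operator of \<open>w n\<close> drops out because \<open>w n\<close>
    solves the equation.\<close>
  define f where "f n z = \<kappa> z * Xtt z * w n z + 2 * (\<kappa> z * Xt z) * pderiv_dir (1, 0) (w n) z" for n z
  define g where "g n z = \<kappa> z * (X z * w n z)" for n z
  have sw: "smooth (w n)" for n unfolding w_def by (rule smooth_focus_wave[OF e(1)])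
  have swt: "smooth (pderiv_dir (1, 0) (w n))" for n by (intro smooth_pderiv_Basis sw) simp
  have sX: "smooth X" unfolding X_def by (rule smooth_time_step) simp
  have sXt: "smooth Xt" unfolding Xt_def by (intro smooth_pderiv_Basis sX) simp
  have sXtt: "smooth Xtt" unfolding Xtt_def by (intro smooth_pderiv_Basis sXt) simp
  have k: "\<kappa> \<in> test_functions" unfolding \<kappa>_def by (rule ball_cutoff_test) simp
  have t1: "(\<lambda>z. \<kappa> z * Xtt z) \<in> test_functions" "(\<lambda>z. \<kappa> z * Xt z) \<in> test_functions" by (intro test_functions_mult k sXt sXtt)+
  have ft: "f n \<in> test_functions" for n unfolding f_def by (intro test_functions_add test_functions_mult test_functions_cmult t1 sw swt)
  have gt: "g n \<in> test_functions" for n unfolding g_def by (intro test_functions_mult k smooth_mult sX sw)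
  have Xt0: "Xt z = 0" if "fst z < 1 \<or> fst z > 2" for z using that
  proof
    assume "fst z < 1"
    have "Xt z = pderiv_dir (1, 0) (\<lambda>_. 1) z" unfolding Xt_def by (rule pderiv_dir_cong_open[of "{z. fst z < 1}"])
        (use \<open>fst z < 1\<close> in \<open>auto simp: X_def smooth_step_1 intro!: open_Collect_less continuous_intros\<close>)
    also have "... = 0" by (rule pderiv_dir_eqI[of _ "\<lambda>_. 0"]) simp
    finally show ?thesis .
  next
    assume "fst z > 2"
    show ?thesis unfolding Xt_def by (rule pderiv_dir_zero_open[of "{z. fst z > 2}"])
        (use \<open>fst z > 2\<close> in \<open>auto simp: X_def smooth_step_0 intro!: open_Collect_less continuous_intros\<close>)
  qed
  have Xtt0: "Xtt z = 0" if "fst z < 1 \<or> fst z > 2" for z unfolding Xtt_def by (rule pderiv_dir_zero_open[of "{z. fst z < 1} \<union> {z. fst z > 2}"])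
      (use that Xt0 in \<open>auto intro!: open_Un open_Collect_less continuous_intros\<close>)
  obtain B1 B2 where B: "B1 > 0" "\<And>z. \<bar>\<kappa> z * Xtt z\<bar> \<le> B1" "B2 > 0" "\<And>z. \<bar>\<kappa> z * Xt z\<bar> \<le> B2"
    using test_functions_bounded[OF t1(1)] test_functions_bounded[OF t1(2)] by metis
  have wt: "pderiv_dir (1, 0) (w n) z = (e n)\<^sup>2 * Re (2 * (of_real (fst z) - \<i> * of_real (e n)) / (cphase T (e n) z)\<^sup>2)" for n z
    unfolding w_def focus_wave_time[OF e(1)] ..
  show thesis
  proof (rule that[of f "B1 + 4 * B2" w])
    show "f n \<in> test_functions" for n by (rule ft)
    show "0 \<le> B1 + 4 * B2" using B by simp
    show "\<bar>f n z\<bar> \<le> (B1 + 4 * B2) * indicator (cball 0 11) z" for n z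
    proof (cases "fst z < 1 \<or> fst z > 2 \<or> norm z \<ge> 11")
      case True
      then have "f n z = 0" using Xt0[of z] Xtt0[of z] ball_cutoff_0[of 10 z] unfolding f_def \<kappa>_def by auto
      then show ?thesis using B by simp
    next
      case False
      then have z: "1 \<le> fst z" "fst z \<le> 2" by auto
      have "\<bar>f n z\<bar> \<le> \<bar>\<kappa> z * Xtt z\<bar> * \<bar>w n z\<bar> + 2 * \<bar>\<kappa> z * Xt z\<bar> * \<bar>pderiv_dir (1, 0) (w n) z\<bar>"
        unfolding f_def using abs_triangle_ineq[of "\<kappa> z * Xtt z * w n z" "2 * (\<kappa> z * Xt z) * pderiv_dir (1, 0) (w n) z"] by (simp add: abs_mult)
      also have "... \<le> B1 * 1 + 2 * B2 * 2"
      proof -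
        have "\<bar>w n z\<bar> \<le> 1" "\<bar>pderiv_dir (1, 0) (w n) z\<bar> \<le> 2" unfolding wt unfolding w_def by (rule focus_wave_bounds[OF e(1)[of n] e(2) z, of T])+
        then show ?thesis using B by (intro add_mono mult_mono) auto
      qed
      finally show ?thesis using False by simp
    qed
    show "AE z in lborel. (\<lambda>n. f n z) \<longlonglongrightarrow> 0" using AE_off_light_cone[of T]
    proof eventually_elim
      case (elim z)
      have "filterlim e (at_right 0) sequentially" unfolding e_def using LIMSEQ_inverse_real_of_nat by (auto simp: filterlim_at)
      note lim = filterlim_compose[OF focus_wave_tendsto(1)[OF elim] this] filterlim_compose[OF focus_wave_tendsto(2)[OF elim] this]
      have "(\<lambda>n. f n z) \<longlonglongrightarrow> \<kappa> z * Xtt z * 0 + 2 * (\<kappa> z * Xt z) * 0" unfolding f_def wt unfolding w_def by (intro tendsto_intros lim)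
      then show ?case by simp
    qed
    show "continuous_on UNIV (w n)" for n using sw by blast
    show "w n 0 = 1" for n unfolding w_def by (rule focus_wave_origin[OF e(1)])
    fix \<rho> :: "(real \<times> (real^'n) => real) => real" and n and z :: "real \<times> (real^'n)"
    assume \<rho>: "wave_fundamental_solution \<rho>" and z: "norm z \<le> 1"
    \<comment> \<open>Up to time 2 the forward cones from the unit ball stay within radius 7 < 10,
      where \<kappa> is 1; after time 2 both the source and \<open>g n\<close> vanish.\<close>
    have "conv_check (f n) \<rho> z = g n z"
    proof (rule wave_potential_local[OF \<rho> ft gt, where U="cball 0 1" and V="{z. norm z < 10} \<union> {z. fst z > 2}"])
      show "z \<in> cball 0 1" using z by simp
      show "open ({z::real \<times> (real^'n). norm z < 10} \<union> {z. fst z > 2})" by (intro open_Collect_less continuous_intros)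
    next
      fix y w :: "real \<times> (real^'n)" assume y: "y \<in> cball 0 1" and w: "norm (snd w) \<le> fst w"
      have "norm (y + w) < 10" if "fst (y + w) \<le> 2"
      proof -
        have "\<bar>fst y\<bar> \<le> 1" using y norm_fst_le[of "fst y" "snd y"] by simp
        then have "fst w \<le> 3" using that by simp
        moreover have "norm w \<le> \<bar>fst w\<bar> + norm (snd w)" by (metis norm_Pair_le prod.collapse real_norm_def)
        ultimately have "norm w \<le> 6" using w by linarith
        then show ?thesis using norm_triangle_ineq[of y w] y by simp
      qed
      then show "y + w \<in> {z. norm z < 10} \<union> {z. fst z > 2}" by auto
    next
      fix z :: "real \<times> (real^'n)" assume "z \<in> {z. norm z < 10} \<union> {z. fst z > 2}"
      then consider "norm z < 10" | "fst z > 2" by blast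
      then show "wave_op (g n) z = f n z"
      proof cases
        case 1
        have "wave_op (g n) z = wave_op (\<lambda>z. X z * w n z) z" by (rule wave_op_cong_open[of "{z. norm z < 10}"])
            (use 1 in \<open>auto simp: g_def \<kappa>_def ball_cutoff_1 intro!: open_Collect_less continuous_intros\<close>)
        also have "... = X z * wave_op (w n) z + Xtt z * w n z + 2 * Xt z * pderiv_dir (1, 0) (w n) z" unfolding Xt_def Xtt_def
          by (rule wave_op_mult_time[OF sX sw]) (simp add: X_def time_step_space_deriv)
        also have "wave_op (w n) z = 0" unfolding w_def by (rule focus_wave_derivatives(2)[OF e(1) T])
        finally show ?thesis using 1 by (simp add: f_def \<kappa>_def ball_cutoff_1)
      next
        case 2
        have "wave_op (g n) z = wave_op (\<lambda>_. 0) z" by (rule wave_op_cong_open[of "{z. fst z > 2}"])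
            (use 2 in \<open>auto simp: g_def X_def smooth_step_0 intro!: open_Collect_less continuous_intros\<close>)
        then show ?thesis using 2 by (simp add: wave_op_zero f_def Xt0 Xtt0)
      qed
    qed
    also have "g n z = w n z" using z norm_fst_le[of "fst z" "snd z"] by (simp add: g_def \<kappa>_def X_def ball_cutoff_1 smooth_step_1)
    finally show "conv_check (f n) \<rho> z = w n z" .
  qed
qed

section \<open>No representing function in dimension at least 3\<close>

lemma L1_norm_tendsto_0:
  fixes g :: "nat => 'a::euclidean_space => real"
  assumes f: "locally_integrable f" and g: "\<And>n. g n \<in> borel_measurable borel"
    and C: "\<And>n z. \<bar>g n z\<bar> \<le> C * indicator (cball 0 r) z" and lim: "AE z in lborel. (\<lambda>n. g n z) \<longlonglongrightarrow> 0"
  shows "(\<lambda>n. LBINT z. \<bar>f z * g n z\<bar>) \<longlonglongrightarrow> 0"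
proof -
  have [measurable]: "f \<in> borel_measurable borel" "\<And>n. g n \<in> borel_measurable borel" using f g unfolding locally_integrable_def by auto
  have i: "integrable lborel (\<lambda>z. C * (indicator (cball 0 r) z *\<^sub>R \<bar>f z\<bar>))"
  proof -
    have "set_integrable lborel (cball 0 r) f" using f unfolding locally_integrable_def by auto
    then have "set_integrable lborel (cball 0 r) (\<lambda>z. \<bar>f z\<bar>)" by (rule set_integrable_abs)
    then show ?thesis unfolding set_integrable_def by simp
  qed
  have b: "norm \<bar>f z * g n z\<bar> \<le> C * (indicator (cball 0 r) z *\<^sub>R \<bar>f z\<bar>)" for n z
  proof -
    have "\<bar>f z\<bar> * \<bar>g n z\<bar> \<le> \<bar>f z\<bar> * (C * indicator (cball 0 r) z)" by (rule mult_left_mono[OF C]) simp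
    then show ?thesis by (simp add: abs_mult mult_ac)
  qed
  have "(\<lambda>n. integral\<^sup>L lborel (\<lambda>z. \<bar>f z * g n z\<bar>)) \<longlonglongrightarrow> integral\<^sup>L lborel (\<lambda>z::'a. 0::real)"
  proof (rule integral_dominated_convergence)
    show "integrable lborel (\<lambda>z. C * (indicator (cball 0 r) z *\<^sub>R \<bar>f z\<bar>))" by (rule i)
    show "AE z in lborel. (\<lambda>n. \<bar>f z * g n z\<bar>) \<longlonglongrightarrow> 0" using lim by eventually_elim (auto intro!: tendsto_eq_intros)
    show "AE z in lborel. norm \<bar>f z * g n z\<bar> \<le> C * (indicator (cball 0 r) z *\<^sub>R \<bar>f z\<bar>)" for n by (intro AE_I2 b)
  qed measurable
  then show ?thesis by simp
qed

lemma no_function_high_dim: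
  fixes \<rho> :: "(real \<times> (real^'n) => real) => real"
  assumes n: "CARD('n) \<ge> 3" and \<rho>: "wave_fundamental_solution \<rho>"
  shows "\<not> represented_by \<rho> f"
proof
  assume r: "represented_by \<rho> f"
  then have f: "locally_integrable f" and rf: "\<And>g. g \<in> test_functions ==> \<rho> g = (LBINT z. f z * g z)" unfolding represented_by_def by auto
  obtain g w :: "nat => real \<times> (real^'n) => real" and C where
    g: "\<And>n. g n \<in> test_functions" "C \<ge> 0" "\<And>n z. \<bar>g n z\<bar> \<le> C * indicator (cball 0 11) z"
    "AE z in lborel. (\<lambda>n. g n z) \<longlonglongrightarrow> 0"
    and w: "\<And>n. continuous_on UNIV (w n)" "\<And>n. w n 0 = 1"
    "\<And>\<rho> n z. wave_fundamental_solution \<rho> ==> norm z \<le> 1 ==> conv_check (g n) \<rho> z = w n z" by (rule focusing_sources[OF n], rule that; assumption)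
  have "1 \<le> (LBINT z. \<bar>f z * g n z\<bar>)" for n
  proof -
    have "1 = conv_check (g n) \<rho> 0" using w(2) w(3)[OF \<rho>, of 0 n] by simp
    also have "... = (LBINT z. f z * g n z)" unfolding conv_check_def using rf[OF g(1)] by simp
    also have "... \<le> (LBINT z. \<bar>f z * g n z\<bar>)" using integral_abs_bound[of lborel "\<lambda>z. f z * g n z"] by linarith
    finally show ?thesis .
  qed
  moreover have "(\<lambda>n. LBINT z. \<bar>f z * g n z\<bar>) \<longlonglongrightarrow> 0" by (rule L1_norm_tendsto_0[OF f test_functions_borel[OF g(1)] g(3,4)])
  ultimately have "1 \<le> (0::real)" by (intro LIMSEQ_le_const) auto
  then show False by simp
qed

section \<open>Symmetric stable random variables\<close>

text \<open>\<open>a\<close> is the coefficient of |u|^\<alpha>, not the scale a^(1/\<alpha>): it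
  adds up over independent summands, and for \<open>W A\<close> it is the Lebesgue measure of
  \<open>A\<close>.\<close>

definition stable_rv :: "'w measure => real => real => ('w => real) => bool" where
  "stable_rv M \<alpha> a X \<longleftrightarrow> X \<in> borel_measurable M \<and> 0 \<le> a \<and>
     (\<forall>u. char (distr M borel X) u = complex_of_real (exp (- a * \<bar>u\<bar> powr \<alpha>)))"

lemma ennreal_term_le_suminf: "f k \<le> (\<Sum>k. f k :: ennreal)" using sum_le_suminf[OF summableI, of "{k}" f] by simp

text \<open>Concavity of 1 - exp(-s) together with its value 0 at s = 0. Keeping 1 - exp(-s) in
  place of its linear bound allows upper and lower estimates of the tails to be compared with each
  other.\<close>

lemma
  fixes s k :: real
  assumes "0 \<le> s" "0 \<le> k"
  shows one_minus_exp_scale_le: "k \<le> 1 ==> k * (1 - exp (- s)) \<le> 1 - exp (- (k * s))"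
    and one_minus_exp_scale_ge: "1 \<le> k ==> 1 - exp (- (k * s)) \<le> k * (1 - exp (- s))"
proof -
  have *: "l * (1 - exp (- t)) \<le> 1 - exp (- (l * t))" if "0 \<le> l" "l \<le> 1" for l t :: real
  proof -
    have "exp ((1 - l) *\<^sub>R 0 + l *\<^sub>R (- t)) \<le> (1 - l) * exp 0 + l * exp (- t)" by (rule convex_onD[OF exp_convex]) (use that in auto)
    then show ?thesis by (simp add: algebra_simps)
  qed
  show "k * (1 - exp (- s)) \<le> 1 - exp (- (k * s))" if "k \<le> 1" using * that assms by blast
  show "1 - exp (- (k * s)) \<le> k * (1 - exp (- s))" if k: "1 \<le> k" using *[of "inverse k" "k * s"] k by (simp add: field_simps)
qed

lemma one_minus_exp_ge_half:
  fixes s :: real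
  assumes "0 \<le> s" "s \<le> 1" shows "s / 2 \<le> 1 - exp (- s)"
proof -
  have "exp (- s) \<le> 1 / (1 + s)" using assms by (simp add: exp_minus divide_simps)
  also have "... \<le> 1 - s / 2" using assms mult_mono[of s 1 s s] by (simp add: divide_simps algebra_simps)
  finally show ?thesis by simp
qed

lemma one_minus_cos_le: "1 - cos (x::real) \<le> x\<^sup>2 / 2"
proof -
  have "(sin (x / 2))\<^sup>2 \<le> (x / 2)\<^sup>2" using abs_sin_x_le_abs_x[of "x/2"] by (metis abs_le_square_iff)
  then show ?thesis using cos_double_sin[of "x/2"] by (simp add: power_divide)
qed

context prob_space begin

lemma stable_rv_cos:
  assumes X: "stable_rv M \<alpha> a X"
  shows "expectation (\<lambda>x. cos (u * X x)) = exp (- a * \<bar>u\<bar> powr \<alpha>)"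
proof -
  have [measurable]: "X \<in> borel_measurable M" using X unfolding stable_rv_def by blast
  have i: "integrable M (\<lambda>x. iexp (u * X x))" by (rule integrable_const_bound[where B=1]) auto
  have "Re (char (distr M borel X) u) = Re (\<integral>x. iexp (u * X x) \<partial>M)" unfolding char_def by (subst integral_distr) auto
  also have "... = expectation (\<lambda>x. Re (iexp (u * X x)))" by (rule integral_Re[OF i, symmetric])
  also have "... = expectation (\<lambda>x. cos (u * X x))" by (simp add: Re_exp)
  finally show ?thesis using X unfolding stable_rv_def by simp
qed

text \<open>The Gaussian mean of cos(g y) is exp(-y^2 / 2). So averaging the characteristic function
  over a standard normal g evaluates the mean of a bounded function of X that is comparable with
  min(1, (X / r)^2). The factor 3 is the mean of \<open>2 + g\<^sup>2\<close>, a bound for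
  |g|^\<alpha> for all \<alpha> < 2.\<close>

lemma stable_rv_gauss_le:
  assumes X: "stable_rv M \<alpha> a X" and \<alpha>: "0 < \<alpha>" "\<alpha> < 2" and r: "0 < r"
  shows "expectation (\<lambda>x. 1 - exp (- (X x / r)\<^sup>2 / 2)) \<le> 3 * (1 - exp (- (a * r powr -\<alpha>)))"
proof -
  let ?N = "std_normal_distribution"
  have [measurable]: "X \<in> borel_measurable M" and a: "0 \<le> a" using X unfolding stable_rv_def by auto
  interpret N: real_distribution ?N by (rule real_dist_normal_dist)
  interpret P: pair_prob_space M ?N ..
  have c: "(\<integral>g. cos (g * y) \<partial>?N) = exp (- y\<^sup>2 / 2)" for y
  proof -
    have i: "integrable ?N (\<lambda>g. iexp (y * g))" by (rule N.integrable_const_bound[where B=1]) auto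
    have "Re (char ?N y) = (\<integral>g. Re (iexp (y * g)) \<partial>?N)" unfolding char_def by (rule integral_Re[OF i, symmetric])
    then show ?thesis by (simp add: char_std_normal_distribution Re_exp mult.commute)
  qed
  have "expectation (\<lambda>x. exp (- (X x / r)\<^sup>2 / 2)) = expectation (\<lambda>x. \<integral>g. cos (g * (X x / r)) \<partial>?N)" unfolding c ..
  also have "... = (\<integral>g. expectation (\<lambda>x. cos (g * (X x / r))) \<partial>?N)"
  proof (rule P.Fubini_integral[symmetric])
    show "integrable (M \<Otimes>\<^sub>M ?N) (\<lambda>(x, g). cos (g * (X x / r)))" by (rule P.P.integrable_const_bound[where B=1]) auto
  qed
  also have "... = (\<integral>g. exp (- a * \<bar>g / r\<bar> powr \<alpha>) \<partial>?N)" using stable_rv_cos[OF X, of "g / r" for g] by simp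
  finally have 1: "expectation (\<lambda>x. exp (- (X x / r)\<^sup>2 / 2)) = (\<integral>g. exp (- a * \<bar>g / r\<bar> powr \<alpha>) \<partial>?N)" .
  let ?q = "1 - exp (- (a * r powr -\<alpha>))"
  have 2: "1 - exp (- a * \<bar>g / r\<bar> powr \<alpha>) \<le> (2 + g\<^sup>2) * ?q" for g
  proof -
    have "\<bar>g\<bar> powr \<alpha> \<le> 1 + g\<^sup>2"
    proof (cases "\<bar>g\<bar> \<le> 1")
      case True
      then have "\<bar>g\<bar> powr \<alpha> \<le> 1" using \<alpha> by (simp add: powr_le1)
      then show ?thesis by (simp add: add_increasing2)
    next
      case False
      then have "\<bar>g\<bar> powr \<alpha> \<le> \<bar>g\<bar> powr 2" using \<alpha> by (intro powr_mono) auto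
      then show ?thesis by simp
    qed
    then have k: "\<bar>g\<bar> powr \<alpha> \<le> 2 + g\<^sup>2" by simp
    have "a * \<bar>g / r\<bar> powr \<alpha> = \<bar>g\<bar> powr \<alpha> * (a * r powr -\<alpha>)" using r by (simp add: powr_divide powr_minus_divide)
    also have "... \<le> (2 + g\<^sup>2) * (a * r powr -\<alpha>)" using k a by (intro mult_right_mono) auto
    finally have "1 - exp (- a * \<bar>g / r\<bar> powr \<alpha>) \<le> 1 - exp (- ((2 + g\<^sup>2) * (a * r powr -\<alpha>)))" by simp
    also have "... \<le> (2 + g\<^sup>2) * ?q" by (rule one_minus_exp_scale_ge) (use a in \<open>auto simp: add_increasing2\<close>)
    finally show ?thesis .
  qed
  have ig: "integrable ?N (\<lambda>g. exp (- a * \<bar>g / r\<bar> powr \<alpha>))" by (rule N.integrable_const_bound[where B=1]) (use a in auto)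
  have ig2: "integrable ?N (\<lambda>g. g\<^sup>2)" using integrable_std_normal_distribution_moment[of 2] .
  have "expectation (\<lambda>x. 1 - exp (- (X x / r)\<^sup>2 / 2)) = 1 - expectation (\<lambda>x. exp (- (X x / r)\<^sup>2 / 2))"
  proof -
    have "integrable M (\<lambda>x. exp (- (X x / r)\<^sup>2 / 2))" by (rule integrable_const_bound[where B=1]) auto
    then show ?thesis by (simp add: prob_space)
  qed
  also have "... = (\<integral>g. 1 - exp (- a * \<bar>g / r\<bar> powr \<alpha>) \<partial>?N)" unfolding 1 using ig N.prob_space by simp
  also have "... \<le> (\<integral>g. (2 + g\<^sup>2) * ?q \<partial>?N)" using ig ig2 by (intro integral_mono 2) auto
  also have "... = 3 * ?q" using ig2 std_normal_distribution_even_moments(1)[of 1] N.prob_space by simp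
  finally show ?thesis .
qed

lemma stable_rv_tail:
  assumes X: "stable_rv M \<alpha> a X" and \<alpha>: "0 < \<alpha>" "\<alpha> < 2" and r: "0 < r"
  shows "prob {x\<in>space M. \<bar>X x\<bar> > r} \<le> 8 * (a * r powr -\<alpha>)"
proof -
  have [measurable]: "X \<in> borel_measurable M" and a: "0 \<le> a" using X unfolding stable_rv_def by auto
  let ?A = "{x\<in>space M. \<bar>X x\<bar> > r}"
  have i: "integrable M (\<lambda>x. 1 - exp (- (X x / r)\<^sup>2 / 2))" by (rule integrable_const_bound[where B=1]) auto
  \<comment> \<open>exp(1/2) \<ge> 13/8 gives exp(-1/2) \<le> 5/8. Beyond the level r the integrand
    is therefore at least 3/8, and 3 / (3/8) = 8 is the constant of the tail bound.\<close>
  have "1 + 1/2 + (1/2)\<^sup>2 / 2 \<le> exp (1 / 2 :: real)" by (rule exp_lower_Taylor_quadratic) simp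
  then have e: "exp (- 1 / 2 :: real) \<le> 5 / 8"
    using le_imp_inverse_le[of "13 / 8" "exp (1 / 2 :: real)"] exp_minus[of "1/2::real"] by (simp add: power2_eq_square)
  have "3 / 8 * prob ?A = expectation (\<lambda>x. 3 / 8 * indicator ?A x)" by simp
  also have "... \<le> expectation (\<lambda>x. 1 - exp (- (X x / r)\<^sup>2 / 2))"
  proof (intro integral_mono i)
    fix x
    have "3 / 8 \<le> 1 - exp (- (X x / r)\<^sup>2 / 2)" if "r < \<bar>X x\<bar>"
    proof -
      have "1 \<le> \<bar>X x / r\<bar>" using that r by simp
      then have "1 \<le> (X x / r)\<^sup>2" by (metis one_power2 power2_abs power_mono zero_le_one)
      then have "exp (- (X x / r)\<^sup>2 / 2) \<le> exp (- 1 / 2)" by simp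
      then show ?thesis using e by linarith
    qed
    then show "3 / 8 * indicator ?A x \<le> 1 - exp (- (X x / r)\<^sup>2 / 2)" by (auto simp: indicator_def)
    show "integrable M (\<lambda>x. 3 / 8 * indicator ?A x :: real)" by (rule integrable_const_bound[where B=1]) (auto simp: indicator_def)
  qed
  also have "... \<le> 3 * (1 - exp (- (a * r powr -\<alpha>)))" by (rule stable_rv_gauss_le[OF X \<alpha> r])
  also have "... \<le> 3 * (a * r powr -\<alpha>)"
  proof -
    have "1 - exp (- y) \<le> y" for y :: real using exp_ge_add_one_self[of "- y"] by simp
    then show ?thesis by (rule mult_left_mono) simp
  qed
  finally show ?thesis by simp
qed

text \<open>Below the level r the exponent s = (X / r)^2 / 2 is at most 1, so s / 2 \<le> 1 -
  exp(-s); this turns the factor 3 of \<open>stable_rv_gauss_le\<close> into 12.\<close>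

lemma stable_rv_truncated_square:
  assumes X: "stable_rv M \<alpha> a X" and \<alpha>: "0 < \<alpha>" "\<alpha> < 2" and r: "0 < r"
  shows "expectation (\<lambda>x. (X x / r)\<^sup>2 * indicator {x. \<bar>X x\<bar> \<le> r} x) \<le> 12 * (1 - exp (- (a * r powr -\<alpha>)))"
proof -
  have [measurable]: "X \<in> borel_measurable M" and a: "0 \<le> a" using X unfolding stable_rv_def by auto
  have i: "integrable M (\<lambda>x. 1 - exp (- (X x / r)\<^sup>2 / 2))" by (rule integrable_const_bound[where B=1]) auto
  have sq: "(X x / r)\<^sup>2 \<le> 1" if "\<bar>X x\<bar> \<le> r" for x using that r abs_square_le_1[of "X x / r"] by simp
  have "expectation (\<lambda>x. (X x / r)\<^sup>2 * indicator {x. \<bar>X x\<bar> \<le> r} x) \<le> expectation (\<lambda>x. 4 * (1 - exp (- (X x / r)\<^sup>2 / 2)))"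
  proof (rule integral_mono)
    show "integrable M (\<lambda>x. (X x / r)\<^sup>2 * indicator {x. \<bar>X x\<bar> \<le> r} x)"
      by (rule integrable_const_bound[where B=1]) (use sq in \<open>auto simp: indicator_def\<close>)
    fix x
    show "(X x / r)\<^sup>2 * indicator {x. \<bar>X x\<bar> \<le> r} x \<le> 4 * (1 - exp (- (X x / r)\<^sup>2 / 2))"
      using one_minus_exp_ge_half[of "(X x / r)\<^sup>2 / 2"] sq[of x] by (auto simp: indicator_def)
    show "integrable M (\<lambda>x. 4 * (1 - exp (- (X x / r)\<^sup>2 / 2)))" by (intro integrable_mult_right i)
  qed
  also have "... = 4 * expectation (\<lambda>x. 1 - exp (- (X x / r)\<^sup>2 / 2))" by (rule integral_mult_right_zero)
  also have "... \<le> 4 * (3 * (1 - exp (- (a * r powr -\<alpha>))))" using stable_rv_gauss_le[OF X \<alpha> r] by simp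
  finally show ?thesis by simp
qed

text \<open>The characteristic function at l / r gives the mean of 1 - cos(l X / r), which is at
  most 2 beyond the level and quadratically small below it. For small l the quadratic part is of
  lower order, as l^2 is small against l^\<alpha>, so the rest must come from the tail.\<close>

lemma stable_rv_lower_tail:
  assumes X: "stable_rv M \<alpha> a X" and \<alpha>: "0 < \<alpha>" "\<alpha> < 2" and r: "0 < r"
  shows "(1 / 12) powr (\<alpha> / (2 - \<alpha>)) / 4 * (1 - exp (- (a * r powr -\<alpha>))) \<le> prob {x\<in>space M. \<bar>X x\<bar> > r}"
proof -
  have [measurable]: "X \<in> borel_measurable M" and a: "0 \<le> a" using X unfolding stable_rv_def by auto
  \<comment> \<open>The solution of l^(2 - \<alpha>) = 1/12: the quadratic part, at most
    \<open>l\<^sup>2 / 2 * (12 * ?q)\<close>, then takes exactly half of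
    \<open>l powr \<alpha> * ?q\<close>.\<close>
  define l :: real where "l = (1 / 12) powr (1 / (2 - \<alpha>))"
  have l: "0 < l" "l \<le> 1" "l powr \<alpha> = (1 / 12) powr (\<alpha> / (2 - \<alpha>))" using \<alpha> by (auto simp: l_def powr_powr intro!: powr_le1)
  have l2: "l\<^sup>2 = l powr \<alpha> / 12"
  proof -
    have "l\<^sup>2 = l powr \<alpha> * l powr (2 - \<alpha>)" using l(1) by (simp add: powr_add[symmetric])
    also have "l powr (2 - \<alpha>) = 1 / 12" using \<alpha> by (simp add: l_def powr_powr)
    finally show ?thesis by simp
  qed
  let ?A = "{x\<in>space M. \<bar>X x\<bar> > r}" and ?q = "1 - exp (- (a * r powr -\<alpha>))"
  have sq: "(X x / r)\<^sup>2 \<le> 1" if "\<bar>X x\<bar> \<le> r" for x using that r abs_square_le_1[of "X x / r"] by simp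
  have it: "integrable M (\<lambda>x. (X x / r)\<^sup>2 * indicator {x. \<bar>X x\<bar> \<le> r} x)"
      by (rule integrable_const_bound[where B=1]) (use sq in \<open>auto simp: indicator_def\<close>)
  have iA: "integrable M (\<lambda>x. 2 * indicator ?A x :: real)" by (rule integrable_const_bound[where B=2]) auto
  have ic: "integrable M (\<lambda>x. cos (l / r * X x))" by (rule integrable_const_bound[where B=1]) auto
  have "l powr \<alpha> * ?q \<le> 1 - exp (- (l powr \<alpha> * (a * r powr -\<alpha>)))" by (rule one_minus_exp_scale_le) (use a l \<alpha> in \<open>auto intro!: powr_le1\<close>)
  also have "l powr \<alpha> * (a * r powr -\<alpha>) = a * \<bar>l / r\<bar> powr \<alpha>" using r l(1) by (simp add: powr_divide powr_minus_divide)
  also have "1 - exp (- (a * \<bar>l / r\<bar> powr \<alpha>)) = expectation (\<lambda>x. 1 - cos (l / r * X x))" using stable_rv_cos[OF X, of "l / r"] ic prob_space by simp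
  also have "... \<le> expectation (\<lambda>x. 2 * indicator ?A x + l\<^sup>2 / 2 * ((X x / r)\<^sup>2 * indicator {x. \<bar>X x\<bar> \<le> r} x))"
  proof (rule integral_mono)
    show "integrable M (\<lambda>x. 2 * indicator ?A x + l\<^sup>2 / 2 * ((X x / r)\<^sup>2 * indicator {x. \<bar>X x\<bar> \<le> r} x))"
      by (intro Bochner_Integration.integrable_add iA integrable_mult_right[OF it])
    fix x assume "x \<in> space M"
    moreover have "1 - cos (l / r * X x) \<le> l\<^sup>2 / 2 * (X x / r)\<^sup>2"
      using one_minus_cos_le[of "l / r * X x"] by (simp add: power_mult_distrib power_divide)
    ultimately show "1 - cos (l / r * X x) \<le> 2 * indicator ?A x + l\<^sup>2 / 2 * ((X x / r)\<^sup>2 * indicator {x. \<bar>X x\<bar> \<le> r} x)" by (auto simp: indicator_def)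
  qed (use ic in auto)
  also have "... = 2 * prob ?A + l\<^sup>2 / 2 * expectation (\<lambda>x. (X x / r)\<^sup>2 * indicator {x. \<bar>X x\<bar> \<le> r} x)"
  proof -
    show ?thesis unfolding Bochner_Integration.integral_add[OF iA integrable_mult_right[OF it]] by simp
  qed
  also have "... \<le> 2 * prob ?A + l\<^sup>2 / 2 * (12 * ?q)" using stable_rv_truncated_square[OF X \<alpha> r] by (intro add_left_mono mult_left_mono) auto
  also have "l\<^sup>2 / 2 * (12 * ?q) = l powr \<alpha> / 2 * ?q" unfolding l2 by simp
  finally have "l powr \<alpha> * ?q \<le> 2 * prob ?A + l powr \<alpha> / 2 * ?q" .
  then show ?thesis unfolding l(3)[symmetric] by simp
qed

text \<open>Summation of the tail bound over the dyadic levels \<open>R / 2 ^ k\<close>.\<close>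

lemma stable_rv_truncated_moment:
  assumes X: "stable_rv M \<alpha> a X" and \<alpha>: "0 < \<alpha>" "\<alpha> < 2" and p: "\<alpha> < p" and R: "0 < R"
  shows "(\<integral>\<^sup>+y. ennreal (\<bar>X y\<bar> powr p) * indicator {y. \<bar>X y\<bar> \<le> R} y \<partial>M)
    \<le> ennreal (8 * 2 powr \<alpha> / (1 - 2 powr (\<alpha> - p)) * R powr (p - \<alpha>) * a)"
proof -
  have [measurable]: "X \<in> borel_measurable M" and a: "0 \<le> a" using X unfolding stable_rv_def by auto
  have pt: "ennreal (\<bar>x\<bar> powr p) * indicator {..R} \<bar>x\<bar> \<le> (\<Sum>k. ennreal ((R / 2 ^ k) powr p) * indicator {R / 2 ^ Suc k<..} \<bar>x\<bar>)" for x
  proof (cases "x \<noteq> 0 \<and> \<bar>x\<bar> \<le> R")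
    case True
    have "(\<lambda>k. R * (1 / 2) ^ Suc k) \<longlonglongrightarrow> R * 0" by (intro tendsto_intros LIMSEQ_Suc) auto
    then have "\<forall>\<^sub>F k in sequentially. R * (1 / 2) ^ Suc k < \<bar>x\<bar>" by (rule order_tendstoD(2)) (use True in simp)
    then obtain j where "R * (1 / 2) ^ Suc j < \<bar>x\<bar>" by force
    then have ex: "\<exists>k. R / 2 ^ Suc k < \<bar>x\<bar>" by (intro exI[of _ j]) (simp only: power_one_over times_divide_eq_right)
    \<comment> \<open>The first halved level that |x| exceeds, so that R / 2^(k+1) < |x| \<le> R /
      2^k; the single term with this k already dominates the left side.\<close>
    define k where "k = (LEAST k. R / 2 ^ Suc k < \<bar>x\<bar>)"
    have k: "R / 2 ^ Suc k < \<bar>x\<bar>" unfolding k_def using ex by (rule LeastI_ex)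
    have k2: "\<bar>x\<bar> \<le> R / 2 ^ k"
    proof (cases k)
      case (Suc j)
      then have "\<not> R / 2 ^ Suc j < \<bar>x\<bar>" unfolding k_def using not_less_Least by (metis lessI)
      then show ?thesis using Suc by simp
    qed (use True in simp)
    have "ennreal (\<bar>x\<bar> powr p) * indicator {..R} \<bar>x\<bar> \<le> ennreal ((R / 2 ^ k) powr p) * indicator {R / 2 ^ Suc k<..} \<bar>x\<bar>"
      using True k k2 \<alpha> p by (auto intro!: powr_mono2)
    also have "... \<le> (\<Sum>k. ennreal ((R / 2 ^ k) powr p) * indicator {R / 2 ^ Suc k<..} \<bar>x\<bar>)" by (rule ennreal_term_le_suminf)
    finally show ?thesis .
  qed (auto simp: indicator_def)
  let ?c = "2 powr (\<alpha> - p)"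
  have c: "0 < ?c" "?c < 1" using p by (auto intro: powr_less_one)
  have term_eq: "(R / 2 ^ k) powr p * (8 * (a * (R / 2 ^ Suc k) powr -\<alpha>)) = 8 * 2 powr \<alpha> * R powr (p - \<alpha>) * a * ?c ^ k" for k
  proof -
    have "(R / 2 ^ k) powr p = R powr p * 2 powr (- (real k * p))" by (simp add: powr_divide powr_realpow[symmetric] powr_powr powr_minus_divide)
    moreover have "(R / 2 ^ Suc k) powr -\<alpha> = R powr -\<alpha> * 2 powr (real (Suc k) * \<alpha>)"
      by (simp only: powr_divide powr_realpow[symmetric] powr_powr) (simp add: powr_minus_divide)
    moreover have "?c ^ k = 2 powr (real k * (\<alpha> - p))" by (simp add: powr_realpow[symmetric] powr_powr mult.commute)
    moreover have "R powr (p - \<alpha>) = R powr p * R powr -\<alpha>" by (simp add: powr_add[symmetric])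
    moreover have "2 powr (- (real k * p)) * 2 powr (real (Suc k) * \<alpha>) = 2 powr \<alpha> * 2 powr (real k * (\<alpha> - p))"
      by (simp add: powr_add[symmetric] algebra_simps)
    ultimately show ?thesis by (simp add: mult_ac)
  qed
  have "(\<integral>\<^sup>+y. ennreal (\<bar>X y\<bar> powr p) * indicator {y. \<bar>X y\<bar> \<le> R} y \<partial>M)
      \<le> (\<integral>\<^sup>+y. (\<Sum>k. ennreal ((R / 2 ^ k) powr p) * indicator {R / 2 ^ Suc k<..} \<bar>X y\<bar>) \<partial>M)"
    using pt by (intro nn_integral_mono) (simp add: indicator_def)
  also have "... = (\<Sum>k. \<integral>\<^sup>+y. ennreal ((R / 2 ^ k) powr p) * indicator {R / 2 ^ Suc k<..} \<bar>X y\<bar> \<partial>M)" by (intro nn_integral_suminf) auto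
  also have "... \<le> (\<Sum>k. ennreal (8 * 2 powr \<alpha> * R powr (p - \<alpha>) * a * ?c ^ k))"
  proof (intro suminf_le allI)
    fix k
    let ?A = "{y\<in>space M. \<bar>X y\<bar> > R / 2 ^ Suc k}"
    have "(\<integral>\<^sup>+y. ennreal ((R / 2 ^ k) powr p) * indicator {R / 2 ^ Suc k<..} \<bar>X y\<bar> \<partial>M)
        = (\<integral>\<^sup>+y. ennreal ((R / 2 ^ k) powr p) * indicator ?A y \<partial>M)" by (intro nn_integral_cong) (simp add: indicator_def)
    also have "... = ennreal ((R / 2 ^ k) powr p) * ennreal (prob ?A)" by (subst nn_integral_cmult_indicator) (auto simp: emeasure_eq_measure)
    also have "... \<le> ennreal ((R / 2 ^ k) powr p) * ennreal (8 * (a * (R / 2 ^ Suc k) powr -\<alpha>))"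
      using stable_rv_tail[OF X \<alpha>, of "R / 2 ^ Suc k"] R by (intro mult_left_mono ennreal_leI) auto
    also have "... = ennreal (8 * 2 powr \<alpha> * R powr (p - \<alpha>) * a * ?c ^ k)" by (subst ennreal_mult''[symmetric]) (use a term_eq[of k] in auto)
    finally show "(\<integral>\<^sup>+y. ennreal ((R / 2 ^ k) powr p) * indicator {R / 2 ^ Suc k<..} \<bar>X y\<bar> \<partial>M)
      \<le> ennreal (8 * 2 powr \<alpha> * R powr (p - \<alpha>) * a * ?c ^ k)" .
  qed auto
  also have "... = ennreal (8 * 2 powr \<alpha> * R powr (p - \<alpha>) * a * (1 / (1 - ?c)))" by (intro suminf_ennreal_eq sums_mult geometric_sums) (use a c in auto)
  finally show ?thesis by (simp add: mult_ac)
qed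

end

text \<open>With h = p / 2 \<le> 1 the powers become powers h of squares. Concavity is applied to (x
  + y)^2 and (x - y)^2, whose mean is x^2 + y^2, and then subadditivity to x^2 and y^2.\<close>

lemma powr_clarkson:
  fixes x y p :: real
  assumes p: "0 < p" "p \<le> 2"
  shows "\<bar>x + y\<bar> powr p + \<bar>x - y\<bar> powr p \<le> 2 * (\<bar>x\<bar> powr p + \<bar>y\<bar> powr p)"
proof -
  define h where "h = p / 2"
  have h: "0 < h" "h \<le> 1" using p by (auto simp: h_def)
  have sq: "\<bar>u\<bar> powr p = (u\<^sup>2) powr h" for u
  proof (cases "u = 0")
    case False
    then have e: "u\<^sup>2 = \<bar>u\<bar> powr 2" by simp
    show ?thesis unfolding e powr_powr h_def by simp
  qed (simp add: h_def)
  have concave: "u powr h + v powr h \<le> 2 * ((u + v) / 2) powr h" if uv: "0 \<le> u" "0 \<le> v" "0 < u + v" for u v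
  proof -
    let ?m = "(u + v) / 2"
    \<comment> \<open>Young's inequality with the midpoint as the second factor is the tangent bound
      for the concave power at the midpoint.\<close>
    have "w powr h * ?m powr (1 - h) \<le> h * w + (1 - h) * ?m" if "0 \<le> w" for w using Youngs_inequality_0[of h "1 - h" w ?m] h that uv by force
    from this[of u] this[of v] have "(u powr h + v powr h) * ?m powr (1 - h) \<le> h * u + h * v + 2 * ((1 - h) * ?m)"
      using uv by (simp add: distrib_right)
    also have "... = 2 * ?m powr h * ?m powr (1 - h)" using uv by (simp add: powr_add[symmetric] field_simps)
    finally show ?thesis by (rule mult_right_le_imp_le) (use uv in simp)
  qed
  have subadd: "(u + v) powr h \<le> u powr h + v powr h" if uv: "0 \<le> u" "0 \<le> v" "0 < u + v" for u v
  proof -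
    have "w / (u + v) \<le> w powr h / (u + v) powr h" if "0 \<le> w" "w \<le> u + v" for w
      using powr_mono'[of h 1 "w / (u + v)"] that uv h by (simp add: powr_divide)
    from this[of u] this[of v] have "(u + v) / (u + v) \<le> (u powr h + v powr h) / (u + v) powr h" using uv by (simp only: add_divide_distrib add_mono)
    then show ?thesis using uv by simp
  qed
  show ?thesis
  proof (cases "x\<^sup>2 + y\<^sup>2 = 0")
    case False
    then have pos: "0 < x\<^sup>2 + y\<^sup>2" by (simp add: sum_power2_gt_zero_iff)
    have e: "(x + y)\<^sup>2 + (x - y)\<^sup>2 = 2 * (x\<^sup>2 + y\<^sup>2)" by (simp add: power2_eq_square algebra_simps)
    have "((x + y)\<^sup>2) powr h + ((x - y)\<^sup>2) powr h \<le> 2 * (x\<^sup>2 + y\<^sup>2) powr h"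
      using concave[of "(x + y)\<^sup>2" "(x - y)\<^sup>2"] pos unfolding e by (simp del: distrib_left_numeral)
    then show ?thesis unfolding sq using subadd[of "x\<^sup>2" "y\<^sup>2"] pos by simp
  qed simp
qed

section \<open>The stochastic integral\<close>

lemma finite_borelI: "A \<in> sets borel ==> A \<subseteq> half_space ==> emeasure lborel A < \<infinity> ==> A \<in> finite_borel" unfolding finite_borel_def by simp

lemma finite_borelD: "A \<in> finite_borel ==> A \<in> sets borel" "A \<in> finite_borel ==> A \<subseteq> half_space"
    "A \<in> finite_borel ==> emeasure lborel A < \<infinity>" unfolding finite_borel_def by auto

lemma finite_borel_empty [simp]: "{} \<in> finite_borel" by (intro finite_borelI) auto

lemma finite_borel_subset: "A \<in> finite_borel ==> B \<in> sets borel ==> B \<subseteq> A ==> B \<in> finite_borel"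
  using emeasure_mono[of B A lborel] finite_borelD[of A] by (intro finite_borelI) auto

section \<open>Independence and sums of stable variables\<close>

context prob_space begin

lemma indep_vars_reindex_inj:
  assumes h: "inj_on h I" and ind: "indep_vars (\<lambda>_. N) X (h ` I)"
  shows "indep_vars (\<lambda>_. N) (\<lambda>i. X (h i)) I" unfolding indep_vars_def2 indep_sets_def
proof (intro conjI ballI allI impI)
  fix i assume "i \<in> I" then show "random_variable N (X (h i))" using ind unfolding indep_vars_def2 by auto
next
  fix i assume "i \<in> I" then show "{X (h i) -` A \<inter> space M |A. A \<in> sets N} \<subseteq> events" using ind unfolding indep_vars_def2 by auto
next
  fix J A assume J: "J \<subseteq> I" "J \<noteq> {}" "finite J" and A: "A \<in> (\<Pi> i\<in>J. {X (h i) -` A \<inter> space M |A. A \<in> sets N})"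
  define B where "B k = A (the_inv_into J h k)" for k
  have hJ: "inj_on h J" using h J by (meson inj_on_subset)
  then have B: "B (h j) = A j" if "j \<in> J" for j using that unfolding B_def by (simp add: the_inv_into_f_f)
  have "prob (\<Inter>k\<in>h ` J. B k) = (\<Prod>k\<in>h ` J. prob (B k))"
  proof -
    have "B \<in> (\<Pi> i\<in>h ` J. {X i -` A \<inter> space M |A. A \<in> sets N})" using A B by (auto simp: Pi_iff)
    moreover have "h ` J \<subseteq> h ` I" "h ` J \<noteq> {}" "finite (h ` J)" using J by auto
    ultimately show ?thesis using ind unfolding indep_vars_def2 indep_sets_def by blast
  qed
  also have "(\<Inter>k\<in>h ` J. B k) = (\<Inter>j\<in>J. A j)" using B by auto
  also have "(\<Prod>k\<in>h ` J. prob (B k)) = (\<Prod>j\<in>J. prob (A j))" using B by (simp add: prod.reindex[OF hJ])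
  finally show "prob (\<Inter>j\<in>J. A j) = (\<Prod>j\<in>J. prob (A j))" .
qed

lemma stable_rv_zero:
  assumes X: "stable_rv M \<alpha> 0 X" and \<alpha>: "0 < \<alpha>" "\<alpha> < 2"
  shows "AE x in M. X x = 0"
proof -
  have [measurable]: "X \<in> borel_measurable M" using X unfolding stable_rv_def by blast
  have "AE x in M. \<bar>X x\<bar> \<le> inverse (real (Suc n))" for n
  proof -
    have "prob {x\<in>space M. \<bar>X x\<bar> > inverse (real (Suc n))} = 0" using stable_rv_tail[OF X \<alpha>, of "inverse (real (Suc n))"] by (simp add: order_antisym)
    then show ?thesis by (subst (asm) prob_eq_0) auto
  qed
  then have "AE x in M. \<forall>n. \<bar>X x\<bar> \<le> inverse (real (Suc n))" by (simp add: AE_all_countable)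
  then show ?thesis
  proof eventually_elim
    case (elim x)
    have "\<bar>X x\<bar> \<le> 0" by (rule LIMSEQ_le_const[OF LIMSEQ_inverse_real_of_nat]) (use elim in auto)
    then show ?case by simp
  qed
qed

lemma char_distr_cmult:
  assumes [measurable]: "X \<in> borel_measurable M"
  shows "char (distr M borel (\<lambda>x. c * X x)) u = char (distr M borel X) (c * u)"
  unfolding char_def by (subst (1 2) integral_distr) (auto simp: mult_ac)

lemma stable_rv_sum:
  fixes X :: "'i => 'a => real"
  assumes X: "\<And>i. i \<in> I ==> stable_rv M \<alpha> (a i) (X i)" and ind: "indep_vars (\<lambda>_. borel) X I" and I: "finite I"
  shows "stable_rv M \<alpha> (\<Sum>i\<in>I. \<bar>c i\<bar> powr \<alpha> * a i) (\<lambda>x. \<Sum>i\<in>I. c i * X i x)" unfolding stable_rv_def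
proof (intro conjI allI)
  have m[measurable]: "X i \<in> borel_measurable M" if "i \<in> I" for i using X that unfolding stable_rv_def by blast
  show "(\<lambda>x. \<Sum>i\<in>I. c i * X i x) \<in> borel_measurable M" by measurable
  show "0 \<le> (\<Sum>i\<in>I. \<bar>c i\<bar> powr \<alpha> * a i)" using X unfolding stable_rv_def by (intro sum_nonneg) auto
  fix u
  have "char (distr M borel (\<lambda>x. \<Sum>i\<in>I. c i * X i x)) u = (\<Prod>i\<in>I. char (distr M borel (\<lambda>x. c i * X i x)) u)"
    by (rule char_distr_sum) (rule indep_vars_compose2[OF ind], auto)
  also have "... = (\<Prod>i\<in>I. of_real (exp (- (\<bar>c i\<bar> powr \<alpha> * a i) * \<bar>u\<bar> powr \<alpha>)))"
    using X by (intro prod.cong) (auto simp: char_distr_cmult m stable_rv_def abs_mult powr_mult)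
  also have "... = of_real (exp (- (\<Sum>i\<in>I. \<bar>c i\<bar> powr \<alpha> * a i) * \<bar>u\<bar> powr \<alpha>))"
    using I by (simp add: exp_sum[symmetric] sum_distrib_right sum_negf flip: of_real_prod)
  finally show "char (distr M borel (\<lambda>x. \<Sum>i\<in>I. c i * X i x)) u = complex_of_real (exp (- (\<Sum>i\<in>I. \<bar>c i\<bar> powr \<alpha> * a i) * \<bar>u\<bar> powr \<alpha>))" .
qed

end

section \<open>Functions constant on the cells of a partition\<close>

abbreviation S_int :: "(real \<times> (real^'n) => ennreal) => ennreal" where
  "S_int f \<equiv> (\<integral>\<^sup>+ z. f z \<partial>restrict_space lborel half_space)"

abbreviation stable_norm :: "real => (real \<times> (real^'n) => real) => ennreal" where
  "stable_norm \<alpha> f \<equiv> (\<integral>\<^sup>+ z. ennreal (\<bar>f z\<bar> powr \<alpha>) \<partial>restrict_space lborel half_space)"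

text \<open>A labelling partitions the half space into finitely many Borel cells. A function that is
  constant on the cells is given by its values \<open>c l\<close>, and \<open>cell_integral\<close> is its stochastic integral. On
  cells of infinite measure, where the noise is unspecified, \<open>c\<close> has to vanish.\<close>

definition cell :: "(real \<times> (real^'n) => 'l) => 'l => (real \<times> (real^'n)) set" where
  "cell t l = {w\<in>half_space. t w = l}"

definition labelling :: "(real \<times> (real^'n) => 'l) => bool" where
  "labelling t \<longleftrightarrow> finite (t ` half_space) \<and> (\<forall>l. cell t l \<in> sets borel)"

definition cell_adm :: "(real \<times> (real^'n) => 'l) => ('l => real) => bool" where
  "cell_adm t c \<longleftrightarrow> (\<forall>l\<in>t ` half_space. c l \<noteq> 0 --> cell t l \<in> finite_borel)"

definition cell_integral ::
    "((real \<times> (real^'n)) set => 'w => real) => (real \<times> (real^'n) => 'l) => ('l => real) => 'w => real" where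
  "cell_integral W t c x = (\<Sum>l\<in>t ` half_space. c l * W (cell t l) x)"

lemma disjoint_cells: "disjoint_family_on (cell t) L" unfolding disjoint_family_on_def cell_def by auto

lemma cell_subset: "cell t l \<subseteq> half_space" unfolding cell_def by auto

lemma finite_borel_cellI:
  "labelling t ==> emeasure lborel (cell t l) < \<infinity> ==> cell t l \<in> finite_borel" by (intro finite_borelI cell_subset) (auto simp: labelling_def)

text \<open>The common refinement of two partitions. Labels may have any type, so it is a mere
  pairing of labels.\<close>

lemma labelling_pair:
  assumes "labelling \<sigma>" "labelling t" shows "labelling (\<lambda>w. (\<sigma> w, t w))" unfolding labelling_def
proof
  have "(\<lambda>w. (\<sigma> w, t w)) ` half_space \<subseteq> \<sigma> ` half_space \<times> t ` half_space" by auto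
  then show "finite ((\<lambda>w. (\<sigma> w, t w)) ` half_space)" using assms unfolding labelling_def by (metis finite_SigmaI finite_subset)
  have "cell (\<lambda>w. (\<sigma> w, t w)) (k, l) = cell \<sigma> k \<inter> cell t l" for k l unfolding cell_def by auto
  then show "\<forall>l. cell (\<lambda>w. (\<sigma> w, t w)) l \<in> sets borel" using assms unfolding labelling_def by auto
qed

lemma cell_coarse:
  assumes "\<And>w. w \<in> half_space ==> \<sigma> w = u (t w)"
  shows "cell \<sigma> k = (\<Union>l\<in>{l\<in>t ` half_space. u l = k}. cell t l)" unfolding cell_def using assms by auto

lemma labelling_coarse:
  assumes t: "labelling t" and \<sigma>: "\<And>w. w \<in> half_space ==> \<sigma> w = u (t w)"
  shows "labelling \<sigma>" unfolding labelling_def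
proof
  have "\<sigma> ` half_space = u ` (t ` half_space)" using \<sigma> by auto
  then show "finite (\<sigma> ` half_space)" using t unfolding labelling_def by simp
  show "\<forall>l. cell \<sigma> l \<in> sets borel"
  proof
    fix k
    have "(\<Union>l\<in>{l\<in>t ` half_space. u l = k}. cell t l) \<in> sets borel" using t unfolding labelling_def by auto
    then show "cell \<sigma> k \<in> sets borel" by (simp only: cell_coarse[where u=u and t=t and k=k, OF \<sigma>])
  qed
qed

lemma cell_adm_coarse:
  assumes t: "labelling t" and \<sigma>: "\<And>w. w \<in> half_space ==> \<sigma> w = u (t w)" and c: "cell_adm \<sigma> c"
  shows "cell_adm t (\<lambda>l. c (u l))" unfolding cell_adm_def
proof (intro ballI impI)
  fix l assume l: "l \<in> t ` half_space" "c (u l) \<noteq> 0"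
  then obtain w where w: "w \<in> half_space" "t w = l" by auto
  then have "cell \<sigma> (u l) \<in> finite_borel" using c l(2) \<sigma>[OF w(1)] unfolding cell_adm_def by auto
  then show "cell t l \<in> finite_borel" using t \<sigma> by (elim finite_borel_subset) (auto simp: labelling_def cell_def)
qed

lemma stable_norm_cells:
  assumes t: "labelling t" and c: "cell_adm t c" and \<alpha>: "0 < \<alpha>"
  shows "stable_norm \<alpha> (\<lambda>w. c (t w)) = ennreal (\<Sum>l\<in>t ` half_space. \<bar>c l\<bar> powr \<alpha> * measure lborel (cell t l))"
proof -
  let ?L = "t ` half_space"
  have [measurable]: "cell t l \<in> sets borel" for l using t unfolding labelling_def by simp
  have fin: "finite ?L" using t unfolding labelling_def by simp
  have "stable_norm \<alpha> (\<lambda>w. c (t w)) = (\<integral>\<^sup>+ w. ennreal (\<bar>c (t w)\<bar> powr \<alpha>) * indicator half_space w \<partial>lborel)" by (rule nn_integral_half_space)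
  also have "... = (\<integral>\<^sup>+ w. (\<Sum>l\<in>?L. ennreal (\<bar>c l\<bar> powr \<alpha>) * indicator (cell t l) w) \<partial>lborel)"
  proof (intro nn_integral_cong)
    fix w
    show "ennreal (\<bar>c (t w)\<bar> powr \<alpha>) * indicator half_space w = (\<Sum>l\<in>?L. ennreal (\<bar>c l\<bar> powr \<alpha>) * indicator (cell t l) w)"
    proof (cases "w \<in> half_space")
      case True
      have "(\<Sum>l\<in>?L. ennreal (\<bar>c l\<bar> powr \<alpha>) * indicator (cell t l) w) = (\<Sum>l\<in>?L. if l = t w then ennreal (\<bar>c l\<bar> powr \<alpha>) else 0)"
        using True by (intro sum.cong) (auto simp: cell_def)
      then show ?thesis using True fin by simp
    qed (simp add: cell_def)
  qed
  also have "... = (\<Sum>l\<in>?L. ennreal (\<bar>c l\<bar> powr \<alpha>) * emeasure lborel (cell t l))" by (subst nn_integral_sum) (auto simp: nn_integral_cmult_indicator)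
  also have "... = (\<Sum>l\<in>?L. ennreal (\<bar>c l\<bar> powr \<alpha> * measure lborel (cell t l)))"
  proof (intro sum.cong refl)
    fix l assume l: "l \<in> ?L"
    show "ennreal (\<bar>c l\<bar> powr \<alpha>) * emeasure lborel (cell t l) = ennreal (\<bar>c l\<bar> powr \<alpha> * measure lborel (cell t l))"
    proof (cases "c l = 0")
      case False
      then have "emeasure lborel (cell t l) < \<infinity>" using c l unfolding cell_adm_def by (blast dest: finite_borelD)
      then show ?thesis by (simp add: ennreal_mult emeasure_eq_ennreal_measure)
    qed (use \<alpha> in simp)
  qed
  also have "... = ennreal (\<Sum>l\<in>?L. \<bar>c l\<bar> powr \<alpha> * measure lborel (cell t l))" by simp
  finally show ?thesis .
qed

lemma labelling_simple_function:
  assumes "labelling t" shows "simple_function (restrict_space lborel half_space) (\<lambda>w. c (t w))"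
proof -
  have "labelling (\<lambda>w. c (t w))" by (rule labelling_coarse[where u=c, OF assms refl])
  then have f: "finite ((\<lambda>w. c (t w)) ` half_space)" and m: "{w \<in> half_space. c (t w) = l} \<in> sets borel" for l
    unfolding labelling_def cell_def by auto
  have "(\<lambda>w. c (t w)) -` {l} \<inter> half_space \<in> sets (restrict_space lborel half_space)" for l
    using m[of l] by (subst sets_restrict_space_iff) (auto simp: Int_def conj_commute)
  then show ?thesis using f unfolding simple_function_def by simp
qed

lemma labelling_L_space:
  assumes "labelling t" "cell_adm t c" "0 < \<alpha>" shows "(\<lambda>w. c (t w)) \<in> L_space \<alpha>"
  unfolding L_space_def using stable_norm_cells[OF assms] borel_measurable_simple_function[OF labelling_simple_function[OF assms(1)]] by simp

text \<open>A simple function labels the points by its own values; the coefficients are then the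
  identity, whence the \<open>\<lambda>x. x\<close> in the following lemmas.\<close>

lemma simple_function_labelling:
  assumes s: "simple_function (restrict_space lborel half_space) s" shows "labelling s" unfolding labelling_def
proof (intro conjI allI)
  show "finite (s ` half_space)" using s unfolding simple_function_def by simp
  fix l
  show "cell s l \<in> sets borel"
  proof (cases "l \<in> s ` half_space")
    case True
    then have "s -` {l} \<inter> half_space \<in> sets (restrict_space lborel half_space)" using s unfolding simple_function_def by auto
    then have "s -` {l} \<inter> half_space \<in> sets borel" by (subst (asm) sets_restrict_space_iff) auto
    also have "s -` {l} \<inter> half_space = cell s l" unfolding cell_def by auto
    finally show ?thesis .
  next
    case False
    then have "cell s l = {}" unfolding cell_def by auto
    then show ?thesis by simp
  qed
qed

lemma simple_function_adm:
  assumes s: "simple_function (restrict_space lborel half_space) s" "s \<in> L_space \<alpha>" and \<alpha>: "0 < \<alpha>"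
  shows "cell_adm s (\<lambda>x. x)" unfolding cell_adm_def
proof (intro ballI impI)
  fix l assume l: "l \<in> s ` half_space" "l \<noteq> 0"
  have lab: "labelling s" using s simple_function_labelling by blast
  then have [measurable]: "cell s l \<in> sets borel" unfolding labelling_def by simp
  have "ennreal (\<bar>l\<bar> powr \<alpha>) * emeasure lborel (cell s l) = (\<integral>\<^sup>+ w. ennreal (\<bar>l\<bar> powr \<alpha>) * indicator (cell s l) w \<partial>lborel)"
    by (subst nn_integral_cmult_indicator) auto
  also have "... \<le> (\<integral>\<^sup>+ w. ennreal (\<bar>s w\<bar> powr \<alpha>) * indicator half_space w \<partial>lborel)" by (intro nn_integral_mono) (auto simp: cell_def indicator_def)
  also have "... < \<infinity>" using s(2) unfolding L_space_def by (simp add: nn_integral_half_space)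
  finally have "emeasure lborel (cell s l) < \<infinity>" using l(2) by (auto simp: ennreal_mult_less_top)
  then show "cell s l \<in> finite_borel" by (rule finite_borel_cellI[OF lab])
qed

lemma simple_stoch_integral_cells:
  assumes s: "simple_function (restrict_space lborel half_space) s"
  shows "simple_stoch_integral W s = cell_integral W s (\<lambda>x. x)"
proof -
  have "finite (s ` half_space)" using simple_function_labelling[OF s] unfolding labelling_def by blast
  then show ?thesis unfolding simple_stoch_integral_def cell_integral_def cell_def by (intro ext sum.mono_neutral_left) auto
qed

section \<open>The noise on cells and the integral of simple functions\<close>

locale stable_noise = prob_space M for M :: "'w measure" +
  fixes \<alpha> :: real and W :: "(real \<times> (real^'n)) set => 'w => real"
  assumes \<alpha>: "0 < \<alpha>" "\<alpha> < 2" and noise: "stable_white_noise M \<alpha> W"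
begin

lemma W_stable: "A \<in> finite_borel ==> stable_rv M \<alpha> (measure lborel A) (W A)" using noise unfolding stable_white_noise_def stable_rv_def by auto

lemma W_measurable: "A \<in> finite_borel ==> W A \<in> borel_measurable M" using W_stable unfolding stable_rv_def by blast

lemma W_empty: "AE x in M. W {} x = 0" using stable_rv_zero[OF _ \<alpha>] W_stable[OF finite_borel_empty] by simp

text \<open>The axioms of the noise speak of sequences of sets. A finite family is padded with empty
  sets, whose noise vanishes almost surely.\<close>

lemma enumerate_family:
  fixes A :: "'i => (real \<times> (real^'n)) set"
  assumes I: "finite I" and d: "disjoint_family_on A I" and A: "\<And>i. i \<in> I ==> A i \<in> finite_borel"
  obtains h B and n :: nat where "bij_betw h I {..<n}" "range B \<subseteq> finite_borel" "disjoint_family B"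
    "\<And>i. i \<in> I ==> B (h i) = A i" "\<And>k. k \<ge> n ==> B k = {}" "(\<Union>k. B k) = (\<Union>i\<in>I. A i)"
proof -
  obtain e and n :: nat where e: "bij_betw e {..<n} I" using ex_bij_betw_nat_finite[OF I] by (auto simp: atLeast0LessThan)
  define B where "B k = (if k < n then A (e k) else {})" for k
  define h where "h = the_inv_into {..<n} e"
  have h: "bij_betw h I {..<n}" unfolding h_def by (rule bij_betw_the_inv_into[OF e])
  have eh: "e (h i) = i" if "i \<in> I" for i unfolding h_def using e that by (intro f_the_inv_into_f_bij_betw)
  have eI: "e k \<in> I" if "k < n" for k using e that by (auto simp: bij_betw_def)
  show thesis
  proof
    show "bij_betw h I {..<n}" by (rule h)
    show "range B \<subseteq> finite_borel" using A eI unfolding B_def by auto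
    show "B (h i) = A i" if "i \<in> I" for i using h that eh unfolding B_def bij_betw_def by auto
    show "disjoint_family B" unfolding disjoint_family_on_def
    proof (intro ballI impI)
      fix j k :: nat assume "j \<noteq> k"
      then show "B j \<inter> B k = {}" using d e unfolding B_def disjoint_family_on_def bij_betw_def inj_on_def by auto
    qed
    show "(\<Union>k. B k) = (\<Union>i\<in>I. A i)" using e unfolding B_def bij_betw_def by auto
  qed (simp add: B_def)
qed

lemma W_indep:
  fixes A :: "'i => (real \<times> (real^'n)) set"
  assumes "finite I" "disjoint_family_on A I" "\<And>i. i \<in> I ==> A i \<in> finite_borel"
  shows "indep_vars (\<lambda>_. borel) (\<lambda>i. W (A i)) I"
proof -
  obtain h B and n :: nat where B: "bij_betw h I {..<n}" "range B \<subseteq> finite_borel" "disjoint_family B"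
    "\<And>i. i \<in> I ==> B (h i) = A i" by (rule enumerate_family[OF assms], assumption, rule that, assumption+)
  have "indep_vars (\<lambda>_. borel) (\<lambda>n. W (B n)) UNIV" using noise B unfolding stable_white_noise_def by blast
  then have "indep_vars (\<lambda>_. borel) (\<lambda>n. W (B n)) (h ` I)" by (rule indep_vars_subset) simp
  then have "indep_vars (\<lambda>_. borel) (\<lambda>i. W (B (h i))) I" by (rule indep_vars_reindex_inj[rotated]) (use B in \<open>auto simp: bij_betw_def\<close>)
  then show ?thesis using B(4) by (subst indep_vars_cong[OF refl _ refl, where Y="\<lambda>i. W (B (h i))"]) auto
qed

lemma W_additive:
  fixes A :: "'i => (real \<times> (real^'n)) set"
  assumes "finite I" "disjoint_family_on A I" "\<And>i. i \<in> I ==> A i \<in> finite_borel" "(\<Union>i\<in>I. A i) \<in> finite_borel"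
  shows "AE x in M. W (\<Union>i\<in>I. A i) x = (\<Sum>i\<in>I. W (A i) x)"
proof -
  obtain h B and n :: nat where B: "bij_betw h I {..<n}" "range B \<subseteq> finite_borel" "disjoint_family B"
    "\<And>i. i \<in> I ==> B (h i) = A i" "\<And>k. k \<ge> n ==> B k = {}" "(\<Union>k. B k) = (\<Union>i\<in>I. A i)"
    by (rule enumerate_family[OF assms(1-3)], assumption, rule that, assumption+)
  have "AE x in M. (\<lambda>n. W (B n) x) sums W (\<Union>n. B n) x" using noise B(2,3) assms(4)[folded B(6)] unfolding stable_white_noise_def by blast
  then show ?thesis using W_empty
  proof eventually_elim
    case (elim x)
    have "(\<lambda>k. W (B k) x) sums (\<Sum>k<n. W (B k) x)" by (rule sums_finite) (use B(5) elim(2) in auto)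
    then have "W (\<Union>n. B n) x = (\<Sum>k<n. W (B k) x)" using elim(1) sums_unique2 by blast
    also have "... = (\<Sum>i\<in>I. W (B (h i)) x)" by (rule sum.reindex_bij_betw[OF B(1), symmetric])
    finally show ?case using B(4,6) by simp
  qed
qed

text \<open>The quantifier over \<open>c\<close> stands inside the almost sure statement: additivity
  of the noise is invoked for finitely many sets only, whatever the values. This is vital where
  \<open>c\<close> depends on a point of space-time and the exceptional set must not.\<close>

lemma cell_integral_coarse:
  fixes \<sigma> :: "real \<times> (real^'n) => 'k" and t :: "real \<times> (real^'n) => 'l"
  assumes t: "labelling t" and \<sigma>: "\<And>w. w \<in> half_space ==> \<sigma> w = u (t w)"
  shows "AE x in M. \<forall>c. cell_adm \<sigma> c --> cell_integral W \<sigma> c x = cell_integral W t (\<lambda>l. c (u l)) x"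
proof -
  let ?L = "t ` half_space" and ?K = "\<sigma> ` half_space"
  have L: "finite ?L" using t unfolding labelling_def by simp
  have K: "finite ?K" using labelling_coarse[where u=u and \<sigma>=\<sigma>, OF t \<sigma>] unfolding labelling_def by simp
  have uL: "u ` ?L \<subseteq> ?K" using \<sigma> by auto
  have "AE x in M. \<forall>k\<in>?K. cell \<sigma> k \<in> finite_borel --> W (cell \<sigma> k) x = (\<Sum>l\<in>{l\<in>?L. u l = k}. W (cell t l) x)"
  proof (intro AE_finite_allI K)
    fix k
    show "AE x in M. cell \<sigma> k \<in> finite_borel --> W (cell \<sigma> k) x = (\<Sum>l\<in>{l\<in>?L. u l = k}. W (cell t l) x)"
    proof (cases "cell \<sigma> k \<in> finite_borel")
      case True
      note c = cell_coarse[where u=u and t=t and k=k, OF \<sigma>]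
      have sub: "cell t l \<in> finite_borel" if "l \<in> {l\<in>?L. u l = k}" for l
        by (rule finite_borel_subset[OF True]) (use t that c in \<open>auto simp: labelling_def\<close>)
      have "AE x in M. W (\<Union>l\<in>{l\<in>?L. u l = k}. cell t l) x = (\<Sum>l\<in>{l\<in>?L. u l = k}. W (cell t l) x)"
        by (rule W_additive) (use L disjoint_cells sub True c in auto)
      then show ?thesis by eventually_elim (simp only: c simp_thms)
    qed simp
  qed
  then show ?thesis
  proof eventually_elim
    case (elim x)
    show ?case
    proof (intro allI impI)
      fix c assume c: "cell_adm \<sigma> c"
      have "cell_integral W \<sigma> c x = (\<Sum>k\<in>?K. \<Sum>l\<in>{l\<in>?L. u l = k}. c (u l) * W (cell t l) x)" unfolding cell_integral_def
      proof (intro sum.cong refl)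
        fix k assume k: "k \<in> ?K"
        show "c k * W (cell \<sigma> k) x = (\<Sum>l\<in>{l\<in>?L. u l = k}. c (u l) * W (cell t l) x)"
        proof (cases "c k = 0")
          case False
          then have "cell \<sigma> k \<in> finite_borel" using c k unfolding cell_adm_def by blast
          then have "W (cell \<sigma> k) x = (\<Sum>l\<in>{l\<in>?L. u l = k}. W (cell t l) x)" using elim k by blast
          then show ?thesis by (simp add: sum_distrib_left)
        qed simp
      qed
      also have "... = cell_integral W t (\<lambda>l. c (u l)) x" unfolding cell_integral_def by (rule sum.group[OF L K uL])
      finally show "cell_integral W \<sigma> c x = cell_integral W t (\<lambda>l. c (u l)) x" .
    qed
  qed
qed

lemma cell_integral_support:
  "labelling t ==> cell_integral W t c = (\<lambda>x. \<Sum>l\<in>{l\<in>t ` half_space. c l \<noteq> 0}. c l * W (cell t l) x)"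
  unfolding cell_integral_def labelling_def by (intro ext sum.mono_neutral_right) auto

lemma cell_integral_stable:
  assumes t: "labelling t" and c: "cell_adm t c"
  shows "stable_rv M \<alpha> (enn2real (stable_norm \<alpha> (\<lambda>w. c (t w)))) (cell_integral W t c)"
proof -
  let ?L = "{l\<in>t ` half_space. c l \<noteq> 0}"
  have L: "finite ?L" "\<And>l. l \<in> ?L ==> cell t l \<in> finite_borel" using t c unfolding labelling_def cell_adm_def by auto
  have "stable_rv M \<alpha> (\<Sum>l\<in>?L. \<bar>c l\<bar> powr \<alpha> * measure lborel (cell t l)) (cell_integral W t c)" unfolding cell_integral_support[OF t]
    by (intro stable_rv_sum W_stable W_indep disjoint_cells L)
  also have "(\<Sum>l\<in>?L. \<bar>c l\<bar> powr \<alpha> * measure lborel (cell t l)) = (\<Sum>l\<in>t ` half_space. \<bar>c l\<bar> powr \<alpha> * measure lborel (cell t l))"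
    using t unfolding labelling_def by (intro sum.mono_neutral_left) auto
  also have "... = enn2real (stable_norm \<alpha> (\<lambda>w. c (t w)))"
    unfolding stable_norm_cells[OF t c \<alpha>(1)] by (intro enn2real_ennreal[symmetric] sum_nonneg) auto
  finally show ?thesis .
qed

abbreviation simple :: "(real \<times> (real^'n) => real) => bool" where
  "simple s \<equiv> simple_function (restrict_space lborel half_space) s \<and> s \<in> L_space \<alpha>"

lemma simple_cells:
  assumes "labelling t" "cell_adm t c" shows "simple (\<lambda>w. c (t w))"
  using labelling_simple_function[OF assms(1)] labelling_L_space[OF assms \<alpha>(1)] by blast

lemma simple_stoch_integral_stable:
  assumes "simple s" shows "stable_rv M \<alpha> (enn2real (stable_norm \<alpha> s)) (simple_stoch_integral W s)"
proof -
  have "labelling s" "cell_adm s (\<lambda>x. x)" using assms simple_function_labelling simple_function_adm \<alpha> by blast+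
  from cell_integral_stable[OF this] show ?thesis using assms by (simp add: simple_stoch_integral_cells)
qed

lemma simple_stoch_integral_measurable: "simple s ==> simple_stoch_integral W s \<in> borel_measurable M"
  using simple_stoch_integral_stable unfolding stable_rv_def by blast

lemma simple_stoch_integral_coarse:
  fixes t :: "real \<times> (real^'n) => 'l"
  assumes t: "labelling t" and s: "simple s" and u: "\<And>w. w \<in> half_space ==> s w = u (t w)"
  shows "AE y in M. simple_stoch_integral W s y = cell_integral W t u y"
proof -
  have "cell_adm s (\<lambda>x. x)" using s simple_function_adm \<alpha> by blast
  then show ?thesis using cell_integral_coarse[where u=u and \<sigma>=s, OF t u] s by (auto simp: simple_stoch_integral_cells)
qed

lemma cell_integral_diff: "cell_integral W t c x - cell_integral W t d x = cell_integral W t (\<lambda>l. c l - d l) x"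
  unfolding cell_integral_def by (simp add: sum_subtractf algebra_simps)

text \<open>The level sets of a difference are unions of cells of the common refinement, and
  splitting them uses additivity of the noise. Linearity is therefore an almost sure
  statement.\<close>

lemma simple_diff:
  assumes s: "simple s" and t: "simple t"
  shows "simple (\<lambda>w. s w - t w)"
    and "AE y in M. simple_stoch_integral W s y - simple_stoch_integral W t y = simple_stoch_integral W (\<lambda>w. s w - t w) y"
proof -
  let ?r = "\<lambda>w. (s w, t w)"
  have r: "labelling ?r" using s t by (intro simple_function_labelling) auto
  have c: "cell_adm ?r fst" "cell_adm ?r snd"
    using cell_adm_coarse[where \<sigma>=s and u=fst and c="\<lambda>x. x", OF r] cell_adm_coarse[where \<sigma>=t and u=snd and c="\<lambda>x. x", OF r] simple_function_adm[of s \<alpha>] simple_function_adm[of t \<alpha>] s t \<alpha> by auto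
  have "cell_adm ?r (\<lambda>l. fst l - snd l)" unfolding cell_adm_def
  proof (intro ballI impI)
    fix l assume l: "l \<in> ?r ` half_space" "fst l - snd l \<noteq> 0"
    then have "fst l \<noteq> 0 \<or> snd l \<noteq> 0" by auto
    then show "cell ?r l \<in> finite_borel" using c l(1) unfolding cell_adm_def by blast
  qed
  from simple_cells[OF r this] show st: "simple (\<lambda>w. s w - t w)" by simp
  have "AE y in M. simple_stoch_integral W s y = cell_integral W ?r fst y"
    "AE y in M. simple_stoch_integral W t y = cell_integral W ?r snd y"
    "AE y in M. simple_stoch_integral W (\<lambda>w. s w - t w) y = cell_integral W ?r (\<lambda>l. fst l - snd l) y"
    by (intro simple_stoch_integral_coarse[OF r] s t st; simp)+
  then show "AE y in M. simple_stoch_integral W s y - simple_stoch_integral W t y = simple_stoch_integral W (\<lambda>w. s w - t w) y"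
    by eventually_elim (simp add: cell_integral_diff)
qed

lemma simple_stoch_integral_diff_tail:
  assumes s: "simple s" and t: "simple t" and r: "0 < r"
  shows "prob {x\<in>space M. \<bar>simple_stoch_integral W s x - simple_stoch_integral W t x\<bar> > r}
     \<le> 8 * (enn2real (stable_norm \<alpha> (\<lambda>w. s w - t w)) * r powr -\<alpha>)"
proof -
  note st = simple_diff[OF s t]
  have [measurable]: "simple_stoch_integral W s \<in> borel_measurable M" "simple_stoch_integral W t \<in> borel_measurable M"
    "simple_stoch_integral W (\<lambda>w. s w - t w) \<in> borel_measurable M" using simple_stoch_integral_measurable s t st(1) by blast+
  have "prob {x\<in>space M. \<bar>simple_stoch_integral W s x - simple_stoch_integral W t x\<bar> > r} =
     prob {x\<in>space M. \<bar>simple_stoch_integral W (\<lambda>w. s w - t w) x\<bar> > r}" by (intro finite_measure_eq_AE) (use st(2) in \<open>auto elim!: AE_mp\<close>)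
  also have "... \<le> 8 * (enn2real (stable_norm \<alpha> (\<lambda>w. s w - t w)) * r powr -\<alpha>)" by (rule stable_rv_tail[OF simple_stoch_integral_stable[OF st(1)] \<alpha> r])
  finally show ?thesis .
qed

end

section \<open>The \<alpha>-th power integral and approximation by simple functions\<close>

lemma ennreal_numeral_mult: "ennreal (numeral k * x) = numeral k * ennreal x" by (simp add: ennreal_mult')

lemma tendsto_0_sandwich:
  fixes f g :: "nat => 'a::{linorder_topology, zero}"
  assumes "\<And>n. 0 \<le> f n" "\<And>n. f n \<le> g n" "g \<longlonglongrightarrow> 0" shows "f \<longlonglongrightarrow> 0" using tendsto_sandwich[of "\<lambda>_. 0" f sequentially g 0] assms by simp

text \<open>A substitute for the triangle inequality that treats \<alpha> < 1 and \<alpha> \<ge> 1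
  alike; 4 is a bound for 2^\<alpha>.\<close>

lemma powr_add_le:
  fixes a b \<alpha> :: real
  assumes "0 < \<alpha>" "\<alpha> < 2"
  shows "\<bar>a + b\<bar> powr \<alpha> \<le> 4 * (\<bar>a\<bar> powr \<alpha> + \<bar>b\<bar> powr \<alpha>)"
proof -
  define m where "m = max \<bar>a\<bar> \<bar>b\<bar>"
  have "\<bar>a + b\<bar> powr \<alpha> \<le> (2 * m) powr \<alpha>" using assms by (intro powr_mono2) (auto simp: m_def)
  also have "... = 2 powr \<alpha> * m powr \<alpha>" by (simp add: powr_mult)
  also have "... \<le> 4 * m powr \<alpha>" using powr_mono[of \<alpha> 2 "2::real"] assms by (intro mult_right_mono) auto
  also have "m powr \<alpha> \<le> \<bar>a\<bar> powr \<alpha> + \<bar>b\<bar> powr \<alpha>" unfolding m_def by (auto simp: max_def)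
  finally show ?thesis by simp
qed

lemma L_space_measurable: "f \<in> L_space \<alpha> ==> f \<in> borel_measurable (restrict_space lborel half_space)"
  and L_space_finite: "f \<in> L_space \<alpha> ==> stable_norm \<alpha> f < \<infinity>" unfolding L_space_def by auto

lemma stable_norm_triangle:
  assumes "f \<in> borel_measurable (restrict_space lborel half_space)" "g \<in> borel_measurable (restrict_space lborel half_space)"
    "h \<in> borel_measurable (restrict_space lborel half_space)" and \<alpha>: "0 < \<alpha>" "\<alpha> < 2"
  shows "stable_norm \<alpha> (\<lambda>w. f w - h w) \<le> 4 * (stable_norm \<alpha> (\<lambda>w. f w - g w) + stable_norm \<alpha> (\<lambda>w. h w - g w))"
proof -
  note [measurable] = assms(1-3)
  have "stable_norm \<alpha> (\<lambda>w. f w - h w) \<le> S_int (\<lambda>w. 4 * (ennreal (\<bar>f w - g w\<bar> powr \<alpha>) + ennreal (\<bar>h w - g w\<bar> powr \<alpha>)))"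
  proof (intro nn_integral_mono)
    fix w
    have "\<bar>f w - h w\<bar> powr \<alpha> \<le> 4 * (\<bar>f w - g w\<bar> powr \<alpha> + \<bar>h w - g w\<bar> powr \<alpha>)"
      using powr_add_le[OF \<alpha>, of "f w - g w" "g w - h w"] by (simp add: abs_minus_commute)
    then have "ennreal (\<bar>f w - h w\<bar> powr \<alpha>) \<le> ennreal (4 * (\<bar>f w - g w\<bar> powr \<alpha> + \<bar>h w - g w\<bar> powr \<alpha>))" by (rule ennreal_leI)
    then show "ennreal (\<bar>f w - h w\<bar> powr \<alpha>) \<le> 4 * (ennreal (\<bar>f w - g w\<bar> powr \<alpha>) + ennreal (\<bar>h w - g w\<bar> powr \<alpha>))"
      by (simp only: ennreal_numeral_mult ennreal_plus powr_ge_zero)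
  qed
  also have "... = 4 * (stable_norm \<alpha> (\<lambda>w. f w - g w) + stable_norm \<alpha> (\<lambda>w. h w - g w))" by (simp add: nn_integral_cmult nn_integral_add)
  finally show ?thesis .
qed

lemma stable_norm_swap: "stable_norm \<alpha> (\<lambda>w. f w - g w) = stable_norm \<alpha> (\<lambda>w. g w - f w)" by (simp add: abs_minus_commute)

lemma L_space_approx:
  fixes f :: "real \<times> (real^'n) => real"
  assumes f: "f \<in> L_space \<alpha>" and \<alpha>: "0 < \<alpha>" "\<alpha> < 2"
  obtains s where "\<And>n. simple_function (restrict_space lborel half_space) (s n)" "\<And>n. s n \<in> L_space \<alpha>"
    "\<And>w. w \<in> half_space ==> (\<lambda>n. s n w) \<longlonglongrightarrow> f w" "(\<lambda>n. stable_norm \<alpha> (\<lambda>w. f w - s n w)) \<longlonglongrightarrow> 0"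
proof -
  let ?R = "restrict_space lborel (half_space :: (real \<times> (real^'n)) set)"
  have m[measurable]: "f \<in> borel_measurable ?R" using f by (rule L_space_measurable)
  obtain s where s0: "\<forall>n. simple_function ?R (s n)" "\<forall>w\<in>space ?R. (\<lambda>n. s n w) \<longlonglongrightarrow> f w"
    "\<forall>n. \<forall>w\<in>space ?R. dist (s n w) 0 \<le> 2 * dist (f w) 0" using borel_measurable_implies_sequence_metric[OF m, of 0] by blast
  note s = s0(1)[rule_format] s0(2)[rule_format] s0(3)[rule_format]
  have [measurable]: "s n \<in> borel_measurable ?R" for n using s(1) by (rule borel_measurable_simple_function)
  have sp: "space ?R = half_space" by simp
  have b: "\<bar>s n w\<bar> powr \<alpha> \<le> 4 * \<bar>f w\<bar> powr \<alpha>" if "w \<in> half_space" for n w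
  proof -
    have "\<bar>s n w\<bar> powr \<alpha> \<le> (2 * \<bar>f w\<bar>) powr \<alpha>" using s(3)[of w n] that sp \<alpha> by (intro powr_mono2) auto
    also have "... = 2 powr \<alpha> * \<bar>f w\<bar> powr \<alpha>" by (simp add: powr_mult)
    also have "... \<le> 4 * \<bar>f w\<bar> powr \<alpha>" using powr_mono[of \<alpha> 2 "2::real"] \<alpha> by (intro mult_right_mono) auto
    finally show ?thesis .
  qed
  \<comment> \<open>20 = 4 (1 + 4): \<open>powr_add_le\<close> together with the bound
    \<open>b\<close> for the approximants.\<close>
  have fin: "S_int (\<lambda>w. ennreal (20 * \<bar>f w\<bar> powr \<alpha>)) < \<infinity>"
    using L_space_finite[OF f] by (simp add: ennreal_mult'' nn_integral_cmult ennreal_mult_less_top)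
  show thesis
  proof
    show "simple_function ?R (s n)" for n by (rule s(1))
    show "s n \<in> L_space \<alpha>" for n
    proof -
      have "stable_norm \<alpha> (s n) \<le> S_int (\<lambda>w. ennreal (20 * \<bar>f w\<bar> powr \<alpha>))"
      proof (intro nn_integral_mono ennreal_leI)
        fix w assume "w \<in> space ?R"
        then show "\<bar>s n w\<bar> powr \<alpha> \<le> 20 * \<bar>f w\<bar> powr \<alpha>" using b[of w n] sp by (auto intro: order_trans)
      qed
      then show ?thesis unfolding L_space_def using fin by auto
    qed
    show "(\<lambda>n. s n w) \<longlonglongrightarrow> f w" if "w \<in> half_space" for w using s(2) that sp by simp
    have "(\<lambda>n. stable_norm \<alpha> (\<lambda>w. f w - s n w)) \<longlonglongrightarrow> S_int (\<lambda>w::real \<times> (real^'n). 0)"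
    proof (rule nn_integral_dominated_convergence[where w="\<lambda>w. ennreal (20 * \<bar>f w\<bar> powr \<alpha>)"])
      show "AE w in ?R. ennreal (\<bar>f w - s n w\<bar> powr \<alpha>) \<le> ennreal (20 * \<bar>f w\<bar> powr \<alpha>)" for n
      proof (intro AE_I2 ennreal_leI)
        fix w assume "w \<in> space ?R"
        then show "\<bar>f w - s n w\<bar> powr \<alpha> \<le> 20 * \<bar>f w\<bar> powr \<alpha>" using powr_add_le[OF \<alpha>, of "f w" "- s n w"] b[of w n] sp by simp
      qed
      show "AE w in ?R. (\<lambda>n. ennreal (\<bar>f w - s n w\<bar> powr \<alpha>)) \<longlonglongrightarrow> 0"
      proof (intro AE_I2)
        fix w assume "w \<in> space ?R"
        then have "(\<lambda>n. f w - s n w) \<longlonglongrightarrow> f w - f w" by (intro tendsto_intros s(2))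
        then have "(\<lambda>n. \<bar>f w - s n w\<bar> powr \<alpha>) \<longlonglongrightarrow> \<bar>0\<bar> powr \<alpha>" using \<alpha> by (intro tendsto_powr2 tendsto_rabs) auto
        then show "(\<lambda>n. ennreal (\<bar>f w - s n w\<bar> powr \<alpha>)) \<longlonglongrightarrow> 0" using tendsto_ennrealI by force
      qed
    qed (use fin in auto)
    then show "(\<lambda>n. stable_norm \<alpha> (\<lambda>w. f w - s n w)) \<longlonglongrightarrow> 0" by simp
  qed
qed

section \<open>Convergence in probability\<close>

context prob_space begin

definition tends_in_prob :: "(nat => 'a => real) => ('a => real) => bool" where
  "tends_in_prob X Y \<longleftrightarrow> (\<forall>e>0. (\<lambda>n. prob {x\<in>space M. \<bar>X n x - Y x\<bar> > e}) \<longlonglongrightarrow> 0)"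

lemma AE_tends_in_prob:
  assumes [measurable]: "\<And>n. X n \<in> borel_measurable M" "Y \<in> borel_measurable M"
    and lim: "AE x in M. (\<lambda>n. X n x) \<longlonglongrightarrow> Y x"
  shows "tends_in_prob X Y" unfolding tends_in_prob_def
proof (intro allI impI)
  fix e :: real assume e: "e > 0"
  let ?A = "\<lambda>n. {x\<in>space M. \<bar>X n x - Y x\<bar> > e}"
  have "(\<lambda>n. expectation (\<lambda>x. indicator (?A n) x :: real)) \<longlonglongrightarrow> expectation (\<lambda>x. 0)"
  proof (rule integral_dominated_convergence[where w="\<lambda>_. 1"])
    show "AE x in M. (\<lambda>n. indicator (?A n) x :: real) \<longlonglongrightarrow> 0" using lim
    proof eventually_elim
      case (elim x)
      then have "(\<lambda>n. \<bar>X n x - Y x\<bar>) \<longlonglongrightarrow> \<bar>Y x - Y x\<bar>" by (intro tendsto_intros)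
      then have "\<forall>\<^sub>F n in sequentially. \<bar>X n x - Y x\<bar> < e" by (rule order_tendstoD(2)) (use e in simp)
      then have "\<forall>\<^sub>F n in sequentially. indicator (?A n) x = 0" by eventually_elim simp
      then show ?case by (rule tendsto_eventually)
    qed
  qed (auto simp: indicator_def)
  then show "(\<lambda>n. prob (?A n)) \<longlonglongrightarrow> 0" by simp
qed

lemma prob_dist_triangle:
  fixes e :: real
  assumes [measurable]: "X \<in> borel_measurable M" "Y \<in> borel_measurable M" "Z \<in> borel_measurable M"
  shows "prob {x\<in>space M. \<bar>X x - Z x\<bar> > e} \<le> prob {x\<in>space M. \<bar>X x - Y x\<bar> > e / 2} + prob {x\<in>space M. \<bar>Y x - Z x\<bar> > e / 2}"
proof -
  have "prob {x\<in>space M. \<bar>X x - Z x\<bar> > e} \<le> prob ({x\<in>space M. \<bar>X x - Y x\<bar> > e / 2} \<union> {x\<in>space M. \<bar>Y x - Z x\<bar> > e / 2})"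
    by (intro finite_measure_mono) (auto simp: abs_if)
  also have "... \<le> prob {x\<in>space M. \<bar>X x - Y x\<bar> > e / 2} + prob {x\<in>space M. \<bar>Y x - Z x\<bar> > e / 2}" by (intro measure_Un_le) auto
  finally show ?thesis .
qed

lemma tends_in_prob_trans:
  assumes [measurable]: "\<And>n. X n \<in> borel_measurable M" "\<And>n. Y n \<in> borel_measurable M" "Z \<in> borel_measurable M"
    and XY: "tends_in_prob (\<lambda>n x. X n x - Y n x) (\<lambda>_. 0)" and YZ: "tends_in_prob Y Z"
  shows "tends_in_prob X Z" unfolding tends_in_prob_def
proof (intro allI impI)
  fix e :: real assume e: "e > 0"
  have "(\<lambda>n. prob {x\<in>space M. \<bar>X n x - Y n x\<bar> > e / 2} + prob {x\<in>space M. \<bar>Y n x - Z x\<bar> > e / 2}) \<longlonglongrightarrow> 0 + 0"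
    using XY[unfolded tends_in_prob_def, rule_format, OF half_gt_zero[OF e]] YZ[unfolded tends_in_prob_def, rule_format, OF half_gt_zero[OF e]]
    by (intro tendsto_add) (simp_all only: diff_zero)
  then have g: "(\<lambda>n. prob {x\<in>space M. \<bar>X n x - Y n x\<bar> > e / 2} + prob {x\<in>space M. \<bar>Y n x - Z x\<bar> > e / 2}) \<longlonglongrightarrow> 0" by simp
  show "(\<lambda>n. prob {x\<in>space M. \<bar>X n x - Z x\<bar> > e}) \<longlonglongrightarrow> 0" by (rule tendsto_0_sandwich[OF measure_nonneg _ g], rule prob_dist_triangle) measurable
qed

lemma tends_in_prob_unique:
  assumes [measurable]: "\<And>n. X n \<in> borel_measurable M" "Y \<in> borel_measurable M" "Z \<in> borel_measurable M"
    and XY: "tends_in_prob X Y" and XZ: "tends_in_prob X Z"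
  shows "AE x in M. Y x = Z x"
proof -
  have "prob {x\<in>space M. \<bar>Y x - Z x\<bar> > e} = 0" if e: "e > 0" for e
  proof -
    have "(\<lambda>n. prob {x\<in>space M. \<bar>X n x - Y x\<bar> > e / 2} + prob {x\<in>space M. \<bar>X n x - Z x\<bar> > e / 2}) \<longlonglongrightarrow> 0 + 0"
      using XY[unfolded tends_in_prob_def, rule_format, OF half_gt_zero[OF e]] XZ[unfolded tends_in_prob_def, rule_format, OF half_gt_zero[OF e]]
      by (intro tendsto_add)
    moreover have "prob {x\<in>space M. \<bar>Y x - Z x\<bar> > e} \<le> prob {x\<in>space M. \<bar>X n x - Y x\<bar> > e / 2} + prob {x\<in>space M. \<bar>X n x - Z x\<bar> > e / 2}" for n
      using prob_dist_triangle[of Y "X n" Z e] by (simp add: abs_minus_commute)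
    ultimately have "prob {x\<in>space M. \<bar>Y x - Z x\<bar> > e} \<le> 0 + 0" by (intro LIMSEQ_le_const) auto
    then show ?thesis by (simp add: measure_le_0_iff)
  qed
  then have "AE x in M. \<bar>Y x - Z x\<bar> \<le> inverse (real (Suc n))" for n by (subst (asm) prob_eq_0) (auto simp: not_less)
  then have "AE x in M. \<forall>n. \<bar>Y x - Z x\<bar> \<le> inverse (real (Suc n))" by (simp add: AE_all_countable)
  then show ?thesis
  proof eventually_elim
    case (elim x)
    have "\<bar>Y x - Z x\<bar> \<le> 0" by (rule LIMSEQ_le_const[OF LIMSEQ_inverse_real_of_nat]) (use elim in auto)
    then show ?case by simp
  qed
qed

text \<open>Borel--Cantelli, with thresholds that are summable themselves.\<close>

lemma AE_summable_prob:
  assumes [measurable]: "\<And>n. Z n \<in> borel_measurable M" and nn: "\<And>n x. 0 \<le> Z n x"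
    and p: "\<And>n. prob {x\<in>space M. Z n x > (1 / 2) ^ n} \<le> C * (1 / 2) ^ n"
  shows "AE x in M. summable (\<lambda>n. Z n x :: real)"
proof -
  have "AE x in M. eventually (\<lambda>n. x \<in> space M - {x\<in>space M. Z n x > (1 / 2) ^ n}) sequentially"
  proof (rule borel_cantelli_AE1)
    show "summable (\<lambda>n. prob {x\<in>space M. Z n x > (1 / 2) ^ n})"
      by (rule summable_comparison_test'[where g="\<lambda>n. C * (1 / 2) ^ n"]) (use p in \<open>auto intro!: summable_mult\<close>)
  qed (auto simp: emeasure_eq_measure)
  then show ?thesis
  proof eventually_elim
    case (elim x)
    then have "eventually (\<lambda>n. norm (Z n x) \<le> (1 / 2) ^ n) sequentially" by eventually_elim (use nn in auto)
    then show ?case by (rule summable_comparison_test_ev) simp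
  qed
qed

end

lemma summable_diff_convergent:
  fixes f :: "nat => real"
  assumes "summable (\<lambda>n. \<bar>f (Suc n) - f n\<bar>)" shows "convergent f"
proof -
  have "summable (\<lambda>n. f (Suc n) - f n)" using assms by (rule summable_rabs_cancel)
  then have "convergent (\<lambda>n. (\<Sum>k<n. f (Suc k) - f k) + f 0)" by (intro convergent_add convergent_const) (simp add: summable_iff_convergent)
  then show ?thesis by (simp add: sum_lessThan_telescope)
qed

section \<open>Existence and uniqueness of the stochastic integral\<close>

context stable_noise begin

lemma has_stoch_integralI_AE:
  assumes f: "f \<in> L_space \<alpha>" and t: "\<And>n. simple (t n)" and lim: "(\<lambda>n. stable_norm \<alpha> (\<lambda>w. f w - t n w)) \<longlonglongrightarrow> 0"
    and [measurable]: "X \<in> borel_measurable M" and X: "AE x in M. (\<lambda>n. simple_stoch_integral W (t n) x) \<longlonglongrightarrow> X x"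
  shows "has_stoch_integral M \<alpha> W f X" unfolding has_stoch_integral_def
  using AE_tends_in_prob[OF simple_stoch_integral_measurable[OF t] _ X] assms unfolding tends_in_prob_def by auto

text \<open>The definition provides just one approximating sequence. By the tail bound, the
  integrals of two such sequences differ by an amount tending to 0 in probability, so every sequence
  converging to \<open>f\<close> has the same limit; uniqueness of the integral follows.\<close>

lemma has_stoch_integral_approx:
  assumes X: "has_stoch_integral M \<alpha> W f X" and t: "\<And>n. simple (t n)" and lim: "(\<lambda>n. stable_norm \<alpha> (\<lambda>w. f w - t n w)) \<longlonglongrightarrow> 0"
  shows "tends_in_prob (\<lambda>n. simple_stoch_integral W (t n)) X"
proof -
  obtain s where s: "\<And>n. simple (s n)" "(\<lambda>n. stable_norm \<alpha> (\<lambda>w. f w - s n w)) \<longlonglongrightarrow> 0"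
    and sX: "tends_in_prob (\<lambda>n. simple_stoch_integral W (s n)) X" and f: "f \<in> L_space \<alpha>" and [measurable]: "X \<in> borel_measurable M"
    using X unfolding has_stoch_integral_def tends_in_prob_def by blast
  have [measurable]: "simple_stoch_integral W (s n) \<in> borel_measurable M" "simple_stoch_integral W (t n) \<in> borel_measurable M" for n
    using simple_stoch_integral_measurable s t by auto
  have "(\<lambda>n. 4 * (stable_norm \<alpha> (\<lambda>w. f w - t n w) + stable_norm \<alpha> (\<lambda>w. f w - s n w))) \<longlonglongrightarrow> 4 * (0 + 0)" by (intro tendsto_intros lim s(2)) auto
  then have g: "(\<lambda>n. 4 * (stable_norm \<alpha> (\<lambda>w. f w - t n w) + stable_norm \<alpha> (\<lambda>w. f w - s n w))) \<longlonglongrightarrow> 0" by simp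
  have b: "stable_norm \<alpha> (\<lambda>w. t n w - s n w) \<le> 4 * (stable_norm \<alpha> (\<lambda>w. f w - t n w) + stable_norm \<alpha> (\<lambda>w. f w - s n w))" for n
    using stable_norm_triangle[where f="t n" and h="s n", OF _ L_space_measurable[OF f] _ \<alpha>] t[of n] s(1)[of n]
    by (simp add: borel_measurable_simple_function stable_norm_swap[where g=f])
  have 0: "(\<lambda>n. stable_norm \<alpha> (\<lambda>w. t n w - s n w)) \<longlonglongrightarrow> 0" by (rule tendsto_0_sandwich[OF zero_le b g])
  have e0: "(\<lambda>n. enn2real (stable_norm \<alpha> (\<lambda>w. t n w - s n w))) \<longlonglongrightarrow> 0"
  proof -
    have "(\<lambda>n. stable_norm \<alpha> (\<lambda>w. t n w - s n w)) \<longlonglongrightarrow> ennreal 0" using 0 by simp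
    from tendsto_enn2real[OF this] show ?thesis by simp
  qed
  have "tends_in_prob (\<lambda>n x. simple_stoch_integral W (t n) x - simple_stoch_integral W (s n) x) (\<lambda>_. 0)" unfolding tends_in_prob_def
  proof (intro allI impI)
    fix e :: real assume e: "e > 0"
    have "(\<lambda>n. 8 * (enn2real (stable_norm \<alpha> (\<lambda>w. t n w - s n w)) * e powr -\<alpha>)) \<longlonglongrightarrow> 8 * (0 * e powr -\<alpha>)" by (intro tendsto_intros e0)
    then have g: "(\<lambda>n. 8 * (enn2real (stable_norm \<alpha> (\<lambda>w. t n w - s n w)) * e powr -\<alpha>)) \<longlonglongrightarrow> 0" by simp
    show "(\<lambda>n. prob {x \<in> space M. e < \<bar>simple_stoch_integral W (t n) x - simple_stoch_integral W (s n) x - 0\<bar>}) \<longlonglongrightarrow> 0"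
      by (rule tendsto_0_sandwich[OF measure_nonneg _ g], unfold diff_zero, rule simple_stoch_integral_diff_tail[OF t s(1) e])
  qed
  then show ?thesis by (intro tends_in_prob_trans[OF _ _ _ _ sX]) auto
qed

lemma has_stoch_integral_unique:
  assumes X: "has_stoch_integral M \<alpha> W f X" and Y: "has_stoch_integral M \<alpha> W f Y"
  shows "AE x in M. X x = Y x"
proof -
  obtain s where s: "\<And>n. simple (s n)" "(\<lambda>n. stable_norm \<alpha> (\<lambda>w. f w - s n w)) \<longlonglongrightarrow> 0" using X unfolding has_stoch_integral_def by blast
  show ?thesis
    by (rule tends_in_prob_unique[OF simple_stoch_integral_measurable[OF s(1)] _ _ has_stoch_integral_approx[OF X s] has_stoch_integral_approx[OF Y s]])
      (use X Y in \<open>auto simp: has_stoch_integral_def\<close>)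
qed

lemma has_stoch_integral_exists:
  assumes f: "f \<in> L_space \<alpha>" shows "\<exists>X. has_stoch_integral M \<alpha> W f X"
proof -
  obtain s where s: "\<And>n. simple_function (restrict_space lborel half_space) (s n)" "\<And>n. s n \<in> L_space \<alpha>"
     "(\<lambda>n. stable_norm \<alpha> (\<lambda>w. f w - s n w)) \<longlonglongrightarrow> 0" by (rule L_space_approx[OF f \<alpha>], rule that, assumption+)
  \<comment> \<open>The rate 8^(-n) suits all \<alpha> < 2: the tail bound at level 2^(-n) costs a
    factor (2^n)^\<alpha> \<le> 4^n, which leaves 64 times 2^(-n), and the integrals converge almost
    surely by \<open>AE_summable_prob\<close>.\<close>
  have "\<exists>N. stable_norm \<alpha> (\<lambda>w. f w - s N w) < ennreal ((1 / 8) ^ n)" for n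
    using order_tendstoD(2)[OF s(3), of "ennreal ((1 / 8) ^ n)"] by (auto simp: eventually_sequentially)
  then obtain N where N: "\<And>n. stable_norm \<alpha> (\<lambda>w. f w - s (N n) w) < ennreal ((1 / 8) ^ n)" by metis
  define t where "t n = s (N n)" for n
  have t: "simple (t n)" for n using s unfolding t_def by auto
  have [measurable]: "simple_stoch_integral W (t n) \<in> borel_measurable M" for n using simple_stoch_integral_measurable t by auto
  have tl: "(\<lambda>n. stable_norm \<alpha> (\<lambda>w. f w - t n w)) \<longlonglongrightarrow> 0"
  proof (rule tendsto_0_sandwich)
    have "(\<lambda>n. (1 / 8 :: real) ^ n) \<longlonglongrightarrow> 0" by (rule LIMSEQ_realpow_zero) auto
    then show "(\<lambda>n. ennreal ((1 / 8) ^ n)) \<longlonglongrightarrow> 0" using tendsto_ennrealI by force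
  qed (use N in \<open>auto simp: t_def intro!: less_imp_le\<close>)
  have d: "enn2real (stable_norm \<alpha> (\<lambda>w. t (Suc n) w - t n w)) \<le> 8 * (1 / 8) ^ n" for n
  proof -
    have "stable_norm \<alpha> (\<lambda>w. t (Suc n) w - t n w) \<le> 4 * (stable_norm \<alpha> (\<lambda>w. f w - t (Suc n) w) + stable_norm \<alpha> (\<lambda>w. f w - t n w))"
      using stable_norm_triangle[where f="t (Suc n)" and h="t n", OF _ L_space_measurable[OF f] _ \<alpha>] t[of n] t[of "Suc n"]
      by (simp add: borel_measurable_simple_function stable_norm_swap[where g=f])
    also have "... \<le> 4 * (ennreal ((1 / 8) ^ Suc n) + ennreal ((1 / 8) ^ n))"
      using N[of n] N[of "Suc n"] unfolding t_def by (intro mult_left_mono add_mono) auto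
    also have "... = ennreal (4 * ((1 / 8) ^ Suc n + (1 / 8) ^ n))" by (subst ennreal_numeral_mult, subst ennreal_plus) auto
    also have "... \<le> ennreal (8 * (1 / 8) ^ n)" by simp
    finally show ?thesis by (intro enn2real_leI) auto
  qed
  have p: "prob {x\<in>space M. \<bar>simple_stoch_integral W (t (Suc n)) x - simple_stoch_integral W (t n) x\<bar> > (1 / 2) ^ n} \<le> 64 * (1 / 2) ^ n" for n
  proof -
    have "((1 / 2 :: real) ^ n) powr -\<alpha> = 2 powr (real n * \<alpha>)" by (simp add: powr_realpow[symmetric] powr_powr powr_minus_divide powr_divide)
    also have "... \<le> 2 powr (real n * 2)" using \<alpha> by (intro powr_mono mult_left_mono) auto
    also have "... = 4 ^ n"
    proof -
      have "(2::real) powr (real n * 2) = (2 powr 2) powr real n" unfolding powr_powr by (simp add: mult.commute)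
      also have "(2::real) powr 2 = 4" by simp
      also have "(4::real) powr real n = 4 ^ n" by (simp add: powr_realpow)
      finally show ?thesis .
    qed
    finally have e: "((1 / 2 :: real) ^ n) powr -\<alpha> \<le> 4 ^ n" .
    have "prob {x\<in>space M. \<bar>simple_stoch_integral W (t (Suc n)) x - simple_stoch_integral W (t n) x\<bar> > (1 / 2) ^ n}
      \<le> 8 * (enn2real (stable_norm \<alpha> (\<lambda>w. t (Suc n) w - t n w)) * ((1 / 2) ^ n) powr -\<alpha>)" by (rule simple_stoch_integral_diff_tail[OF t t]) simp
    also have "... \<le> 8 * (8 * (1 / 8) ^ n * 4 ^ n)" using d e by (intro mult_mono) auto
    also have "... = 64 * (1 / 2) ^ n" by (simp add: power_mult_distrib[symmetric])
    finally show ?thesis .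
  qed
  have "AE x in M. summable (\<lambda>n. \<bar>simple_stoch_integral W (t (Suc n)) x - simple_stoch_integral W (t n) x\<bar>)" by (rule AE_summable_prob[OF _ _ p]) auto
  then have c: "AE x in M. (\<lambda>n. simple_stoch_integral W (t n) x) \<longlonglongrightarrow> lim (\<lambda>n. simple_stoch_integral W (t n) x)"
    by eventually_elim (auto dest: summable_diff_convergent simp: convergent_LIMSEQ_iff)
  have "has_stoch_integral M \<alpha> W f (\<lambda>x. lim (\<lambda>n. simple_stoch_integral W (t n) x))" by (rule has_stoch_integralI_AE[OF f t tl _ c]) measurable
  then show ?thesis by blast
qed

lemma stoch_integral_works: "f \<in> L_space \<alpha> ==> has_stoch_integral M \<alpha> W f (stoch_integral M \<alpha> W f)"
  unfolding stoch_integral_def using has_stoch_integral_exists by (rule someI_ex)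

lemma stoch_integral_measurable: "f \<in> L_space \<alpha> ==> stoch_integral M \<alpha> W f \<in> borel_measurable M"
  using stoch_integral_works unfolding has_stoch_integral_def by blast

lemma stoch_integral_eq:
  assumes "has_stoch_integral M \<alpha> W f X" shows "AE x in M. X x = stoch_integral M \<alpha> W f x"
  using assms stoch_integral_works by (intro has_stoch_integral_unique[OF assms]) (auto simp: has_stoch_integral_def)

lemma has_stoch_integral_cong_AE:
  assumes X: "has_stoch_integral M \<alpha> W f X" and g: "g \<in> L_space \<alpha>"
    and eq: "AE w in restrict_space lborel half_space. f w = g w"
  shows "has_stoch_integral M \<alpha> W g X"
proof -
  have "stable_norm \<alpha> (\<lambda>w. f w - s w) = stable_norm \<alpha> (\<lambda>w. g w - s w)" for s by (rule nn_integral_cong_AE) (use eq in \<open>auto elim!: AE_mp\<close>)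
  then show ?thesis using X g unfolding has_stoch_integral_def by simp
qed

end

section \<open>Maxima of stochastic integrals\<close>

context prob_space begin

lemma stable_rv_symmetric:
  assumes X: "stable_rv M \<alpha> a X" shows "distr M borel (\<lambda>x. - X x) = distr M borel X"
proof -
  have [measurable]: "X \<in> borel_measurable M" using X unfolding stable_rv_def by blast
  have "char (distr M borel (\<lambda>x. - X x)) u = char (distr M borel X) u" for u using char_distr_cmult[of X "-1" u] X unfolding stable_rv_def by simp
  then show ?thesis by (intro Levy_uniqueness) auto
qed

text \<open>By independence the joint law is the product of the marginal laws, and only the factor
  \<open>j\<close> is affected.\<close>

lemma flip_one_coordinate:
  fixes V :: "'i => 'a => real"
  assumes ind: "indep_vars (\<lambda>_. borel) V I" and j: "j \<in> I"
    and sym: "distr M borel (\<lambda>y. - V j y) = distr M borel (V j)"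
  shows "distr M (\<Pi>\<^sub>M i\<in>I. borel) (\<lambda>y. \<lambda>i\<in>I. V i y) = distr M (\<Pi>\<^sub>M i\<in>I. borel) (\<lambda>y. \<lambda>i\<in>I. if i = j then - V i y else V i y)"
proof -
  let ?V = "\<lambda>i y. if i = j then - V i y else V i y"
  have I0: "I \<noteq> {}" using j by blast
  have rv: "V i \<in> borel_measurable M" if "i \<in> I" for i using ind that unfolding indep_vars_def2 by blast
  have rv2: "?V i \<in> borel_measurable M" if "i \<in> I" for i using rv[OF that] by auto
  have ind2: "indep_vars (\<lambda>_. borel) ?V I" using indep_vars_compose2[OF ind, of "\<lambda>i x. if i = j then - x else x" "\<lambda>_. borel"] by simp
  have "distr M (\<Pi>\<^sub>M i\<in>I. borel) (\<lambda>y. \<lambda>i\<in>I. V i y) = (\<Pi>\<^sub>M i\<in>I. distr M borel (V i))"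
    by (rule indep_vars_iff_distr_eq_PiM'[OF I0 rv, THEN iffD1, OF _ ind])
  also have "... = (\<Pi>\<^sub>M i\<in>I. distr M borel (?V i))"
  proof (rule PiM_cong)
    fix i show "distr M borel (V i) = distr M borel (?V i)" by (cases "i = j") (simp_all add: sym)
  qed simp
  also have "... = distr M (\<Pi>\<^sub>M i\<in>I. borel) (\<lambda>y. \<lambda>i\<in>I. ?V i y)" by (rule indep_vars_iff_distr_eq_PiM'[OF I0 rv2, THEN iffD1, OF _ ind2, symmetric])
  finally show ?thesis .
qed

text \<open>Write u for the summand \<open>j\<close> and v for the sum of the others. If |u| > R,
  then |v + u| or |v - u| exceeds R, and by \<open>flip_one_coordinate\<close> both events,
  intersected with the event that |V j| is large, have the same probability. So the other summands
  can cancel a large one at most half of the time.\<close>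

lemma symmetric_sum_large:
  fixes V :: "'i => 'a => real"
  assumes ind: "indep_vars (\<lambda>_. borel) V I" and I: "finite I" and j: "j \<in> I"
    and sym: "distr M borel (\<lambda>x. - V j x) = distr M borel (V j)" and c: "\<bar>c j\<bar> \<ge> 1 / 4"
  shows "prob {x\<in>space M. \<bar>V j x\<bar> > 4 * R} \<le> 2 * prob {x\<in>space M. \<bar>V j x\<bar> > 4 * R \<and> \<bar>\<Sum>i\<in>I. c i * V i x\<bar> > R}"
proof -
  let ?P = "\<Pi>\<^sub>M i\<in>I. (borel :: real measure)" and ?V = "\<lambda>x i. if i = j then - V i x else V i x"
  let ?E = "\<lambda>v. \<bar>v j\<bar> > 4 * R \<and> \<bar>\<Sum>i\<in>I. c i * v i\<bar> > R"
  have rv[measurable]: "V i \<in> borel_measurable M" if "i \<in> I" for i using ind that unfolding indep_vars_def2 by blast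
  have mV[measurable]: "(\<lambda>x. V j x) \<in> borel_measurable M" by (rule rv[OF j])
  have mS: "(\<lambda>x. \<Sum>i\<in>I. c i * V i x) \<in> borel_measurable M" "(\<lambda>x. \<Sum>i\<in>I. c i * ?V x i) \<in> borel_measurable M" by auto
  have co: "(\<lambda>v. v i) \<in> borel_measurable ?P" if "i \<in> I" for i using that by simp
  have E: "{v\<in>space ?P. ?E v} \<in> sets ?P" using co[OF j] by simp
  have meas: "measure (distr M ?P (\<lambda>x. \<lambda>i\<in>I. X x i)) {v\<in>space ?P. ?E v} = prob {x\<in>space M. ?E (X x)}"
    if X: "\<And>i. i \<in> I ==> (\<lambda>x. X x i) \<in> borel_measurable M" for X
  proof -
    have "(\<lambda>x. \<lambda>i\<in>I. X x i) -` {v\<in>space ?P. ?E v} \<inter> space M = {x\<in>space M. ?E (X x)}" using j by (auto simp: space_PiM)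
    then show ?thesis using measure_distr[OF measurable_restrict[OF X] E] by simp
  qed
  have eq: "prob {x\<in>space M. ?E (\<lambda>i. V i x)} = prob {x\<in>space M. ?E (?V x)}"
    using meas[of "\<lambda>x i. V i x"] meas[of ?V] rv flip_one_coordinate[OF ind j sym] by simp
  have S: "(\<Sum>i\<in>I. c i * V i x) = c j * V j x + (\<Sum>i\<in>I - {j}. c i * V i x)"
    "(\<Sum>i\<in>I. c i * ?V x i) = - c j * V j x + (\<Sum>i\<in>I - {j}. c i * V i x)" for x unfolding sum.remove[OF I j] by auto
  have sets: "{x\<in>space M. ?E (\<lambda>i. V i x)} \<in> events" "{x\<in>space M. ?E (?V x)} \<in> events" using mS by measurable
  have "prob {x\<in>space M. \<bar>V j x\<bar> > 4 * R} \<le> prob ({x\<in>space M. ?E (\<lambda>i. V i x)} \<union> {x\<in>space M. ?E (?V x)})"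
  proof (intro finite_measure_mono sets.Un sets subsetI)
    fix x assume x: "x \<in> {x\<in>space M. \<bar>V j x\<bar> > 4 * R}"
    have "1 / 4 * \<bar>V j x\<bar> \<le> \<bar>c j * V j x\<bar>" unfolding abs_mult by (intro mult_right_mono c) simp
    then have "\<bar>c j * V j x\<bar> > R" using x by simp
    then have "\<bar>\<Sum>i\<in>I. c i * V i x\<bar> > R \<or> \<bar>\<Sum>i\<in>I. c i * ?V x i\<bar> > R" unfolding S by arith
    then show "x \<in> {x\<in>space M. ?E (\<lambda>i. V i x)} \<union> {x\<in>space M. ?E (?V x)}" using x by auto
  qed
  also have "... \<le> prob {x\<in>space M. ?E (\<lambda>i. V i x)} + prob {x\<in>space M. ?E (?V x)}" by (rule measure_Un_le[OF sets])
  finally show ?thesis unfolding eq[symmetric] by simp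
qed

text \<open>Bonferroni's inequality. The subtracted square dominates the sum over unordered pairs,
  and in this form the induction step is a linear estimate.\<close>

lemma union_prob_lower:
  assumes "finite J" and F: "\<And>j. j \<in> J ==> F j \<in> events" and q: "\<And>j. j \<in> J ==> 0 \<le> q j"
    and pair: "\<And>i j. i \<in> J ==> j \<in> J ==> i \<noteq> j ==> prob (F i \<inter> F j) \<le> q i * q j"
  shows "(\<Sum>j\<in>J. prob (F j)) - (\<Sum>j\<in>J. q j)\<^sup>2 \<le> prob (\<Union>j\<in>J. F j)" using assms
proof (induction J rule: finite_induct)
  case (insert x J)
  let ?U = "\<Union>j\<in>J. F j"
  have U: "?U \<in> events" "F x \<in> events" using insert by auto
  have "prob (F x \<inter> ?U) \<le> (\<Sum>j\<in>J. prob (F x \<inter> F j))" unfolding Int_UN_distrib using insert by (intro finite_measure_subadditive_finite) auto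
  also have "... \<le> (\<Sum>j\<in>J. q x * q j)" using insert by (intro sum_mono) auto
  finally have "prob (F x \<inter> ?U) \<le> q x * (\<Sum>j\<in>J. q j)" by (simp add: sum_distrib_left)
  moreover have "prob (F x \<union> ?U) = prob (F x) + prob ?U - prob (F x \<inter> ?U)" using U by (intro measure_Un3) (auto simp: fmeasurable_eq_sets)
  moreover have "(\<Sum>j\<in>J. prob (F j)) - (\<Sum>j\<in>J. q j)\<^sup>2 \<le> prob ?U" using insert by auto
  moreover have "0 \<le> q x * (\<Sum>j\<in>J. q j)" "0 \<le> (q x)\<^sup>2" using insert by (auto intro!: mult_nonneg_nonneg sum_nonneg)
  moreover have "(\<Sum>j\<in>insert x J. q j)\<^sup>2 = (q x)\<^sup>2 + (\<Sum>j\<in>J. q j)\<^sup>2 + 2 * (q x * (\<Sum>j\<in>J. q j))" using insert.hyps by (simp add: power2_sum)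
  moreover have "(\<Sum>j\<in>insert x J. prob (F j)) = prob (F x) + (\<Sum>j\<in>J. prob (F j))" using insert.hyps by auto
  ultimately have "(\<Sum>j\<in>insert x J. prob (F j)) - (\<Sum>j\<in>insert x J. q j)\<^sup>2 \<le> prob (F x \<union> ?U)" by linarith
  then show ?case by simp
qed simp

end

text \<open>The common refinement of a finite family. The restriction to \<open>K\<close> makes the
  labels extensional functions, so that their number is finite.\<close>

lemma labelling_restrict:
  assumes K: "finite K" and s: "\<And>k. k \<in> K ==> labelling (s k)"
  shows "labelling (\<lambda>w. \<lambda>k\<in>K. s k w)" unfolding labelling_def
proof (intro conjI allI)
  have sub: "(\<lambda>w. \<lambda>k\<in>K. s k w) ` half_space \<subseteq> (\<Pi>\<^sub>E k\<in>K. s k ` half_space)" by auto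
  show "finite ((\<lambda>w. \<lambda>k\<in>K. s k w) ` half_space)" by (rule finite_subset[OF sub]) (use K s in \<open>auto simp: labelling_def intro!: finite_PiE\<close>)
  fix l
  show "cell (\<lambda>w. \<lambda>k\<in>K. s k w) l \<in> sets borel"
  proof (cases "l \<in> extensional K")
    case True
    have "cell (\<lambda>w. \<lambda>k\<in>K. s k w) l = half_space \<inter> (\<Inter>k\<in>K. (cell (s k) (l k) \<union> - half_space))"
      unfolding cell_def using True by (auto simp: extensional_def)
    then show ?thesis using K s unfolding labelling_def by (cases "K = {}") (auto intro!: sets.Int sets.Un)
  next
    case False
    then have "cell (\<lambda>w. \<lambda>k\<in>K. s k w) l = {}" unfolding cell_def by auto
    then show ?thesis by simp
  qed
qed

lemma labelling_set:
  assumes "B \<in> sets borel" shows "labelling (\<lambda>w. w \<in> B)" unfolding labelling_def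
proof (intro conjI allI)
  show "finite ((\<lambda>w. w \<in> B) ` half_space)" by simp
  fix l :: bool
  have "cell (\<lambda>w. w \<in> B) l = (if l then half_space \<inter> B else half_space - B)" unfolding cell_def by auto
  then show "cell (\<lambda>w. w \<in> B) l \<in> sets borel" using assms by auto
qed

text \<open>Markov's inequality; the constant is 16 because (1/4)^\<alpha> \<ge> 1/16 for \<alpha> <
  2.\<close>

lemma stable_norm_Markov:
  fixes f :: "real \<times> (real^'n) => real"
  assumes [measurable]: "f \<in> borel_measurable (restrict_space lborel half_space)" and \<alpha>: "0 < \<alpha>" "\<alpha> < 2"
  shows "{w\<in>half_space. \<bar>f w\<bar> \<ge> 1 / 4} \<in> sets borel" (is "?A \<in> _")
    and "emeasure lborel {w\<in>half_space. \<bar>f w\<bar> \<ge> 1 / 4} \<le> 16 * stable_norm \<alpha> f"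
proof -
  let ?R = "restrict_space lborel (half_space :: (real \<times> (real^'n)) set)"
  have "{w\<in>space ?R. \<bar>f w\<bar> \<ge> 1 / 4} \<in> sets ?R" by measurable
  then have AR: "?A \<in> sets ?R" by simp
  then show A: "?A \<in> sets borel" by (subst (asm) sets_restrict_space_iff) auto
  have "emeasure lborel ?A = emeasure ?R ?A" by (intro emeasure_restrict_space[symmetric]) auto
  also have "... = (\<integral>\<^sup>+w. indicator ?A w \<partial>?R)" using AR by simp
  also have "... \<le> (\<integral>\<^sup>+w. 16 * ennreal (\<bar>f w\<bar> powr \<alpha>) \<partial>?R)"
  proof (intro nn_integral_mono)
    fix w
    have "1 \<le> 16 * \<bar>f w\<bar> powr \<alpha>" if "\<bar>f w\<bar> \<ge> 1 / 4"
    proof -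
      have "(1 / 4) powr 2 \<le> (1 / 4 :: real) powr \<alpha>" using \<alpha> by (intro powr_mono') auto
      also have "... \<le> \<bar>f w\<bar> powr \<alpha>" using that \<alpha> by (intro powr_mono2) auto
      finally show ?thesis by (simp add: power2_eq_square)
    qed
    then show "indicator ?A w \<le> 16 * ennreal (\<bar>f w\<bar> powr \<alpha>)" by (auto simp: indicator_def ennreal_numeral_mult[symmetric])
  qed
  also have "... = 16 * stable_norm \<alpha> f" by (rule nn_integral_cmult) measurable
  finally show "emeasure lborel ?A \<le> 16 * stable_norm \<alpha> f" .
qed

context stable_noise begin

text \<open>The constant of \<open>stable_rv_lower_tail\<close> divided by 4: one factor 2 passes
  from 1 - exp(-s) to s, the other one is the loss in \<open>symmetric_sum_large\<close>.\<close>

abbreviation jump_const :: real where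
  "jump_const \<equiv> (1 / 12) powr (\<alpha> / (2 - \<alpha>)) / 16"

text \<open>The largest of the integrals exceeds \<open>R\<close> if some cell \<open>l\<close> carries noise of size \<open>4 * R\<close>, up to the
  sign of that noise, and such cells are unlikely to occur in pairs.\<close>

lemma simple_max_lower:
  assumes K: "finite K" and s: "\<And>k. k \<in> K ==> simple (s k)" and B: "B \<in> finite_borel" and R: "0 < R"
    and N: "N \<in> sets borel" "\<And>w. w \<in> B - N ==> \<exists>k\<in>K. \<bar>s k w\<bar> \<ge> 1 / 4" and B1: "measure lborel B * (4 * R) powr -\<alpha> \<le> 1"
  shows "jump_const * (measure lborel (B - N) * (4 * R) powr -\<alpha>) - (8 * (measure lborel B * (4 * R) powr -\<alpha>))\<^sup>2
    \<le> prob {v\<in>space M. \<exists>k\<in>K. \<bar>simple_stoch_integral W (s k) v\<bar> > R}"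
proof -
  \<comment> \<open>One labelling on whose cells all the \<open>s k\<close> and membership in
    \<open>B\<close> are constant.\<close>
  define t where "t = (\<lambda>w. (\<lambda>k\<in>K. s k w, w \<in> B))"
  have Bb: "B \<in> sets borel" "B \<subseteq> half_space" using B finite_borelD by auto
  have lab: "labelling t" unfolding t_def using K s Bb by (intro labelling_pair labelling_restrict labelling_set simple_function_labelling) auto
  have adm: "cell_adm t (\<lambda>l. fst l k)" if k: "k \<in> K" for k
    using cell_adm_coarse[where \<sigma>="s k" and u="\<lambda>l. fst l k" and c="\<lambda>x. x", OF lab] simple_function_adm[of "s k" \<alpha>] s[OF k] k \<alpha> by (simp add: t_def)
  have int: "AE v in M. simple_stoch_integral W (s k) v = cell_integral W t (\<lambda>l. fst l k) v" if k: "k \<in> K" for k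
    by (rule simple_stoch_integral_coarse[OF lab s[OF k]]) (simp add: t_def k)
  define I where "I = {l\<in>t ` half_space. cell t l \<in> finite_borel}"
  have I: "finite I" using lab unfolding I_def labelling_def by simp
  \<comment> \<open>The cells in \<open>B\<close> on which some function is at least 1/4 in modulus;
    \<kappa> selects such a function. They cover \<open>B - N\<close>, and the noise of any single
    one of them can make the integral of its function large.\<close>
  define J where "J = {l\<in>I. snd l \<and> (\<exists>k\<in>K. \<bar>fst l k\<bar> \<ge> 1 / 4)}"
  have J: "J \<subseteq> I" "finite J" using I unfolding J_def by auto
  define \<kappa> where "\<kappa> l = (SOME k. k \<in> K \<and> \<bar>fst l k\<bar> \<ge> 1 / 4)" for l :: "(_ => real) \<times> bool"
  have \<kappa>: "\<kappa> l \<in> K" "\<bar>fst l (\<kappa> l)\<bar> \<ge> 1 / 4" if "l \<in> J" for l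
  proof -
    have "\<exists>k. k \<in> K \<and> \<bar>fst l k\<bar> \<ge> 1 / 4" using that unfolding J_def by blast
    then have "\<kappa> l \<in> K \<and> \<bar>fst l (\<kappa> l)\<bar> \<ge> 1 / 4" unfolding \<kappa>_def by (rule someI_ex)
    then show "\<kappa> l \<in> K" "\<bar>fst l (\<kappa> l)\<bar> \<ge> 1 / 4" by auto
  qed
  have cb: "cell t l \<in> finite_borel" if "l \<in> I" for l using that unfolding I_def by blast
  have ind: "indep_vars (\<lambda>_. borel) (\<lambda>l. W (cell t l)) I" by (intro W_indep I disjoint_cells cb)
  have V: "stable_rv M \<alpha> (measure lborel (cell t l)) (W (cell t l))" if "l \<in> I" for l by (intro W_stable cb that)
  have [measurable]: "W (cell t l) \<in> borel_measurable M" if "l \<in> I" for l by (intro W_measurable cb that)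
  let ?Z = "{v\<in>space M. \<exists>k\<in>K. \<bar>\<Sum>l\<in>I. fst l k * W (cell t l) v\<bar> > R}" and ?T = "{v\<in>space M. \<exists>k\<in>K. \<bar>simple_stoch_integral W (s k) v\<bar> > R}"
  let ?y = "(4 * R) powr -\<alpha>" and ?b = "\<lambda>l. measure lborel (cell t l)"
  let ?S = "\<lambda>k v. \<Sum>l\<in>I. fst l k * W (cell t l) v" and ?A = "\<lambda>l. {v\<in>space M. \<bar>W (cell t l) v\<bar> > 4 * R}"
  let ?F = "\<lambda>l. {v\<in>space M. \<bar>W (cell t l) v\<bar> > 4 * R \<and> \<bar>?S (\<kappa> l) v\<bar> > R}"
  have F: "?F l \<in> events" "?A l \<in> events" if "l \<in> J" for l
  proof -
    have [measurable]: "W (cell t l) \<in> borel_measurable M" using that J by auto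
    show "?F l \<in> events" "?A l \<in> events" by measurable
  qed
  have cellsJ: "cell t l \<in> sets borel" "cell t l \<subseteq> B" "emeasure lborel (cell t l) \<noteq> \<infinity>" if "l \<in> J" for l
    using that J finite_borelD[OF cb[of l]] by (auto simp: J_def cell_def t_def)
  have sumJ: "(\<Sum>l\<in>J. ?b l) = measure lborel (\<Union>l\<in>J. cell t l)" by (intro measure_finite_Union[symmetric] J disjoint_cells) (use cellsJ in auto)
  have UJ: "(\<Union>l\<in>J. cell t l) \<in> sets borel" using cellsJ J by auto
  have "B - N \<subseteq> (\<Union>l\<in>J. cell t l)"
  proof
    fix w assume w: "w \<in> B - N"
    then have wh: "w \<in> half_space" using Bb by auto
    have "cell t (t w) \<in> sets borel" using lab unfolding labelling_def by blast
    then have "cell t (t w) \<in> finite_borel" by (rule finite_borel_subset[OF B]) (use w in \<open>auto simp: cell_def t_def\<close>)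
    then have "t w \<in> J" using w wh N(2)[OF w] unfolding J_def I_def by (auto simp: t_def)
    then show "w \<in> (\<Union>l\<in>J. cell t l)" using wh unfolding cell_def by blast
  qed
  moreover have "(\<Union>l\<in>J. cell t l) \<subseteq> B" using cellsJ by blast
  moreover have "B \<in> fmeasurable lborel" using finite_borelD[OF B] by (simp add: fmeasurable_def)
  ultimately have m: "measure lborel (B - N) \<le> (\<Sum>l\<in>J. ?b l)" and m2: "(\<Sum>l\<in>J. ?b l) \<le> measure lborel B"
    unfolding sumJ using UJ Bb N(1) fmeasurableI2[of B lborel "\<Union>l\<in>J. cell t l"] by (auto intro!: measure_mono_fmeasurable)
  have sumB: "(\<Sum>l\<in>J. ?b l * ?y) \<le> measure lborel B * ?y" unfolding sum_distrib_right[symmetric] using m2 by (rule mult_right_mono) simp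
  have A: "prob (?A l) \<le> 8 * (?b l * ?y)" if "l \<in> J" for l by (rule stable_rv_tail[OF V \<alpha>]) (use that J R in auto)
  have half: "jump_const * (?b l * ?y) \<le> prob (?F l)" if l: "l \<in> J" for l
  proof -
    have "?b l * ?y \<le> (\<Sum>l\<in>J. ?b l * ?y)" using member_le_sum[OF l, of "\<lambda>l. ?b l * ?y"] J by simp
    then have "?b l * ?y / 2 \<le> 1 - exp (- (?b l * ?y))" using sumB B1 by (intro one_minus_exp_ge_half) auto
    then have "jump_const * 4 * (?b l * ?y / 2) \<le> jump_const * 4 * (1 - exp (- (?b l * ?y)))" by simp
    also have "... \<le> prob (?A l)" using stable_rv_lower_tail[OF V \<alpha>, of l "4 * R"] l J R by auto
    also have "... \<le> 2 * prob (?F l)" using symmetric_sum_large[OF ind I, of l "\<lambda>i. fst i (\<kappa> l)"] stable_rv_symmetric[OF V] \<kappa>(2) l J by auto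
    finally show ?thesis by simp
  qed
  have "prob (?F i \<inter> ?F j) \<le> 8 * (?b i * ?y) * (8 * (?b j * ?y))" if ij: "i \<in> J" "j \<in> J" "i \<noteq> j" for i j
  proof -
    have "prob (?F i \<inter> ?F j) \<le> prob (\<Inter>l\<in>{i, j}. W (cell t l) -` {x. \<bar>x\<bar> > 4 * R} \<inter> space M)"
    proof (rule finite_measure_mono)
      show "(\<Inter>l\<in>{i, j}. W (cell t l) -` {x. \<bar>x\<bar> > 4 * R} \<inter> space M) \<in> events"
        using ij J by (intro sets.finite_INT measurable_sets[OF W_measurable] cb) auto
    qed auto
    also have "... = (\<Prod>l\<in>{i, j}. prob (W (cell t l) -` {x. \<bar>x\<bar> > 4 * R} \<inter> space M))"
      by (rule indep_varsD[OF indep_vars_subset[OF ind, of "{i, j}"]]) (use ij J in auto)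
    also have "... = prob (?A i) * prob (?A j)" using ij by (simp add: Int_def conj_commute)
    also have "... \<le> 8 * (?b i * ?y) * (8 * (?b j * ?y))" using A ij by (intro mult_mono) auto
    finally show ?thesis .
  qed
  then have "(\<Sum>l\<in>J. prob (?F l)) - (\<Sum>l\<in>J. 8 * (?b l * ?y))\<^sup>2 \<le> prob (\<Union>l\<in>J. ?F l)" by (intro union_prob_lower J F) auto
  moreover have "(\<Sum>l\<in>J. 8 * (?b l * ?y))\<^sup>2 \<le> (8 * (measure lborel B * ?y))\<^sup>2"
    using sumB by (intro power_mono) (auto simp: sum_distrib_left[symmetric] intro!: sum_nonneg)
  moreover have "jump_const * (measure lborel (B - N) * ?y) \<le> (\<Sum>l\<in>J. prob (?F l))"
  proof -
    have "jump_const * (measure lborel (B - N) * ?y) \<le> jump_const * ((\<Sum>l\<in>J. ?b l) * ?y)" using m by (intro mult_left_mono mult_right_mono) auto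
    also have "... \<le> (\<Sum>l\<in>J. prob (?F l))" unfolding sum_distrib_left sum_distrib_right using half by (intro sum_mono)
    finally show ?thesis .
  qed
  moreover have "prob (\<Union>l\<in>J. ?F l) \<le> prob ?Z" by (intro finite_measure_mono sets.sets_Collect_finite_Ex K) (use \<kappa>(1) in \<open>auto, measurable\<close>)
  ultimately have "jump_const * (measure lborel (B - N) * ?y) - (8 * (measure lborel B * ?y))\<^sup>2 \<le> prob ?Z" by linarith
  also have "prob ?Z = prob ?T"
  proof (rule finite_measure_eq_AE)
    have "AE v in M. \<forall>k\<in>K. simple_stoch_integral W (s k) v = cell_integral W t (\<lambda>l. fst l k) v" by (intro AE_finite_allI K int)
    then show "AE v in M. v \<in> ?Z \<longleftrightarrow> v \<in> ?T"
    proof eventually_elim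
      case (elim v)
      have "cell_integral W t (\<lambda>l. fst l k) v = (\<Sum>l\<in>I. fst l k * W (cell t l) v)" if "k \<in> K" for k
        unfolding cell_integral_def using lab adm[OF that] unfolding I_def cell_adm_def labelling_def by (intro sum.mono_neutral_right) auto
      then show ?case using elim by auto
    qed
    show "?Z \<in> events" using K by simp
    show "?T \<in> events"
    proof (intro sets.sets_Collect_finite_Ex K)
      fix k assume "k \<in> K"
      then have [measurable]: "simple_stoch_integral W (s k) \<in> borel_measurable M" using simple_stoch_integral_measurable s by blast
      show "{v\<in>space M. \<bar>simple_stoch_integral W (s k) v\<bar> > R} \<in> events" by measurable
    qed
  qed
  finally show ?thesis .
qed

text \<open>The order of the quantifiers is what matters: \<open>R\<close> and \<open>p\<close> are
  chosen before \<open>K\<close> and \<open>g\<close>, and do not depend on the number of functions.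
  The passage from simple functions to general ones costs up to half of \<open>B\<close>, where the
  approximation may be bad, and half of the level.\<close>

lemma stoch_integral_max_lower:
  assumes B: "B \<in> finite_borel" and B0: "measure lborel B > 0"
  shows "\<exists>R>0. \<exists>p>0. \<forall>K :: 'k set. \<forall>g. finite K --> (\<forall>k\<in>K. g k \<in> L_space \<alpha>) --> (\<forall>w\<in>B. \<exists>k\<in>K. \<bar>g k w\<bar> \<ge> 1 / 2) -->
    p \<le> prob {x\<in>space M. \<exists>k\<in>K. \<bar>stoch_integral M \<alpha> W (g k) x\<bar> > R}"
proof -
  \<comment> \<open>y will be the measure of \<open>B\<close> times r^(-\<alpha>). With c =
    \<open>jump_const\<close>, the lower bound c y / 2 - 64 y^2 is largest at y = c / 256, where it
    equals c y / 4.\<close>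
  define y where "y = jump_const / 256"
  have jc: "0 < jump_const" by simp
  have "(1 / 12) powr (\<alpha> / (2 - \<alpha>)) \<le> (1 :: real)" using \<alpha> by (intro powr_le1) auto
  then have y: "0 < y" "y \<le> 1" unfolding y_def by auto
  define r where "r = (y / measure lborel B) powr (- 1 / \<alpha>)"
  have r: "0 < r" "measure lborel B * r powr -\<alpha> = y" unfolding r_def powr_powr using y B0 \<alpha> by auto
  define p where "p = jump_const * (y / 2) - (8 * y)\<^sup>2"
  have p: "0 < p"
  proof -
    have "p = y * (jump_const / 4)" unfolding p_def y_def by (simp add: power2_eq_square)
    also have "... > 0" using jc y by simp
    finally show ?thesis .
  qed
  have Bb[measurable]: "B \<in> sets borel" and Bh: "B \<subseteq> half_space" and Bf: "emeasure lborel B < \<infinity>" using B finite_borelD by auto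
  have "p \<le> prob {x\<in>space M. \<exists>k\<in>K. \<bar>stoch_integral M \<alpha> W (g k) x\<bar> > r / 8}"
    if K: "finite K" and g: "\<forall>k\<in>K. g k \<in> L_space \<alpha>" and gB: "\<forall>w\<in>B. \<exists>k\<in>K. \<bar>g k w\<bar> \<ge> 1 / 2" for K :: "'k set" and g
  proof -
    \<comment> \<open>\<open>simple_max_lower\<close> is used at the level r / 4; half of it remains
      for the limits of the simple integrals.\<close>
    let ?R = "r / 8" and ?X = "\<lambda>k. stoch_integral M \<alpha> W (g k)"
    have "\<forall>k\<in>K. \<exists>s. (\<forall>n. simple (s n)) \<and> (\<lambda>n. stable_norm \<alpha> (\<lambda>w. g k w - s n w)) \<longlonglongrightarrow> 0"
    proof
      fix k assume "k \<in> K"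
      then have "g k \<in> L_space \<alpha>" using g by blast
      from stoch_integral_works[OF this] show "\<exists>s. (\<forall>n. simple (s n)) \<and> (\<lambda>n. stable_norm \<alpha> (\<lambda>w. g k w - s n w)) \<longlonglongrightarrow> 0"
        unfolding has_stoch_integral_def by blast
    qed
    from bchoice[OF this] obtain s where s0: "\<forall>k\<in>K. (\<forall>n. simple (s k n)) \<and> (\<lambda>n. stable_norm \<alpha> (\<lambda>w. g k w - s k n w)) \<longlonglongrightarrow> 0" by (rule exE)
    have s: "simple (s k n)" "(\<lambda>n. stable_norm \<alpha> (\<lambda>w. g k w - s k n w)) \<longlonglongrightarrow> 0" if "k \<in> K" for k n using bspec[OF s0 that] by blast+
    let ?Z = "{x\<in>space M. \<exists>k\<in>K. \<bar>?X k x\<bar> > ?R}"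
    let ?I = "\<lambda>k n. simple_stoch_integral W (s k n)" and ?D = "\<lambda>k n. {x\<in>space M. \<bar>simple_stoch_integral W (s k n) x - ?X k x\<bar> > ?R}"
    have mI[measurable]: "?I k n \<in> borel_measurable M" "?X k \<in> borel_measurable M" if "k \<in> K" for k n
      using that g simple_stoch_integral_measurable[OF s(1)] stoch_integral_measurable by auto
    let ?A = "\<lambda>k n. {w\<in>half_space. \<bar>g k w - s k n w\<bar> \<ge> 1 / 4}"
    have A: "?A k n \<in> sets borel" "emeasure lborel (?A k n) \<le> 16 * stable_norm \<alpha> (\<lambda>w. g k w - s k n w)" if k: "k \<in> K" for k n
    proof -
      have "(\<lambda>w. g k w - s k n w) \<in> borel_measurable (restrict_space lborel half_space)" using L_space_measurable[of "g k" \<alpha>] s(1)[OF k, of n] g k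
        by (intro borel_measurable_diff) (auto intro: borel_measurable_simple_function)
      from stable_norm_Markov[OF this \<alpha>] show "?A k n \<in> sets borel" "emeasure lborel (?A k n) \<le> 16 * stable_norm \<alpha> (\<lambda>w. g k w - s k n w)" .
    qed
    \<comment> \<open>For each k the function and its approximant differ by 1/4 or more on a set of
      measure at most 16 e; for all k together this is at most half of the measure of
      \<open>B\<close>.\<close>
    define e where "e = measure lborel B / (32 * real (card K + 1))"
    have e: "0 < e" "real (card K) * (16 * e) \<le> measure lborel B / 2" unfolding e_def using B0 by (auto simp: field_simps)
    have "\<forall>\<^sub>F n in sequentially. \<forall>k\<in>K. stable_norm \<alpha> (\<lambda>w. g k w - s k n w) < ennreal e"
      by (intro eventually_ball_finite K ballI order_tendstoD(2)[OF s(2)]) (use e in auto)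
    then have ev: "\<forall>\<^sub>F n in sequentially. p \<le> prob ?Z + (\<Sum>k\<in>K. prob (?D k n))"
    proof eventually_elim
      case (elim n)
      define N where "N = (\<Union>k\<in>K. ?A k n)"
      have Ak: "measure lborel (?A k n) \<le> 16 * e" "emeasure lborel (?A k n) < \<infinity>" if "k \<in> K" for k
      proof -
        have "emeasure lborel (?A k n) \<le> 16 * ennreal e" using elim that by (intro order_trans[OF A(2)[OF that]] mult_left_mono) auto
        also have "... = ennreal (16 * e)" by (simp add: ennreal_numeral_mult)
        finally show "measure lborel (?A k n) \<le> 16 * e" "emeasure lborel (?A k n) < \<infinity>"
          using e by (auto simp: measure_def intro!: enn2real_leI elim: order_le_less_trans)
      qed
      have N: "N \<in> fmeasurable lborel" unfolding N_def using A(1) Ak K by (intro fmeasurable.finite_UN) (auto simp: fmeasurable_def)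
      have "measure lborel N \<le> (\<Sum>k\<in>K. measure lborel (?A k n))" unfolding N_def using A(1) Ak K by (intro measure_UNION_le) auto
      also have "... \<le> real (card K) * (16 * e)" using Ak by (intro sum_bounded_above)
      finally have "measure lborel N \<le> measure lborel B / 2" using e by simp
      moreover have "measure lborel B \<le> measure lborel ((B - N) \<union> N)"
        using Bf N Bb by (intro measure_mono_fmeasurable fmeasurable.Un fmeasurable_Diff) (auto simp: fmeasurable_def)
      moreover have "measure lborel ((B - N) \<union> N) \<le> measure lborel (B - N) + measure lborel N" using N by (intro measure_Un_le) auto
      ultimately have half: "measure lborel B / 2 \<le> measure lborel (B - N)" by linarith
      have large: "\<exists>k\<in>K. \<bar>s k n w\<bar> \<ge> 1 / 4" if w: "w \<in> B - N" for w
      proof -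
        obtain k where k: "k \<in> K" "\<bar>g k w\<bar> \<ge> 1 / 2" using gB w by blast
        then have "\<bar>g k w - s k n w\<bar> < 1 / 4" using w Bh unfolding N_def by auto
        then have "\<bar>s k n w\<bar> \<ge> 1 / 4" using k(2) by arith
        then show ?thesis using k(1) by blast
      qed
      have "p \<le> jump_const * (measure lborel (B - N) * (4 * (2 * ?R)) powr -\<alpha>) - (8 * (measure lborel B * (4 * (2 * ?R)) powr -\<alpha>))\<^sup>2"
      proof -
        have "y / 2 = measure lborel B / 2 * r powr -\<alpha>" using r(2) by simp
        also have "... \<le> measure lborel (B - N) * r powr -\<alpha>" using half by (rule mult_right_mono) simp
        finally show ?thesis unfolding p_def using r(2) jc by simp
      qed
      also have "... \<le> prob {x\<in>space M. \<exists>k\<in>K. \<bar>?I k n x\<bar> > 2 * ?R}" by (rule simple_max_lower[OF K s(1) B]) (use r y large N in auto)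
      also have "... \<le> prob (?Z \<union> (\<Union>k\<in>K. ?D k n))"
      proof (intro finite_measure_mono sets.Un sets.finite_UN sets.sets_Collect_finite_Ex K)
        have "\<bar>a\<bar> > 2 * ?R ==> \<bar>b\<bar> > ?R \<or> \<bar>a - b\<bar> > ?R" for a b :: real by arith
        then show "{x\<in>space M. \<exists>k\<in>K. \<bar>?I k n x\<bar> > 2 * ?R} \<subseteq> ?Z \<union> (\<Union>k\<in>K. ?D k n)" by blast
      qed measurable
      also have "... \<le> prob ?Z + prob (\<Union>k\<in>K. ?D k n)" by (intro measure_Un_le sets.finite_UN sets.sets_Collect_finite_Ex K) measurable
      also have "prob (\<Union>k\<in>K. ?D k n) \<le> (\<Sum>k\<in>K. prob (?D k n))"
        by (intro finite_measure_subadditive_finite K) (use mI in \<open>auto intro!: sets.sets_Collect\<close>)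
      finally show ?case by simp
    qed
    have "(\<lambda>n. prob (?D k n)) \<longlonglongrightarrow> 0" if "k \<in> K" for k
      using has_stoch_integral_approx[OF stoch_integral_works s(1)[OF that] s(2)[OF that]] g that r(1) unfolding tends_in_prob_def by (auto elim!: allE[of _ ?R])
    then have "(\<lambda>n. prob ?Z + (\<Sum>k\<in>K. prob (?D k n))) \<longlonglongrightarrow>
      prob ?Z + (\<Sum>k\<in>K. 0)" by (intro tendsto_add tendsto_const tendsto_sum)
    from tendsto_lowerbound[OF this ev] show ?thesis by simp
  qed
  then show ?thesis using p r by (intro exI[of _ "r / 8"] allI impI) auto
qed

end

section \<open>High dimensions\<close>

lemma lborel_integral_shift:
  fixes f :: "'a::euclidean_space => real"
  assumes [measurable]: "f \<in> borel_measurable borel"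
  shows "(LBINT z. f (c + z)) = (LBINT z. f z)"
proof -
  have "(LBINT z. f z) = (\<integral>z. f z \<partial>(distr lborel borel ((+) c)))" by (simp only: lborel_distr_plus)
  also have "... = (LBINT z. f (c + z))" by (rule integral_distr) auto
  finally show ?thesis by simp
qed

lemma random_field_measurable:
  assumes "(\<lambda>(z, x). Y z x) \<in> borel_measurable (borel \<Otimes>\<^sub>M M)"
  shows "(\<lambda>(x, z). Y z x) \<in> borel_measurable (M \<Otimes>\<^sub>M lborel)"
proof -
  have "(\<lambda>(z, x). Y z x) \<circ> (\<lambda>(x, z). (z, x)) \<in> borel_measurable (M \<Otimes>\<^sub>M borel)" by (rule measurable_comp[OF measurable_pair_swap' assms])
  also have "(\<lambda>(z, x). Y z x) \<circ> (\<lambda>(x, z). (z, x)) = (\<lambda>(x, z). Y z x)" by auto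
  also have "borel_measurable (M \<Otimes>\<^sub>M borel) = borel_measurable (M \<Otimes>\<^sub>M lborel)" by auto
  finally show ?thesis .
qed

text \<open>The excess of |Y| over the level \<open>m\<close>. The pairing of Y with a source
  bounded by C is split at this level, into C times the excess and m times the L^1 norm of the
  source. This bound is the same for all translates that stay in the ball, so that one random
  variable controls them all.\<close>

definition tail_integral :: "('a::euclidean_space => 'w => real) => real => nat => 'w => real" where
  "tail_integral Y r m x = (LBINT z. indicator (cball 0 r) z * max 0 (\<bar>Y z x\<bar> - real m))"

lemma tail_integral_measurable:
  fixes Y :: "'a::euclidean_space => 'b => real"
  assumes "(\<lambda>(z, y). Y z y) \<in> borel_measurable (borel \<Otimes>\<^sub>M M)"
  shows "tail_integral Y r m \<in> borel_measurable M"
proof -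
  have [measurable]: "(\<lambda>x. Y (snd x) (fst x)) \<in> borel_measurable (M \<Otimes>\<^sub>M lborel)" using random_field_measurable[OF assms] by simp
  have [measurable]: "cball 0 r \<in> sets lborel" by simp
  show ?thesis unfolding tail_integral_def by simp
qed

lemma locally_integrable_abs_cball:
  assumes "locally_integrable f" shows "integrable lborel (\<lambda>z. indicator (cball 0 r) z * \<bar>f z\<bar>)"
proof -
  have "set_integrable lborel (cball 0 r) f" using assms unfolding locally_integrable_def by auto
  then have "set_integrable lborel (cball 0 r) (\<lambda>z. \<bar>f z\<bar>)" by (rule set_integrable_abs)
  then show ?thesis unfolding set_integrable_def by simp
qed

lemma tail_integral_tendsto:
  fixes Y :: "'a::euclidean_space => 'w => real"
  assumes f: "locally_integrable (\<lambda>z. Y z x)"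
  shows "(\<lambda>m. tail_integral Y r m x) \<longlonglongrightarrow> 0"
proof -
  have [measurable]: "(\<lambda>z. Y z x) \<in> borel_measurable borel" "cball 0 r \<in> sets borel" using f unfolding locally_integrable_def by auto
  have "(\<lambda>m. tail_integral Y r m x) \<longlonglongrightarrow> integral\<^sup>L lborel (\<lambda>z::'a. 0::real)" unfolding tail_integral_def
  proof (rule integral_dominated_convergence[OF _ _ locally_integrable_abs_cball[OF f]])
    show "AE z in lborel. (\<lambda>m. indicator (cball 0 r) z * max 0 (\<bar>Y z x\<bar> - real m)) \<longlonglongrightarrow> 0"
    proof (intro AE_I2)
      fix z
      obtain N :: nat where N: "\<bar>Y z x\<bar> \<le> real N" using real_arch_simple by blast
      have "\<forall>\<^sub>F m in sequentially. indicator (cball 0 r) z * max 0 (\<bar>Y z x\<bar> - real m) = 0"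
        using eventually_ge_at_top[of N] by eventually_elim (use N in \<open>auto simp: max_def\<close>)
      then show "(\<lambda>m. indicator (cball 0 r) z * max 0 (\<bar>Y z x\<bar> - real m)) \<longlonglongrightarrow> 0" by (rule tendsto_eventually)
    qed
  qed (auto simp: indicator_def)
  then show ?thesis by simp
qed

lemma integral_tail_bound:
  assumes f: "locally_integrable (\<lambda>z. Y z x)" and [measurable]: "g \<in> borel_measurable borel"
    and C: "\<And>z. \<bar>g z\<bar> \<le> C * indicator (cball 0 r) z" and i: "integrable lborel g"
  shows "\<bar>LBINT z. Y z x * g z\<bar> \<le> C * tail_integral Y r m x + real m * (LBINT z. \<bar>g z\<bar>)"
proof -
  let ?T = "\<lambda>z. indicator (cball 0 r) z * max 0 (\<bar>Y z x\<bar> - real m)"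
  have [measurable]: "(\<lambda>z. Y z x) \<in> borel_measurable borel" using f unfolding locally_integrable_def by blast
  have it: "integrable lborel ?T"
    by (rule Bochner_Integration.integrable_bound[OF locally_integrable_abs_cball[OF f, of r]]) (auto simp: indicator_def)
  have "\<bar>LBINT z. Y z x * g z\<bar> \<le> (LBINT z. \<bar>Y z x * g z\<bar>)" by simp
  also have "... \<le> (LBINT z. C * ?T z + real m * \<bar>g z\<bar>)"
  proof (rule integral_mono')
    show "integrable lborel (\<lambda>z. C * ?T z + real m * \<bar>g z\<bar>)" using it i by simp
    fix z
    have "\<bar>Y z x * g z\<bar> \<le> (max 0 (\<bar>Y z x\<bar> - real m) + real m) * \<bar>g z\<bar>" unfolding abs_mult by (intro mult_right_mono) auto
    also have "... \<le> C * ?T z + real m * \<bar>g z\<bar>" using mult_left_mono[OF C[of z], of "max 0 (\<bar>Y z x\<bar> - real m)"] by (simp add: algebra_simps)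
    finally show "\<bar>Y z x * g z\<bar> \<le> C * ?T z + real m * \<bar>g z\<bar>" .
    then show "0 \<le> C * ?T z + real m * \<bar>g z\<bar>" by force
  qed
  also have "... = C * tail_integral Y r m x + real m * (LBINT z. \<bar>g z\<bar>)" unfolding tail_integral_def using it i by simp
  finally show ?thesis .
qed

context stable_noise begin

theorem no_random_field_high_dim:
  fixes \<rho> :: "(real \<times> (real^'n) => real) => real"
  assumes n: "CARD('n) \<ge> 3" and \<rho>: "wave_fundamental_solution \<rho>"
  shows "\<not> random_field_representation M (u_gen M \<alpha> W \<rho>) Y"
proof
  assume Y: "random_field_representation M (u_gen M \<alpha> W \<rho>) Y"
  then have Ym: "(\<lambda>(z, x). Y z x) \<in> borel_measurable (borel \<Otimes>\<^sub>M M)"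
    and Yl: "AE x in M. locally_integrable (\<lambda>z. Y z x)"
    and Yr: "\<And>f. f \<in> test_functions ==> AE x in M. u_gen M \<alpha> W \<rho> f x = (LBINT z. Y z x * f z)" unfolding random_field_representation_def by auto
  obtain f w :: "nat => real \<times> (real^'n) => real" and C where
    f: "\<And>n. f n \<in> test_functions" "C \<ge> 0" "\<And>n z. \<bar>f n z\<bar> \<le> C * indicator (cball 0 11) z"
    "AE z in lborel. (\<lambda>n. f n z) \<longlonglongrightarrow> 0"
    and w: "\<And>n. continuous_on UNIV (w n)" "\<And>n. w n 0 = 1"
    "\<And>\<rho> n z. wave_fundamental_solution \<rho> ==> norm z \<le> 1 ==> conv_check (f n) \<rho> z = w n z" by (rule focusing_sources[OF n], rule that; assumption)
  define B :: "(real \<times> (real^'n)) set" where "B = cball (2, 0) 1"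
  have Bh: "B \<subseteq> half_space"
  proof
    fix z assume "z \<in> B"
    then have "norm (fst (2, 0) - fst z, snd (2, 0) - snd z) \<le> 1" unfolding B_def by (simp add: dist_norm minus_prod_def)
    then have "norm (2 - fst z) \<le> 1" using norm_fst_le[of "2 - fst z" "0 - snd z"] by simp
    then show "z \<in> half_space" unfolding half_space_def by (cases z) auto
  qed
  have B: "B \<in> finite_borel" by (intro finite_borelI) (use Bh emeasure_compact_finite[of "cball (2, 0::real^'n) 1"] in \<open>auto simp: B_def\<close>)
  have mB: "measure lborel B > 0" unfolding B_def by simp
  have nB: "norm z \<le> 3" if "z \<in> B" for z
  proof -
    have "norm z \<le> norm ((2, 0) :: real \<times> (real^'n)) + norm (z - (2, 0))" using norm_triangle_ineq[of "(2, 0)" "z - (2, 0)"] by simp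
    also have "norm (z - (2, 0)) \<le> 1" using that unfolding B_def by (simp add: dist_norm norm_minus_commute)
    finally show ?thesis by simp
  qed
  from stoch_integral_max_lower[OF B mB, where 'k="real \<times> (real^'n)"]
  obtain R p where low: "\<forall>(K :: (real \<times> (real^'n)) set) g. finite K --> (\<forall>k\<in>K. g k \<in> L_space \<alpha>) -->
      (\<forall>w\<in>B. \<exists>k\<in>K. \<bar>g k w\<bar> \<ge> 1 / 2) --> p \<le> prob {x\<in>space M. \<exists>k\<in>K. \<bar>stoch_integral M \<alpha> W (g k) x\<bar> > R}" and R: "R > 0" "p > 0" by auto
  \<comment> \<open>14 = 11 + 3, the radius of the sources plus a bound for the norms of the points
    of \<open>B\<close> to which they are translated.\<close>
  let ?E = "\<lambda>m. {x\<in>space M. \<bar>C * tail_integral Y 14 m x\<bar> > R / 2}"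
  have Tm[measurable]: "tail_integral Y 14 m \<in> borel_measurable M" for m by (rule tail_integral_measurable[OF Ym])
  have "tends_in_prob (\<lambda>m x. C * tail_integral Y 14 m x) (\<lambda>_. 0)"
  proof (rule AE_tends_in_prob)
    show "AE x in M. (\<lambda>m. C * tail_integral Y 14 m x) \<longlonglongrightarrow> 0" using Yl
    proof eventually_elim
      case (elim x)
      have "(\<lambda>m. C * tail_integral Y 14 m x) \<longlonglongrightarrow> C * 0" by (intro tendsto_intros tail_integral_tendsto elim)
      then show ?case by simp
    qed
  qed auto
  from this[unfolded tends_in_prob_def, rule_format, of "R / 2"]
  have "(\<lambda>m. prob (?E m)) \<longlonglongrightarrow> 0" using R by simp
  then have "\<forall>\<^sub>F m in sequentially. prob (?E m) < p" by (rule order_tendstoD(2)) (rule R)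
  \<comment> \<open>The order of the choices: \<open>m\<close> depends on Y, the source
    \<open>n\<close> on \<open>m\<close>, and the finite set \<open>K\<close> of translations on
    \<open>n\<close>. \<open>R\<close> and \<open>p\<close> are already fixed.\<close>
  then obtain m where m: "prob (?E m) < p" by force
  have "(\<lambda>n. real m * (LBINT z. \<bar>1 * f n z\<bar>)) \<longlonglongrightarrow> real m * 0"
    by (intro tendsto_intros L1_norm_tendsto_0[OF locally_integrable_const test_functions_borel[OF f(1)] f(3,4)])
  then have "\<forall>\<^sub>F n in sequentially. real m * (LBINT z. \<bar>1 * f n z\<bar>) < R / 2" by (rule order_tendstoD(2)) (use R in simp)
  then obtain n where n: "real m * (LBINT z. \<bar>f n z\<bar>) < R / 2" by force
  have "isCont (w n) 0" using w(1)[of n] continuous_on_eq_continuous_at[OF open_UNIV, of "w n"] by blast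
  from this[unfolded continuous_at_eps_delta, rule_format, of "1 / 2"]
  obtain d where d0: "d > 0" "\<forall>z. norm (z - 0) < d --> dist (w n z) (w n 0) < 1 / 2" by auto
  have d: "d > 0" "norm z < d ==> \<bar>w n z - 1\<bar> < 1 / 2" for z using d0(1) d0(2)[rule_format, of z] w(2)[of n] by (simp_all add: dist_real_def)
  have cov: "B \<subseteq> (\<Union>c\<in>B. ball c (min d 1))" using d by auto
  have "compact B" unfolding B_def by simp
  then obtain K where K: "K \<subseteq> B" "finite K" "B \<subseteq> (\<Union>c\<in>K. ball c (min d 1))" using compactE_image[of B B "\<lambda>c. ball c (min d 1)"] cov by auto
  define h where "h c z = f n (- c + z)" for c z
  have ht: "h c \<in> test_functions" for c unfolding h_def by (intro test_functions_shift f)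
  define g where "g c = conv_check (h c) \<rho>" for c
  have g: "g c \<in> L_space \<alpha>" for c using wave_generalized_solution_exists[OF \<rho> \<alpha>(1)] ht unfolding g_def generalized_solution_exists_def by blast
  have gB: "\<exists>c\<in>K. \<bar>g c z\<bar> \<ge> 1 / 2" if z: "z \<in> B" for z
  proof -
    obtain c where c: "c \<in> K" "norm (- c + z) < min d 1" using K(3) z by (auto simp: dist_norm norm_minus_commute)
    have "g c z = conv_check (f n) \<rho> (- c + z)" unfolding g_def h_def conv_check_def by (simp only: add.assoc)
    also have "... = w n (- c + z)" using c(2) by (intro w(3)[OF \<rho>]) auto
    finally have "\<bar>g c z - 1\<bar> < 1 / 2" using d(2) c(2) by simp
    then have "\<bar>g c z\<bar> \<ge> 1 / 2" by arith
    then show ?thesis using c(1) by blast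
  qed
  have "p \<le> prob {x\<in>space M. \<exists>c\<in>K. \<bar>stoch_integral M \<alpha> W (g c) x\<bar> > R}" using low[rule_format, OF K(2)] g gB by blast
  also have "... \<le> prob (?E m)"
  proof (rule finite_measure_mono_AE)
    have "AE x in M. \<forall>c\<in>K. u_gen M \<alpha> W \<rho> (h c) x = (LBINT z. Y z x * h c z)" by (intro AE_finite_allI K Yr ht)
    then show "AE x in M. x \<in> {x\<in>space M. \<exists>c\<in>K. \<bar>stoch_integral M \<alpha> W (g c) x\<bar> > R} --> x \<in> ?E m" using Yl
    proof eventually_elim
      case (elim x)
      have "\<bar>C * tail_integral Y 14 m x\<bar> > R / 2" if c: "c \<in> K" "\<bar>stoch_integral M \<alpha> W (g c) x\<bar> > R" for c
      proof -
        have "stoch_integral M \<alpha> W (g c) x = (LBINT z. Y z x * h c z)" using elim(1) c(1) unfolding u_gen_def g_def by blast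
        also have "\<bar>...\<bar> \<le> C * tail_integral Y 14 m x + real m * (LBINT z. \<bar>h c z\<bar>)"
        proof (rule integral_tail_bound[where Y=Y and x=x and g="h c", OF elim(2) test_functions_borel[OF ht] _ test_functions_integrable[OF ht]])
          fix z
          have "norm z \<le> 14" if "norm (- c + z) \<le> 11" using norm_triangle_ineq[of c "- c + z"] nB[of c] K(1) c(1) that by auto
          then have "C * indicator (cball 0 11) (- c + z) \<le> C * indicator (cball 0 14) z" using f(2) by (auto simp: indicator_def)
          then show "\<bar>h c z\<bar> \<le> C * indicator (cball 0 14) z" using f(3)[of n "- c + z"] unfolding h_def by simp
        qed
        also have "(LBINT z. \<bar>h c z\<bar>) = (LBINT z. \<bar>f n z\<bar>)"
          unfolding h_def by (rule lborel_integral_shift) (use test_functions_borel[OF f(1)] in measurable)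
        finally show ?thesis using c(2) n by simp
      qed
      then show ?case by blast
    qed
  qed auto
  finally show False using m by simp
qed

end

section \<open>The fundamental solution in dimensions one and two\<close>

lemma borel_measurable_fst_real [measurable]: "(\<lambda>z::real \<times> (real^'n). fst z) \<in> borel_measurable borel"
  and borel_measurable_norm_snd [measurable]: "(\<lambda>z::real \<times> (real^'n). norm (snd z)) \<in> borel_measurable borel"
  by (intro borel_measurable_continuous_onI continuous_intros)+

text \<open>Polar coordinates for radial functions without a surface measure: in the variable s =
  |x|^d the ball s \<le> a has a volume linear in a.\<close>

lemma distr_norm_power:
  "distr lborel borel (\<lambda>x::real^'n. norm x ^ CARD('n))
    = density lborel (\<lambda>s. ennreal (unit_ball_vol (real CARD('n))) * indicator {0..} s)"
proof (rule measure_eqI_generator_eq[where E="range (\<lambda>a::real. {..a})" and \<Omega>=UNIV and A="\<lambda>n. {..real n}"])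
  let ?v = "unit_ball_vol (real CARD('n))"
  have 1: "emeasure (distr lborel borel (\<lambda>x::real^'n. norm x ^ CARD('n))) {..a} = ennreal (?v * max 0 a)" for a
  proof (cases "a < 0")
    case True
    then have "(\<lambda>x::real^'n. norm x ^ CARD('n)) -` {..a} \<inter> space lborel = {}" by auto (smt (verit) norm_ge_zero zero_le_power)
    then show ?thesis using True by (simp add: emeasure_distr)
  next
    case False
    define r where "r = root CARD('n) a"
    have r: "r \<ge> 0" "r ^ CARD('n) = a" using False unfolding r_def by auto
    have "norm x ^ CARD('n) \<le> a \<longleftrightarrow> norm x \<le> r" for x :: "real^'n" unfolding r(2)[symmetric] using r(1) by simp
    then have "(\<lambda>x::real^'n. norm x ^ CARD('n)) -` {..a} \<inter> space lborel = cball 0 r" by auto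
    then have "emeasure (distr lborel borel (\<lambda>x::real^'n. norm x ^ CARD('n))) {..a} = emeasure lborel (cball (0::real^'n) r)"
      by (simp add: emeasure_distr)
    also have "... = ennreal (?v * r ^ CARD('n))" using emeasure_cball[OF r(1), of "0::real^'n"] by simp
    finally show ?thesis using False r(2) by simp
  qed
  have 2: "emeasure (density lborel (\<lambda>s. ennreal ?v * indicator {0..} s)) {..a} = ennreal (?v * max 0 a)" for a
  proof -
    have "emeasure (density lborel (\<lambda>s. ennreal ?v * indicator {0..} s)) {..a} = (\<integral>\<^sup>+ s. ennreal ?v * indicator {0..a} s \<partial>lborel)"
      by (subst emeasure_density) (auto intro!: nn_integral_cong simp: indicator_def)
    also have "... = ennreal ?v * emeasure lborel {0..a}" by (subst nn_integral_cmult_indicator) auto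
    also have "... = ennreal (?v * max 0 a)" by (cases "0 \<le> a") (auto simp: ennreal_mult)
    finally show ?thesis .
  qed
  show "Int_stable (range (\<lambda>a::real. {..a}))" by (auto simp: Int_stable_def)
  show "emeasure (distr lborel borel (\<lambda>x::real^'n. norm x ^ CARD('n))) X = emeasure (density lborel (\<lambda>s. ennreal ?v * indicator {0..} s)) X"
    if "X \<in> range (\<lambda>a::real. {..a})" for X using that 1 2 by auto
  show "emeasure (distr lborel borel (\<lambda>x::real^'n. norm x ^ CARD('n))) {..real n} \<noteq> \<infinity>" for n unfolding 1 by simp
  show "(\<Union>n. {..real n}) = (UNIV :: real set)" using real_arch_simple by auto
qed (auto simp: borel_eq_atMost)

lemma nn_integral_norm_power:
  assumes [measurable]: "g \<in> borel_measurable borel"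
  shows "(\<integral>\<^sup>+ x. g (norm (x::real^'n) ^ CARD('n)) \<partial>lborel) = ennreal (unit_ball_vol (real CARD('n))) * (\<integral>\<^sup>+ s. g s * indicator {0..} s \<partial>lborel)"
proof -
  have "(\<integral>\<^sup>+ x. g (norm (x::real^'n) ^ CARD('n)) \<partial>lborel) = (\<integral>\<^sup>+ s. g s \<partial>distr lborel borel (\<lambda>x::real^'n. norm x ^ CARD('n)))"
    by (subst nn_integral_distr) auto
  also have "... = (\<integral>\<^sup>+ s. (ennreal (unit_ball_vol (real CARD('n))) * indicator {0..} s) * g s \<partial>lborel)"
    unfolding distr_norm_power by (subst nn_integral_density) auto
  also have "... = (\<integral>\<^sup>+ s. ennreal (unit_ball_vol (real CARD('n))) * (g s * indicator {0..} s) \<partial>lborel)" by (simp add: mult_ac)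
  also have "... = ennreal (unit_ball_vol (real CARD('n))) * (\<integral>\<^sup>+ s. g s * indicator {0..} s \<partial>lborel)" by (subst nn_integral_cmult) auto
  finally show ?thesis .
qed

lemma nn_integral_abs_powr:
  assumes b: "b < 1" and c: "c \<ge> 0"
  shows "(\<integral>\<^sup>+ u. ennreal (\<bar>u::real\<bar> powr -b) * indicator {-c..c} u \<partial>lborel) \<le> ennreal (2 * (c powr (1 - b) / (1 - b)))"
proof -
  let ?I = "\<integral>\<^sup>+ u. ennreal (u powr -b) * indicator {0..c} u \<partial>lborel" and ?J = "\<integral>\<^sup>+ u. ennreal ((-u) powr -b) * indicator {0..c} (-u) \<partial>lborel"
  have h: "?I = ennreal (c powr (1 - b) / (1 - b))"
  proof -
    have "((\<lambda>x. x powr -b) has_integral (c powr (-b + 1) / (-b + 1))) {0..c}" by (rule has_integral_powr_from_0) (use b c in auto)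
    then have "((\<lambda>x. if x \<in> {0..c} then x powr -b else 0) has_integral (c powr (1 - b) / (1 - b))) UNIV" by (subst has_integral_restrict_UNIV) simp
    then have "(\<integral>\<^sup>+ u. ennreal (if u \<in> {0..c} then u powr -b else 0) \<partial>lborel) = ennreal (c powr (1 - b) / (1 - b))"
      by (intro nn_integral_has_integral_lborel) auto
    also have "(\<integral>\<^sup>+ u. ennreal (if u \<in> {0..c} then u powr -b else 0) \<partial>lborel) = ?I" by (intro nn_integral_cong) auto
    finally show ?thesis .
  qed
  have "(\<integral>\<^sup>+ u. ennreal (\<bar>u::real\<bar> powr -b) * indicator {-c..c} u \<partial>lborel)
     \<le> (\<integral>\<^sup>+ u. ennreal (u powr -b) * indicator {0..c} u + ennreal ((-u) powr -b) * indicator {0..c} (-u) \<partial>lborel)"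
    by (intro nn_integral_mono) (auto simp: indicator_def)
  also have "... = ?I + ?J" by (rule nn_integral_add) auto
  also have "?J = ?I"
  proof -
    have "?I = (\<integral>\<^sup>+ u. ennreal (u powr -b) * indicator {0..c} u \<partial>(distr lborel borel uminus))" by (simp only: lborel_distr_uminus)
    also have "... = ?J" by (rule nn_integral_distr) auto
    finally show ?thesis by simp
  qed
  also have "?I + ?I
     = ennreal (2 * (c powr (1 - b) / (1 - b)))" unfolding h using b by (subst ennreal_plus[symmetric]) auto
  finally show ?thesis .
qed

text \<open>In dimension 2, with s = |x|^2, the inner integral is that of |t^2 - s|^(-b) over a
  bounded interval, finite because b < 1. With b = p / 2 this gives the range p < 2 of exponents for
  the kernel.\<close>

lemma light_cone_power_integrable:
  assumes n: "CARD('n) = 2" and b: "b < 1"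
  shows "(\<integral>\<^sup>+ z. ennreal (\<bar>(fst z)\<^sup>2 - (norm (snd z))\<^sup>2\<bar> powr -b) * indicator (cball 0 R) z \<partial>(lborel :: (real \<times> (real^'n)) measure)) < \<infinity>"
proof -
  define c where "c = R\<^sup>2"
  have c: "c \<ge> 0" unfolding c_def by simp
  define C where "C = ennreal pi * ennreal (2 * (c powr (1 - b) / (1 - b)))"
  have inner: "(\<integral>\<^sup>+ x. ennreal (\<bar>t\<^sup>2 - (norm (x::real^'n))\<^sup>2\<bar> powr -b) * indicator (cball 0 R) (t, x) \<partial>lborel) \<le> C * indicator {-\<bar>R\<bar>..\<bar>R\<bar>} t" for t
  proof (cases "\<bar>t\<bar> \<le> \<bar>R\<bar>")
    case True
    have t2: "t\<^sup>2 \<le> c" unfolding c_def using True abs_le_square_iff by blast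
    let ?g = "\<lambda>s. ennreal (\<bar>t\<^sup>2 - s\<bar> powr -b) * indicator {..c} s"
    have "(\<integral>\<^sup>+ s. ?g s * indicator {0..} s \<partial>lborel) \<le> (\<integral>\<^sup>+ s. ennreal (\<bar>- t\<^sup>2 + s\<bar> powr -b) * indicator {-c..c} (- t\<^sup>2 + s) \<partial>lborel)"
    proof (intro nn_integral_mono)
      fix s
      have "?g s * indicator {0..} s \<le> ennreal (\<bar>- q + s\<bar> powr -b) * indicator {-c..c} (- q + s)" if "q = t\<^sup>2" "0 \<le> q" "q \<le> c" for q
        unfolding that(1)[symmetric] using that(2,3) c by (auto simp: indicator_def abs_minus_commute)
      then show "?g s * indicator {0..} s \<le> ennreal (\<bar>- t\<^sup>2 + s\<bar> powr -b) * indicator {-c..c} (- t\<^sup>2 + s)" using t2 by simp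
    qed
    also have "... = (\<integral>\<^sup>+ u. ennreal (\<bar>u\<bar> powr -b) * indicator {-c..c} u \<partial>(distr lborel borel ((+) (- t\<^sup>2))))"
      by (rule nn_integral_distr[symmetric]) auto
    also have "... = (\<integral>\<^sup>+ u. ennreal (\<bar>u\<bar> powr -b) * indicator {-c..c} u \<partial>lborel)" by (simp only: lborel_distr_plus)
    also have "... \<le> ennreal (2 * (c powr (1 - b) / (1 - b)))" by (rule nn_integral_abs_powr[OF b c])
    finally have J: "(\<integral>\<^sup>+ s. ?g s * indicator {0..} s \<partial>lborel) \<le> ennreal (2 * (c powr (1 - b) / (1 - b)))" .
    have "(\<integral>\<^sup>+ x. ennreal (\<bar>t\<^sup>2 - (norm (x::real^'n))\<^sup>2\<bar> powr -b) * indicator (cball 0 R) (t, x) \<partial>lborel) \<le> (\<integral>\<^sup>+ x. ?g (norm (x::real^'n) ^ CARD('n)) \<partial>lborel)"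
    proof (intro nn_integral_mono)
      fix x :: "real^'n"
      have "(norm x)\<^sup>2 \<le> c" if "norm (t, x) \<le> R" unfolding c_def using that norm_snd_le[of x t] by (intro power_mono) auto
      then show "ennreal (\<bar>t\<^sup>2 - (norm x)\<^sup>2\<bar> powr -b) * indicator (cball 0 R) (t, x) \<le> ?g (norm x ^ CARD('n))"
        unfolding n by (auto simp: indicator_def)
    qed
    also have "... = ennreal pi * (\<integral>\<^sup>+ s. ?g s * indicator {0..} s \<partial>lborel)" by (subst nn_integral_norm_power) (auto simp: n unit_ball_vol_2)
    also have "... \<le> C" unfolding C_def by (rule mult_left_mono[OF J]) simp
    finally show ?thesis using True by (simp add: abs_le_iff)
  next
    case False
    have "\<bar>t\<bar> \<le> \<bar>R\<bar>" if "norm (t, x) \<le> R" for x :: "real^'n" using that norm_fst_le[of t x] by simp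
    then have "(\<integral>\<^sup>+ x. ennreal (\<bar>t\<^sup>2 - (norm (x::real^'n))\<^sup>2\<bar> powr -b) * indicator (cball 0 R) (t, x) \<partial>lborel) = integral\<^sup>N lborel (\<lambda>x::real^'n. 0)"
      using False by force
    then show ?thesis by simp
  qed
  have [measurable]: "(\<lambda>z::real \<times> (real^'n). indicator (cball 0 R) z :: ennreal) \<in> borel_measurable borel" by (rule borel_measurable_indicator) simp
  have m: "(\<lambda>z::real \<times> (real^'n). ennreal (\<bar>(fst z)\<^sup>2 - (norm (snd z))\<^sup>2\<bar> powr -b) * indicator (cball 0 R) z) \<in> borel_measurable (lborel \<Otimes>\<^sub>M lborel)"
    unfolding lborel_prod by simp
  have "(\<integral>\<^sup>+ z. ennreal (\<bar>(fst z)\<^sup>2 - (norm (snd z))\<^sup>2\<bar> powr -b) * indicator (cball 0 R) z \<partial>(lborel :: (real \<times> (real^'n)) measure))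
    = (\<integral>\<^sup>+ t. \<integral>\<^sup>+ x. ennreal (\<bar>t\<^sup>2 - (norm (x::real^'n))\<^sup>2\<bar> powr -b) * indicator (cball 0 R) (t, x) \<partial>lborel \<partial>lborel)"
    using lborel.nn_integral_fst[OF m] unfolding lborel_prod by simp
  also have "... \<le> (\<integral>\<^sup>+ t. C * indicator {-\<bar>R\<bar>..\<bar>R\<bar>} t \<partial>lborel)" by (intro nn_integral_mono inner)
  also have "... = C * ennreal (2 * \<bar>R\<bar>)" by (subst nn_integral_cmult_indicator) auto
  also have "... < \<infinity>" unfolding C_def by (simp add: ennreal_mult_less_top)
  finally show ?thesis .
qed

text \<open>The formulas for d = 1 and d = 2 in one; on the boundary of the cone, a null set, the
  value is 0 in both. For d \<ge> 3 the value is a dummy.\<close>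

definition wave_kernel :: "real \<times> (real^'n) => real" where
  "wave_kernel z = (if norm (snd z) < fst z
     then (if CARD('n) = 1 then 1 / 2 else 1 / (2 * pi * sqrt ((fst z)\<^sup>2 - (norm (snd z))\<^sup>2))) else 0)"

lemma wave_kernel_measurable [measurable]: "wave_kernel \<in> borel_measurable (borel :: (real \<times> (real^'n)) measure)" unfolding wave_kernel_def by simp

lemma wave_kernel_nonneg: "0 \<le> wave_kernel z" unfolding wave_kernel_def by (auto simp: power_mono)

lemma wave_kernel_outside: "\<not> norm (snd z) < fst z ==> wave_kernel z = 0" unfolding wave_kernel_def by simp

lemma wave_kernel_le:
  fixes z :: "real \<times> (real^'n)"
  assumes "CARD('n) = 2"
  shows "wave_kernel z \<le> \<bar>(fst z)\<^sup>2 - (norm (snd z))\<^sup>2\<bar> powr - (1 / 2)"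
proof (cases "norm (snd z) < fst z")
  case True
  then have q: "(fst z)\<^sup>2 - (norm (snd z))\<^sup>2 > 0" by (simp add: power_strict_mono)
  have "1 / (2 * pi) \<le> 1" using pi_ge_two by simp
  then have "1 / (2 * pi) * (1 / sqrt ((fst z)\<^sup>2 - (norm (snd z))\<^sup>2)) \<le> 1 * (1 / sqrt ((fst z)\<^sup>2 - (norm (snd z))\<^sup>2))"
    using q by (intro mult_right_mono) auto
  moreover have "((fst z)\<^sup>2 - (norm (snd z))\<^sup>2) powr - (1 / 2) = 1 / sqrt ((fst z)\<^sup>2 - (norm (snd z))\<^sup>2)"
    using q by (simp add: powr_minus_divide powr_half_sqrt)
  ultimately show ?thesis using q assms unfolding wave_kernel_def by simp
qed (simp add: wave_kernel_outside)

lemma wave_kernel_power_integrable: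
  fixes R :: real
  assumes n: "CARD('n) \<le> 2" and p: "0 < p" "p < 2"
  shows "(\<integral>\<^sup>+ z. ennreal (wave_kernel z powr p) * indicator (cball 0 R) z \<partial>(lborel :: (real \<times> (real^'n)) measure)) < \<infinity>"
proof -
  have "CARD('n) = 1 \<or> CARD('n) = 2" using n by (metis One_nat_def Suc_1 Suc_leI le_SucE le_antisym zero_less_card_finite)
  then show ?thesis
  proof
    assume n1: "CARD('n) = 1"
    have "(\<integral>\<^sup>+ z. ennreal (wave_kernel z powr p) * indicator (cball 0 R) z \<partial>(lborel :: (real \<times> (real^'n)) measure))
      \<le> (\<integral>\<^sup>+ z. 1 * indicator (cball 0 R) z \<partial>(lborel :: (real \<times> (real^'n)) measure))"
    proof (intro nn_integral_mono mult_right_mono)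
      fix z :: "real \<times> (real^'n)"
      have "wave_kernel z powr p \<le> 1" using p by (intro powr_le1) (auto simp: wave_kernel_def n1)
      then show "ennreal (wave_kernel z powr p) \<le> 1" by simp
    qed auto
    also have "... < \<infinity>" using emeasure_compact_finite[of "cball 0 R"] by simp
    finally show ?thesis .
  next
    assume n2: "CARD('n) = 2"
    have "(\<integral>\<^sup>+ z. ennreal (wave_kernel z powr p) * indicator (cball 0 R) z \<partial>(lborel :: (real \<times> (real^'n)) measure))
      \<le> (\<integral>\<^sup>+ z. ennreal (\<bar>(fst z)\<^sup>2 - (norm (snd z))\<^sup>2\<bar> powr - (p / 2)) * indicator (cball 0 R) z \<partial>(lborel :: (real \<times> (real^'n)) measure))"
    proof (intro nn_integral_mono mult_right_mono ennreal_leI)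
      fix z :: "real \<times> (real^'n)"
      have "wave_kernel z powr p \<le> (\<bar>(fst z)\<^sup>2 - (norm (snd z))\<^sup>2\<bar> powr - (1 / 2)) powr p"
        using p by (intro powr_mono2 wave_kernel_le[OF n2] wave_kernel_nonneg) auto
      then show "wave_kernel z powr p \<le> \<bar>(fst z)\<^sup>2 - (norm (snd z))\<^sup>2\<bar> powr - (p / 2)" by (simp add: powr_powr)
    qed auto
    also have "... < \<infinity>" by (rule light_cone_power_integrable[OF n2]) (use p in simp)
    finally show ?thesis .
  qed
qed

lemma wave_kernel_integrable_cball:
  assumes n: "CARD('n) \<le> 2"
  shows "integrable lborel (\<lambda>z::real \<times> (real^'n). indicator (cball 0 R) z * wave_kernel z)"
proof (rule integrableI_bounded)
  show "(\<lambda>z::real \<times> (real^'n). indicator (cball 0 R) z * wave_kernel z) \<in> borel_measurable lborel"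
    by (intro borel_measurable_times borel_measurable_indicator) auto
  have "(\<integral>\<^sup>+ z. ennreal (norm (indicator (cball 0 R) z * wave_kernel z)) \<partial>(lborel :: (real \<times> (real^'n)) measure))
    = (\<integral>\<^sup>+ z. ennreal (wave_kernel z powr 1) * indicator (cball 0 R) z \<partial>(lborel :: (real \<times> (real^'n)) measure))"
    by (intro nn_integral_cong) (auto simp: indicator_def)
  then show "(\<integral>\<^sup>+ z. ennreal (norm (indicator (cball 0 R) z * wave_kernel z)) \<partial>(lborel :: (real \<times> (real^'n)) measure)) < \<infinity>"
    using wave_kernel_power_integrable[OF n, of 1 R] by simp
qed

lemma wave_kernel_locally_integrable:
  assumes n: "CARD('n) \<le> 2"
  shows "locally_integrable (wave_kernel :: real \<times> (real^'n) => real)" unfolding locally_integrable_def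
proof (intro conjI allI impI)
  fix K :: "(real \<times> (real^'n)) set" assume K: "compact K"
  then obtain R where R: "\<And>z. z \<in> K ==> norm z \<le> R" using compact_imp_bounded bounded_iff by metis
  have [measurable]: "K \<in> sets borel" using K compact_imp_closed borel_closed by blast
  show "set_integrable lborel K (wave_kernel :: real \<times> (real^'n) => real)" unfolding set_integrable_def
    by (rule Bochner_Integration.integrable_bound[OF wave_kernel_integrable_cball[OF n, of R]])
      (use R wave_kernel_nonneg in \<open>auto simp: indicator_def\<close>)
qed measurable

section \<open>Integration by parts and Green's formula on the half space\<close>

lemma continuous_bounded_support_bounded:
  fixes F :: "'a::euclidean_space => real"
  assumes F: "continuous_on UNIV F" and R: "\<And>z. norm z > R ==> F z = 0"
  obtains B where "B \<ge> 0" "\<And>z. \<bar>F z\<bar> \<le> B"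
proof -
  have "compact (F ` cball 0 R)" by (intro compact_continuous_image continuous_on_subset[OF F]) auto
  then obtain B where B: "\<forall>y\<in>F ` cball 0 R. norm y \<le> B" using compact_imp_bounded bounded_iff by metis
  have "\<bar>F z\<bar> \<le> max 0 B" for z by (cases "norm z \<le> R") (use B R[of z] in \<open>auto simp: le_max_iff_disj\<close>)
  then show thesis using that[of "max 0 B"] by auto
qed

lemma continuous_bounded_support_integrable:
  fixes F :: "'a::euclidean_space => real"
  assumes F: "continuous_on UNIV F" and R: "\<And>z. norm z > R ==> F z = 0" and S: "S \<in> sets borel"
  shows "integrable lborel (\<lambda>z. indicator S z * F z)"
proof -
  obtain B where B: "B \<ge> 0" "\<And>z. \<bar>F z\<bar> \<le> B" by (rule continuous_bounded_support_bounded[OF F R]) auto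
  have [measurable]: "F \<in> borel_measurable borel" by (rule borel_measurable_continuous_onI[OF F])
  have "emeasure lborel (cball (0::'a) R) < \<infinity>" by (rule emeasure_compact_finite) simp
  then have "integrable lborel (\<lambda>z::'a. indicator (cball 0 R) z * B)" by simp
  then show ?thesis by (rule Bochner_Integration.integrable_bound) (use B S R in \<open>auto simp: indicator_def not_le\<close>)
qed

text \<open>Integration by parts along \<open>v\<close> on a set that is invariant in this
  direction: the difference quotients of \<open>F\<close> integrate to 0 by translation invariance,
  and they converge boundedly to \<open>F'\<close>.\<close>

lemma integral_line_derivative_zero:
  fixes F F' :: "'a::euclidean_space => real"
  assumes F: "continuous_on UNIV F" and F': "continuous_on UNIV F'"
    and R: "\<And>z. norm z > R ==> F z = 0" "\<And>z. norm z > R ==> F' z = 0"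
    and der: "\<And>z. ((\<lambda>h. F (z + h *\<^sub>R v)) has_real_derivative F' z) (at 0)"
    and S: "S \<in> sets borel" "\<And>z h. z + h *\<^sub>R v \<in> S \<longleftrightarrow> z \<in> S"
  shows "(LBINT z. indicator S z * F' z) = 0"
proof -
  have [measurable]: "F \<in> borel_measurable borel" "F' \<in> borel_measurable borel" "S \<in> sets borel"
    using F F' S by (auto intro: borel_measurable_continuous_onI)
  obtain B where B: "B \<ge> 0" "\<And>z. \<bar>F' z\<bar> \<le> B" by (rule continuous_bounded_support_bounded[OF F' R(2)]) auto
  have der': "((\<lambda>h. F (z + h *\<^sub>R v)) has_real_derivative F' (z + k *\<^sub>R v)) (at k)" for z k
    using DERIV_shift[of "\<lambda>h. F (z + h *\<^sub>R v)" "F' (z + k *\<^sub>R v)" 0 k] der[of "z + k *\<^sub>R v"] by (simp add: algebra_simps)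
  define q where "q n z = real (Suc n) * (F (z + inverse (real (Suc n)) *\<^sub>R v) - F z)" for n z
  have qb: "\<bar>q n z\<bar> \<le> B * indicator (cball 0 (R + norm v)) z" for n z
  proof -
    define h where "h = inverse (real (Suc n))"
    have h: "0 < h" "h \<le> 1" unfolding h_def by (auto simp: inverse_le_1_iff)
    have "\<exists>k. 0 < k \<and> k < h \<and> F (z + h *\<^sub>R v) - F (z + 0 *\<^sub>R v) = (h - 0) * F' (z + k *\<^sub>R v)" by (rule MVT2[OF h(1)]) (rule der')
    then obtain k where k: "0 < k" "k < h" "F (z + h *\<^sub>R v) - F z = h * F' (z + k *\<^sub>R v)" by auto
    have "q n z = F' (z + k *\<^sub>R v)" unfolding q_def h_def[symmetric] k(3) by (simp add: h_def)
    moreover have "F' (z + k *\<^sub>R v) = 0" if "norm z > R + norm v"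
    proof (rule R(2))
      have "norm (k *\<^sub>R v) \<le> norm v" using k h by (simp add: mult_left_le_one_le)
      then show "R < norm (z + k *\<^sub>R v)" using that norm_triangle_ineq4[of "z + k *\<^sub>R v" "k *\<^sub>R v"] by simp
    qed
    ultimately show ?thesis using B(2)[of "z + k *\<^sub>R v"] by force
  qed
  have q0: "(LBINT z. indicator S z * q n z) = 0" for n
  proof -
    define h where "h = inverse (real (Suc n))"
    have i: "integrable lborel (\<lambda>z. indicator S z * F z)" by (rule continuous_bounded_support_integrable[OF F R(1) S(1)])
    have sh: "indicator S z * F (z + h *\<^sub>R v) = (\<lambda>z. indicator S z * F z) (h *\<^sub>R v + z)" for z
      using S(2)[of z h] by (simp add: indicator_def add.commute)
    have eq: "(LBINT z. indicator S z * F (z + h *\<^sub>R v)) = (LBINT z. indicator S z * F z)" unfolding sh by (rule lborel_integral_shift) measurable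
    have i2: "integrable lborel (\<lambda>z. indicator S z * F (z + h *\<^sub>R v))"
    proof (rule continuous_bounded_support_integrable[OF _ _ S(1), where R="R + norm (h *\<^sub>R v)"])
      show "continuous_on UNIV (\<lambda>z. F (z + h *\<^sub>R v))" by (intro continuous_on_compose2[OF F] continuous_intros) auto
      show "F (z + h *\<^sub>R v) = 0" if "norm z > R + norm (h *\<^sub>R v)" for z
        using that norm_triangle_ineq4[of "z + h *\<^sub>R v" "h *\<^sub>R v"] by (intro R(1)) simp
    qed
    have "(LBINT z. indicator S z * q n z) = (LBINT z. real (Suc n) * (indicator S z * F (z + h *\<^sub>R v) - indicator S z * F z))"
      unfolding q_def h_def[symmetric] by (intro Bochner_Integration.integral_cong) (auto simp: algebra_simps)
    also have "... = real (Suc n) * ((LBINT z. indicator S z * F (z + h *\<^sub>R v)) - (LBINT z. indicator S z * F z))" using i i2 by simp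
    finally show ?thesis unfolding eq by simp
  qed
  have "(\<lambda>n. LBINT z. indicator S z * q n z) \<longlonglongrightarrow> (LBINT z. indicator S z * F' z)"
  proof (rule integral_dominated_convergence[where w="\<lambda>z. B * indicator (cball 0 (R + norm v)) z"])
    have "emeasure lborel (cball (0::'a) (R + norm v)) < \<infinity>" by (rule emeasure_compact_finite) simp
    then show "integrable lborel (\<lambda>z::'a. B * indicator (cball 0 (R + norm v)) z)" by simp
    show "AE z in lborel. (\<lambda>n. indicator S z * q n z) \<longlonglongrightarrow> indicator S z * F' z"
    proof (intro AE_I2 tendsto_mult tendsto_const)
      fix z
      have "((\<lambda>h. (F (z + h *\<^sub>R v) - F z) / h) \<longlongrightarrow> F' z) (at 0)" using der[of z] unfolding DERIV_def by simp
      moreover have "filterlim (\<lambda>n. inverse (real (Suc n))) (at 0) sequentially" using LIMSEQ_inverse_real_of_nat by (auto simp: filterlim_at)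
      ultimately have "(\<lambda>n. (F (z + inverse (real (Suc n)) *\<^sub>R v) - F z) / inverse (real (Suc n))) \<longlonglongrightarrow> F' z" by (rule filterlim_compose)
      then show "(\<lambda>n. q n z) \<longlonglongrightarrow> F' z" unfolding q_def by (simp add: divide_inverse mult.commute)
    qed
    show "AE z in lborel. norm (indicator S z * q n z) \<le> B * indicator (cball 0 (R + norm v)) z" for n
    proof (intro AE_I2)
      fix z show "norm (indicator S z * q n z) \<le> B * indicator (cball 0 (R + norm v)) z" using qb[of n z] by (cases "z \<in> S") auto
    qed
    show "(\<lambda>z. indicator S z * q n z) \<in> borel_measurable lborel" for n unfolding q_def by simp
  qed measurable
  then show ?thesis unfolding q0 by (simp add: LIMSEQ_const_iff)
qed

text \<open>The fundamental theorem of calculus on each line parallel to the time axis, up to a time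
  beyond the support; what remains is the boundary at time 0.\<close>

lemma integral_time_derivative:
  fixes F F' :: "real \<times> (real^'n) => real"
  assumes F: "continuous_on UNIV F" and F': "continuous_on UNIV F'"
    and R: "\<And>z. norm z > R ==> F z = 0" "\<And>z. norm z > R ==> F' z = 0"
    and der: "\<And>z. ((\<lambda>h. F (z + h *\<^sub>R (1, 0))) has_real_derivative F' z) (at 0)"
  shows "(LBINT z. indicator half_space z * F' z) = - (LBINT x. F (0, x))"
proof -
  have i: "integrable lborel (\<lambda>z. indicator half_space z * F' z)" by (rule continuous_bounded_support_integrable[OF F' R(2) half_space_borel])
  define r where "r = max 0 R + 1"
  have der': "((\<lambda>t. F (t, x)) has_real_derivative F' (t, x)) (at t)" for t x
    using DERIV_shift[of "\<lambda>h. F (h, x)" "F' (t, x)" 0 t] der[of "(t, x)"] by (simp add: add.commute)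
  have inner: "(LBINT t. indicator half_space (t, x) * F' (t, x)) = - F (0, x)" for x
  proof -
    have big: "norm (t, x) > R" if "t > r - 1" for t using that norm_fst_le[of t x] unfolding r_def by auto
    have "has_bochner_integral lborel (\<lambda>t. F' (t, x) * indicator {0..r} t) (F (r, x) - F (0, x))"
    proof (rule has_bochner_integral_FTC_Icc_real)
      show "0 \<le> r" unfolding r_def by simp
      show "((\<lambda>t. F (t, x)) has_real_derivative F' (t, x)) (at t)" for t by (rule der')
      show "isCont (\<lambda>t. F' (t, x)) t" for t
      proof -
        have "continuous_on UNIV (\<lambda>t. F' (t, x))" by (intro continuous_on_compose2[OF F'] continuous_intros) auto
        then show ?thesis by (simp add: continuous_on_eq_continuous_at)
      qed
    qed
    then have "(LBINT t. F' (t, x) * indicator {0..r} t) = F (r, x) - F (0, x)" by (rule has_bochner_integral_integral_eq)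
    moreover have "F' (t, x) * indicator {0..r} t = indicator half_space (t, x) * F' (t, x)" for t
      using R(2)[of "(t, x)"] big[of t] by (auto simp: indicator_def half_space_def)
    moreover have "F (r, x) = 0" by (intro R(1) big) simp
    ultimately show ?thesis by simp
  qed
  have "(LBINT z. indicator half_space z * F' z) = (\<integral>x. \<integral>t. indicator half_space (t, x) * F' (t, x) \<partial>lborel \<partial>lborel)"
  proof -
    have e: "(\<lambda>(t, x). indicator half_space (t, x) * F' (t, x)) = (\<lambda>z. indicator half_space z * F' z)" by auto
    have "integrable (lborel \<Otimes>\<^sub>M lborel) (\<lambda>(t, x). indicator half_space (t, x) * F' (t, x))" unfolding lborel_prod by (simp only: i e)
    from lborel_pair.integral_snd[OF this] show ?thesis unfolding lborel_prod e by simp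
  qed
  then show ?thesis unfolding inner by simp
qed

lemma pderiv_has_real_derivative:
  "smooth f ==> ((\<lambda>h. f (z + h *\<^sub>R v)) has_real_derivative pderiv_dir v f z) (at 0)" using pderiv_dir_DERIV[of f z v 0] by simp

text \<open>U f_tt - U_tt f is the time derivative of U f_t - U_t f, likewise in space, and the
  terms with second derivatives of \<open>U\<close> cancel by the wave equation. Only the boundary
  at time 0 contributes. The derivatives of \<open>U\<close> are passed as functions, since those of
  the regularized solutions are known explicitly.\<close>

lemma wave_green:
  fixes U Ut Utt :: "real \<times> (real^'n) => real" and Ui Uii :: "'n => real \<times> (real^'n) => real"
  assumes c: "continuous_on UNIV U" "continuous_on UNIV Ut" "continuous_on UNIV Utt"
      "\<And>i. continuous_on UNIV (Ui i)" "\<And>i. continuous_on UNIV (Uii i)"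
    and t: "\<And>z. ((\<lambda>h. U (z + h *\<^sub>R (1, 0))) has_real_derivative Ut z) (at 0)"
      "\<And>z. ((\<lambda>h. Ut (z + h *\<^sub>R (1, 0))) has_real_derivative Utt z) (at 0)"
    and x: "\<And>i z. ((\<lambda>h. U (z + h *\<^sub>R (0, axis i 1))) has_real_derivative Ui i z) (at 0)"
      "\<And>i z. ((\<lambda>h. Ui i (z + h *\<^sub>R (0, axis i 1))) has_real_derivative Uii i z) (at 0)"
    and wave: "\<And>z. Utt z = (\<Sum>i\<in>UNIV. Uii i z)"
    and f: "f \<in> test_functions"
  shows "(LBINT z. indicator half_space z * (U z * wave_op f z))
    = (LBINT x. Ut (0, x) * f (0, x) - U (0, x) * pderiv_dir (1, 0) f (0, x))"
proof -
  let ?p = "\<lambda>v. pderiv_dir v f" and ?pp = "\<lambda>v. pderiv_dir v (pderiv_dir v f)"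
  have s: "smooth f" "\<And>v. v \<in> Basis ==> smooth (?p v)" "\<And>v. v \<in> Basis ==> smooth (?pp v)"
    using test_functions_smooth[OF f] by (auto intro: smooth_pderiv_Basis)
  obtain R0 where R0: "\<And>z. z \<in> fun_supp f ==> norm z \<le> R0" using test_functions_compact[OF f] compact_imp_bounded bounded_iff by metis
  have R: "f z = 0" "?p v z = 0" "?pp v z = 0" if "norm z > R0" for z v
  proof -
    have "z \<notin> fun_supp f" using R0[of z] that by auto
    then show "f z = 0" "?p v z = 0" "?pp v z = 0" using fun_supp_pderiv[of v f] fun_supp_pderiv[of v "?p v"] by (auto intro: not_fun_supp_eq_0)
  qed
  define F0 where "F0 z = U z * ?p (1, 0) z - Ut z * f z" for z
  define F0' where "F0' z = U z * ?pp (1, 0) z - Utt z * f z" for z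
  define F where "F i z = U z * ?p (0, axis i 1) z - Ui i z * f z" for i z
  define F' where "F' i z = U z * ?pp (0, axis i 1) z - Uii i z * f z" for i z
  have cF: "continuous_on UNIV F0" "continuous_on UNIV F0'" "continuous_on UNIV (F i)" "continuous_on UNIV (F' i)" for i
    unfolding F0_def F0'_def F_def F'_def by (intro continuous_intros c smooth_continuous_on s; simp)+
  have 0: "(LBINT z. indicator half_space z * F0' z) = - (LBINT x. F0 (0, x))"
  proof (rule integral_time_derivative[OF cF(1,2)])
    show "F0 z = 0" "F0' z = 0" if "norm z > R0" for z unfolding F0_def F0'_def using R that by auto
    fix z
    have "((\<lambda>h. F0 (z + h *\<^sub>R (1, 0))) has_real_derivative
       (U z * ?pp (1, 0) z + Ut z * ?p (1, 0) z) - (Ut z * ?p (1, 0) z + Utt z * f z)) (at 0)"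
      unfolding F0_def using t[of z] pderiv_has_real_derivative[where z=z and v="(1, 0)", OF s(1)] pderiv_has_real_derivative[where z=z and v="(1, 0)", OF s(2)[OF time_Basis]] by (auto intro!: derivative_eq_intros simp: zero_prod_def[symmetric])
    then show "((\<lambda>h. F0 (z + h *\<^sub>R (1, 0))) has_real_derivative F0' z) (at 0)" unfolding F0'_def by simp
  qed
  have 1: "(LBINT z. indicator half_space z * F' i z) = 0" for i
  proof (rule integral_line_derivative_zero[OF cF(3,4)])
    show "F i z = 0" "F' i z = 0" if "norm z > R0" for z unfolding F_def F'_def using R that by auto
    fix z
    have "((\<lambda>h. F i (z + h *\<^sub>R (0, axis i 1))) has_real_derivative
       (U z * ?pp (0, axis i 1) z + Ui i z * ?p (0, axis i 1) z) - (Ui i z * ?p (0, axis i 1) z + Uii i z * f z)) (at 0)"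
      unfolding F_def using x[where i=i and z=z] pderiv_has_real_derivative[where z=z and v="(0, axis i 1)", OF s(1)] pderiv_has_real_derivative[where z=z and v="(0, axis i 1)", OF s(2)[where v="(0, axis i 1)", OF space_Basis]] by (auto intro!: derivative_eq_intros simp: zero_prod_def[symmetric])
    then show "((\<lambda>h. F i (z + h *\<^sub>R (0, axis i 1))) has_real_derivative F' i z) (at 0)" unfolding F'_def by simp
    show "z + h *\<^sub>R (0, axis i 1) \<in> half_space \<longleftrightarrow> z \<in> half_space" for h by (cases z) (simp add: half_space_def)
  qed (rule half_space_borel)
  have i0: "integrable lborel (\<lambda>z. indicator half_space z * F0' z)"
    by (rule continuous_bounded_support_integrable[OF cF(2), where R=R0]) (use R in \<open>auto simp: F0'_def\<close>)
  have i1: "integrable lborel (\<lambda>z. indicator half_space z * F' i z)" for i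
    by (rule continuous_bounded_support_integrable[OF cF(4), where R=R0]) (use R in \<open>auto simp: F'_def\<close>)
  have "U z * wave_op f z = F0' z - (\<Sum>i\<in>UNIV. F' i z)" for z
    unfolding F0'_def F'_def wave_op_def wave by (simp add: sum_subtractf sum_distrib_left algebra_simps)
  then have "(LBINT z. indicator half_space z * (U z * wave_op f z))
     = (LBINT z. indicator half_space z * F0' z - (\<Sum>i\<in>UNIV. indicator half_space z * F' i z))" by (simp add: right_diff_distrib sum_distrib_left)
  also have "... = (LBINT z. indicator half_space z * F0' z) - (\<Sum>i\<in>UNIV. \<integral>z. indicator half_space z * F' i z \<partial>lborel)"
    unfolding Bochner_Integration.integral_diff[OF i0 Bochner_Integration.integrable_sum[OF i1]]
      Bochner_Integration.integral_sum[OF i1] ..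
  also have "... = (LBINT x. - F0 (0, x))" unfolding 0 1 by simp
  finally show ?thesis unfolding F0_def by simp
qed

section \<open>Complex profiles and the Poisson kernel\<close>

lemma sum_nth_square: "(\<Sum>i\<in>UNIV. (x $ i)\<^sup>2) = (norm x)\<^sup>2" by (simp only: power2_norm_eq_inner inner_vec_def) (simp add: power2_eq_square)

text \<open>Normalizes the Poisson kernel c e / (|x|^2 + e^2)^((d+1)/2) to integral 1 for d = 1 and
  d = 2.\<close>

definition poisson_const :: "nat => real" where
  "poisson_const d = (if d = 1 then 1 / pi else 1 / (2 * pi))"

text \<open>For \<open>G\<close> as below, the imaginary part of \<open>G (cphase UNIV e z)\<close> is a regular solution of the wave
  equation with zero initial value, with a Poisson kernel as initial velocity, and with the
  fundamental solution as limit.\<close>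

definition wave_profile :: "nat => (complex => complex) => (complex => complex) => (complex => complex) => bool" where
  "wave_profile d G G1 G2 \<longleftrightarrow>
    (\<forall>y. y \<notin> \<real>\<^sub>\<le>\<^sub>0 --> (G has_field_derivative G1 y) (at y) \<and> (G1 has_field_derivative G2 y) (at y) \<and> isCont G2 y
        \<and> of_nat (d + 1) * G1 y = - 2 * y * G2 y \<and> \<bar>Im (G y)\<bar> \<le> (if d = 1 then 1 / 2 else norm y powr - (1 / 2)))
    \<and> (\<forall>x>0. Im (G (of_real x)) = 0 \<and> Im (G1 (of_real x)) = 0
        \<and> 2 * Re (G1 (of_real x)) = poisson_const d * x powr (- (real d + 1) / 2))
    \<and> (\<forall>y x. y \<longlonglongrightarrow> of_real x --> x \<noteq> 0 --> (\<forall>n. Im (y n) > 0) -->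
        (\<lambda>n. Im (G (y n))) \<longlonglongrightarrow> (if x > 0 then 0 else if d = 1 then 1 / 2 else 1 / (2 * pi * sqrt (- x))))"

text \<open>The imaginary part of \<open>Ln\<close> is 0 on the positive axis and tends to pi when
  the negative axis is approached from above; division by 2 pi gives 0 outside and 1/2 inside the
  cone.\<close>

lemma wave_profile_1:
  "wave_profile 1 (\<lambda>y. Ln y / of_real (2 * pi)) (\<lambda>y. inverse y / of_real (2 * pi)) (\<lambda>y. - inverse (y\<^sup>2) / of_real (2 * pi))"
  unfolding wave_profile_def
proof (intro conjI allI impI)
  fix y :: complex assume z: "y \<notin> \<real>\<^sub>\<le>\<^sub>0"
  then have nz: "y \<noteq> 0" by auto
  show "((\<lambda>y. Ln y / of_real (2 * pi)) has_field_derivative inverse y / of_real (2 * pi)) (at y)" by (intro DERIV_cdivide has_field_derivative_Ln z)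
  show "((\<lambda>y. inverse y / of_real (2 * pi)) has_field_derivative - inverse (y\<^sup>2) / of_real (2 * pi)) (at y)"
    using nz by (auto intro!: derivative_eq_intros simp: power2_eq_square)
  show "isCont (\<lambda>y. - inverse (y\<^sup>2) / of_real (2 * pi)) y" using nz by (intro continuous_intros) auto
  show "of_nat (1 + 1) * (inverse y / of_real (2 * pi)) = - 2 * y * (- inverse (y\<^sup>2) / of_real (2 * pi))" using nz by (simp add: power2_eq_square)
  have "\<bar>Im (Ln y)\<bar> \<le> pi" using mpi_less_Im_Ln[OF nz] Im_Ln_le_pi[OF nz] by simp
  then show "\<bar>Im (Ln y / of_real (2 * pi))\<bar> \<le> (if 1 = 1 then 1 / 2 else norm y powr - (1 / 2))" by simp
next
  fix x :: real assume x: "x > 0"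
  show "Im (Ln (of_real x) / of_real (2 * pi)) = 0" using x by simp
  have e: "inverse (of_real x) / of_real (2 * pi) = complex_of_real (inverse x / (2 * pi))" by simp
  show "Im (inverse (of_real x) / of_real (2 * pi)) = 0" by simp
  have "x powr - 1 = inverse x" using x by (simp add: powr_minus)
  moreover have "- (real 1 + 1) / 2 = - 1" "poisson_const 1 = 1 / pi" by (simp_all add: poisson_const_def)
  ultimately show "2 * Re (inverse (of_real x) / of_real (2 * pi)) = poisson_const 1 * x powr (- (real 1 + 1) / 2)"
    unfolding e Re_complex_of_real by simp
next
  fix y and x :: real
  assume lim: "y \<longlonglongrightarrow> of_real x" and x: "x \<noteq> 0" and im: "\<forall>n. Im (y n) > 0"
  show "(\<lambda>n. Im (Ln (y n) / of_real (2 * pi))) \<longlonglongrightarrow> (if x > 0 then 0 else if 1 = 1 then 1 / 2 else 1 / (2 * pi * sqrt (- x)))"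
  proof (cases "x > 0")
    case True
    have "(\<lambda>n. Im (Ln (y n)) / (2 * pi)) \<longlonglongrightarrow> Im (Ln (of_real x)) / (2 * pi)" using True by (intro tendsto_intros lim) auto
    then show ?thesis using True by simp
  next
    case False
    \<comment> \<open>The points \<open>- y n\<close> tend to a positive number, where
      \<open>Ln\<close> is continuous; the change of branch contributes the summand pi.\<close>
    have "Ln (y n) = Ln (- y n) + \<i> * pi" for n
    proof -
      have "- y n \<noteq> 0" using im[rule_format, of n] by auto
      from Ln_minus[OF this] show ?thesis using im[rule_format, of n] by simp
    qed
    then have e: "Im (Ln (y n)) = Im (Ln (- y n)) + pi" for n by simp
    have "(\<lambda>n. (Im (Ln (- y n)) + pi) / (2 * pi)) \<longlonglongrightarrow> (Im (Ln (- of_real x)) + pi) / (2 * pi)" using False x by (intro tendsto_intros lim) auto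
    moreover have "Im (Ln (- of_real x)) = 0" using False x Ln_of_real[of "-x"] by simp
    ultimately show ?thesis using False by (simp add: e)
  qed
qed

text \<open>\<open>csqrt y\<close> tends to i sqrt |x| when a negative number x is approached from
  above, so - 1 / \<open>csqrt y\<close> tends to i / sqrt |x|. On the positive axis it is real,
  which makes the limit 0 outside the cone.\<close>

lemma wave_profile_2:
  "wave_profile 2 (\<lambda>y. - inverse (csqrt y) / of_real (2 * pi)) (\<lambda>y. inverse (y * csqrt y) / of_real (4 * pi))
     (\<lambda>y. - (3 * inverse (y\<^sup>2 * csqrt y)) / of_real (8 * pi))" unfolding wave_profile_def
proof (intro conjI allI impI)
  fix y :: complex assume z: "y \<notin> \<real>\<^sub>\<le>\<^sub>0"
  then have nz: "y \<noteq> 0" "csqrt y \<noteq> 0" by auto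
  have sq: "csqrt y * csqrt y = y" using power2_csqrt[of y] by (simp add: power2_eq_square)
  define s where "s = csqrt y"
  have s: "s \<noteq> 0" "y = s * s" using nz sq by (auto simp: s_def)
  have d: "(csqrt has_field_derivative inverse (2 * csqrt y)) (at y)" by (rule has_field_derivative_csqrt[OF z])
  have "((\<lambda>y. - inverse (csqrt y) / of_real (2 * pi)) has_field_derivative
     - (- (inverse (csqrt y) * inverse (2 * csqrt y) * inverse (csqrt y))) / of_real (2 * pi)) (at y)"
    by (intro DERIV_cdivide DERIV_minus DERIV_inverse' d nz)
  also have "- (- (inverse (csqrt y) * inverse (2 * csqrt y) * inverse (csqrt y))) / of_real (2 * pi) = inverse (y * csqrt y) / of_real (4 * pi)"
    unfolding s_def[symmetric] unfolding s(2) by simp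
  finally show "((\<lambda>y. - inverse (csqrt y) / of_real (2 * pi)) has_field_derivative inverse (y * csqrt y) / of_real (4 * pi)) (at y)" .
  have "((\<lambda>y. inverse (y * csqrt y) / of_real (4 * pi)) has_field_derivative
     (- (inverse (y * csqrt y) * (y * inverse (2 * csqrt y) + 1 * csqrt y) * inverse (y * csqrt y))) / of_real (4 * pi)) (at y)"
    using nz by (intro DERIV_cdivide DERIV_inverse' DERIV_mult' d) auto
  also have "(- (inverse (y * csqrt y) * (y * inverse (2 * csqrt y) + 1 * csqrt y) * inverse (y * csqrt y))) / of_real (4 * pi)
     = - (3 * inverse (y\<^sup>2 * csqrt y)) / of_real (8 * pi)" unfolding s_def[symmetric] unfolding s(2) by (simp add: field_simps power2_eq_square)
  finally show "((\<lambda>y. inverse (y * csqrt y) / of_real (4 * pi)) has_field_derivative - (3 * inverse (y\<^sup>2 * csqrt y)) / of_real (8 * pi)) (at y)" .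
  show "isCont (\<lambda>y. - (3 * inverse (y\<^sup>2 * csqrt y)) / of_real (8 * pi)) y" using nz by (intro continuous_intros DERIV_isCont[OF d]) auto
  show "of_nat (2 + 1) * (inverse (y * csqrt y) / of_real (4 * pi)) = - 2 * y * (- (3 * inverse (y\<^sup>2 * csqrt y)) / of_real (8 * pi))"
    using s(1) by (simp add: field_simps power2_eq_square)
  have "\<bar>Im (- inverse (csqrt y) / of_real (2 * pi))\<bar> \<le> norm (- inverse (csqrt y) / of_real (2 * pi) :: complex)" by (rule abs_Im_le_cmod)
  also have "... = inverse (sqrt (norm y)) / (2 * pi)" by (simp only: norm_divide norm_minus_cancel norm_inverse) simp
  also have "... \<le> inverse (sqrt (norm y)) / 1" using pi_ge_two by (intro divide_left_mono) auto
  also have "... = norm y powr - (1 / 2)" by (simp add: powr_minus powr_half_sqrt)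
  finally show "\<bar>Im (- inverse (csqrt y) / of_real (2 * pi))\<bar> \<le> (if 2 = (1::nat) then 1 / 2 else norm y powr - (1 / 2))" by simp
next
  fix x :: real assume x: "x > 0"
  have c: "csqrt (of_real x) = of_real (sqrt x)" using x by simp
  show "Im (- inverse (csqrt (of_real x)) / of_real (2 * pi)) = 0" unfolding c by simp
  have e: "inverse (of_real x * csqrt (of_real x)) / of_real (4 * pi) = complex_of_real (inverse (x * sqrt x) / (4 * pi))" unfolding c by simp
  show "Im (inverse (of_real x * csqrt (of_real x)) / of_real (4 * pi)) = 0" unfolding e by simp
  have "x powr (- (3 / 2)) = inverse (x * sqrt x)"
  proof -
    have "x powr (3 / 2) = x powr (1 + 1 / 2)" by simp
    also have "... = x * sqrt x" using x by (simp only: powr_add) (simp add: powr_half_sqrt)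
    finally show ?thesis by (simp add: powr_minus)
  qed
  then show "2 * Re (inverse (of_real x * csqrt (of_real x)) / of_real (4 * pi)) = poisson_const 2 * x powr (- (real 2 + 1) / 2)"
    unfolding e Re_complex_of_real by (simp add: poisson_const_def)
next
  fix y and x :: real
  assume lim: "y \<longlonglongrightarrow> of_real x" and x: "x \<noteq> 0" and im: "\<forall>n. Im (y n) > 0"
  have cont: "(\<lambda>n. csqrt (f n)) \<longlonglongrightarrow> csqrt l" if "f \<longlonglongrightarrow> l" "l \<notin> \<real>\<^sub>\<le>\<^sub>0" for f and l
    using isCont_tendsto_compose[OF DERIV_isCont[OF has_field_derivative_csqrt[OF that(2)]] that(1)] .
  show "(\<lambda>n. Im (- inverse (csqrt (y n)) / of_real (2 * pi))) \<longlonglongrightarrow> (if x > 0 then 0 else if 2 = (1::nat) then 1 / 2 else 1 / (2 * pi * sqrt (- x)))"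
  proof (cases "x > 0")
    case True
    have "(\<lambda>n. Im (- inverse (csqrt (y n)) / of_real (2 * pi))) \<longlonglongrightarrow> Im (- inverse (csqrt (of_real x)) / of_real (2 * pi))"
      using True by (intro tendsto_intros cont lim) auto
    moreover have "csqrt (of_real x) = of_real (sqrt x)" using True by simp
    ultimately show ?thesis by auto
  next
    case False
    have e: "csqrt (y n) = \<i> * csqrt (- y n)" for n using csqrt_minus[of "- y n"] im[rule_format, of n] by simp
    have "(\<lambda>n. Im (- inverse (\<i> * csqrt (- y n)) / of_real (2 * pi))) \<longlonglongrightarrow> Im (- inverse (\<i> * csqrt (- of_real x)) / of_real (2 * pi))"
      using False x by (intro tendsto_intros cont lim) auto
    moreover have "Im (- inverse (\<i> * csqrt (- of_real x)) / of_real (2 * pi)) = 1 / (2 * pi * sqrt (- x))"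
    proof -
      have "csqrt (- of_real x) = of_real (sqrt (- x))" using False by simp
      then have "- inverse (\<i> * csqrt (- of_real x)) / of_real (2 * pi) = \<i> * of_real (1 / (2 * pi * sqrt (- x)))" using x by (simp add: field_simps)
      then show ?thesis by simp
    qed
    ultimately show ?thesis unfolding e by auto
  qed
qed

text \<open>In the variable s = |x|^d the radial integrals are elementary: the antiderivatives are
  multiples of arctan s for d = 1 and of (1 + s)^(-1/2) for d = 2.\<close>

lemma poisson_integral:
  assumes "CARD('n) \<le> 2"
  shows "integrable lborel (\<lambda>y::real^'n. poisson_const CARD('n) * (1 + (norm y)\<^sup>2) powr (- (real CARD('n) + 1) / 2))" (is "integrable _ ?P")
    and "(LBINT y. poisson_const CARD('n) * (1 + (norm (y::real^'n))\<^sup>2) powr (- (real CARD('n) + 1) / 2)) = 1"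
proof -
  have P0: "?P y \<ge> 0" for y unfolding poisson_const_def by simp
  have "CARD('n) = 1 \<or> CARD('n) = 2" using assms by (metis One_nat_def Suc_1 Suc_leI le_SucE le_antisym zero_less_card_finite)
  then have nn: "(\<integral>\<^sup>+ y. ennreal (?P y) \<partial>lborel) = 1"
  proof
    assume n: "CARD('n) = 1"
    have "(\<integral>\<^sup>+ y. ennreal (?P y) \<partial>lborel) = (\<integral>\<^sup>+ y. ennreal (1 / pi * (1 / (1 + (norm (y::real^'n) ^ CARD('n))\<^sup>2))) \<partial>lborel)"
    proof (intro nn_integral_cong)
      fix y :: "real^'n"
      show "ennreal (?P y) = ennreal (1 / pi * (1 / (1 + (norm y ^ CARD('n))\<^sup>2)))" unfolding n by (simp add: poisson_const_def)
    qed
    also have "... = ennreal 2 * (\<integral>\<^sup>+ s. ennreal (1 / pi * (1 / (1 + s\<^sup>2))) * indicator {0..} s \<partial>lborel)"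
      using nn_integral_norm_power[of "\<lambda>s. ennreal (1 / pi * (1 / (1 + s\<^sup>2)))", where 'n='n] n by simp
    also have "(\<integral>\<^sup>+ s. ennreal (1 / pi * (1 / (1 + s\<^sup>2))) * indicator {0..} s \<partial>lborel) = ennreal (1 / pi * (pi / 2) - 1 / pi * arctan 0)"
    proof (rule nn_integral_FTC_atLeast)
      show "((\<lambda>s. 1 / pi * arctan s) has_real_derivative 1 / pi * (1 / (1 + s\<^sup>2))) (at s)" for s
        by (intro DERIV_cmult) (auto intro!: derivative_eq_intros simp: divide_inverse)
      show "((\<lambda>s. 1 / pi * arctan s) \<longlongrightarrow> 1 / pi * (pi / 2)) at_top" by (intro tendsto_intros tendsto_arctan_at_top)
    qed (auto intro: add_nonneg_nonneg)
    also have "ennreal 2 * ennreal (1 / pi * (pi / 2) - 1 / pi * arctan 0) = ennreal (2 * (1 / pi * (pi / 2) - 1 / pi * arctan 0))"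
      by (rule ennreal_mult[symmetric]) auto
    finally show ?thesis by simp
  next
    assume n: "CARD('n) = 2"
    have "(\<integral>\<^sup>+ y. ennreal (?P y) \<partial>lborel) = (\<integral>\<^sup>+ y. ennreal (1 / (2 * pi) * (1 + norm (y::real^'n) ^ CARD('n)) powr (- (3 / 2))) \<partial>lborel)"
      unfolding n by (simp add: poisson_const_def)
    also have "... = ennreal pi * (\<integral>\<^sup>+ s. ennreal (1 / (2 * pi) * \<bar>1 + s\<bar> powr (- (3 / 2))) * indicator {0..} s \<partial>lborel)"
      using nn_integral_norm_power[of "\<lambda>s. ennreal (1 / (2 * pi) * \<bar>1 + s\<bar> powr (- (3 / 2)))", where 'n='n] n by (simp add: unit_ball_vol_2)
    also have "(\<integral>\<^sup>+ s. ennreal (1 / (2 * pi) * \<bar>1 + s\<bar> powr (- (3 / 2))) * indicator {0..} s \<partial>lborel) = ennreal (- (1 / pi) * 0 - (- (1 / pi) * (1 + 0) powr (- (1 / 2))))"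
    proof (rule nn_integral_FTC_atLeast)
      fix s :: real assume s: "0 \<le> s"
      have "((\<lambda>s. - (1 / pi) * (1 + s) powr (- (1 / 2))) has_real_derivative - (1 / pi) * (- (1 / 2) * (1 + s) powr (- (1 / 2) - 1))) (at s)"
        by (intro DERIV_cmult) (use s in \<open>auto intro!: derivative_eq_intros\<close>)
      then show "((\<lambda>s. - (1 / pi) * (1 + s) powr (- (1 / 2))) has_real_derivative 1 / (2 * pi) * \<bar>1 + s\<bar> powr (- (3 / 2))) (at s)"
        using s by (simp add: mult.commute)
    next
      have "((\<lambda>s::real. (1 + s) powr (- (1 / 2))) \<longlongrightarrow> 0) at_top"
        by (intro tendsto_neg_powr filterlim_tendsto_add_at_top[OF tendsto_const filterlim_ident]) auto
      then show "((\<lambda>s. - (1 / pi) * (1 + s) powr (- (1 / 2))) \<longlongrightarrow> - (1 / pi) * 0) at_top" by (intro tendsto_intros)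
    qed auto
    also have "ennreal pi * ennreal (- (1 / pi) * 0 - (- (1 / pi) * (1 + 0) powr (- (1 / 2)))) = ennreal (pi * (- (1 / pi) * 0 - (- (1 / pi) * (1 + 0) powr (- (1 / 2)))))"
      by (rule ennreal_mult[symmetric]) auto
    finally show ?thesis by simp
  qed
  show "integrable lborel ?P" by (rule integrableI_nonneg[OF _ AE_I2[OF P0]]) (measurable, unfold nn, simp)
  have "(LBINT y. ?P y) = enn2real (\<integral>\<^sup>+ y. ennreal (?P y) \<partial>lborel)" by (rule integral_eq_nn_integral[OF _ AE_I2[OF P0]]) measurable
  then show "(LBINT y. ?P y) = 1" unfolding nn by simp
qed

lemma lborel_integral_scale:
  fixes f :: "real^'n => real"
  assumes [measurable]: "f \<in> borel_measurable borel" and c: "c > 0"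
  shows "(LBINT x. f x) = (LBINT y. c ^ CARD('n) * f (c *\<^sub>R y))"
proof -
  have "(LBINT x. f x) = (\<integral>x. f x \<partial>density (distr lborel borel (\<lambda>y. 0 + c *\<^sub>R y)) (\<lambda>_. ennreal (\<bar>c\<bar> ^ DIM(real^'n))))"
    using lborel_affine[of c "0 :: real^'n"] c by simp
  also have "... = (\<integral>x. \<bar>c\<bar> ^ DIM(real^'n) *\<^sub>R f x \<partial>distr lborel borel (\<lambda>y. 0 + c *\<^sub>R y))" by (rule integral_density) auto
  also have "... = (LBINT y. c ^ CARD('n) * f (c *\<^sub>R y))" by (subst integral_distr) (use c in auto)
  finally show ?thesis .
qed

text \<open>Rescaling by \<open>e k\<close> turns the kernel into a fixed probability density and
  the other factor into f(e y), which tends boundedly to f(0).\<close>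

lemma poisson_limit:
  fixes f :: "real^'n => real"
  assumes n: "CARD('n) \<le> 2" and f: "continuous_on UNIV f" and B: "\<And>x. \<bar>f x\<bar> \<le> B"
    and e: "\<And>k. e k > 0" "e \<longlonglongrightarrow> 0"
  shows "(\<lambda>k. LBINT x. e k * (poisson_const CARD('n) * ((norm x)\<^sup>2 + (e k)\<^sup>2) powr (- (real CARD('n) + 1) / 2)) * f x) \<longlonglongrightarrow> f 0"
proof -
  let ?P = "\<lambda>y::real^'n. poisson_const CARD('n) * (1 + (norm y)\<^sup>2) powr (- (real CARD('n) + 1) / 2)"
  have fm[measurable]: "f \<in> borel_measurable borel" by (rule borel_measurable_continuous_onI[OF f])
  have P0: "?P y \<ge> 0" for y unfolding poisson_const_def by simp
  have eq: "(LBINT x. e k * (poisson_const CARD('n) * ((norm x)\<^sup>2 + (e k)\<^sup>2) powr (- (real CARD('n) + 1) / 2)) * f x)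
     = (LBINT y. ?P y * f (e k *\<^sub>R y))" for k
  proof -
    have "(LBINT x. e k * (poisson_const CARD('n) * ((norm x)\<^sup>2 + (e k)\<^sup>2) powr (- (real CARD('n) + 1) / 2)) * f x)
      = (LBINT y. e k ^ CARD('n) * (e k * (poisson_const CARD('n) * ((norm (e k *\<^sub>R y :: real^'n))\<^sup>2 + (e k)\<^sup>2) powr (- (real CARD('n) + 1) / 2)) * f (e k *\<^sub>R y)))"
      by (rule lborel_integral_scale[OF _ e(1)]) measurable
    also have "... = (LBINT y. ?P y * f (e k *\<^sub>R y))"
    proof (intro Bochner_Integration.integral_cong refl)
      fix y :: "real^'n"
      have "(norm (e k *\<^sub>R y))\<^sup>2 + (e k)\<^sup>2 = (e k)\<^sup>2 * (1 + (norm y)\<^sup>2)" by (simp add: algebra_simps)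
      then have "((norm (e k *\<^sub>R y))\<^sup>2 + (e k)\<^sup>2) powr (- (real CARD('n) + 1) / 2)
         = ((e k)\<^sup>2) powr (- (real CARD('n) + 1) / 2) * (1 + (norm y)\<^sup>2) powr (- (real CARD('n) + 1) / 2)" by (simp add: powr_mult)
      also have "((e k)\<^sup>2) powr (- (real CARD('n) + 1) / 2) = inverse (e k ^ (CARD('n) + 1))"
      proof -
        have "(e k)\<^sup>2 = e k powr 2" using e(1)[of k] by simp
        then have "((e k)\<^sup>2) powr (- (real CARD('n) + 1) / 2) = e k powr (2 * (- (real CARD('n) + 1) / 2))" by (simp only: powr_powr)
        also have "2 * (- (real CARD('n) + 1) / 2) = - real (CARD('n) + 1)" by simp
        finally show ?thesis using e(1)[of k] by (simp only: powr_minus powr_realpow)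
      qed
      finally show "e k ^ CARD('n) * (e k * (poisson_const CARD('n) * ((norm (e k *\<^sub>R y))\<^sup>2 + (e k)\<^sup>2) powr (- (real CARD('n) + 1) / 2)) * f (e k *\<^sub>R y)) = ?P y * f (e k *\<^sub>R y)"
        using e(1)[of k] by (simp add: field_simps)
    qed
    finally show ?thesis .
  qed
  have "(\<lambda>k. LBINT y. ?P y * f (e k *\<^sub>R y)) \<longlonglongrightarrow> (LBINT y. ?P y * f 0)"
  proof (rule integral_dominated_convergence[where w="\<lambda>y. ?P y * B"])
    show "integrable lborel (\<lambda>y. ?P y * B)" using poisson_integral(1)[OF n] by simp
    show "AE y in lborel. (\<lambda>k. ?P y * f (e k *\<^sub>R y)) \<longlonglongrightarrow> ?P y * f 0"
    proof (intro AE_I2 tendsto_mult tendsto_const)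
      fix y :: "real^'n"
      have "(\<lambda>k. e k *\<^sub>R y) \<longlonglongrightarrow> 0 *\<^sub>R y" by (intro tendsto_intros e)
      then have "(\<lambda>k. e k *\<^sub>R y) \<longlonglongrightarrow> 0" by simp
      moreover have "isCont f 0" using f continuous_on_eq_continuous_at[OF open_UNIV, of f] by blast
      ultimately show "(\<lambda>k. f (e k *\<^sub>R y)) \<longlonglongrightarrow> f 0" using isCont_tendsto_compose by blast
    qed
    show "AE y in lborel. norm (?P y * f (e k *\<^sub>R y)) \<le> ?P y * B" for k
    proof (intro AE_I2)
      fix y
      have "\<bar>?P y\<bar> * \<bar>f (e k *\<^sub>R y)\<bar> \<le> ?P y * B" using P0[of y] by (intro mult_mono B) auto
      then show "norm (?P y * f (e k *\<^sub>R y)) \<le> ?P y * B" by (simp only: real_norm_def abs_mult)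
    qed
  qed measurable
  then show ?thesis unfolding eq using poisson_integral(2)[OF n] by simp
qed

section \<open>Regularized solutions and their limit\<close>

lemma continuous_on_cphase: "continuous_on UNIV (cphase T e)" unfolding cphase_def by (intro continuous_intros)

text \<open>The squared modulus of the phase is q^2 plus nonnegative terms, q = t^2 - |x|^2. The
  bound does not involve e and so provides a dominating function as e tends to 0.\<close>

lemma norm_cphase_ge_cone: "norm (cphase UNIV e z) \<ge> \<bar>(fst z)\<^sup>2 - (norm (snd z))\<^sup>2\<bar>"
proof -
  let ?q = "(fst z)\<^sup>2 - (norm (snd z))\<^sup>2"
  have "(norm (cphase UNIV e z))\<^sup>2 = (e\<^sup>2 - ?q)\<^sup>2 + (2 * fst z * e)\<^sup>2" by (simp add: cmod_power2 Re_cphase Im_cphase sum_nth_square algebra_simps)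
  also have "... = ?q\<^sup>2 + 2 * (e\<^sup>2 * ((fst z)\<^sup>2 + (norm (snd z))\<^sup>2)) + (e\<^sup>2)\<^sup>2" by (simp add: power2_eq_square algebra_simps)
  finally show ?thesis using abs_le_square_iff[of ?q "norm (cphase UNIV e z)"] by simp
qed

lemma wave_regularization:
  fixes f :: "real \<times> (real^'n) => real"
  assumes pr: "wave_profile CARD('n) G G1 G2" and e: "e > 0" and f: "f \<in> test_functions"
  shows "(LBINT z. indicator half_space z * (Im (G (cphase UNIV e z)) * wave_op f z))
    = (LBINT x. e * (poisson_const CARD('n) * ((norm x)\<^sup>2 + e\<^sup>2) powr (- (real CARD('n) + 1) / 2)) * f (0, x))"
proof -
  let ?c = "cphase UNIV e :: real \<times> (real^'n) => complex"
  have G: "(G has_field_derivative G1 y) (at y)" "(G1 has_field_derivative G2 y) (at y)" "isCont G2 y"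
    "of_nat (CARD('n) + 1) * G1 y = - 2 * y * G2 y" if "y \<notin> \<real>\<^sub>\<le>\<^sub>0" for y using pr that unfolding wave_profile_def by blast+
  have Gp: "Im (G (of_real x)) = 0" "Im (G1 (of_real x)) = 0" "2 * Re (G1 (of_real x)) = poisson_const CARD('n) * x powr (- (real CARD('n) + 1) / 2)"
    if "x > 0" for x using pr that unfolding wave_profile_def by blast+
  have np: "?c z \<notin> \<real>\<^sub>\<le>\<^sub>0" for z by (rule cphase_nonpos_Reals[OF e])
  note D = cphase_wave_derivatives[of G G1 UNIV e G2, OF G(1)[OF np] G(2)[OF np]]
  define A where "A z = of_real (fst z) - \<i> * of_real e" for z :: "real \<times> (real^'n)"
  define V where "V z = G (?c z)" for z
  define Vt where "Vt z = - 2 * A z * G1 (?c z)" for z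
  define Vtt where "Vtt z = - 2 * G1 (?c z) + 4 * (A z)\<^sup>2 * G2 (?c z)" for z
  define Vi where "Vi i z = 2 * of_real (snd z $ i) * G1 (?c z)" for i z
  define Vii where "Vii i z = 2 * G1 (?c z) + 4 * of_real ((snd z $ i)\<^sup>2) * G2 (?c z)" for i z
  have cont: "continuous_on UNIV (\<lambda>z. g (?c z))" if "\<And>y. y \<notin> \<real>\<^sub>\<le>\<^sub>0 ==> isCont g y" for g
  proof (rule continuous_on_compose2[OF _ continuous_on_cphase])
    show "continuous_on (- \<real>\<^sub>\<le>\<^sub>0) g" using that by (intro continuous_at_imp_continuous_on) auto
  qed (use np in auto)
  have cG: "continuous_on UNIV (\<lambda>z. G (?c z))" "continuous_on UNIV (\<lambda>z. G1 (?c z))" "continuous_on UNIV (\<lambda>z. G2 (?c z))"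
    by (intro cont DERIV_isCont[OF G(1)] DERIV_isCont[OF G(2)] G(3); assumption)+
  have cV: "continuous_on UNIV V" "continuous_on UNIV Vt" "continuous_on UNIV Vtt" "continuous_on UNIV (Vi i)" "continuous_on UNIV (Vii i)" for i
    unfolding V_def Vt_def Vtt_def Vi_def Vii_def A_def by (intro continuous_intros cG)+
  have w: "Vtt z = (\<Sum>i\<in>UNIV. Vii i z)" for z unfolding Vtt_def Vii_def A_def
    using cphase_wave_equation[where T="UNIV :: 'n set" and e=e and z=z and a="G1 (?c z)" and b="G2 (?c z)"] G(4)[OF np[of z]] by simp
  have "(LBINT z. indicator half_space z * (Im (V z) * wave_op f z))
    = (LBINT x. Im (Vt (0, x)) * f (0, x) - Im (V (0, x)) * pderiv_dir (1, 0) f (0, x))"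
  proof (rule wave_green[where Utt="\<lambda>z. Im (Vtt z)" and Ui="\<lambda>i z. Im (Vi i z)" and Uii="\<lambda>i z. Im (Vii i z)"])
    show "continuous_on UNIV (\<lambda>z. Im (V z))" "continuous_on UNIV (\<lambda>z. Im (Vt z))" "continuous_on UNIV (\<lambda>z. Im (Vtt z))"
      "continuous_on UNIV (\<lambda>z. Im (Vi i z))" "continuous_on UNIV (\<lambda>z. Im (Vii i z))" for i by (intro continuous_intros cV)+
    fix z
    show "((\<lambda>h. Im (V (z + h *\<^sub>R (1, 0)))) has_real_derivative Im (Vt z)) (at 0)" unfolding V_def Vt_def A_def by (intro has_real_derivative_Im D(1))
    show "((\<lambda>h. Im (Vt (z + h *\<^sub>R (1, 0)))) has_real_derivative Im (Vtt z)) (at 0)"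
      unfolding Vt_def Vtt_def A_def by (intro has_real_derivative_Im D(2))
    show "((\<lambda>h. Im (V (z + h *\<^sub>R (0, axis i 1)))) has_real_derivative Im (Vi i z)) (at 0)" for i
      unfolding V_def Vi_def using D(3)[where i=i and z=z] by (intro has_real_derivative_Im) simp
    show "((\<lambda>h. Im (Vi i (z + h *\<^sub>R (0, axis i 1)))) has_real_derivative Im (Vii i z)) (at 0)" for i
      unfolding Vi_def Vii_def using D(4)[where i=i and z=z] by (intro has_real_derivative_Im) simp
    show "Im (Vtt z) = (\<Sum>i\<in>UNIV. Im (Vii i z))" unfolding w by simp
  qed (rule f)
  also have "... = (LBINT x. e * (poisson_const CARD('n) * ((norm x)\<^sup>2 + e\<^sup>2) powr (- (real CARD('n) + 1) / 2)) * f (0, x))"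
  proof (intro Bochner_Integration.integral_cong refl)
    fix x
    have c0: "?c (0, x) = of_real ((norm x)\<^sup>2 + e\<^sup>2)" by (simp add: complex_eq_iff Re_cphase Im_cphase sum_nth_square)
    have pos: "(norm x)\<^sup>2 + e\<^sup>2 > 0" using e by (simp add: add_nonneg_pos)
    have "Im (V (0, x)) = 0" unfolding V_def c0 by (rule Gp(1)[OF pos])
    \<comment> \<open>At time 0 the factor \<open>A\<close> is - i e, so the initial velocity is e
      times twice the real part of \<open>G1\<close>. This is why \<open>wave_profile\<close>
      prescribes twice the real part of \<open>G1\<close> on the positive axis.\<close>
    moreover have "Im (Vt (0, x)) = e * (2 * Re (G1 (?c (0, x))))" unfolding Vt_def A_def by simp
    ultimately show "Im (Vt (0, x)) * f (0, x) - Im (V (0, x)) * pderiv_dir (1, 0) f (0, x)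
      = e * (poisson_const CARD('n) * ((norm x)\<^sup>2 + e\<^sup>2) powr (- (real CARD('n) + 1) / 2)) * f (0, x)" unfolding c0 Gp(3)[OF pos] by simp
  qed
  finally show ?thesis unfolding V_def .
qed

lemma wave_profile_exists:
  assumes "CARD('n) \<le> 2"
  obtains G G1 G2 where "wave_profile CARD('n::finite) G G1 G2"
proof -
  have "CARD('n) = 1 \<or> CARD('n) = 2" using assms by (metis One_nat_def Suc_1 Suc_leI le_SucE le_antisym zero_less_card_finite)
  then show thesis
  proof
    assume n: "CARD('n) = 1"
    show thesis by (rule that, unfold n, rule wave_profile_1)
  next
    assume n: "CARD('n) = 2"
    show thesis by (rule that, unfold n, rule wave_profile_2)
  qed
qed

text \<open>Both sides of \<open>wave_regularization\<close> pass to the limit e = 0: on the left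
  the bound \<open>D\<close>, integrable on balls, dominates, and on the right the Poisson kernels
  form an approximate identity.\<close>

lemma wave_kernel_fundamental:
  fixes f :: "real \<times> (real^'n) => real"
  assumes n: "CARD('n) \<le> 2" and f: "f \<in> test_functions"
  shows "(LBINT z. wave_kernel z * wave_op f z) = f 0"
proof -
  obtain G G1 G2 where pr: "wave_profile CARD('n) G G1 G2" by (rule wave_profile_exists[OF n])
  define e where "e k = inverse (real (Suc k))" for k
  have e: "e k > 0" "e \<longlonglongrightarrow> 0" for k unfolding e_def using LIMSEQ_inverse_real_of_nat by auto
  define U where "U k z = Im (G (cphase UNIV (e k) z))" for k and z :: "real \<times> (real^'n)"
  define w where "w = wave_op f"
  have wt: "w \<in> test_functions" unfolding w_def by (rule test_functions_wave_op[OF f])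
  obtain R where R: "\<And>z. w z \<noteq> 0 ==> norm z \<le> R" using wt unfolding test_functions_iff by blast
  obtain B where B: "B > 0" "\<And>z. \<bar>w z\<bar> \<le> B" by (rule test_functions_bounded[OF wt], rule that, assumption+)
  have [measurable]: "w \<in> borel_measurable borel" by (rule test_functions_borel[OF wt])
  have np: "cphase UNIV (e k) z \<notin> \<real>\<^sub>\<le>\<^sub>0" for k and z by (rule cphase_nonpos_Reals[OF e(1)])
  have Um[measurable]: "U k \<in> borel_measurable borel" for k
  proof -
    have "continuous_on (- \<real>\<^sub>\<le>\<^sub>0) G" using pr unfolding wave_profile_def by (intro continuous_at_imp_continuous_on) (auto intro: DERIV_isCont)
    then have "continuous_on UNIV (\<lambda>z::real \<times> (real^'n). G (cphase UNIV (e k) z))"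
      by (rule continuous_on_compose2[OF _ continuous_on_cphase[where T="UNIV :: 'n set"]]) (use np in auto)
    then show ?thesis unfolding U_def by (intro borel_measurable_continuous_onI continuous_intros)
  qed
  define q where "q z = (fst z)\<^sup>2 - (norm (snd z))\<^sup>2" for z :: "real \<times> (real^'n)"
  have AEq: "AE z in lborel. q z \<noteq> 0" using AE_off_light_cone[of "UNIV :: 'n set"] by eventually_elim (auto simp: q_def sum_nth_square)
  define D where "D z = (if CARD('n) = 1 then 1 / 2 else \<bar>q z\<bar> powr - (1 / 2))" for z
  have [measurable]: "q \<in> borel_measurable borel" "D \<in> borel_measurable borel" unfolding D_def q_def by auto
  have D0: "D z \<ge> 0" for z unfolding D_def by simp
  have UD: "\<bar>U k z\<bar> \<le> D z" if "q z \<noteq> 0" for k z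
  proof -
    have "\<bar>U k z\<bar> \<le> (if CARD('n) = 1 then 1 / 2 else norm (cphase UNIV (e k) z) powr - (1 / 2))" using pr np unfolding wave_profile_def U_def by blast
    also have "... \<le> D z"
    proof -
      have "norm (cphase UNIV (e k) z) powr - (1 / 2) \<le> \<bar>q z\<bar> powr - (1 / 2)"
        using norm_cphase_ge_cone[of z "e k"] that unfolding q_def by (intro powr_mono2') auto
      then show ?thesis unfolding D_def by auto
    qed
    finally show ?thesis .
  qed
  have iD: "integrable lborel (\<lambda>z. D z * (B * indicator (cball 0 R) z))"
  proof (rule integrableI_bounded)
    show "(\<lambda>z. D z * (B * indicator (cball 0 R) z)) \<in> borel_measurable lborel" by (intro borel_measurable_times borel_measurable_indicator) auto
    have "(\<integral>\<^sup>+ z. ennreal (norm (D z * (B * indicator (cball 0 R) z))) \<partial>lborel) = (\<integral>\<^sup>+ z. ennreal B * (ennreal (D z) * indicator (cball 0 R) z) \<partial>lborel)"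
      using D0 B by (intro nn_integral_cong) (auto simp: indicator_def ennreal_mult mult_ac)
    also have "... = ennreal B * (\<integral>\<^sup>+ z. ennreal (D z) * indicator (cball 0 R) z \<partial>lborel)"
      by (intro nn_integral_cmult borel_measurable_times_ennreal borel_measurable_indicator) auto
    also have "... < \<infinity>"
    proof -
      have "(\<integral>\<^sup>+ z. ennreal (D z) * indicator (cball 0 R) z \<partial>lborel) < \<infinity>"
      proof (cases "CARD('n) = 1")
        case True
        have "integrable lborel (indicator (cball (0::real \<times> (real^'n)) R) :: _ => real)"
          using emeasure_compact_finite[of "cball (0::real \<times> (real^'n)) R"] by simp
        then have "integrable lborel (\<lambda>z::real \<times> (real^'n). 1 / 2 * indicator (cball 0 R) z :: real)" by simp
        then have "(\<integral>\<^sup>+ z. ennreal (norm (1 / 2 * indicator (cball 0 R) z :: real)) \<partial>(lborel :: (real \<times> (real^'n)) measure)) < \<infinity>"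
          unfolding integrable_iff_bounded by blast
        moreover have "ennreal (norm (1 / 2 * indicator (cball 0 R) z :: real)) = ennreal (1 / 2) * indicator (cball 0 R) z" for z :: "real \<times> (real^'n)"
          by (simp add: indicator_def)
        ultimately show ?thesis using True unfolding D_def by simp
      next
        case False
        then have "CARD('n) = 2" using n zero_less_card_finite[where 'a='n] by linarith
        from light_cone_power_integrable[OF this, of "1 / 2" R] show ?thesis using False unfolding D_def q_def by simp
      qed
      then show ?thesis by (simp add: ennreal_mult_less_top)
    qed
    finally show "(\<integral>\<^sup>+ z. ennreal (norm (D z * (B * indicator (cball 0 R) z))) \<partial>lborel) < \<infinity>" .
  qed
  have "(\<lambda>k. LBINT z. indicator half_space z * (U k z * w z)) \<longlonglongrightarrow> (LBINT z. wave_kernel z * w z)"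
  proof (rule integral_dominated_convergence[OF _ _ iD])
    show "AE z in lborel. (\<lambda>k. indicator half_space z * (U k z * w z)) \<longlonglongrightarrow> wave_kernel z * w z" using AEq
    proof eventually_elim
      case (elim z)
      show ?case
      proof (cases "fst z \<ge> 0")
        case False
        then have "\<not> norm (snd z) < fst z" using norm_ge_zero[of "snd z"] by linarith
        then have "wave_kernel z = 0" by (rule wave_kernel_outside)
        moreover have "z \<notin> half_space" using False unfolding half_space_def by auto
        ultimately show ?thesis by simp
      next
        case True
        then have zS: "z \<in> half_space" unfolding half_space_def by (cases z) auto
        \<comment> \<open>At time 0 the phase is real and positive, and both sides are 0. At
          positive times its imaginary part is positive, so the profile tends to its boundary value
          from above, which yields the values inside the cone.\<close>
        have "(\<lambda>k. U k z) \<longlonglongrightarrow> wave_kernel z"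
        proof (cases "fst z = 0")
          case t0: True
          have x: "(norm (snd z))\<^sup>2 > 0" using elim t0 unfolding q_def by simp
          have "U k z = 0" for k
          proof -
            have "cphase UNIV (e k) z = of_real ((norm (snd z))\<^sup>2 + (e k)\<^sup>2)"
              using t0 by (simp add: complex_eq_iff Re_cphase Im_cphase sum_nth_square)
            moreover have "(norm (snd z))\<^sup>2 + (e k)\<^sup>2 > 0" using x by (simp add: add_pos_nonneg)
            ultimately show ?thesis using pr unfolding U_def wave_profile_def by metis
          qed
          moreover have "wave_kernel z = 0" by (rule wave_kernel_outside) (simp add: t0)
          ultimately show ?thesis by simp
        next
          case False
          then have t: "fst z > 0" using True by simp
          have lim: "(\<lambda>k. cphase UNIV (e k) z) \<longlonglongrightarrow> of_real (- q z)"
          proof -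
            have "(\<lambda>k. cphase UNIV (e k) z) \<longlonglongrightarrow> of_real (\<Sum>i\<in>UNIV. (snd z $ i)\<^sup>2) - (of_real (fst z) - \<i> * of_real 0)\<^sup>2"
              unfolding cphase_def by (intro tendsto_intros e(2))
            then show ?thesis by (simp add: q_def sum_nth_square)
          qed
          have im: "\<forall>k. Im (cphase UNIV (e k) z) > 0" using t e(1) by (simp add: Im_cphase)
          have "(\<lambda>k. U k z) \<longlonglongrightarrow> (if - q z > 0 then 0 else if CARD('n) = 1 then 1 / 2 else 1 / (2 * pi * sqrt (- (- q z))))"
            using pr lim im elim unfolding wave_profile_def U_def by (metis neg_equal_0_iff_equal)
          moreover have "(if - q z > 0 then 0 else if CARD('n) = 1 then 1 / 2 else 1 / (2 * pi * sqrt (- (- q z)))) = wave_kernel z"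
          proof (cases "q z > 0")
            case qp: True
            then have "norm (snd z) < fst z" using t unfolding q_def by (simp add: power2_less_imp_less)
            then show ?thesis using qp unfolding wave_kernel_def q_def by simp
          next
            case qn: False
            then have "\<not> norm (snd z) < fst z" unfolding q_def using power_strict_mono[of "norm (snd z)" "fst z" 2] by auto
            then show ?thesis using qn elim by (simp add: wave_kernel_outside)
          qed
          ultimately show ?thesis by simp
        qed
        then show ?thesis using zS by (simp add: tendsto_mult_right)
      qed
    qed
    show "AE z in lborel. norm (indicator half_space z * (U k z * w z)) \<le> D z * (B * indicator (cball 0 R) z)" for k using AEq
    proof eventually_elim
      case (elim z)
      have "\<bar>w z\<bar> \<le> B * indicator (cball 0 R) z" using B R[of z] by (cases "w z = 0") auto
      then have "\<bar>U k z\<bar> * \<bar>w z\<bar> \<le> D z * (B * indicator (cball 0 R) z)" using UD[OF elim] D0 by (intro mult_mono) auto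
      moreover have "norm (indicator half_space z * (U k z * w z)) \<le> \<bar>U k z\<bar> * \<bar>w z\<bar>" by (auto simp: indicator_def abs_mult)
      ultimately show ?case by linarith
    qed
  qed (simp_all, measurable)
  moreover have "(LBINT z. indicator half_space z * (U k z * w z))
     = (LBINT x. e k * (poisson_const CARD('n) * ((norm x)\<^sup>2 + (e k)\<^sup>2) powr (- (real CARD('n) + 1) / 2)) * f (0, x))" for k
    unfolding U_def w_def by (rule wave_regularization[OF pr e(1) f])
  moreover have "(\<lambda>k. LBINT x. e k * (poisson_const CARD('n) * ((norm x)\<^sup>2 + (e k)\<^sup>2) powr (- (real CARD('n) + 1) / 2)) * f (0, x :: real^'n)) \<longlonglongrightarrow> f (0, 0)"
  proof -
    obtain C where C: "C > 0" "\<And>z. \<bar>f z\<bar> \<le> C" by (rule test_functions_bounded[OF f], rule that, assumption+)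
    have "continuous_on UNIV (\<lambda>x. f (0, x))"
      by (intro continuous_on_compose2[OF smooth_continuous_on[OF test_functions_smooth[OF f], of UNIV]] continuous_intros) auto
    from poisson_limit[OF n this C(2) e] show ?thesis by simp
  qed
  ultimately show ?thesis unfolding w_def using LIMSEQ_unique by (fastforce simp: zero_prod_def)
qed

text \<open>Differentiation under the integral sign for the total derivative; it is tested on
  sequences of increments tending to 0, to which dominated convergence applies.\<close>

lemma convolution_has_derivative:
  fixes E f :: "'a::euclidean_space => real"
  assumes E: "locally_integrable E" and f: "f \<in> test_functions"
  shows "((\<lambda>z. LBINT w. E w * f (z + w)) has_derivative
    (\<lambda>v. \<Sum>b\<in>Basis. (v \<bullet> b) * (LBINT w. E w * pderiv_dir b f (z + w)))) (at z)" (is "(?p has_derivative ?D) _")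
proof -
  have [measurable]: "E \<in> borel_measurable borel" using E unfolding locally_integrable_def by blast
  have [measurable]: "f \<in> borel_measurable borel" by (rule test_functions_borel[OF f])
  have s: "smooth f" by (rule test_functions_smooth[OF f])
  have int: "integrable lborel (\<lambda>w. E w * g (y + w))" if "g \<in> test_functions" for g y
    by (rule test_functions_locally_integrable_mult[OF E test_functions_shift[OF that]])
  have pm: "pderiv_dir b f \<in> test_functions" if "b \<in> Basis" for b by (rule test_functions_pderiv[OF f that])
  have "\<forall>b\<in>Basis. \<exists>B. \<forall>z. \<bar>pderiv_dir b f z\<bar> \<le> B" by (metis test_functions_bounded pm)
  then obtain B where B: "\<And>b z. b \<in> Basis ==> \<bar>pderiv_dir b f z\<bar> \<le> B b" by metis
  obtain L where L: "L \<ge> 0" "\<And>z w. \<bar>f z - f w\<bar> \<le> L * norm (z - w)" by (rule test_functions_lipschitz[OF f], rule that, assumption+)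
  obtain R where R: "\<And>z. f z \<noteq> 0 ==> norm z \<le> R" using f unfolding test_functions_iff by blast
  \<comment> \<open>Bounds the remainder divided by the norm of the increment: the Lipschitz
    constant is for the difference, the sum of the \<open>B b\<close> for the linear part.\<close>
  define M where "M = L + (\<Sum>b\<in>Basis. B b)"
  have lin: "pderiv_dir v f y = (\<Sum>b\<in>Basis. (v \<bullet> b) * pderiv_dir b f y)" for v y by (rule pderiv_dir_Basis_sum[OF s])
  have D: "?D v = (LBINT w. E w * pderiv_dir v f (z + w))" for v
  proof -
    have "?D v = (\<Sum>b\<in>Basis. (LBINT w. (v \<bullet> b) * (E w * pderiv_dir b f (z + w))))" by simp
    also have "... = (LBINT w. (\<Sum>b\<in>Basis. (v \<bullet> b) * (E w * pderiv_dir b f (z + w))))"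
      by (intro Bochner_Integration.integral_sum[symmetric] integrable_mult_right int pm)
    also have "... = (LBINT w. E w * pderiv_dir v f (z + w))"
      unfolding lin[of v] by (intro Bochner_Integration.integral_cong refl) (simp add: sum_distrib_left mult_ac)
    finally show ?thesis .
  qed
  have intD: "integrable lborel (\<lambda>w. E w * pderiv_dir v f (z + w))" for v
  proof -
    have "integrable lborel (\<lambda>w. \<Sum>b\<in>Basis. (v \<bullet> b) * (E w * pderiv_dir b f (z + w)))"
      by (intro Bochner_Integration.integrable_sum integrable_mult_right int pm)
    then show ?thesis unfolding lin[of v] by (simp add: sum_distrib_left mult_ac)
  qed
  have lim0: "(\<lambda>n. norm (?p (z + h n) - ?p z - ?D (h n)) / norm (h n)) \<longlonglongrightarrow> 0" if h: "\<And>n. h n \<noteq> 0" "h \<longlonglongrightarrow> 0" for h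
  proof -
    obtain H where H: "\<And>n. norm (h n) \<le> H" using convergent_imp_Bseq[of h] h(2) unfolding Bseq_def convergent_def by blast
    define q where "q n w = (f (z + w + h n) - f (z + w) - pderiv_dir (h n) f (z + w)) / norm (h n)" for n w
    have e: "(?p (z + h n) - ?p z - ?D (h n)) / norm (h n) = (LBINT w. E w * q n w)" for n
    proof -
      have "?p (z + h n) - ?p z - ?D (h n) = (LBINT w. E w * f (z + h n + w) - E w * f (z + w) - E w * pderiv_dir (h n) f (z + w))"
        unfolding D by (simp add: int[OF f] intD)
      then have "(?p (z + h n) - ?p z - ?D (h n)) / norm (h n)
        = (LBINT w. (E w * f (z + h n + w) - E w * f (z + w) - E w * pderiv_dir (h n) f (z + w)) / norm (h n))" by simp
      also have "... = (LBINT w. E w * q n w)" unfolding q_def by (intro Bochner_Integration.integral_cong refl) (simp add: algebra_simps)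
      finally show ?thesis .
    qed
    define S where "S = cball (0::'a) (R + norm z + H)"
    have "(\<lambda>n. LBINT w. E w * q n w) \<longlonglongrightarrow> (\<integral>w. 0 \<partial>(lborel :: 'a measure))"
    proof (rule integral_dominated_convergence[where w="\<lambda>w. M * \<bar>indicator S w *\<^sub>R E w\<bar>"])
      have "set_integrable lborel S E" using E unfolding locally_integrable_def S_def by simp
      then show "integrable lborel (\<lambda>w. M * \<bar>indicator S w *\<^sub>R E w\<bar>)" unfolding set_integrable_def by simp
      show "AE w in lborel. (\<lambda>n. E w * q n w) \<longlonglongrightarrow> 0"
      proof (intro AE_I2 tendsto_mult_right_zero)
        fix w
        have "(\<lambda>k. norm (f (z + w + k) - f (z + w) - pderiv_dir k f (z + w)) / norm k) \<midarrow>0\<rightarrow> 0"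
          using smooth_has_derivative[OF s, of "z + w"] unfolding has_derivative_at by blast
        then have "((\<lambda>k. norm (f (z + w + k) - f (z + w) - pderiv_dir k f (z + w)) / norm k) \<circ> h) \<longlonglongrightarrow> 0"
          using h unfolding tendsto_at_iff_sequentially by blast
        then have "(\<lambda>n. \<bar>q n w\<bar>) \<longlonglongrightarrow> 0" unfolding q_def comp_def by simp
        then show "(\<lambda>n. q n w) \<longlonglongrightarrow> 0" by (rule tendsto_rabs_zero_cancel)
      qed
      show "AE w in lborel. norm (E w * q n w) \<le> M * \<bar>indicator S w *\<^sub>R E w\<bar>" for n
      proof (intro AE_I2)
        fix w
        have hn: "norm (h n) > 0" using h by simp
        have "\<bar>pderiv_dir (h n) f (z + w)\<bar> \<le> (\<Sum>b\<in>Basis. \<bar>h n \<bullet> b\<bar> * \<bar>pderiv_dir b f (z + w)\<bar>)"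
          unfolding lin[of "h n"] by (simp add: order_trans[OF sum_abs] abs_mult)
        also have "... \<le> (\<Sum>b\<in>Basis. norm (h n) * B b)" by (intro sum_mono mult_mono B) (auto simp: Basis_le_norm)
        finally have 1: "\<bar>pderiv_dir (h n) f (z + w)\<bar> \<le> norm (h n) * (\<Sum>b\<in>Basis. B b)" by (simp add: sum_distrib_left)
        have 2: "\<bar>f (z + w + h n) - f (z + w)\<bar> \<le> L * norm (h n)" using L(2)[of "z + w + h n" "z + w"] by simp
        have "\<bar>f (z + w + h n) - f (z + w) - pderiv_dir (h n) f (z + w)\<bar> \<le> M * norm (h n)" using 1 2 unfolding M_def by (simp add: algebra_simps)
        then have 3: "\<bar>q n w\<bar> \<le> M" unfolding q_def using hn by (simp add: divide_simps)
        have 4: "q n w = 0" if "w \<notin> S"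
        proof -
          have w: "norm w > R + norm z + norm (h n)" using that H[of n] unfolding S_def by simp
          have "norm w \<le> norm (z + w) + norm z" using norm_triangle_ineq4[of "z + w" z] by simp
          then have zw: "norm (z + w) > R" using w norm_ge_zero[of "h n"] by linarith
          have "norm (z + w) \<le> norm (z + w + h n) + norm (h n)" using norm_triangle_ineq4[of "z + w + h n" "h n"] by simp
          then have "norm (z + w + h n) > R" using w \<open>norm w \<le> norm (z + w) + norm z\<close> by simp
          then have a: "f (z + w + h n) = 0" using R by fastforce
          have "pderiv_dir b f (z + w) = 0" for b by (rule pderiv_dir_zero_open[of "- cball 0 R"]) (use R zw in \<open>auto simp: not_le, fastforce\<close>)
          then show ?thesis unfolding q_def using a R[of "z + w"] zw by auto
        qed
        show "norm (E w * q n w) \<le> M * \<bar>indicator S w *\<^sub>R E w\<bar>"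
          using 4 mult_right_mono[OF 3, of "\<bar>E w\<bar>"] by (cases "w \<in> S") (simp_all add: abs_mult mult.commute)
      qed
      have "(\<lambda>w. pderiv_dir (h n) f (z + w)) \<in> borel_measurable lborel" for n unfolding lin[of "h n"] using test_functions_borel[OF pm] by simp
      then show "(\<lambda>w. E w * q n w) \<in> borel_measurable lborel" for n unfolding q_def by simp
    qed simp
    then have "(\<lambda>n. \<bar>(?p (z + h n) - ?p z - ?D (h n)) / norm (h n)\<bar>) \<longlonglongrightarrow> 0"
      unfolding e by (simp only: Bochner_Integration.integral_zero tendsto_rabs_zero)
    then show ?thesis by simp
  qed
  have "(\<lambda>h. norm (?p (z + h) - ?p z - ?D h) / norm h) \<midarrow>0\<rightarrow> 0" unfolding tendsto_at_iff_sequentially comp_def using lim0 by simp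
  moreover have "bounded_linear ?D" by (intro bounded_linear_sum bounded_linear_mult_const bounded_linear_inner_left)
  ultimately show ?thesis unfolding has_derivative_at by blast
qed

lemma pderiv_dir_convolution:
  fixes E f :: "'a::euclidean_space => real"
  assumes "locally_integrable E" "f \<in> test_functions" "b \<in> Basis"
  shows "pderiv_dir b (\<lambda>z. LBINT w. E w * f (z + w)) = (\<lambda>z. LBINT w. E w * pderiv_dir b f (z + w))"
proof
  fix z
  have "(\<Sum>c\<in>Basis. (b \<bullet> c) * (LBINT w. E w * pderiv_dir c f (z + w))) = (\<Sum>c\<in>Basis. if c = b then (LBINT w. E w * pderiv_dir c f (z + w)) else 0)"
    using assms(3) by (intro sum.cong) (auto simp: inner_Basis)
  then show "pderiv_dir b (\<lambda>z. LBINT w. E w * f (z + w)) z = (LBINT w. E w * pderiv_dir b f (z + w))"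
    using pderiv_dir_eqI[OF convolution_has_derivative[OF assms(1,2)]] assms(3) by simp
qed

lemma smooth_convolution:
  fixes E h :: "'a::euclidean_space => real"
  assumes "locally_integrable E" "h \<in> test_functions"
  shows "smooth (\<lambda>z. LBINT w. E w * h (z + w))"
proof (rule smooth_coinduct[where P="\<lambda>f. \<exists>h\<in>test_functions. f = (\<lambda>z. LBINT w. E w * h (z + w))"])
  show "\<exists>h'\<in>test_functions. (\<lambda>z. LBINT w. E w * h (z + w)) = (\<lambda>z. LBINT w. E w * h' (z + w))" using assms(2) by blast
next
  fix g and z assume "\<exists>h\<in>test_functions. g = (\<lambda>z. LBINT w. E w * h (z + w))"
  then obtain h where h: "h \<in> test_functions" "g = (\<lambda>z. LBINT w. E w * h (z + w))" by (rule bexE)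
  show "g differentiable (at z)" unfolding h(2) by (rule differentiableI[OF convolution_has_derivative[OF assms(1) h(1)]])
next
  fix g and b :: 'a assume g: "\<exists>h\<in>test_functions. g = (\<lambda>z. LBINT w. E w * h (z + w))" and b: "b \<in> Basis"
  from g obtain h where h: "h \<in> test_functions" "g = (\<lambda>z. LBINT w. E w * h (z + w))" by (rule bexE)
  show "\<exists>h\<in>test_functions. pderiv_dir b g = (\<lambda>z. LBINT w. E w * h (z + w))"
    unfolding h(2) by (rule bexI, rule pderiv_dir_convolution[OF assms(1) h(1) b], rule test_functions_pderiv[OF h(1) b])
qed

lemma wave_op_convolution:
  fixes E f :: "real \<times> (real^'n) => real"
  assumes E: "locally_integrable E" and f: "f \<in> test_functions"
  shows "wave_op (\<lambda>z. LBINT w. E w * f (z + w)) z = (LBINT w. E w * wave_op f (z + w))"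
proof -
  have 2: "pderiv_dir v (pderiv_dir v (\<lambda>z. LBINT w. E w * f (z + w))) z = (LBINT w. E w * pderiv_dir v (pderiv_dir v f) (z + w))" if "v \<in> Basis" for v
    using pderiv_dir_convolution[OF E f that] pderiv_dir_convolution[OF E test_functions_pderiv[OF f that] that] by simp
  have int: "integrable lborel (\<lambda>w. E w * pderiv_dir v (pderiv_dir v f) (z + w))" if "v \<in> Basis" for v
    by (intro test_functions_locally_integrable_mult[OF E] test_functions_shift test_functions_pderiv f that)
  have "(LBINT w. E w * wave_op f (z + w)) = (\<integral>w. E w * pderiv_dir (1, 0) (pderiv_dir (1, 0) f) (z + w)
      - (\<Sum>i\<in>UNIV. E w * pderiv_dir (0, axis i 1) (pderiv_dir (0, axis i 1) f) (z + w)) \<partial>lborel)"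
    unfolding wave_op_def by (simp only: right_diff_distrib sum_distrib_left)
  also have "... = (LBINT w. E w * pderiv_dir (1, 0) (pderiv_dir (1, 0) f) (z + w))
      - (\<Sum>i\<in>UNIV. (LBINT w. E w * pderiv_dir (0, axis i 1) (pderiv_dir (0, axis i 1) f) (z + w)))"
    by (subst Bochner_Integration.integral_diff, rule int[OF time_Basis],
        rule Bochner_Integration.integrable_sum, rule int[OF space_Basis],
        subst Bochner_Integration.integral_sum, rule int[OF space_Basis], rule refl)
  also have "... = wave_op (\<lambda>z. LBINT w. E w * f (z + w)) z" unfolding wave_op_def 2[OF time_Basis] 2[OF space_Basis] ..
  finally show ?thesis ..
qed

text \<open>This is the uniqueness of the fundamental solution for d \<le> 2. The potential
  \<open>g\<close> of \<open>f\<close> under the explicit kernel solves the wave equation with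
  source \<open>f\<close>. A cut-off in the past makes it a test function, and
  \<open>wave_potential_local\<close> at the origin then identifies \<rho>.\<close>

lemma wave_kernel_represents:
  fixes \<rho> :: "(real \<times> (real^'n) => real) => real"
  assumes \<rho>: "wave_fundamental_solution \<rho>" and n: "CARD('n) \<le> 2"
  shows "represented_by \<rho> wave_kernel" unfolding represented_by_def
proof (intro conjI ballI)
  show E: "locally_integrable (wave_kernel :: real \<times> (real^'n) => real)" by (rule wave_kernel_locally_integrable[OF n])
  fix f :: "real \<times> (real^'n) => real" assume f: "f \<in> test_functions"
  define g where "g z = (LBINT w. wave_kernel w * f (z + w))" for z
  have g: "smooth g" unfolding g_def by (rule smooth_convolution[OF E f])
  have w: "wave_op g z = f z" for z
  proof -
    have "wave_op g z = (LBINT w. wave_kernel w * wave_op f (z + w))" unfolding g_def by (rule wave_op_convolution[OF E f])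
    also have "... = (LBINT w. wave_kernel w * wave_op (\<lambda>w. f (z + w)) w)" unfolding wave_op_shift ..
    also have "... = f (z + 0)" by (rule wave_kernel_fundamental[OF n test_functions_shift[OF f]])
    finally show ?thesis by simp
  qed
  obtain R where R: "\<And>z. f z \<noteq> 0 ==> norm z \<le> R" using f unfolding test_functions_iff by blast
  \<comment> \<open>The support of \<open>g\<close> is bounded only for times bounded from below.
    The cut-off takes place between times -2 and -1 and leaves the forward cone of the origin
    untouched.\<close>
  define e where "e z = 1 - smooth_step (- 2) (- 1) (fst z)" for z :: "real \<times> (real^'n)"
  have e: "smooth e" unfolding e_def by (intro smooth_diff smooth_const smooth_time_step) simp
  \<comment> \<open>R + 2 (R + 2) = 3 R + 4: a point w of the cone with z + w in the support of
    \<open>f\<close> has a time of at most R + 2, hence a norm of at most twice that.\<close>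
  have nz: "norm z \<le> 3 * \<bar>R\<bar> + 4" if "e z * g z \<noteq> 0" for z
  proof (rule ccontr)
    assume far: "\<not> norm z \<le> 3 * \<bar>R\<bar> + 4"
    have t: "fst z \<ge> - 2"
    proof (rule ccontr)
      assume "\<not> fst z \<ge> - 2"
      then have "e z = 0" unfolding e_def by (simp add: smooth_step_1)
      then show False using that by simp
    qed
    have "wave_kernel w * f (z + w) = 0" for w
    proof (rule ccontr)
      assume a: "wave_kernel w * f (z + w) \<noteq> 0"
      then have c: "norm (snd w) < fst w" using wave_kernel_outside[of w] by auto
      have r: "norm (z + w) \<le> R" using a R[of "z + w"] by simp
      have "\<bar>fst (z + w)\<bar> \<le> R" using norm_fst_le[of "fst (z + w)" "snd (z + w)"] r by (simp only: prod.collapse real_norm_def)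
      then have fw: "fst w \<le> R + 2" using t by simp
      have "norm z \<le> norm (z + w) + norm w" using norm_triangle_ineq4[of "z + w" w] by simp
      moreover have "norm w \<le> \<bar>fst w\<bar> + norm (snd w)" using norm_Pair_le[of "fst w" "snd w"] by simp
      moreover have "\<bar>fst w\<bar> = fst w" using c norm_ge_zero[of "snd w"] by linarith
      ultimately have "norm z \<le> R + 2 * (R + 2)" using c r fw by argo
      moreover have "R + 2 \<ge> 0" using c fw norm_ge_zero[of "snd w"] by linarith
      ultimately show False using far by simp
    qed
    then have "g z = 0" unfolding g_def by (simp only: Bochner_Integration.integral_zero)
    then show False using that by simp
  qed
  have \<chi>: "(\<lambda>z. e z * g z) \<in> test_functions" unfolding test_functions_iff using smooth_mult[OF e g] nz by blast
  have "conv_check f \<rho> 0 = e 0 * g 0"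
  proof (rule wave_potential_local[OF \<rho> f \<chi>, where U="{0}" and V="{z. fst z > - 1}"])
    show op: "open {z::real \<times> (real^'n). fst z > - 1}" by (intro open_Collect_less continuous_intros)
    show "y + w \<in> {z. fst z > - 1}" if "y \<in> {0}" "norm (snd w) \<le> fst w" for y w using that norm_ge_zero[of "snd w"] by (simp del: norm_ge_zero)
    fix z :: "real \<times> (real^'n)" assume z: "z \<in> {z. fst z > - 1}"
    have "wave_op (\<lambda>z. e z * g z) z = wave_op g z" by (rule wave_op_cong_open[OF op z]) (simp add: e_def smooth_step_0)
    then show "wave_op (\<lambda>z. e z * g z) z = f z" using w by simp
  qed simp
  then show "\<rho> f = (LBINT z. wave_kernel z * f z)" unfolding conv_check_def g_def e_def by (simp add: smooth_step_0)
qed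

section \<open>Truncated moments of the noise\<close>

text \<open>Odd, so that truncation preserves symmetry. Large values are dropped rather than
  clipped, which makes the moments those of \<open>stable_rv_truncated_moment\<close>.\<close>

definition truncate :: "real => real => real" where
  "truncate r x = (if \<bar>x\<bar> \<le> r then x else 0)"

lemma truncate_measurable [measurable]: "truncate r \<in> borel_measurable borel" unfolding truncate_def by simp

lemma truncate_minus: "truncate r (- x) = - truncate r x" unfolding truncate_def by simp

context prob_space begin

lemma nn_integral_flip_one_coordinate:
  fixes V :: "'i => 'a => real"
  assumes ind: "indep_vars (\<lambda>_. borel) V I" and j: "j \<in> I"
    and sym: "distr M borel (\<lambda>x. - V j x) = distr M borel (V j)"
    and F: "F \<in> borel_measurable (\<Pi>\<^sub>M i\<in>I. borel)"
  shows "(\<integral>\<^sup>+x. F (\<lambda>i\<in>I. V i x) \<partial>M) = (\<integral>\<^sup>+x. F (\<lambda>i\<in>I. if i = j then - V i x else V i x) \<partial>M)"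
proof -
  let ?V = "\<lambda>i x. if i = j then - V i x else V i x"
  have rv: "V i \<in> borel_measurable M" if "i \<in> I" for i using ind that unfolding indep_vars_def2 by blast
  have "(\<lambda>x. \<lambda>i\<in>I. V i x) \<in> measurable M (\<Pi>\<^sub>M i\<in>I. borel)" "(\<lambda>x. \<lambda>i\<in>I. ?V i x) \<in> measurable M (\<Pi>\<^sub>M i\<in>I. borel)"
    by (intro measurable_restrict; use rv in auto)+
  from this[THEN nn_integral_distr, of F] show ?thesis using F by (simp add: flip_one_coordinate[OF ind j sym])
qed

text \<open>The von Bahr--Esseen inequality. For symmetric summands it has constant 1, for by flipping the
  sign of one summand it reduces to Clarkson's inequality.\<close>

lemma truncated_sum_moment:
  fixes V :: "'i => 'a => real"
  assumes ind: "indep_vars (\<lambda>_. borel) V I" and I: "finite I"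
    and sym: "\<And>j. j \<in> I ==> distr M borel (\<lambda>x. - V j x) = distr M borel (V j)"
    and p: "0 < p" "p \<le> 2"
  shows "(\<integral>\<^sup>+x. ennreal (\<bar>\<Sum>i\<in>I. c i * truncate r (V i x)\<bar> powr p) \<partial>M)
    \<le> (\<Sum>i\<in>I. ennreal (\<bar>c i\<bar> powr p) * (\<integral>\<^sup>+x. ennreal (\<bar>truncate r (V i x)\<bar> powr p) \<partial>M))"
proof -
  have rv: "V i \<in> borel_measurable M" if "i \<in> I" for i using ind that unfolding indep_vars_def2 by blast
  define S where "S T x = (\<Sum>i\<in>T. c i * truncate r (V i x))" for T x
  have Sm: "S T \<in> borel_measurable M" if "T \<subseteq> I" for T
    unfolding S_def using that by (intro borel_measurable_sum borel_measurable_times measurable_compose[OF rv truncate_measurable]) auto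
  have "(\<integral>\<^sup>+x. ennreal (\<bar>S T x\<bar> powr p) \<partial>M) \<le> (\<Sum>i\<in>T. ennreal (\<bar>c i\<bar> powr p) * (\<integral>\<^sup>+x. ennreal (\<bar>truncate r (V i x)\<bar> powr p) \<partial>M))"
    if "T \<subseteq> I" for T using finite_subset[OF that I] that
  proof (induction T rule: finite_induct)
    case empty
    then show ?case unfolding S_def by simp
  next
    case (insert j T)
    then have j: "j \<in> I" "T \<subseteq> I" by auto
    define U where "U x = c j * truncate r (V j x)" for x
    have [measurable]: "S T \<in> borel_measurable M" "U \<in> borel_measurable M" using Sm[OF j(2)] rv[OF j(1)] unfolding U_def by auto
    have ST: "S (insert j T) x = S T x + U x" for x using insert.hyps unfolding S_def U_def by simp
    define F where "F v = ennreal (\<bar>(\<Sum>i\<in>T. c i * truncate r (v i)) + c j * truncate r (v j)\<bar> powr p)" for v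
    have cm: "(\<lambda>v. truncate r (v i)) \<in> borel_measurable (\<Pi>\<^sub>M i\<in>I. borel)" if "i \<in> I" for i
      by (rule measurable_compose[OF measurable_component_singleton[OF that] truncate_measurable])
    have "(\<lambda>v. \<Sum>i\<in>T. c i * truncate r (v i)) \<in> borel_measurable (\<Pi>\<^sub>M i\<in>I. borel)" using j by (intro borel_measurable_sum cm) auto
    moreover note cm[OF j(1), measurable]
    ultimately have F: "F \<in> borel_measurable (\<Pi>\<^sub>M i\<in>I. borel)" unfolding F_def by simp
    have F1: "F (\<lambda>i\<in>I. V i x) = ennreal (\<bar>S T x + U x\<bar> powr p)" for x
    proof -
      have "(\<Sum>i\<in>T. c i * truncate r ((\<lambda>i\<in>I. V i x) i)) = S T x" unfolding S_def using j by (intro sum.cong) auto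
      then show ?thesis unfolding F_def U_def using j by simp
    qed
    have F2: "F (\<lambda>i\<in>I. if i = j then - V i x else V i x) = ennreal (\<bar>S T x - U x\<bar> powr p)" for x
    proof -
      have "(\<Sum>i\<in>T. c i * truncate r ((\<lambda>i\<in>I. if i = j then - V i x else V i x) i)) = S T x"
        unfolding S_def using j insert.hyps by (intro sum.cong) auto
      then show ?thesis unfolding F_def U_def using j by (simp add: truncate_minus)
    qed
    have eq: "(\<integral>\<^sup>+x. ennreal (\<bar>S T x + U x\<bar> powr p) \<partial>M) = (\<integral>\<^sup>+x. ennreal (\<bar>S T x - U x\<bar> powr p) \<partial>M)"
      using nn_integral_flip_one_coordinate[OF ind j(1) sym[OF j(1)] F] unfolding F1 F2 .
    have "2 * (\<integral>\<^sup>+x. ennreal (\<bar>S T x + U x\<bar> powr p) \<partial>M)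
      = (\<integral>\<^sup>+x. ennreal (\<bar>S T x + U x\<bar> powr p) \<partial>M) + (\<integral>\<^sup>+x. ennreal (\<bar>S T x - U x\<bar> powr p) \<partial>M)" by (simp only: eq mult_2)
    also have "... = (\<integral>\<^sup>+x. ennreal (\<bar>S T x + U x\<bar> powr p) + ennreal (\<bar>S T x - U x\<bar> powr p) \<partial>M)" by (rule nn_integral_add[symmetric]) measurable
    also have "... \<le> (\<integral>\<^sup>+x. 2 * (ennreal (\<bar>S T x\<bar> powr p) + ennreal (\<bar>U x\<bar> powr p)) \<partial>M)"
    proof (rule nn_integral_mono)
      fix x
      have "ennreal (\<bar>S T x + U x\<bar> powr p) + ennreal (\<bar>S T x - U x\<bar> powr p) = ennreal (\<bar>S T x + U x\<bar> powr p + \<bar>S T x - U x\<bar> powr p)" by simp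
      also have "... \<le> ennreal (2 * (\<bar>S T x\<bar> powr p + \<bar>U x\<bar> powr p))" by (rule ennreal_leI[OF powr_clarkson[OF p]])
      also have "... = 2 * (ennreal (\<bar>S T x\<bar> powr p) + ennreal (\<bar>U x\<bar> powr p))" by (simp add: ennreal_numeral_mult)
      finally show "ennreal (\<bar>S T x + U x\<bar> powr p) + ennreal (\<bar>S T x - U x\<bar> powr p) \<le> 2 * (ennreal (\<bar>S T x\<bar> powr p) + ennreal (\<bar>U x\<bar> powr p))" .
    qed
    also have "... = 2 * ((\<integral>\<^sup>+x. ennreal (\<bar>S T x\<bar> powr p) \<partial>M) + (\<integral>\<^sup>+x. ennreal (\<bar>U x\<bar> powr p) \<partial>M))"
      by (subst nn_integral_cmult, measurable, subst nn_integral_add, measurable)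
    finally have le: "(\<integral>\<^sup>+x. ennreal (\<bar>S T x + U x\<bar> powr p) \<partial>M) \<le> (\<integral>\<^sup>+x. ennreal (\<bar>S T x\<bar> powr p) \<partial>M) + (\<integral>\<^sup>+x. ennreal (\<bar>U x\<bar> powr p) \<partial>M)"
      by (subst (asm) ennreal_mult_le_mult_iff) auto
    have U: "(\<integral>\<^sup>+x. ennreal (\<bar>U x\<bar> powr p) \<partial>M) = ennreal (\<bar>c j\<bar> powr p) * (\<integral>\<^sup>+x. ennreal (\<bar>truncate r (V j x)\<bar> powr p) \<partial>M)"
    proof -
      have "(\<lambda>x. truncate r (V j x)) \<in> borel_measurable M" by (rule measurable_compose[OF rv[OF j(1)] truncate_measurable])
      then show ?thesis unfolding U_def by (subst nn_integral_cmult[symmetric]) (auto simp: abs_mult powr_mult ennreal_mult)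
    qed
    have "(\<integral>\<^sup>+x. ennreal (\<bar>S (insert j T) x\<bar> powr p) \<partial>M)
      \<le> (\<Sum>i\<in>T. ennreal (\<bar>c i\<bar> powr p) * (\<integral>\<^sup>+x. ennreal (\<bar>truncate r (V i x)\<bar> powr p) \<partial>M))
        + ennreal (\<bar>c j\<bar> powr p) * (\<integral>\<^sup>+x. ennreal (\<bar>truncate r (V j x)\<bar> powr p) \<partial>M)"
      unfolding ST using order_trans[OF le add_mono[OF insert.IH[OF j(2)] eq_refl[OF U]]] .
    then show ?case by (simp only: sum.insert[OF insert.hyps] add.commute)
  qed
  from this[OF order_refl] show ?thesis unfolding S_def .
qed

lemma stable_rv_truncate_moment:
  assumes X: "stable_rv M \<alpha> a X" and \<alpha>: "0 < \<alpha>" "\<alpha> < 2" and p: "\<alpha> < p" and R: "0 < R"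
  shows "(\<integral>\<^sup>+x. ennreal (\<bar>truncate R (X x)\<bar> powr p) \<partial>M) \<le> ennreal (8 * 2 powr \<alpha> / (1 - 2 powr (\<alpha> - p)) * R powr (p - \<alpha>) * a)"
proof -
  have "(\<integral>\<^sup>+x. ennreal (\<bar>truncate R (X x)\<bar> powr p) \<partial>M) = (\<integral>\<^sup>+x. ennreal (\<bar>X x\<bar> powr p) * indicator {x. \<bar>X x\<bar> \<le> R} x \<partial>M)"
    by (intro nn_integral_cong) (auto simp: truncate_def)
  then show ?thesis using stable_rv_truncated_moment[OF assms] by simp
qed

end

context stable_noise begin

abbreviation moment_const :: "real => real" where
  "moment_const p \<equiv> 8 * 2 powr \<alpha> / (1 - 2 powr (\<alpha> - p))"

text \<open>Here the order p > \<alpha> pays off: the moment is controlled by the integral of the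
  p-th power of the coefficient function, and the partition enters through this integral
  only.\<close>

lemma truncated_cell_moment:
  assumes t: "labelling t" and L: "finite L" "\<And>l. l \<in> L ==> cell t l \<in> finite_borel"
    and p: "\<alpha> < p" "p \<le> 2" and R: "0 < R"
  shows "(\<integral>\<^sup>+x. ennreal (\<bar>\<Sum>l\<in>L. c l * truncate R (W (cell t l) x)\<bar> powr p) \<partial>M)
    \<le> ennreal (moment_const p * R powr (p - \<alpha>) * (\<Sum>l\<in>L. \<bar>c l\<bar> powr p * measure lborel (cell t l)))"
proof -
  have C: "0 \<le> moment_const p"
  proof -
    have "2 powr (\<alpha> - p) \<le> 2 powr 0" using p by (intro powr_mono) auto
    then show ?thesis by simp
  qed
  have "(\<integral>\<^sup>+x. ennreal (\<bar>\<Sum>l\<in>L. c l * truncate R (W (cell t l) x)\<bar> powr p) \<partial>M)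
    \<le> (\<Sum>l\<in>L. ennreal (\<bar>c l\<bar> powr p) * (\<integral>\<^sup>+x. ennreal (\<bar>truncate R (W (cell t l) x)\<bar> powr p) \<partial>M))"
    using p \<alpha> by (intro truncated_sum_moment W_indep L disjoint_cells stable_rv_symmetric[OF W_stable]) auto
  also have "... \<le> (\<Sum>l\<in>L. ennreal (\<bar>c l\<bar> powr p) * ennreal (moment_const p * R powr (p - \<alpha>) * measure lborel (cell t l)))"
    by (intro sum_mono mult_left_mono stable_rv_truncate_moment[OF W_stable \<alpha> p(1) R] L) auto
  also have "... = (\<Sum>l\<in>L. ennreal (moment_const p * R powr (p - \<alpha>) * (\<bar>c l\<bar> powr p * measure lborel (cell t l))))"
    by (intro sum.cong refl) (simp add: ennreal_mult'[symmetric] mult_ac)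
  also have "... = ennreal (\<Sum>l\<in>L. moment_const p * R powr (p - \<alpha>) * (\<bar>c l\<bar> powr p * measure lborel (cell t l)))"
    using C by (intro sum_ennreal mult_nonneg_nonneg) auto
  finally show ?thesis by (simp add: sum_distrib_left)
qed

text \<open>Passes from the p-th to the first moment, with a free parameter d in place of Hoelder's
  inequality.\<close>

lemma abs_le_small_add_powr:
  fixes x d p :: real
  assumes "0 < d" "1 \<le> p" shows "\<bar>x\<bar> \<le> d + d powr (1 - p) * \<bar>x\<bar> powr p"
proof (cases "\<bar>x\<bar> \<le> d")
  case True
  have "0 \<le> d powr (1 - p) * \<bar>x\<bar> powr p" by simp
  then show ?thesis using True by linarith
next
  case False
  then have x: "\<bar>x\<bar> > d" "\<bar>x\<bar> > 0" using assms by auto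
  have "\<bar>x\<bar> = \<bar>x\<bar> powr (1 - p) * \<bar>x\<bar> powr p" by (simp add: powr_add[symmetric])
  also have "... \<le> d powr (1 - p) * \<bar>x\<bar> powr p" using x assms by (intro mult_right_mono powr_mono2') auto
  finally show ?thesis using assms by simp
qed

text \<open>A union bound. The tail bound for the noise of a cell is linear in its measure, so the
  sum over disjoint cells is controlled by the measure of \<open>D\<close>, however fine the
  partition is.\<close>

lemma some_cell_large:
  assumes t: "labelling t" and L: "finite L" "\<And>l. l \<in> L ==> cell t l \<subseteq> D" and D: "D \<in> finite_borel" and r: "0 < r"
  shows "prob {x\<in>space M. \<exists>l\<in>L. \<bar>W (cell t l) x\<bar> > r} \<le> 8 * (measure lborel D * r powr -\<alpha>)"
proof -
  have cb: "cell t l \<in> sets borel" for l using t unfolding labelling_def by blast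
  have fb: "cell t l \<in> finite_borel" if "l \<in> L" for l using finite_borel_subset[OF D cb L(2)[OF that]] .
  have cf: "emeasure lborel (cell t l) \<noteq> \<infinity>" if "l \<in> L" for l using finite_borelD(3)[OF fb[OF that]] by simp
  have Db: "D \<in> sets borel" "emeasure lborel D < \<infinity>" using D finite_borelD by auto
  have [measurable]: "W (cell t l) \<in> borel_measurable M" if "l \<in> L" for l using W_measurable[OF fb[OF that]] .
  have "prob {x\<in>space M. \<exists>l\<in>L. \<bar>W (cell t l) x\<bar> > r} = prob (\<Union>l\<in>L. {x\<in>space M. \<bar>W (cell t l) x\<bar> > r})" by (rule arg_cong[where f=prob]) auto
  also have "... \<le> (\<Sum>l\<in>L. prob {x\<in>space M. \<bar>W (cell t l) x\<bar> > r})" by (intro finite_measure_subadditive_finite L) auto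
  also have "... \<le> (\<Sum>l\<in>L. 8 * (measure lborel (cell t l) * r powr -\<alpha>))" by (intro sum_mono stable_rv_tail[OF W_stable[OF fb] \<alpha> r])
  also have "... = 8 * ((\<Sum>l\<in>L. measure lborel (cell t l)) * r powr -\<alpha>)" by (simp add: sum_distrib_left sum_distrib_right)
  also have "(\<Sum>l\<in>L. measure lborel (cell t l)) = measure lborel (\<Union>l\<in>L. cell t l)"
    by (intro measure_finite_Union[symmetric] L disjoint_cells) (use cb cf in auto)
  also have "... \<le> measure lborel D" by (intro measure_mono_fmeasurable) (use L cb Db in \<open>auto simp: fmeasurable_def intro!: sets.finite_UN\<close>)
  finally show ?thesis by (simp add: mult_right_mono)
qed

text \<open>Off an event of probability r / 2 no cell in \<open>D\<close> carries noise beyond a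
  certain level, and the field agrees with the truncated one. The mean L^1 norm of the latter on
  \<open>K\<close> is small by the moment bound, and Markov's inequality costs another r / 2. The
  bound \<open>e\<close> depends neither on the partition nor on the coefficients.\<close>

lemma cell_field_small:
  fixes K :: "'b::euclidean_space set"
  assumes D: "D \<in> finite_borel" and K: "K \<in> sets borel" "emeasure lborel K < \<infinity>"
    and p: "\<alpha> < p" "1 \<le> p" "p \<le> 2" and r: "0 < r"
  shows "\<exists>e>0. \<forall>t (G :: 'b => 'l => real). labelling t \<and> (\<forall>z. \<forall>l\<in>t ` half_space. G z l \<noteq> 0 --> cell t l \<subseteq> D) \<and>
      (\<forall>l. (\<lambda>z. G z l) \<in> borel_measurable borel) \<and> (\<forall>z\<in>K. stable_norm p (\<lambda>w. G z (t w)) \<le> ennreal e) -->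
    prob {y\<in>space M. ennreal r < (\<integral>\<^sup>+z. indicator K z * ennreal \<bar>cell_integral W t (G z) y\<bar> \<partial>lborel)} \<le> r"
proof -
  define v where "v = measure lborel D"
  define b where "b = measure lborel K"
  have vb: "0 \<le> v" "0 \<le> b" unfolding v_def b_def by auto
  \<comment> \<open>Makes 8 v \<rho>^(-\<alpha>), a bound for the probability that truncation at
    \<rho> changes anything, at most r / 2.\<close>
  define \<rho> where "\<rho> = (r / (16 * (v + 1))) powr (- 1 / \<alpha>)"
  have \<rho>: "\<rho> > 0" unfolding \<rho>_def using r vb by simp
  have \<rho>v: "8 * (v * \<rho> powr -\<alpha>) \<le> r / 2"
  proof -
    have "\<rho> powr -\<alpha> = r / (16 * (v + 1))" unfolding \<rho>_def powr_powr using \<alpha> r vb by simp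
    then have "8 * (v * \<rho> powr -\<alpha>) = r / 2 * (v / (v + 1))" using vb by (simp add: field_simps)
    also have "... \<le> r / 2 * 1" using vb r by (intro mult_left_mono) auto
    finally show ?thesis by simp
  qed
  define C where "C = moment_const p * \<rho> powr (p - \<alpha>)"
  have C: "0 \<le> C"
  proof -
    have "2 powr (\<alpha> - p) \<le> 2 powr 0" using p by (intro powr_mono) auto
    then show ?thesis unfolding C_def by simp
  qed
  \<comment> \<open>A mean of at most 2 d at each z gives at most 2 d b \<le> r^2 / 2 after
    integration over \<open>K\<close>, and r / 2 after division by r in Markov's inequality. The
    choice of \<open>e\<close> below makes the moment term contribute at most d.\<close>
  define d where "d = r\<^sup>2 / (4 * (b + 1))"
  have d: "d > 0" unfolding d_def using r vb by simp
  define e where "e = d / (d powr (1 - p) * C + 1)"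
  have den: "d powr (1 - p) * C + 1 > 0" using C by (simp add: add_nonneg_pos)
  have e: "e > 0" unfolding e_def using d den by simp
  have ed: "d powr (1 - p) * (C * e) \<le> d"
  proof -
    have "d powr (1 - p) * (C * e) = d * ((d powr (1 - p) * C) / (d powr (1 - p) * C + 1))" unfolding e_def by simp
    also have "... \<le> d * 1" using d den C by (intro mult_left_mono) auto
    finally show ?thesis by simp
  qed
  have "prob {y\<in>space M. ennreal r < (\<integral>\<^sup>+z. indicator K z * ennreal \<bar>cell_integral W t (G z) y\<bar> \<partial>lborel)} \<le> r"
    if t: "labelling t" and sub: "\<And>z l. l \<in> t ` half_space ==> G z l \<noteq> 0 ==> cell t l \<subseteq> D"
      and Gm: "\<And>l. (\<lambda>z. G z l) \<in> borel_measurable borel" and small: "\<And>z. z \<in> K ==> stable_norm p (\<lambda>w. G z (t w)) \<le> ennreal e" for t and G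
  proof -
    let ?E = "{y\<in>space M. ennreal r < (\<integral>\<^sup>+z. indicator K z * ennreal \<bar>cell_integral W t (G z) y\<bar> \<partial>lborel)}"
    let ?N = "\<lambda>L z. \<Sum>l\<in>L. \<bar>G z l\<bar> powr p * measure lborel (cell t l)"
    define L where "L = {l \<in> t ` half_space. cell t l \<subseteq> D}"
    have L: "finite L" "\<And>l. l \<in> L ==> cell t l \<subseteq> D" using t unfolding L_def labelling_def by auto
    have cb: "cell t l \<in> sets borel" for l using t unfolding labelling_def by blast
    have fb: "cell t l \<in> finite_borel" if "l \<in> L" for l using finite_borel_subset[OF D cb L(2)[OF that]] .
    have ci: "cell_integral W t (G z) y = (\<Sum>l\<in>L. G z l * W (cell t l) y)" for z y
      unfolding cell_integral_def L_def using t sub unfolding labelling_def by (intro sum.mono_neutral_right) auto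
    define T where "T z y = (\<Sum>l\<in>L. G z l * truncate \<rho> (W (cell t l) y))" for z y
    define J where "J y = (\<integral>\<^sup>+z. indicator K z * ennreal \<bar>T z y\<bar> \<partial>lborel)" for y
    have Tm: "(\<lambda>x. T (fst x) (snd x)) \<in> borel_measurable (lborel \<Otimes>\<^sub>M M)" unfolding T_def
    proof (intro borel_measurable_sum borel_measurable_times)
      fix l assume l: "l \<in> L"
      show "(\<lambda>x. G (fst x) l) \<in> borel_measurable (lborel \<Otimes>\<^sub>M M)" by (rule measurable_compose[OF measurable_fst]) (use Gm in simp)
      show "(\<lambda>x. truncate \<rho> (W (cell t l) (snd x))) \<in> borel_measurable (lborel \<Otimes>\<^sub>M M)"
        by (rule measurable_compose[OF measurable_compose[OF measurable_snd W_measurable[OF fb[OF l]]] truncate_measurable])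
    qed
    have Km: "(\<lambda>x. indicator K (fst x) :: ennreal) \<in> borel_measurable (lborel \<Otimes>\<^sub>M M)" by (rule measurable_compose[OF measurable_fst]) (use K in simp)
    have fm: "(\<lambda>(z, y). indicator K z * ennreal \<bar>T z y\<bar>) \<in> borel_measurable (lborel \<Otimes>\<^sub>M M)" using Tm Km by simp
    interpret P: pair_sigma_finite lborel M ..
    have Jm: "J \<in> borel_measurable M"
    proof -
      have "(\<lambda>(y, z). indicator K z * ennreal \<bar>T z y\<bar>) \<in> borel_measurable (M \<Otimes>\<^sub>M lborel)"
        using measurable_compose[OF measurable_pair_swap' fm] by (simp add: split_beta)
      then show ?thesis unfolding J_def by simp
    qed
    have zT: "(\<integral>\<^sup>+y. ennreal \<bar>T z y\<bar> \<partial>M) \<le> ennreal (2 * d)" if z: "z \<in> K" for z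
    proof -
      have [measurable]: "T z \<in> borel_measurable M" unfolding T_def
        by (intro borel_measurable_sum borel_measurable_times borel_measurable_const measurable_compose[OF W_measurable truncate_measurable] fb)
      have adm: "cell_adm t (G z)" unfolding cell_adm_def using sub fb unfolding L_def by blast
      have "ennreal (?N L z) = stable_norm p (\<lambda>w. G z (t w))"
      proof -
        have "?N L z = ?N (t ` half_space) z" unfolding L_def using t sub[of _ z] p unfolding labelling_def by (intro sum.mono_neutral_left) auto
        then show ?thesis using stable_norm_cells[OF t adm, of p] p by simp
      qed
      also have "... \<le> ennreal e" by (rule small[OF z])
      finally have s: "?N L z \<le> e" using e by simp
      have "(\<integral>\<^sup>+y. ennreal (\<bar>T z y\<bar> powr p) \<partial>M) \<le> ennreal (C * ?N L z)" unfolding T_def C_def by (rule truncated_cell_moment[OF t L(1) fb p(1,3) \<rho>])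
      also have "... \<le> ennreal (C * e)" by (intro ennreal_leI mult_left_mono s C)
      finally have Tp: "(\<integral>\<^sup>+y. ennreal (\<bar>T z y\<bar> powr p) \<partial>M) \<le> ennreal (C * e)" .
      have "(\<integral>\<^sup>+y. ennreal \<bar>T z y\<bar> \<partial>M) \<le> (\<integral>\<^sup>+y. ennreal d + ennreal (d powr (1 - p)) * ennreal (\<bar>T z y\<bar> powr p) \<partial>M)"
      proof (rule nn_integral_mono)
        fix y
        have "ennreal \<bar>T z y\<bar> \<le> ennreal (d + d powr (1 - p) * \<bar>T z y\<bar> powr p)" by (rule ennreal_leI[OF abs_le_small_add_powr[OF d p(2)]])
        also have "... = ennreal d + ennreal (d powr (1 - p)) * ennreal (\<bar>T z y\<bar> powr p)" using d by (simp add: ennreal_mult)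
        finally show "ennreal \<bar>T z y\<bar> \<le> ennreal d + ennreal (d powr (1 - p)) * ennreal (\<bar>T z y\<bar> powr p)" .
      qed
      also have "... = ennreal d + ennreal (d powr (1 - p)) * (\<integral>\<^sup>+y. ennreal (\<bar>T z y\<bar> powr p) \<partial>M)"
        by (subst nn_integral_add, simp, measurable, subst nn_integral_cmult, measurable, simp add: emeasure_space_1)
      also have "... \<le> ennreal d + ennreal (d powr (1 - p)) * ennreal (C * e)" by (intro add_left_mono mult_left_mono Tp) auto
      also have "... = ennreal (d + d powr (1 - p) * (C * e))" using d C e by (simp add: ennreal_mult)
      also have "... \<le> ennreal (2 * d)" using ed by (intro ennreal_leI) simp
      finally show ?thesis .
    qed
    have "(\<integral>\<^sup>+y. J y \<partial>M) = (\<integral>\<^sup>+z. (\<integral>\<^sup>+y. indicator K z * ennreal \<bar>T z y\<bar> \<partial>M) \<partial>lborel)" unfolding J_def using P.Fubini[OF fm] by simp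
    also have "... \<le> (\<integral>\<^sup>+z. ennreal (2 * d) * indicator K z \<partial>lborel)" by (intro nn_integral_mono) (use zT in \<open>auto simp: indicator_def\<close>)
    also have "... = ennreal (2 * d) * emeasure lborel K" using K by (subst nn_integral_cmult_indicator) auto
    also have "... = ennreal (2 * d * b)" unfolding b_def using K d by (simp add: emeasure_eq_ennreal_measure ennreal_mult)
    also have "... \<le> ennreal (r\<^sup>2 / 2)"
    proof (rule ennreal_leI)
      have "2 * d * b = r\<^sup>2 / 2 * (b / (b + 1))" unfolding d_def using vb by (simp add: field_simps)
      also have "... \<le> r\<^sup>2 / 2 * 1" using vb by (intro mult_left_mono) auto
      finally show "2 * d * b \<le> r\<^sup>2 / 2" by simp
    qed
    finally have EJ: "(\<integral>\<^sup>+y. J y \<partial>M) \<le> ennreal (r\<^sup>2 / 2)" .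
    have "emeasure M {y\<in>space M. 1 \<le> ennreal (1 / r) * J y} \<le> ennreal (1 / r) * (\<integral>\<^sup>+y. J y * indicator (space M) y \<partial>M)"
      using Jm by (intro nn_integral_Markov_inequality) auto
    also have "(\<integral>\<^sup>+y. J y * indicator (space M) y \<partial>M) = (\<integral>\<^sup>+y. J y \<partial>M)" by simp
    also have "ennreal (1 / r) * (\<integral>\<^sup>+y. J y \<partial>M) \<le> ennreal (1 / r) * ennreal (r\<^sup>2 / 2)" by (intro mult_left_mono EJ) simp
    also have "... = ennreal (r / 2)" using r by (simp add: ennreal_mult[symmetric] power2_eq_square)
    finally have m: "prob {y\<in>space M. 1 \<le> ennreal (1 / r) * J y} \<le> r / 2" using r by (simp add: emeasure_eq_measure)
    have Jsub: "1 \<le> ennreal (1 / r) * J y" if "ennreal r < J y" for y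
    proof -
      have "1 = ennreal (1 / r) * ennreal r" using r by (simp add: ennreal_mult[symmetric])
      also have "... \<le> ennreal (1 / r) * J y" using that by (intro mult_left_mono) auto
      finally show ?thesis .
    qed
    let ?B = "{y\<in>space M. \<exists>l\<in>L. \<bar>W (cell t l) y\<bar> > \<rho>}" and ?A = "{y\<in>space M. 1 \<le> ennreal (1 / r) * J y}"
    have [measurable]: "W (cell t l) \<in> borel_measurable M" if "l \<in> L" for l using W_measurable[OF fb[OF that]] .
    have Bs: "?B \<in> sets M"
    proof -
      have "?B = (\<Union>l\<in>L. {y\<in>space M. \<bar>W (cell t l) y\<bar> > \<rho>})" by auto
      also have "... \<in> sets M" using L(1) by auto
      finally show ?thesis .
    qed
    have As: "?A \<in> sets M" using Jm by measurable
    have "prob ?E \<le> prob (?B \<union> ?A)"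
    proof (rule finite_measure_mono)
      show "?E \<subseteq> ?B \<union> ?A"
      proof
        fix y assume o: "y \<in> ?E"
        show "y \<in> ?B \<union> ?A"
        proof (cases "y \<in> ?B")
          case False
          then have "truncate \<rho> (W (cell t l) y) = W (cell t l) y" if "l \<in> L" for l using o that unfolding truncate_def by auto
          then have "cell_integral W t (G z) y = T z y" for z unfolding ci T_def by simp
          then have "ennreal r < J y" using o unfolding J_def by simp
          then show ?thesis using Jsub o by blast
        qed blast
      qed
    qed (use As Bs in blast)
    also have "... \<le> prob ?B + prob ?A" by (rule measure_Un_le[OF Bs As])
    also have "... \<le> r / 2 + r / 2" using some_cell_large[OF t L D \<rho>] \<rho>v m unfolding v_def by simp
    finally show ?thesis by simp
  qed
  then show ?thesis using e by (intro exI[of _ e]) blast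
qed

end

section \<open>Approximation of the kernel\<close>

lemma nn_integral_reflect_translate:
  fixes f :: "'a::euclidean_space => ennreal"
  assumes [measurable]: "f \<in> borel_measurable borel"
  shows "(\<integral>\<^sup>+w. f (z - w) \<partial>lborel) = (\<integral>\<^sup>+w. f w \<partial>lborel)" and "(\<integral>\<^sup>+w. f (w - z) \<partial>lborel) = (\<integral>\<^sup>+w. f w \<partial>lborel)"
proof -
  have *: "(\<integral>\<^sup>+w. f w \<partial>lborel) = (\<integral>\<^sup>+w. f (t + c *\<^sub>R w) \<partial>lborel)" if "c = 1 \<or> c = -1" for t and c
  proof -
    have a: "\<bar>c\<bar> = 1" "c \<noteq> 0" using that by auto
    have "lborel = density (distr lborel borel (\<lambda>w::'a. t + c *\<^sub>R w)) (\<lambda>_. 1)" using lborel_affine[OF a(2), of t] a by simp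
    then have "(\<integral>\<^sup>+w. f w \<partial>lborel) = (\<integral>\<^sup>+w. f w \<partial>distr lborel borel (\<lambda>w::'a. t + c *\<^sub>R w))" by (metis density_1)
    also have "... = (\<integral>\<^sup>+w. f (t + c *\<^sub>R w) \<partial>lborel)" by (rule nn_integral_distr) measurable
    finally show ?thesis .
  qed
  show "(\<integral>\<^sup>+w. f (z - w) \<partial>lborel) = (\<integral>\<^sup>+w. f w \<partial>lborel)" using *[of "-1" z] by simp
  show "(\<integral>\<^sup>+w. f (w - z) \<partial>lborel) = (\<integral>\<^sup>+w. f w \<partial>lborel)" using *[of 1 "- z"] by simp
qed

text \<open>Points of \<open>D\<close> are labelled by the first ball of a finite cover that
  contains them, all others by \<open>N\<close>; the centres serve as representatives of the
  cells.\<close>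

lemma compact_labels:
  fixes D :: "'a::euclidean_space set"
  assumes D: "compact D" and d: "0 < d"
  obtains t :: "'a => nat" and c N where "\<And>w. w \<in> D ==> t w < N \<and> dist (c (t w)) w < d"
    "\<And>w. w \<notin> D ==> t w = N" "\<And>i. i < N ==> c i \<in> D" "\<And>i. {w. t w = i} \<in> sets borel"
proof -
  obtain k where k: "finite k" "k \<subseteq> D" "D \<subseteq> (\<Union>x\<in>k. ball x d)" using compactE_image[OF D, of D "\<lambda>x. ball x d"] d by force
  obtain c where c: "bij_betw c {0..<card k} k" using ex_bij_betw_nat_finite[OF k(1)] by blast
  define N where "N = card k"
  have ck: "c i \<in> k" if "i < N" for i using c that unfolding N_def bij_betw_def by auto
  have ex: "\<exists>i<N. dist (c i) w < d" if "w \<in> D" for w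
  proof -
    have "w \<in> (\<Union>x\<in>k. ball x d)" using k(3) that by blast
    then obtain x where x: "x \<in> k" "dist x w < d" by auto
    then obtain i where "i < N" "c i = x" using c unfolding N_def bij_betw_def by force
    then show ?thesis using x by blast
  qed
  define t where "t w = (if w \<in> D then LEAST i. dist (c i) w < d else N)" for w
  have t: "t w < N \<and> dist (c (t w)) w < d" if w: "w \<in> D" for w
  proof -
    obtain i where i: "i < N" "dist (c i) w < d" using ex[OF w] by blast
    have "t w \<le> i" unfolding t_def using w i(2) by (simp add: Least_le)
    moreover have "dist (c (t w)) w < d" unfolding t_def using w LeastI[of "\<lambda>i. dist (c i) w < d", OF i(2)] by simp
    ultimately show ?thesis using i(1) by simp
  qed
  have [measurable]: "D \<in> sets borel" using D by (intro borel_closed compact_imp_closed)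
  have "{w. t w = i} \<in> sets borel" for i
  proof -
    have iff: "t w = i \<longleftrightarrow> dist (c i) w < d \<and> (\<forall>j<i. \<not> dist (c j) w < d)" if w: "w \<in> D" for w
    proof
      assume "t w = i"
      then have i: "(LEAST i. dist (c i) w < d) = i" using w unfolding t_def by simp
      have "dist (c i) w < d" using t[OF w] \<open>t w = i\<close> by simp
      moreover have "\<not> dist (c j) w < d" if "j < i" for j using not_less_Least[of j "\<lambda>i. dist (c i) w < d"] that unfolding i by blast
      ultimately show "dist (c i) w < d \<and> (\<forall>j<i. \<not> dist (c j) w < d)" by blast
    next
      assume a: "dist (c i) w < d \<and> (\<forall>j<i. \<not> dist (c j) w < d)"
      then have "(LEAST i. dist (c i) w < d) = i" by (intro Least_equality) (auto simp: not_less[symmetric])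
      then show "t w = i" unfolding t_def using w by simp
    qed
    have "{w. t w = i} = (D \<inter> (ball (c i) d - (\<Union>j\<in>{..<i}. ball (c j) d))) \<union> (if i = N then - D else {})"
    proof (rule set_eqI)
      fix w show "w \<in> {w. t w = i} \<longleftrightarrow> w \<in> (D \<inter> (ball (c i) d - (\<Union>j\<in>{..<i}. ball (c j) d))) \<union> (if i = N then - D else {})"
        by (cases "w \<in> D") (use iff in \<open>auto simp: t_def\<close>)
    qed
    also have "... \<in> sets borel" by simp
    finally show ?thesis .
  qed
  from that[OF t _ _ this] show thesis using ck k(2) by (auto simp: t_def)
qed

text \<open>For R > 0 the second factor vanishes for t - |x| \<le> 1 / R and is 1 from 2 / R on. It
  removes the singularity at the cone, and the product stays between 0 and the kernel.\<close>

definition smoothed_kernel :: "real => real \<times> (real^'n) => real" where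
  "smoothed_kernel R z = wave_kernel z * max 0 (min 1 (R * (fst z - norm (snd z)) - 1))"

lemma smoothed_kernel_bounds: "0 \<le> smoothed_kernel R z" "smoothed_kernel R z \<le> wave_kernel z"
  unfolding smoothed_kernel_def using wave_kernel_nonneg[of z] by (auto intro!: mult_left_le)

text \<open>Glued from two open sets: the interior of the cone, where the square root does not
  vanish, and a neighbourhood of its complement, where the second factor is 0.\<close>

lemma smoothed_kernel_continuous:
  assumes R: "0 < R" shows "continuous_on UNIV (smoothed_kernel R :: real \<times> (real^'n) => real)"
proof -
  let ?S = "{z::real \<times> (real^'n). norm (snd z) < fst z}" and ?T = "{z::real \<times> (real^'n). R * (fst z - norm (snd z)) < 1}"
  have S: "open ?S" and T: "open ?T" by (intro open_Collect_less continuous_intros)+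
  have ne: "(fst z)\<^sup>2 - (norm (snd z))\<^sup>2 \<noteq> 0" if "z \<in> ?S" for z
  proof -
    have "(norm (snd z))\<^sup>2 < (fst z)\<^sup>2" using that by (intro power_strict_mono) auto
    then show ?thesis by simp
  qed
  have "continuous_on ?S (\<lambda>z. (if CARD('n) = 1 then 1 / 2 else 1 / (2 * pi * sqrt ((fst z)\<^sup>2 - (norm (snd z))\<^sup>2))) * max 0 (min 1 (R * (fst z - norm (snd z)) - 1)))"
    using ne by (cases "CARD('n) = 1") (auto intro!: continuous_intros)
  then have 1: "continuous_on ?S (smoothed_kernel R)" by (rule continuous_on_eq) (auto simp: smoothed_kernel_def wave_kernel_def)
  have 2: "continuous_on ?T (smoothed_kernel R)" by (rule continuous_on_eq[OF continuous_on_const[of _ 0]]) (auto simp: smoothed_kernel_def)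
  have "?S \<union> ?T = UNIV"
  proof -
    have "z \<in> ?T" if "z \<notin> ?S" for z
    proof -
      have "R * (fst z - norm (snd z)) \<le> 0" using that R by (intro mult_nonneg_nonpos) auto
      then show ?thesis by simp
    qed
    then show ?thesis by blast
  qed
  then show ?thesis using continuous_on_open_Un[OF S T 1 2] by simp
qed

lemma smoothed_kernel_tendsto: "(\<lambda>k. smoothed_kernel (real k) z) \<longlonglongrightarrow> wave_kernel z"
proof (cases "norm (snd z) < fst z")
  case True
  define a where "a = fst z - norm (snd z)"
  have a: "a > 0" using True unfolding a_def by simp
  obtain N where N: "real N > 2 / a" using reals_Archimedean2 by blast
  have "smoothed_kernel (real k) z = wave_kernel z" if "k \<ge> N" for k
  proof -
    have "2 / a \<le> real k" using N that by simp
    then have "2 \<le> real k * a" using a by (simp add: divide_simps)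
    then show ?thesis unfolding smoothed_kernel_def a_def[symmetric] by simp
  qed
  then show ?thesis by (intro tendsto_eventually) (auto simp: eventually_sequentially)
qed (simp add: smoothed_kernel_def wave_kernel_outside)

lemma smoothed_kernel_norm_tendsto:
  assumes n: "CARD('n) \<le> 2" and q: "0 < q" "q < 2"
  shows "(\<lambda>k. \<integral>\<^sup>+ z. ennreal (\<bar>wave_kernel z - smoothed_kernel (real (Suc k)) z\<bar> powr q) * indicator (cball 0 r) z \<partial>(lborel :: (real \<times> (real^'n)) measure)) \<longlonglongrightarrow> 0"
proof -
  let ?d = "\<lambda>k (z :: real \<times> (real^'n)). \<bar>wave_kernel z - smoothed_kernel (real (Suc k)) z\<bar>"
  have [measurable]: "(smoothed_kernel (real (Suc k)) :: real \<times> (real^'n) => real) \<in> borel_measurable borel" for k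
    by (intro borel_measurable_continuous_onI smoothed_kernel_continuous) simp
  have [measurable]: "cball (0::real \<times> (real^'n)) r \<in> sets borel" by simp
  have "(\<lambda>k. \<integral>\<^sup>+ z. ennreal (?d k z powr q) * indicator (cball 0 r) z \<partial>lborel)
    \<longlonglongrightarrow> (\<integral>\<^sup>+ z. 0 \<partial>(lborel :: (real \<times> (real^'n)) measure))"
  proof (rule nn_integral_dominated_convergence[where w="\<lambda>z. ennreal (wave_kernel z powr q) * indicator (cball 0 r) z"])
    show "(\<integral>\<^sup>+ z. ennreal (wave_kernel z powr q) * indicator (cball 0 r) z \<partial>(lborel :: (real \<times> (real^'n)) measure)) < \<infinity>"
      by (rule wave_kernel_power_integrable[OF n q])
    show "AE z in lborel. ennreal (?d k z powr q) * indicator (cball 0 r) z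
      \<le> ennreal (wave_kernel (z :: real \<times> (real^'n)) powr q) * indicator (cball 0 r) z" for k
    proof (intro AE_I2 mult_right_mono ennreal_leI powr_mono2)
      fix z :: "real \<times> (real^'n)"
      show "?d k z \<le> wave_kernel z" using smoothed_kernel_bounds[where z=z and R="real (Suc k)"] by simp
    qed (use q in auto)
    show "AE z in lborel. (\<lambda>k. ennreal (?d k z powr q) * indicator (cball 0 r) (z :: real \<times> (real^'n))) \<longlonglongrightarrow> 0"
    proof (intro AE_I2)
      fix z :: "real \<times> (real^'n)"
      have "(\<lambda>k. wave_kernel z - smoothed_kernel (real (Suc k)) z) \<longlonglongrightarrow> wave_kernel z - wave_kernel z"
        by (intro tendsto_intros LIMSEQ_Suc[OF smoothed_kernel_tendsto])
      then have "(\<lambda>k. (?d k z)) \<longlonglongrightarrow> 0" by (simp only: diff_self tendsto_rabs_zero)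
      then have "(\<lambda>k. (?d k z) powr q) \<longlonglongrightarrow> 0" using q by (intro tendsto_zero_powrI) auto
      then have "(\<lambda>k. ennreal (?d k z powr q)) \<longlonglongrightarrow> ennreal 0" by (rule tendsto_ennrealI)
      then show "(\<lambda>k. ennreal (?d k z powr q) * indicator (cball 0 r) z) \<longlonglongrightarrow> 0" by (cases "z \<in> cball 0 r") (simp_all del: of_nat_Suc)
    qed
  qed measurable
  then show ?thesis by simp
qed

text \<open>The backward cone of a point, cut at time 0, is bounded; the radii \<open>3 * r\<close>
  of the cells come from here.\<close>

lemma wave_kernel_past:
  assumes "w \<in> half_space" "norm z \<le> r" "wave_kernel (z - w) \<noteq> 0" shows "norm w \<le> 3 * r"
proof -
  have c: "norm (snd z - snd w) < fst z - fst w" using assms(3) wave_kernel_outside[of "z - w"] by auto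
  have t: "fst w \<ge> 0" using assms(1) unfolding half_space_def by auto
  have z: "\<bar>fst z\<bar> \<le> r" "norm (snd z) \<le> r" using norm_fst_le[of "fst z" "snd z"] norm_snd_le[of "snd z" "fst z"] assms(2) by auto
  have "norm (snd w) \<le> norm (snd z) + norm (snd z - snd w)" by (metis norm_minus_commute norm_triangle_sub)
  moreover have "norm w \<le> norm (fst w) + norm (snd w)" using norm_Pair_le[of "fst w" "snd w"] by simp
  ultimately show ?thesis using c z t by simp
qed

text \<open>The first norm bound controls the noise integral at a fixed \<open>z\<close>, the second one, at a fixed \<open>w\<close>,
  the pairing of the field with a test function.\<close>

definition kernel_approx ::
    "real => real => real set => (real \<times> (real^'n) => nat) => (real \<times> (real^'n) => nat => real) => bool" where
  "kernel_approx r e Q t F \<longleftrightarrow> labelling t \<and> (\<forall>l. (\<lambda>z. F z l) \<in> borel_measurable borel) \<and> (\<exists>B. \<forall>z l. \<bar>F z l\<bar> \<le> B) \<and>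
    (\<forall>z l. F z l \<noteq> 0 --> z \<in> cball 0 r \<and> cell t l \<subseteq> cball 0 (3 * r)) \<and>
    (\<forall>z\<in>cball 0 r. \<forall>q\<in>Q. stable_norm q (\<lambda>w. wave_kernel (z - w) - F z (t w)) \<le> ennreal e) \<and>
    (\<forall>w\<in>half_space. (\<integral>\<^sup>+z. indicator (cball 0 r) z * ennreal \<bar>wave_kernel (z - w) - F z (t w)\<bar> \<partial>lborel) \<le> ennreal e)"

text \<open>The kernel is replaced by a continuous one, close in the integral sense, and this by its
  values at representatives of small cells, close uniformly. The uniform continuity is used on the
  ball of radius 4 r, which contains z - w for |z| \<le> r and |w| \<le> 3 r.\<close>

lemma kernel_approx_exists:
  fixes Q :: "real set"
  assumes n: "CARD('n) \<le> 2" and r: "0 < r" and d: "0 < d" and Q: "finite Q" "\<And>q. q \<in> Q ==> 0 < q \<and> q < 2"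
  shows "\<exists>t (F :: real \<times> (real^'n) => nat => real). kernel_approx r d Q t F"
proof -
  let ?E = "wave_kernel :: real \<times> (real^'n) => real"
  define D where "D = half_space \<inter> cball (0 :: real \<times> (real^'n)) (3 * r)"
  have D: "compact D" unfolding D_def by auto
  have [measurable]: "D \<in> sets borel" "cball (0 :: real \<times> (real^'n)) s \<in> sets borel" for s using D by (simp_all add: borel_closed compact_imp_closed)
  define v where "v = measure lborel (cball (0 :: real \<times> (real^'n)) (3 * r))"
  have v: "v \<ge> 0" "emeasure lborel (cball (0 :: real \<times> (real^'n)) (3 * r)) = ennreal v"
    unfolding v_def using emeasure_compact_finite[of "cball (0 :: real \<times> (real^'n)) (3 * r)"] by (auto simp: emeasure_eq_ennreal_measure)
  have Dv: "emeasure lborel D \<le> ennreal v" "emeasure lborel (cball (0 :: real \<times> (real^'n)) r) \<le> ennreal v"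
    unfolding v(2)[symmetric] D_def using r by (auto intro!: emeasure_mono)
  \<comment> \<open>The exponent 1 is added for the last condition of \<open>kernel_approx\<close>.
    The share d / 8 becomes d / 2 by the factor 4 of \<open>powr_add_le\<close>; the uniform error
    takes the other half.\<close>
  have "eventually (\<lambda>k. \<forall>q\<in>insert 1 Q. (\<integral>\<^sup>+ z. ennreal (\<bar>?E z - smoothed_kernel (real (Suc k)) z\<bar> powr q) * indicator (cball 0 (4 * r)) z \<partial>lborel) < ennreal (d / 8)) sequentially"
    by (intro eventually_ball_finite ballI order_tendstoD(2)[OF smoothed_kernel_norm_tendsto[OF n]]) (use Q d in auto)
  then obtain k where k: "\<And>q. q \<in> insert 1 Q ==> (\<integral>\<^sup>+ z. ennreal (\<bar>?E z - smoothed_kernel (real (Suc k)) z\<bar> powr q) * indicator (cball 0 (4 * r)) z \<partial>lborel) < ennreal (d / 8)"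
    unfolding eventually_sequentially by blast
  define h where "h = (smoothed_kernel (real (Suc k)) :: real \<times> (real^'n) => real)"
  have h: "continuous_on UNIV h" unfolding h_def by (rule smoothed_kernel_continuous) simp
  have [measurable]: "h \<in> borel_measurable borel" by (rule borel_measurable_continuous_onI[OF h])
  have "eventually (\<lambda>j. \<forall>q\<in>insert 1 Q. 4 * v * inverse (real (Suc j)) powr q < d / 2) sequentially"
  proof (intro eventually_ball_finite ballI)
    fix q assume q: "q \<in> insert 1 Q"
    then have "(\<lambda>j. inverse (real (Suc j)) powr q) \<longlonglongrightarrow> 0" using Q by (intro tendsto_zero_powrI[OF LIMSEQ_inverse_real_of_nat tendsto_const]) auto
    then have "(\<lambda>j. 4 * v * inverse (real (Suc j)) powr q) \<longlonglongrightarrow> 0" by (rule tendsto_mult_right_zero)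
    then show "eventually (\<lambda>j. 4 * v * inverse (real (Suc j)) powr q < d / 2) sequentially" using d by (intro order_tendstoD(2)) auto
  qed (use Q in auto)
  then obtain j where j: "\<And>q. q \<in> insert 1 Q ==> 4 * v * inverse (real (Suc j)) powr q < d / 2" unfolding eventually_sequentially by blast
  define e where "e = inverse (real (Suc j))"
  have e: "e > 0" unfolding e_def by simp
  have "uniformly_continuous_on (cball 0 (4 * r)) h" by (rule compact_uniformly_continuous[OF continuous_on_subset[OF h]]) auto
  then obtain \<delta> where \<delta>: "\<delta> > 0" "\<And>x y. x \<in> cball 0 (4 * r) ==> y \<in> cball 0 (4 * r) ==> dist y x < \<delta> ==> dist (h y) (h x) < e"
    unfolding uniformly_continuous_on_def using e by blast
  have "compact (h ` cball 0 (4 * r))" by (intro compact_continuous_image continuous_on_subset[OF h]) auto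
  then obtain B where B: "\<And>y. y \<in> h ` cball 0 (4 * r) ==> norm y \<le> B" using compact_imp_bounded bounded_iff by metis
  obtain t :: "real \<times> (real^'n) => nat" and c N where t: "\<And>w. w \<in> D ==> t w < N \<and> dist (c (t w)) w < \<delta>"
    "\<And>w. w \<notin> D ==> t w = N" "\<And>i. i < N ==> c i \<in> D" "\<And>i. {w. t w = i} \<in> sets borel" by (rule compact_labels[OF D \<delta>(1)], rule that, assumption+)
  define F where "F z l = (if l < N \<and> z \<in> cball 0 r then h (z - c l) else 0)" for z l
  have lab: "labelling t" unfolding labelling_def
  proof (intro conjI allI)
    have "t ` half_space \<subseteq> {..N}" using t(1,2) by force
    then show "finite (t ` half_space)" by (rule finite_subset) simp
    show "cell t l \<in> sets borel" for l
    proof -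
      have "cell t l = half_space \<inter> {w. t w = l}" unfolding cell_def by blast
      then show ?thesis using t(4) by simp
    qed
  qed
  have in4: "z - w \<in> cball 0 (4 * r)" if "z \<in> cball 0 r" "w \<in> D" for z w
  proof -
    have "norm z \<le> r" "norm w \<le> 3 * r" using that unfolding D_def by auto
    then have "norm (z - w) \<le> 4 * r" using norm_triangle_ineq4[of z w] by simp
    then show ?thesis by simp
  qed
  have Fm: "(\<lambda>z. F z l) \<in> borel_measurable borel" for l unfolding F_def by simp
  have FB: "\<bar>F z l\<bar> \<le> max 0 B" for z l using B[of "h (z - c l)"] in4[of z "c l"] t(3)[of l] unfolding F_def by auto
  have Fc: "z \<in> cball 0 r \<and> cell t l \<subseteq> cball 0 (3 * r)" if "F z l \<noteq> 0" for z l
  proof -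
    have "l < N" "z \<in> cball 0 r" using that unfolding F_def by (auto split: if_splits)
    moreover have "w \<in> D" if "t w = l" for w using t(2)[of w] that \<open>l < N\<close> by auto
    ultimately show ?thesis unfolding cell_def D_def by blast
  qed
  have out: "?E (z - w) - F z (t w) = 0" if "z \<in> cball 0 r" "w \<in> half_space" "w \<notin> D" for z w
    using wave_kernel_past[of w z r] that t(2)[of w] unfolding D_def F_def by auto
  let ?g = "\<lambda>z w. \<bar>?E (z - w) - h (z - w)\<bar>" and ?G = "\<lambda>z w. \<bar>?E (z - w) - F z (t w)\<bar>"
  have ptw: "?G z w \<le> e + ?g z w" if zw: "z \<in> cball 0 r" "w \<in> D" for z w
  proof -
    have "dist (h (z - c (t w))) (h (z - w)) < e" using t(1)[OF zw(2)] t(3)[of "t w"] by (intro \<delta>(2) in4 zw) (auto simp: dist_norm norm_minus_commute)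
    moreover have "F z (t w) = h (z - c (t w))" using t(1)[OF zw(2)] zw(1) unfolding F_def by simp
    ultimately show ?thesis by (simp add: dist_real_def)
  qed
  have a: "stable_norm q (\<lambda>w. ?E (z - w) - F z (t w)) \<le> ennreal d" if z: "z \<in> cball 0 r" and q: "q \<in> Q" for z q
  proof -
    have q02: "0 < q" "q < 2" using Q q by auto
    have "stable_norm q (\<lambda>w. ?E (z - w) - F z (t w)) = (\<integral>\<^sup>+w. ennreal (?G z w powr q) * indicator half_space w \<partial>lborel)"
      by (rule nn_integral_half_space)
    also have "... \<le> (\<integral>\<^sup>+w. ennreal (4 * e powr q) * indicator D w + 4 * (ennreal (?g z w powr q) * indicator (cball 0 (4 * r)) (z - w)) \<partial>lborel)"
    proof (intro nn_integral_mono)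
      fix w
      show "ennreal (?G z w powr q) * indicator half_space w
        \<le> ennreal (4 * e powr q) * indicator D w + 4 * (ennreal (?g z w powr q) * indicator (cball 0 (4 * r)) (z - w))"
      proof (cases "w \<in> D")
        case True
        have "?G z w powr q \<le> \<bar>e + ?g z w\<bar> powr q" using ptw[OF z True] e q02 by (intro powr_mono2) auto
        also have "... \<le> 4 * (\<bar>e\<bar> powr q + \<bar>(?g z w)\<bar> powr q)" by (rule powr_add_le[OF q02])
        finally have "ennreal (?G z w powr q) \<le> ennreal (4 * e powr q + 4 * ?g z w powr q)" using e by (intro ennreal_leI) simp
        also have "... = ennreal (4 * e powr q) + 4 * ennreal (?g z w powr q)" by (simp add: ennreal_numeral_mult)
        finally show ?thesis using True in4[OF z True] by (simp add: D_def)
      next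
        case False
        then have "ennreal (?G z w powr q) * indicator half_space w = 0" using out[OF z _ False] by force
        then show ?thesis by (simp only: zero_le)
      qed
    qed
    also have "... = ennreal (4 * e powr q) * emeasure lborel D + 4 * (\<integral>\<^sup>+w. ennreal (?g z w powr q) * indicator (cball 0 (4 * r)) (z - w) \<partial>lborel)"
      by (subst nn_integral_add, measurable, subst nn_integral_cmult_indicator, measurable, subst nn_integral_cmult, measurable)
    also have "(\<integral>\<^sup>+w. ennreal (?g z w powr q) * indicator (cball 0 (4 * r)) (z - w) \<partial>lborel)
      = (\<integral>\<^sup>+w. ennreal (\<bar>?E w - h w\<bar> powr q) * indicator (cball 0 (4 * r)) w \<partial>lborel)" by (rule nn_integral_reflect_translate(1)) measurable
    also have "ennreal (4 * e powr q) * emeasure lborel D + 4 * ... \<le> ennreal (4 * e powr q) * ennreal v + 4 * ennreal (d / 8)"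
      using k[of q] q unfolding h_def by (intro add_mono mult_left_mono Dv) auto
    also have "... = ennreal (4 * v * e powr q + d / 2)"
      using v d by (simp add: ennreal_mult[symmetric] ennreal_numeral_mult[symmetric] ennreal_plus[symmetric] del: ennreal_plus)
    also have "... \<le> ennreal d" using j[of q] q unfolding e_def by (intro ennreal_leI) auto
    finally show ?thesis .
  qed
  have b: "(\<integral>\<^sup>+z. indicator (cball 0 r) z * ennreal (?G z w) \<partial>lborel) \<le> ennreal d" if w: "w \<in> half_space" for w
  proof -
    have "(\<integral>\<^sup>+z. indicator (cball 0 r) z * ennreal (?G z w) \<partial>lborel)
      \<le> (\<integral>\<^sup>+z. ennreal e * indicator (cball 0 r) z + ennreal (?g z w powr 1) * indicator (cball 0 (4 * r)) (z - w) \<partial>lborel)"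
    proof (intro nn_integral_mono)
      fix z
      show "indicator (cball 0 r) z * ennreal (?G z w)
        \<le> ennreal e * indicator (cball 0 r) z + ennreal (?g z w powr 1) * indicator (cball 0 (4 * r)) (z - w)"
      proof (cases "z \<in> cball 0 r \<and> w \<in> D")
        case True
        then have "ennreal (?G z w) \<le> ennreal (e + ?g z w)" by (intro ennreal_leI ptw) auto
        also have "... = ennreal e + ennreal (?g z w powr 1)" using e by simp
        finally show ?thesis using True in4[of z w] by simp
      next
        case False
        then have "indicator (cball 0 r) z * ennreal (?G z w) = 0" using out[of z w] w by force
        then show ?thesis by (simp only: zero_le)
      qed
    qed
    also have "... = ennreal e * emeasure lborel (cball (0 :: real \<times> (real^'n)) r) + (\<integral>\<^sup>+z. ennreal (?g z w powr 1) * indicator (cball 0 (4 * r)) (z - w) \<partial>lborel)"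
      by (subst nn_integral_add, measurable, subst nn_integral_cmult_indicator, measurable)
    also have "(\<integral>\<^sup>+z. ennreal (?g z w powr 1) * indicator (cball 0 (4 * r)) (z - w) \<partial>lborel)
      = (\<integral>\<^sup>+z. ennreal (\<bar>?E z - h z\<bar> powr 1) * indicator (cball 0 (4 * r)) z \<partial>lborel)" by (rule nn_integral_reflect_translate(2)) measurable
    also have "ennreal e * emeasure lborel (cball (0 :: real \<times> (real^'n)) r) + ... \<le> ennreal e * ennreal v + ennreal (d / 8)"
      using k[of 1] unfolding h_def by (intro add_mono mult_left_mono Dv) auto
    also have "... = ennreal (e * v + d / 8)" using v d e by (simp add: ennreal_mult)
    also have "... \<le> ennreal d"
    proof (rule ennreal_leI)
      have "4 * v * e < d / 2" using j[of 1] unfolding e_def by simp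
      then have "4 * (e * v) < d / 2" by (simp add: mult_ac)
      then show "e * v + d / 8 \<le> d" using d by linarith
    qed
    finally show ?thesis .
  qed
  show ?thesis unfolding kernel_approx_def using lab Fm FB Fc a b by blast
qed

section \<open>Limits of fields in L^1 on balls\<close>

lemma bounded_test_integrable:
  fixes f g :: "'a::euclidean_space => real"
  assumes [measurable]: "f \<in> borel_measurable borel" "g \<in> borel_measurable borel"
    and f: "\<And>z. \<bar>f z\<bar> \<le> B" and g: "\<And>z. \<bar>g z\<bar> \<le> C" and r: "\<And>z. g z \<noteq> 0 ==> norm z \<le> r"
  shows "integrable lborel (\<lambda>z. f z * g z)"
proof (rule Bochner_Integration.integrable_bound)
  show "integrable lborel (\<lambda>z::'a. indicator (cball 0 r) z * (B * C))" using emeasure_compact_finite[of "cball (0::'a) r"] by simp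
  have BC: "0 \<le> B" "0 \<le> C" using f[of 0] g[of 0] by auto
  show "AE z in lborel. norm (f z * g z) \<le> norm (indicator (cball 0 r) z * (B * C))"
  proof (intro AE_I2)
    fix z
    show "norm (f z * g z) \<le> norm (indicator (cball 0 r) z * (B * C))"
    proof (cases "g z = 0")
      case False
      have "\<bar>f z\<bar> * \<bar>g z\<bar> \<le> B * C" using f g BC by (intro mult_mono) auto
      then show ?thesis using r[OF False] BC by (simp add: abs_mult)
    qed simp
  qed
qed measurable

text \<open>Summable increments on growing balls give convergence almost everywhere on the support
  of \<open>g\<close> and convergence of the pairings. Where \<open>g\<close> vanishes,
  \<open>lim\<close> may be arbitrary, but there the product is 0.\<close>

lemma local_L1_limit:
  fixes y :: "nat => 'a::euclidean_space => real"
  assumes y[measurable]: "\<And>k. y k \<in> borel_measurable borel" and bnd: "\<And>k. \<exists>B. \<forall>z. \<bar>y k z\<bar> \<le> B"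
    and sm: "summable (\<lambda>k. LBINT z. indicator (cball 0 (real (Suc k))) z * \<bar>y (Suc k) z - y k z\<bar>)"
    and g[measurable]: "g \<in> borel_measurable borel" and C: "\<And>z. \<bar>g z\<bar> \<le> C" and r: "\<And>z. g z \<noteq> 0 ==> norm z \<le> real r"
  shows "AE z in lborel. g z \<noteq> 0 --> Cauchy (\<lambda>k. y k z)"
    and "integrable lborel (\<lambda>z. lim (\<lambda>k. y k z) * g z)"
    and "(\<lambda>k. LBINT z. y k z * g z) \<longlonglongrightarrow> (LBINT z. lim (\<lambda>k. y k z) * g z)"
proof -
  \<comment> \<open>From index r on the balls contain all points where \<open>g\<close> does not
    vanish, hence the shift by r.\<close>
  let ?d = "\<lambda>k z. \<bar>y (Suc (k + r)) z - y (k + r) z\<bar>"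
  have C0: "0 \<le> C" using C[of 0] by simp
  have int: "integrable lborel (\<lambda>z. y k z * g z)" for k
  proof -
    obtain B where B: "\<And>z. \<bar>y k z\<bar> \<le> B" using bnd by blast
    show ?thesis by (rule bounded_test_integrable[OF y g B C r])
  qed
  define f where "f k z = y (Suc (k + r)) z * g z - y (k + r) z * g z" for k z
  have fi: "integrable lborel (f k)" for k unfolding f_def by (intro Bochner_Integration.integrable_diff int)
  have fb: "(LBINT z. norm (f k z)) \<le> C * (LBINT z. indicator (cball 0 (real (Suc (k + r)))) z * ?d k z)" for k
  proof -
    obtain B1 where B1: "\<And>z. \<bar>y (Suc (k + r)) z\<bar> \<le> B1" using bnd by blast
    obtain B2 where B2: "\<And>z. \<bar>y (k + r) z\<bar> \<le> B2" using bnd by blast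
    let ?I = "indicator (cball 0 (real (Suc (k + r)))) :: 'a => real"
    have "integrable lborel (\<lambda>z. (?d k z) * ?I z)"
    proof (rule bounded_test_integrable[where B="B1 + B2" and C=1 and r="real (Suc (k + r))"])
      show "\<bar>(?d k z)\<bar> \<le> B1 + B2" for z using B1[of z] B2[of z] by simp
    qed (auto simp: indicator_def split: if_splits)
    then have i: "integrable lborel (\<lambda>z. ?I z * ?d k z)" by (simp add: mult.commute)
    have "(LBINT z. norm (f k z)) \<le> (LBINT z. C * (?I z * ?d k z))"
    proof (rule integral_mono[OF integrable_norm[OF fi] integrable_mult_right[OF i]])
      fix z
      have e: "norm (f k z) = \<bar>g z\<bar> * ?d k z" unfolding f_def left_diff_distrib[symmetric] by (simp add: abs_mult)
      show "norm (f k z) \<le> C * (?I z * ?d k z)"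
      proof (cases "g z = 0")
        case False
        then have "?I z = 1" using r[OF False] by simp
        then show ?thesis unfolding e using mult_right_mono[OF C, of "?d k z" z] by simp
      qed (use C0 in \<open>simp only: e abs_zero mult_zero_left, simp\<close>)
    qed
    then show ?thesis by simp
  qed
  have sf: "summable (\<lambda>k. LBINT z. norm (f k z))"
  proof (rule summable_comparison_test)
    show "\<exists>N. \<forall>k\<ge>N. norm (LBINT z. norm (f k z)) \<le> C * (LBINT z. indicator (cball 0 (real (Suc (k + r)))) z * ?d k z)" using fb by simp
    show "summable (\<lambda>k. C * (LBINT z. indicator (cball 0 (real (Suc (k + r)))) z * ?d k z))"
      using summable_ignore_initial_segment[OF sm, of r] by simp
  qed
  have AEs: "AE z in lborel. summable (\<lambda>k. norm (f k z))"
  proof -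
    have fm[measurable]: "(\<lambda>z. ennreal (norm (f k z))) \<in> borel_measurable lborel" for k unfolding f_def by simp
    have "(\<integral>\<^sup>+z. (\<Sum>k. ennreal (norm (f k z))) \<partial>lborel) = (\<Sum>k. \<integral>\<^sup>+z. ennreal (norm (f k z)) \<partial>lborel)" by (rule nn_integral_suminf[OF fm])
    also have "... = (\<Sum>k. ennreal (LBINT z. norm (f k z)))"
      by (rule arg_cong[where f=suminf], rule ext, rule nn_integral_eq_integral[OF integrable_norm[OF fi]]) simp
    also have "... \<noteq> \<infinity>" using sf by (simp add: suminf_ennreal2)
    finally have "(\<integral>\<^sup>+z. (\<Sum>k. ennreal (norm (f k z))) \<partial>lborel) \<noteq> \<infinity>" .
    moreover have "(\<lambda>z. \<Sum>k. ennreal (norm (f k z))) \<in> borel_measurable lborel" by measurable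
    ultimately have "AE z in lborel. (\<Sum>k. ennreal (norm (f k z))) \<noteq> \<infinity>" by (intro nn_integral_PInf_AE)
    then show ?thesis by eventually_elim (rule summable_suminf_not_top[OF norm_ge_zero], simp)
  qed
  note S = integrable_suminf[OF fi AEs sf] sums_integral[OF fi AEs sf]
  have part: "(\<Sum>k<N. f k z) = y (N + r) z * g z - y r z * g z" for N z by (induction N) (simp_all add: f_def)
  have lim: "AE z in lborel. (g z \<noteq> 0 --> Cauchy (\<lambda>k. y k z)) \<and> lim (\<lambda>k. y k z) * g z = y r z * g z + (\<Sum>k. f k z)" using AEs
  proof eventually_elim
    case (elim z)
    show ?case
    proof (cases "g z = 0")
      case True
      then have "f k z = 0" for k unfolding f_def by simp
      then show ?thesis using True by simp
    next
      case False
      have "(\<lambda>N. \<Sum>k<N. f k z) \<longlonglongrightarrow> (\<Sum>k. f k z)" using summable_LIMSEQ[OF summable_norm_cancel[OF elim]] .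
      then have "(\<lambda>N. ((\<Sum>k<N. f k z) + y r z * g z) / g z) \<longlonglongrightarrow> ((\<Sum>k. f k z) + y r z * g z) / g z" using False by (intro tendsto_intros)
      moreover have "((\<Sum>k<N. f k z) + y r z * g z) / g z = y (N + r) z" for N unfolding part using False by simp
      ultimately have "(\<lambda>N. y (N + r) z) \<longlonglongrightarrow> ((\<Sum>k. f k z) + y r z * g z) / g z" by simp
      then have l: "(\<lambda>k. y k z) \<longlonglongrightarrow> ((\<Sum>k. f k z) + y r z * g z) / g z" by (rule LIMSEQ_offset)
      then have "lim (\<lambda>k. y k z) = ((\<Sum>k. f k z) + y r z * g z) / g z" by (rule limI)
      then show ?thesis using LIMSEQ_imp_Cauchy[OF l] False by simp
    qed
  qed
  then show "AE z in lborel. g z \<noteq> 0 --> Cauchy (\<lambda>k. y k z)" by simp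
  have lm: "(\<lambda>z. lim (\<lambda>k. y k z) * g z) \<in> borel_measurable lborel" by measurable
  have AEeq: "AE z in lborel. y r z * g z + (\<Sum>k. f k z) = lim (\<lambda>k. y k z) * g z" using lim by auto
  have i2: "integrable lborel (\<lambda>z. y r z * g z + (\<Sum>k. f k z))" by (intro Bochner_Integration.integrable_add int S)
  show "integrable lborel (\<lambda>z. lim (\<lambda>k. y k z) * g z)" by (rule integrable_cong_AE_imp[OF i2 lm]) (use AEeq in eventually_elim, simp)
  have "(\<lambda>N. \<Sum>k<N. (LBINT z. f k z)) \<longlonglongrightarrow> (LBINT z. (\<Sum>k. f k z))" using S(2) unfolding sums_def .
  moreover have "(\<Sum>k<N. (LBINT z. f k z)) = (LBINT z. y (N + r) z * g z) - (LBINT z. y r z * g z)" for N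
    using part[of _ N] fi int by (subst Bochner_Integration.integral_sum[symmetric]) auto
  ultimately have "(\<lambda>N. (LBINT z. y (N + r) z * g z) - (LBINT z. y r z * g z)) \<longlonglongrightarrow> (LBINT z. (\<Sum>k. f k z))" by simp
  from tendsto_add[OF this tendsto_const[of "\<integral>z. y r z * g z \<partial>lborel"]]
  have "(\<lambda>N. LBINT z. y (N + r) z * g z) \<longlonglongrightarrow> (LBINT z. (\<Sum>k. f k z)) + (LBINT z. y r z * g z)" by simp
  also have "(LBINT z. (\<Sum>k. f k z)) + (LBINT z. y r z * g z) = (LBINT z. y r z * g z + (\<Sum>k. f k z))" using int S(1) by simp
  also have "... = (LBINT z. lim (\<lambda>k. y k z) * g z)" by (rule integral_cong_AE[OF borel_measurable_integrable[OF i2] lm AEeq])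
  finally show "(\<lambda>k. LBINT z. y k z * g z) \<longlonglongrightarrow> (LBINT z. lim (\<lambda>k. y k z) * g z)" by (rule LIMSEQ_offset)
qed

text \<open>The case where \<open>g\<close> is the indicator of a ball; such balls exhaust the
  space.\<close>

lemma local_L1_limit_ball:
  fixes y :: "nat => 'a::euclidean_space => real"
  assumes y[measurable]: "\<And>k. y k \<in> borel_measurable borel" and bnd: "\<And>k. \<exists>B. \<forall>z. \<bar>y k z\<bar> \<le> B"
    and sm: "summable (\<lambda>k. LBINT z. indicator (cball 0 (real (Suc k))) z * \<bar>y (Suc k) z - y k z\<bar>)"
  shows "AE z in lborel. Cauchy (\<lambda>k. y k z)" and "locally_integrable (\<lambda>z. lim (\<lambda>k. y k z))"
proof -
  note L = local_L1_limit[OF assms, of "indicator (cball 0 (real r)) :: 'a => real" 1 r for r]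
  have I: "(indicator (cball 0 (real r)) :: 'a => real) \<in> borel_measurable borel" for r by (intro borel_measurable_indicator) simp
  have I1: "\<bar>indicator (cball 0 (real r)) z :: real\<bar> \<le> 1" "indicator (cball 0 (real r)) z \<noteq> 0 ==> norm z \<le> real r" for r and z
    by (auto simp: indicator_def)
  have "AE z in lborel. indicator (cball 0 (real r)) z \<noteq> (0::real) --> Cauchy (\<lambda>k. y k z)" for r by (rule L(1)[OF I I1])
  then have "AE z in lborel. \<forall>r. indicator (cball 0 (real r)) z \<noteq> (0::real) --> Cauchy (\<lambda>k. y k z)" by (subst AE_all_countable) blast
  then show "AE z in lborel. Cauchy (\<lambda>k. y k z)"
  proof eventually_elim
    case (elim z)
    obtain r where "norm z \<le> real r" using real_arch_simple by blast
    then have "indicator (cball 0 (real r)) z \<noteq> 0" by simp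
    then show ?case using elim by blast
  qed
  show "locally_integrable (\<lambda>z. lim (\<lambda>k. y k z))" unfolding locally_integrable_def
  proof (intro conjI allI impI)
    show m: "(\<lambda>z. lim (\<lambda>k. y k z)) \<in> borel_measurable borel" by measurable
    fix K :: "'a set" assume K: "compact K"
    then obtain R where "\<And>z. z \<in> K ==> norm z \<le> R" using compact_imp_bounded bounded_iff by metis
    then obtain r where r: "\<And>z. z \<in> K ==> norm z \<le> real r" using real_arch_simple[of R] order_trans by blast
    have Kb: "K \<in> sets borel" using K by (intro borel_closed compact_imp_closed)
    have "integrable lborel (\<lambda>z. lim (\<lambda>k. y k z) * indicator (cball 0 (real r)) z)" by (rule L(2)[OF I I1])
    then show "set_integrable lborel K (\<lambda>z. lim (\<lambda>k. y k z))" unfolding set_integrable_def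
      by (rule Bochner_Integration.integrable_bound) (use r Kb m in \<open>auto simp: indicator_def\<close>)
  qed
qed

lemma wave_kernel_L_space:
  assumes n: "CARD('n) \<le> 2" and \<alpha>: "0 < \<alpha>" "\<alpha> < 2"
  shows "(\<lambda>w :: real \<times> (real^'n). wave_kernel (z - w)) \<in> L_space \<alpha>"
proof -
  define r where "r = norm z + 3 * norm z"
  have [measurable]: "cball 0 r \<in> sets borel" by simp
  have m: "(\<lambda>w :: real \<times> (real^'n). wave_kernel (z - w)) \<in> borel_measurable borel" by measurable
  have "(\<integral>\<^sup>+w. ennreal (\<bar>wave_kernel (z - w)\<bar> powr \<alpha>) * indicator half_space w \<partial>lborel)
    \<le> (\<integral>\<^sup>+w. ennreal (wave_kernel (z - w) powr \<alpha>) * indicator (cball 0 r) (z - w) \<partial>lborel)"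
  proof (intro nn_integral_mono)
    fix w
    show "ennreal (\<bar>wave_kernel (z - w)\<bar> powr \<alpha>) * indicator half_space w \<le> ennreal (wave_kernel (z - w) powr \<alpha>) * indicator (cball 0 r) (z - w)"
    proof (cases "w \<in> half_space \<and> wave_kernel (z - w) \<noteq> 0")
      case True
      then have "norm w \<le> 3 * norm z" by (intro wave_kernel_past) auto
      then have "norm (z - w) \<le> r" unfolding r_def using norm_triangle_ineq4[of z w] by simp
      then show ?thesis using wave_kernel_nonneg[of "z - w"] by (simp add: indicator_def)
    qed (use \<alpha> in auto)
  qed
  also have "... = (\<integral>\<^sup>+w. ennreal (wave_kernel w powr \<alpha>) * indicator (cball 0 r) w \<partial>(lborel :: (real \<times> (real^'n)) measure))"
    by (rule nn_integral_reflect_translate(1)) measurable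
  also have "... < \<infinity>" by (rule wave_kernel_power_integrable[OF n \<alpha>])
  finally show ?thesis using L_space_borel[OF m] by blast
qed

section \<open>Existence of the random field\<close>

lemma kernel_approxD:
  fixes F :: "real \<times> (real^'n) => nat => real"
  assumes "kernel_approx r e Q t F"
  shows "labelling t" and "(\<lambda>z. F z l) \<in> borel_measurable borel" and "\<exists>B. \<forall>z l. \<bar>F z l\<bar> \<le> B"
    and "F z l \<noteq> 0 ==> z \<in> cball 0 r" and "F z l \<noteq> 0 ==> cell t l \<subseteq> cball 0 (3 * r)"
    and "z \<in> cball 0 r ==> q \<in> Q ==> stable_norm q (\<lambda>w. wave_kernel (z - w) - F z (t w)) \<le> ennreal e"
    and "w \<in> half_space ==> (\<integral>\<^sup>+z. indicator (cball 0 r) z * ennreal \<bar>wave_kernel (z - w) - F z (t w)\<bar> \<partial>lborel) \<le> ennreal e"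
    and "F z l \<noteq> 0 ==> cell t l \<in> finite_borel" and "cell_adm t (F z)"
proof -
  note a = assms[unfolded kernel_approx_def]
  show lab: "labelling t" and "(\<lambda>z. F z l) \<in> borel_measurable borel" and "\<exists>B. \<forall>z l. \<bar>F z l\<bar> \<le> B"
    and "F z l \<noteq> 0 ==> z \<in> cball 0 r"
    and "z \<in> cball 0 r ==> q \<in> Q ==> stable_norm q (\<lambda>w. wave_kernel (z - w) - F z (t w)) \<le> ennreal e"
    and "w \<in> half_space ==> (\<integral>\<^sup>+z. indicator (cball 0 r) z * ennreal \<bar>wave_kernel (z - w) - F z (t w)\<bar> \<partial>lborel) \<le> ennreal e" using a by blast+
  show c: "cell t l \<subseteq> cball 0 (3 * r)" if "F z l \<noteq> 0" for z l using a that by blast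
  show f: "cell t l \<in> finite_borel" if "F z l \<noteq> 0" for z l
  proof (rule finite_borel_cellI[OF lab])
    have "emeasure lborel (cell t l) \<le> emeasure lborel (cball 0 (3 * r) :: (real \<times> (real^'n)) set)" by (intro emeasure_mono c[OF that]) simp
    also have "... < \<infinity>" by (intro emeasure_compact_finite) simp
    finally show "emeasure lborel (cell t l) < \<infinity>" .
  qed
  show "cell_adm t (F z)" unfolding cell_adm_def using f by blast
qed

context stable_noise begin

lemma cell_field_measurable:
  fixes G :: "'b::topological_space => 'l => real"
  assumes m: "\<And>l. (\<lambda>z. G z l) \<in> borel_measurable borel"
    and f: "\<And>z l. l \<in> t ` half_space ==> G z l \<noteq> 0 ==> cell t l \<in> finite_borel"
  shows "(\<lambda>x. cell_integral W t (G (fst x)) (snd x)) \<in> borel_measurable (borel \<Otimes>\<^sub>M M)" unfolding cell_integral_def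
proof (rule borel_measurable_sum)
  fix l assume l: "l \<in> t ` half_space"
  show "(\<lambda>x. G (fst x) l * W (cell t l) (snd x)) \<in> borel_measurable (borel \<Otimes>\<^sub>M M)"
  proof (cases "\<exists>z. G z l \<noteq> 0")
    case True
    then have "cell t l \<in> finite_borel" using f[OF l] by blast
    then show ?thesis by (intro borel_measurable_times measurable_compose[OF measurable_fst m]
          measurable_compose[OF measurable_snd W_measurable])
  next
    case False
    then show ?thesis by simp
  qed
qed

lemma kernel_field_measurable:
  assumes "kernel_approx r e Q t F"
  shows "(\<lambda>x. cell_integral W t (F (fst x)) (snd x)) \<in> borel_measurable (borel \<Otimes>\<^sub>M M)"
  by (rule cell_field_measurable[OF kernel_approxD(2)[OF assms] kernel_approxD(8)[OF assms]])

lemma measurable_swap_lborel: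
  fixes f :: "'b::euclidean_space \<times> 'w => 'c::topological_space"
  assumes "f \<in> borel_measurable (borel \<Otimes>\<^sub>M M)" shows "(\<lambda>x. f (snd x, fst x)) \<in> borel_measurable (M \<Otimes>\<^sub>M lborel)"
proof -
  have "(\<lambda>x. f (snd x, fst x)) \<in> borel_measurable (M \<Otimes>\<^sub>M borel)" using measurable_compose[OF measurable_pair_swap' assms] by (simp add: split_beta)
  also have "borel_measurable (M \<Otimes>\<^sub>M borel) = borel_measurable (M \<Otimes>\<^sub>M (lborel :: 'b measure))" by auto
  finally show ?thesis .
qed

lemma kernel_field_bounded:
  assumes "kernel_approx r e Q t F" shows "\<exists>B. \<forall>z. \<bar>cell_integral W t (F z) x\<bar> \<le> B"
proof -
  obtain B where B: "\<And>z l. \<bar>F z l\<bar> \<le> B" using kernel_approxD(3)[OF assms] by blast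
  have "\<bar>cell_integral W t (F z) x\<bar> \<le> (\<Sum>l\<in>t ` half_space. B * \<bar>W (cell t l) x\<bar>)" for z unfolding cell_integral_def
    by (rule order_trans[OF sum_abs]) (intro sum_mono, simp add: abs_mult mult_right_mono B)
  then show ?thesis by blast
qed

lemma kernel_field_borel:
  assumes "kernel_approx r e Q t F"
  shows "(\<lambda>z. cell_integral W t (F z) x) \<in> borel_measurable borel"
  unfolding cell_integral_def by (intro borel_measurable_sum borel_measurable_times kernel_approxD(2)[OF assms]) simp

text \<open>On the common refinement the difference of two fields is the field of the difference of
  the coefficients. Both coefficients approximate the same kernel, so the integral of the p-th power
  of their difference is at most 4 (d1 + d2), and \<open>cell_field_small\<close> applies.\<close>

lemma kernel_field_diff_small:
  fixes r :: real
  assumes p: "\<alpha> < p" "1 \<le> p" "p < 2" and r: "r \<le> r'" and b: "0 < b"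
  shows "\<exists>d>0. \<forall>d1 d2 t \<sigma> F G. kernel_approx r d1 {\<alpha>, p} t F \<and> kernel_approx r' d2 {\<alpha>, p} \<sigma> (G :: real \<times> (real^'n) => nat => real)
      \<and> 0 < d1 \<and> 0 < d2 \<and> d1 + d2 \<le> d -->
    prob {y\<in>space M. b < (LBINT z. indicator (cball 0 r) z * \<bar>cell_integral W \<sigma> (G z) y - cell_integral W t (F z) y\<bar>)} \<le> b"
proof -
  define D where "D = half_space \<inter> cball (0 :: real \<times> (real^'n)) (3 * r')"
  have "emeasure lborel D \<le> emeasure lborel (cball (0 :: real \<times> (real^'n)) (3 * r'))" unfolding D_def by (intro emeasure_mono) auto
  also have "... < \<infinity>" by (intro emeasure_compact_finite) simp
  finally have D: "D \<in> finite_borel" by (intro finite_borelI) (auto simp: D_def)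
  have K: "cball 0 r \<in> sets borel" "emeasure lborel (cball (0 :: real \<times> (real^'n)) r) < \<infinity>" using emeasure_compact_finite[of "cball 0 r"] by auto
  obtain d where d: "d > 0" and small: "\<forall>\<kappa> (H :: real \<times> (real^'n) => nat \<times> nat => real). labelling \<kappa> \<and> (\<forall>z. \<forall>l\<in>\<kappa> ` half_space. H z l \<noteq> 0 --> cell \<kappa> l \<subseteq> D) \<and>
      (\<forall>l. (\<lambda>z. H z l) \<in> borel_measurable borel) \<and> (\<forall>z\<in>cball 0 r. stable_norm p (\<lambda>w. H z (\<kappa> w)) \<le> ennreal d) -->
    prob {y\<in>space M. ennreal b < (\<integral>\<^sup>+z. indicator (cball 0 r) z * ennreal \<bar>cell_integral W \<kappa> (H z) y\<bar> \<partial>lborel)} \<le> b"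
    using cell_field_small[OF D K p(1,2) less_imp_le[OF p(3)] b, where 'l="nat \<times> nat"] by auto
  have main: "prob {y\<in>space M. b < (LBINT z. indicator (cball 0 r) z * \<bar>cell_integral W \<sigma> (G z) y - cell_integral W t (F z) y\<bar>)} \<le> b"
    if F: "kernel_approx r d1 {\<alpha>, p} t F" and G: "kernel_approx r' d2 {\<alpha>, p} \<sigma> G" and e: "0 < d1" "0 < d2" "d1 + d2 \<le> d / 4"
    for d1 d2 t \<sigma> and F G :: "real \<times> (real^'n) => nat => real"
  proof -
    let ?D = "\<lambda>z y. \<bar>cell_integral W \<sigma> (G z) y - cell_integral W t (F z) y\<bar>"
    note FD = kernel_approxD[OF F] and GD = kernel_approxD[OF G]
    define \<kappa> where "\<kappa> w = (t w, \<sigma> w)" for w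
    define H where "H z l = G z (snd l) - F z (fst l)" for z l
    have \<kappa>: "labelling \<kappa>" unfolding \<kappa>_def by (rule labelling_pair[OF FD(1) GD(1)])
    have Hs: "\<forall>z. \<forall>l\<in>\<kappa> ` half_space. H z l \<noteq> 0 --> cell \<kappa> l \<subseteq> D"
    proof (intro allI ballI impI)
      fix z l assume "H z l \<noteq> 0"
      then have nz: "F z (fst l) \<noteq> 0 \<or> G z (snd l) \<noteq> 0" unfolding H_def by simp
      have ck: "cell \<kappa> l \<subseteq> cell t (fst l)" "cell \<kappa> l \<subseteq> cell \<sigma> (snd l)" unfolding cell_def \<kappa>_def by auto
      have cb: "cball 0 (3 * r) \<subseteq> cball 0 (3 * r')" using r by auto
      have "cell \<kappa> l \<subseteq> cball 0 (3 * r')" using nz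
      proof
        assume "F z (fst l) \<noteq> 0"
        then show ?thesis by (intro order_trans[OF ck(1)] order_trans[OF FD(5) cb])
      next
        assume "G z (snd l) \<noteq> 0"
        then show ?thesis by (intro order_trans[OF ck(2)] GD(5))
      qed
      then show "cell \<kappa> l \<subseteq> D" unfolding D_def using cell_subset[of \<kappa> l] by simp
    qed
    have Hm: "\<forall>l. (\<lambda>z. H z l) \<in> borel_measurable borel" unfolding H_def by (intro allI borel_measurable_diff FD(2) GD(2))
    have Hn: "\<forall>z\<in>cball 0 r. stable_norm p (\<lambda>w. H z (\<kappa> w)) \<le> ennreal d"
    proof
      fix z :: "real \<times> (real^'n)" assume z: "z \<in> cball 0 r"
      then have z': "z \<in> cball 0 r'" using r by auto
      have Em: "(\<lambda>w. wave_kernel (z - w)) \<in> borel_measurable (restrict_space lborel half_space)" by (intro measurable_restrict_space1) measurable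
      have Gm: "(\<lambda>w. G z (\<sigma> w)) \<in> borel_measurable (restrict_space lborel half_space)"
        by (intro borel_measurable_simple_function labelling_simple_function GD(1))
      have Fm: "(\<lambda>w. F z (t w)) \<in> borel_measurable (restrict_space lborel half_space)"
        by (intro borel_measurable_simple_function labelling_simple_function FD(1))
      have p0: "0 < p" "p < 2" using p by auto
      have "stable_norm p (\<lambda>w. H z (\<kappa> w)) \<le> 4 * (stable_norm p (\<lambda>w. G z (\<sigma> w) - wave_kernel (z - w)) + stable_norm p (\<lambda>w. F z (t w) - wave_kernel (z - w)))"
        unfolding H_def \<kappa>_def fst_conv snd_conv by (rule stable_norm_triangle[OF Gm Em Fm p0])
      also have "... \<le> 4 * (ennreal d2 + ennreal d1)" unfolding stable_norm_swap[where g="\<lambda>w. wave_kernel (z - w)"]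
        by (intro mult_left_mono add_mono GD(6)[OF z'] FD(6)[OF z]) auto
      also have "... = ennreal (4 * (d2 + d1))" using e by (simp add: ennreal_numeral_mult)
      also have "... \<le> ennreal d" using e by (intro ennreal_leI) auto
      finally show "stable_norm p (\<lambda>w. H z (\<kappa> w)) \<le> ennreal d" .
    qed
    have "AE y in M. \<forall>c. cell_adm t c --> cell_integral W t c y = cell_integral W \<kappa> (\<lambda>l. c (fst l)) y"
      "AE y in M. \<forall>c. cell_adm \<sigma> c --> cell_integral W \<sigma> c y = cell_integral W \<kappa> (\<lambda>l. c (snd l)) y"
      by (rule cell_integral_coarse[OF \<kappa>], simp add: \<kappa>_def)+
    \<comment> \<open>One exceptional set serves all z, since \<open>cell_integral_coarse\<close> is
      uniform in the coefficients.\<close>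
    then have AEd: "AE y in M. \<forall>z. cell_integral W \<sigma> (G z) y - cell_integral W t (F z) y = cell_integral W \<kappa> (H z) y"
    proof eventually_elim
      case (elim y)
      then show ?case using FD(9) GD(9) by (simp add: H_def[abs_def] cell_integral_diff)
    qed
    let ?J = "\<lambda>y. \<integral>z. indicator (cball 0 r) z * ?D z y \<partial>lborel"
    let ?N = "\<lambda>y. \<integral>\<^sup>+z. indicator (cball 0 r) z * ennreal \<bar>cell_integral W \<kappa> (H z) y\<bar> \<partial>lborel"
    let ?N' = "\<lambda>y. \<integral>\<^sup>+z. indicator (cball 0 r) z * ennreal (?D z y) \<partial>lborel"
    have JN: "?N' y = ennreal (?J y)" for y
    proof -
      obtain B1 where B1: "\<And>z. \<bar>cell_integral W \<sigma> (G z) y\<bar> \<le> B1" using kernel_field_bounded[OF G] by blast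
      obtain B2 where B2: "\<And>z. \<bar>cell_integral W t (F z) y\<bar> \<le> B2" using kernel_field_bounded[OF F] by blast
      have "integrable lborel (\<lambda>z. (?D z y) * indicator (cball 0 r) z)"
      proof (rule bounded_test_integrable[where B="B1 + B2" and C=1 and r=r])
        show "(\<lambda>z. (?D z y)) \<in> borel_measurable borel"
          by (intro borel_measurable_abs borel_measurable_diff kernel_field_borel[OF F] kernel_field_borel[OF G])
        show "\<bar>(?D z y)\<bar> \<le> B1 + B2" for z using B1[of z] B2[of z] by simp
      qed (use K in \<open>auto simp: indicator_def split: if_splits\<close>)
      then have "integrable lborel (\<lambda>z. indicator (cball 0 r) z * ?D z y)" by (simp add: mult.commute)
      from nn_integral_eq_integral[OF this]
      have "(\<integral>\<^sup>+z. ennreal (indicator (cball 0 r) z * ?D z y) \<partial>lborel) = ennreal (?J y)" by simp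
      moreover have "ennreal (indicator (cball 0 r) z * ?D z y)
         = indicator (cball 0 r) z * ennreal (?D z y)" for z by (simp add: indicator_def)
      ultimately show ?thesis by simp
    qed
    have Im: "(\<lambda>x. indicator (cball 0 r) (snd x) :: ennreal) \<in> borel_measurable (M \<Otimes>\<^sub>M (lborel :: (real \<times> (real^'n)) measure))"
      by (rule measurable_compose[OF measurable_snd borel_measurable_indicator]) simp
    have Nm': "{y\<in>space M. ennreal b < ?N' y} \<in> sets M"
    proof -
      note swap = measurable_swap_lborel[OF kernel_field_measurable[OF G]] measurable_swap_lborel[OF kernel_field_measurable[OF F]]
      have "(\<lambda>(y, z). indicator (cball 0 r) z * ennreal (?D z y)) \<in> borel_measurable (M \<Otimes>\<^sub>M lborel)" unfolding split_beta
        by (intro borel_measurable_times_ennreal Im measurable_compose[OF _ measurable_ennreal] borel_measurable_abs borel_measurable_diff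
            swap[unfolded fst_conv snd_conv])
      then show ?thesis by measurable
    qed
    have Nm: "{y\<in>space M. ennreal b < ?N y} \<in> sets M"
    proof -
      have cb: "cell \<kappa> l \<in> sets borel" for l using \<kappa> unfolding labelling_def by blast
      have "(\<lambda>x. cell_integral W \<kappa> (H (fst x)) (snd x)) \<in> borel_measurable (borel \<Otimes>\<^sub>M M)"
        by (rule cell_field_measurable[OF Hm[THEN spec]]) (rule finite_borel_subset[OF D cb Hs[rule_format]])
      note swap = measurable_swap_lborel[OF this]
      have "(\<lambda>(y, z). indicator (cball 0 r) z * ennreal \<bar>cell_integral W \<kappa> (H z) y\<bar>) \<in> borel_measurable (M \<Otimes>\<^sub>M lborel)" unfolding split_beta
        by (intro borel_measurable_times_ennreal Im measurable_compose[OF _ measurable_ennreal] borel_measurable_abs swap[unfolded fst_conv snd_conv])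
      then show ?thesis by measurable
    qed
    have "{y\<in>space M. b < ?J y} = {y\<in>space M. ennreal b < ?N' y}" unfolding JN using b by (auto simp: ennreal_less_iff)
    then have "prob {y\<in>space M. b < ?J y} = prob {y\<in>space M. ennreal b < ?N' y}" by simp
    also have "... \<le> b"
    proof -
      have "AE y in M. ?N' y = ?N y" using AEd by (rule AE_mp) (intro AE_I2 impI, simp only:)
      then have c: "AE y in M. y \<in> {y\<in>space M. ennreal b < ?N' y} \<longleftrightarrow> y \<in> {y\<in>space M. ennreal b < ?N y}" by auto
      have "prob {y\<in>space M. ennreal b < ?N' y} = prob {y\<in>space M. ennreal b < ?N y}" by (rule finite_measure_eq_AE[OF c Nm' Nm])
      also have "... \<le> b" by (rule small[THEN spec, THEN spec, THEN mp, OF conjI[OF \<kappa> conjI[OF Hs conjI[OF Hm Hn]]]])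
      finally show ?thesis .
    qed
    finally show ?thesis .
  qed
  show ?thesis by (intro exI[of _ "d / 4"] conjI allI impI, use d in simp, elim conjE, rule main, assumption+)
qed

text \<open>The exponent \<alpha> in the approximations serves to identify limits as stochastic
  integrals, the exponent p to bound the increments of the fields.\<close>

lemma kernel_sequence_exists:
  assumes n: "CARD('n) \<le> 2"
  obtains r t and F :: "nat => real \<times> (real^'n) => nat => real" and p where
    "\<And>k. kernel_approx (real (Suc k)) (r k) {\<alpha>, p} (t k) (F k)" "\<And>k. 0 < r k" "r \<longlonglongrightarrow> 0"
    "(\<lambda>k. r k powr \<alpha> * measure lborel (cball (0 :: real \<times> (real^'n)) (3 * real (Suc k)))) \<longlonglongrightarrow> 0"
    "\<And>k. prob {y\<in>space M. (1 / 2) ^ k < (\<integral>z. indicator (cball 0 (real (Suc k))) z *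
       \<bar>cell_integral W (t (Suc k)) (F (Suc k) z) y - cell_integral W (t k) (F k z) y\<bar> \<partial>lborel)} \<le> (1 / 2) ^ k"
proof -
  \<comment> \<open>The midpoint of max(1, \<alpha>) and 2 lies above \<alpha> and 1 and below
    2.\<close>
  define p where "p = (max 1 \<alpha> + 2) / 2"
  have p: "\<alpha> < p" "1 \<le> p" "p < 2" unfolding p_def using \<alpha> by auto
  define P where "P k d \<longleftrightarrow> 0 < d \<and> (\<forall>d1 d2 t \<sigma> F G. kernel_approx (real (Suc k)) d1 {\<alpha>, p} t F \<and> kernel_approx (real (Suc (Suc k))) d2 {\<alpha>, p} \<sigma> (G :: real \<times> (real^'n) => nat => real)
      \<and> 0 < d1 \<and> 0 < d2 \<and> d1 + d2 \<le> d -->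
    prob {y\<in>space M. (1 / 2) ^ k < (LBINT z. indicator (cball 0 (real (Suc k))) z * \<bar>cell_integral W \<sigma> (G z) y - cell_integral W t (F z) y\<bar>)} \<le> (1 / 2) ^ k)" for k d
  have "\<forall>k. \<exists>d. P k d" unfolding P_def by (intro allI kernel_field_diff_small p) auto
  then obtain e where e: "\<forall>k. P k (e k)" by (elim choice[THEN exE])
  then have e0: "e k > 0" for k unfolding P_def by blast
  define v where "v k = measure lborel (cball (0 :: real \<times> (real^'n)) (3 * real (Suc k)))" for k
  have v: "0 \<le> v k" for k unfolding v_def by simp
  \<comment> \<open>Three demands: small increments of the fields, errors tending to 0, and the same
    for the \<alpha>-th powers multiplied by the volumes of the growing balls. The minimum over
    \<open>{..k}\<close> below makes the errors decrease, so that the demand of index k also binds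
    the approximation with index k + 1.\<close>
  define m where "m j = min (e j / 2) (min ((1 / 2) ^ j) (((1 / 2) ^ j / (v j + 1)) powr (1 / \<alpha>)))" for j
  have m0: "m j > 0" for j unfolding m_def using e0[of j] v[of j] by simp
  define r where "r k = Min (m ` {..k})" for k
  have rm: "r k \<le> m k" for k unfolding r_def by simp
  have r0: "r k > 0" for k unfolding r_def using m0 by simp
  have rdec: "r (Suc k) \<le> r k" for k unfolding r_def by simp
  have "\<forall>k. \<exists>x. kernel_approx (real (Suc k)) (r k) {\<alpha>, p} (fst x) (snd x :: real \<times> (real^'n) => nat => real)"
  proof
    fix k
    have "\<exists>t (F :: real \<times> (real^'n) => nat => real). kernel_approx (real (Suc k)) (r k) {\<alpha>, p} t F"
      by (rule kernel_approx_exists[OF n _ r0]) (use \<alpha> p in auto)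
    then obtain t and F :: "real \<times> (real^'n) => nat => real" where "kernel_approx (real (Suc k)) (r k) {\<alpha>, p} t F" by (elim exE)
    then show "\<exists>x. kernel_approx (real (Suc k)) (r k) {\<alpha>, p} (fst x) (snd x :: real \<times> (real^'n) => nat => real)" by auto
  qed
  then obtain x where x: "\<forall>k. kernel_approx (real (Suc k)) (r k) {\<alpha>, p} (fst (x k)) (snd (x k) :: real \<times> (real^'n) => nat => real)"
    by (elim choice[THEN exE])
  have half: "(\<lambda>k. (1 / 2 :: real) ^ k) \<longlonglongrightarrow> 0" by (rule LIMSEQ_power_zero) simp
  show thesis
  proof (rule that[of r p "\<lambda>k. fst (x k)" "\<lambda>k. snd (x k)"])
    show "kernel_approx (real (Suc k)) (r k) {\<alpha>, p} (fst (x k)) (snd (x k))" for k using x by (rule spec)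
    show "0 < r k" for k by (rule r0)
    show "r \<longlonglongrightarrow> 0" by (rule tendsto_0_sandwich[OF less_imp_le[OF r0] _ half]) (use rm in \<open>auto simp: m_def\<close>)
    have "r k powr \<alpha> * v k \<le> (1 / 2) ^ k" for k
    proof -
      have "r k \<le> ((1 / 2) ^ k / (v k + 1)) powr (1 / \<alpha>)" using rm[of k] unfolding m_def by simp
      then have "r k powr \<alpha> \<le> (((1 / 2) ^ k / (v k + 1)) powr (1 / \<alpha>)) powr \<alpha>" using r0[of k] \<alpha> by (intro powr_mono2) auto
      also have "... = (1 / 2) ^ k / (v k + 1)" unfolding powr_powr using \<alpha> v[of k] by simp
      finally have "r k powr \<alpha> * v k \<le> (1 / 2) ^ k / (v k + 1) * v k" using v[of k] by (rule mult_right_mono)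
      also have "... = (1 / 2) ^ k * (v k / (v k + 1))" by simp
      also have "... \<le> (1 / 2) ^ k * 1" using v[of k] by (intro mult_left_mono) auto
      finally show ?thesis by simp
    qed
    then have "(\<lambda>k. r k powr \<alpha> * v k) \<longlonglongrightarrow> 0" by (rule tendsto_0_sandwich[rotated, OF _ half]) (use v in simp)
    then show "(\<lambda>k. r k powr \<alpha> * measure lborel (cball (0 :: real \<times> (real^'n)) (3 * real (Suc k)))) \<longlonglongrightarrow> 0" unfolding v_def .
    fix k
    have "r k + r (Suc k) \<le> e k" using rdec[of k] rm[of k] unfolding m_def by simp
    then show "prob {y\<in>space M. (1 / 2) ^ k < (\<integral>z. indicator (cball 0 (real (Suc k))) z *
       \<bar>cell_integral W (fst (x (Suc k))) (snd (x (Suc k)) z) y - cell_integral W (fst (x k)) (snd (x k) z) y\<bar> \<partial>lborel)} \<le> (1 / 2) ^ k"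
      using e[THEN spec, of k, unfolded P_def, THEN conjunct2, THEN spec, THEN spec, THEN spec, THEN spec, THEN spec, THEN spec, THEN mp,
        OF conjI[OF x[THEN spec] conjI[OF x[THEN spec] conjI[OF r0 conjI[OF r0]]]]] by blast
  qed
qed

text \<open>For a step kernel, pairing with \<open>f\<close> exchanges an integral with a finite
  sum. In the half space the error of the resulting coefficients is at most C e, by the second norm
  bound of \<open>kernel_approx\<close>, and vanishes off the ball of radius 3 r.\<close>

lemma kernel_field_test:
  fixes F :: "real \<times> (real^'n) => nat => real"
  assumes n: "CARD('n) \<le> 2" and K: "kernel_approx r e Q t F" and f: "f \<in> test_functions"
    and C: "\<And>z. \<bar>f z\<bar> \<le> C" and supp: "\<And>z. f z \<noteq> 0 ==> norm z \<le> r" and e: "0 < e" and q: "0 < q"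
  defines "c \<equiv> (\<lambda>l. LBINT z. F z l * f z)"
  shows "cell_adm t c" and "(LBINT z. cell_integral W t (F z) x * f z) = cell_integral W t c x"
    and "stable_norm q (\<lambda>w. (LBINT v. wave_kernel v * f (w + v)) - c (t w))
      \<le> ennreal ((C * e) powr q * measure lborel (cball (0 :: real \<times> (real^'n)) (3 * r)))"
proof -
  note KD = kernel_approxD[OF K]
  have fm[measurable]: "f \<in> borel_measurable borel" by (rule test_functions_borel[OF f])
  note Fm[measurable] = KD(2)
  have C0: "0 \<le> C" using C[of 0] by simp
  obtain B where B: "\<And>z l. \<bar>F z l\<bar> \<le> B" using KD(3) by blast
  have int: "integrable lborel (\<lambda>z. F z l * f z)" for l by (rule bounded_test_integrable[OF Fm fm B C supp])
  have cnz: "\<exists>z. F z l \<noteq> 0" if "c l \<noteq> 0" for l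
  proof (rule ccontr)
    assume "\<not> (\<exists>z. F z l \<noteq> 0)"
    then have z: "F z l = 0" for z by blast
    have "c l = 0" unfolding c_def z by simp
    then show False using that by blast
  qed
  show "cell_adm t c" unfolding cell_adm_def using cnz KD(8) by blast
  show "(LBINT z. cell_integral W t (F z) x * f z) = cell_integral W t c x"
  proof -
    have "(LBINT z. cell_integral W t (F z) x * f z) = (LBINT z. (\<Sum>l\<in>t ` half_space. W (cell t l) x * (F z l * f z)))"
      unfolding cell_integral_def sum_distrib_right by (simp only: mult_ac)
    also have "... = (\<Sum>l\<in>t ` half_space. (LBINT z. W (cell t l) x * (F z l * f z)))"
      by (rule Bochner_Integration.integral_sum[OF integrable_mult_right[OF int]])
    also have "... = cell_integral W t c x" unfolding cell_integral_def c_def by (simp add: mult.commute)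
    finally show ?thesis .
  qed
  have E: "locally_integrable (wave_kernel :: real \<times> (real^'n) => real)" by (rule wave_kernel_locally_integrable[OF n])
  let ?g = "\<lambda>w. \<integral>v. wave_kernel v * f (w + v) \<partial>lborel"
  have bound: "\<bar>?g w - c (t w)\<bar> \<le> C * e" if w: "w \<in> half_space" for w
  proof -
    have cw: "c (t w) = (LBINT v. F (w + v) (t w) * f (w + v))" unfolding c_def by (rule lborel_integral_shift[symmetric]) measurable
    have i1: "integrable lborel (\<lambda>v. wave_kernel v * f (w + v))" by (rule test_functions_locally_integrable_mult[OF E test_functions_shift[OF f]])
    have i2: "integrable lborel (\<lambda>v. F (w + v) (t w) * f (w + v))"
    proof (rule bounded_test_integrable[where B=B and C=C and r="r + norm w"])
      fix v assume "f (w + v) \<noteq> 0"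
      then have "norm (w + v) \<le> r" by (rule supp)
      then show "norm v \<le> r + norm w" using norm_triangle_ineq4[of "w + v" w] by simp
    qed (use B C in \<open>simp_all, measurable\<close>)
    have "ennreal \<bar>?g w - c (t w)\<bar> = ennreal (norm (LBINT v. wave_kernel v * f (w + v) - F (w + v) (t w) * f (w + v)))"
      unfolding cw using i1 i2 by simp
    also have "... \<le> (\<integral>\<^sup>+v. ennreal (norm (wave_kernel v * f (w + v) - F (w + v) (t w) * f (w + v))) \<partial>lborel)"
      by (intro integral_norm_bound_ennreal Bochner_Integration.integrable_diff i1 i2)
    also have "... = (\<integral>\<^sup>+v. ennreal \<bar>(wave_kernel (v - w) - F v (t w)) * f v\<bar> \<partial>lborel)"
      using nn_integral_reflect_translate(2)[of "\<lambda>v. ennreal \<bar>(wave_kernel (v - w) - F v (t w)) * f v\<bar>" "- w"]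
      by (simp add: left_diff_distrib add.commute)
    also have "... \<le> (\<integral>\<^sup>+z. ennreal C * (indicator (cball 0 r) z * ennreal \<bar>wave_kernel (z - w) - F z (t w)\<bar>) \<partial>lborel)"
    proof (intro nn_integral_mono)
      fix z
      show "ennreal \<bar>(wave_kernel (z - w) - F z (t w)) * f z\<bar> \<le> ennreal C * (indicator (cball 0 r) z * ennreal \<bar>wave_kernel (z - w) - F z (t w)\<bar>)"
      proof (cases "f z = 0")
        case False
        have "\<bar>(wave_kernel (z - w) - F z (t w)) * f z\<bar> \<le> C * \<bar>wave_kernel (z - w) - F z (t w)\<bar>"
          using mult_right_mono[OF C[of z], of "\<bar>wave_kernel (z - w) - F z (t w)\<bar>"] by (simp only: abs_mult mult.commute)
        then have "ennreal \<bar>(wave_kernel (z - w) - F z (t w)) * f z\<bar> \<le> ennreal C * ennreal \<bar>wave_kernel (z - w) - F z (t w)\<bar>"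
          using C0 by (simp add: ennreal_mult[symmetric])
        then show ?thesis using supp[OF False] by simp
      qed simp
    qed
    also have "... = ennreal C * (\<integral>\<^sup>+z. indicator (cball 0 r) z * ennreal \<bar>wave_kernel (z - w) - F z (t w)\<bar> \<partial>lborel)"
      by (intro nn_integral_cmult borel_measurable_times_ennreal borel_measurable_indicator) (simp_all add: borel_closed)
    also have "... \<le> ennreal C * ennreal e" by (intro mult_left_mono KD(7)[OF w]) simp
    also have "... = ennreal (C * e)" using C0 e by (simp add: ennreal_mult)
    finally show ?thesis using C0 e by simp
  qed
  have out: "?g w - c (t w) = 0" if w: "w \<in> half_space" "w \<notin> cball 0 (3 * r)" for w
  proof -
    have "wave_kernel v * f (w + v) = 0" for v
    proof (rule ccontr)
      assume a: "wave_kernel v * f (w + v) \<noteq> 0"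
      then have "norm (w + v) \<le> r" "wave_kernel ((w + v) - w) \<noteq> 0" using supp[of "w + v"] by auto
      then have "norm w \<le> 3 * r" by (rule wave_kernel_past[OF w(1)])
      then show False using w by simp
    qed
    then have "?g w = 0" by (simp only: Bochner_Integration.integral_zero)
    moreover have "c (t w) = 0"
    proof (rule ccontr)
      assume "c (t w) \<noteq> 0"
      then have "cell t (t w) \<subseteq> cball 0 (3 * r)" using cnz KD(5) by blast
      then show False using w unfolding cell_def by blast
    qed
    ultimately show ?thesis by simp
  qed
  have "stable_norm q (\<lambda>w. ?g w - c (t w)) = (\<integral>\<^sup>+w. ennreal (\<bar>?g w - c (t w)\<bar> powr q) * indicator half_space w \<partial>lborel)"
    by (rule nn_integral_half_space)
  also have "... \<le> (\<integral>\<^sup>+w. ennreal ((C * e) powr q) * indicator (cball (0 :: real \<times> (real^'n)) (3 * r)) w \<partial>lborel)"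
  proof (intro nn_integral_mono)
    fix w
    show "ennreal (\<bar>?g w - c (t w)\<bar> powr q) * indicator half_space w \<le> ennreal ((C * e) powr q) * indicator (cball 0 (3 * r)) w"
    proof (cases "w \<in> half_space")
      case True
      show ?thesis
      proof (cases "w \<in> cball 0 (3 * r)")
        case inb: True
        have "\<bar>?g w - c (t w)\<bar> powr q \<le> (C * e) powr q" using bound[OF True] q by (intro powr_mono2) auto
        then show ?thesis using True inb by simp
      next
        case False
        show ?thesis unfolding out[OF True False] by simp
      qed
    qed simp
  qed
  also have "... = ennreal ((C * e) powr q) * emeasure lborel (cball (0 :: real \<times> (real^'n)) (3 * r))" by (rule nn_integral_cmult_indicator) simp
  also have "... = ennreal ((C * e) powr q * measure lborel (cball (0 :: real \<times> (real^'n)) (3 * r)))"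
    using emeasure_compact_finite[of "cball (0 :: real \<times> (real^'n)) (3 * r)"] by (simp add: emeasure_eq_ennreal_measure ennreal_mult)
  finally show "stable_norm q (\<lambda>w. ?g w - c (t w)) \<le> ennreal ((C * e) powr q * measure lborel (cball (0 :: real \<times> (real^'n)) (3 * r)))" .
qed

text \<open>The pairings of the step fields with \<open>f\<close>, and their values at a fixed z,
  are integrals of simple functions that approximate the desired integrands in the \<alpha>-th
  power. Their almost sure limits, expressed by Y, are therefore the stochastic integrals. This
  takes the place of a stochastic Fubini theorem.\<close>

theorem wave_field_exists:
  assumes n: "CARD('n) \<le> 2"
    and gL: "\<And>f :: real \<times> (real^'n) => real. f \<in> test_functions ==> (\<lambda>w. LBINT v. wave_kernel v * f (w + v)) \<in> L_space \<alpha>"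
  obtains Y :: "real \<times> (real^'n) => 'w => real" where
    "(\<lambda>(z, s). Y z s) \<in> borel_measurable (borel \<Otimes>\<^sub>M M)" "AE s in M. locally_integrable (\<lambda>z. Y z s)"
    "\<And>f. f \<in> test_functions ==> has_stoch_integral M \<alpha> W (\<lambda>w. LBINT v. wave_kernel v * f (w + v)) (\<lambda>s. LBINT z. Y z s * f z)"
    "AE z in lborel. has_stoch_integral M \<alpha> W (\<lambda>w. wave_kernel (z - w)) (Y z)"
proof -
  obtain d r and F :: "nat => real \<times> (real^'n) => nat => real" and p where
    K: "\<And>k. kernel_approx (real (Suc k)) (d k) {\<alpha>, p} (r k) (F k)" and d: "\<And>k. 0 < d k" "d \<longlonglongrightarrow> 0"
    and dv: "(\<lambda>k. d k powr \<alpha> * measure lborel (cball (0 :: real \<times> (real^'n)) (3 * real (Suc k)))) \<longlonglongrightarrow> 0"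
    and small: "\<And>k. prob {s\<in>space M. (1 / 2) ^ k < (\<integral>z. indicator (cball 0 (real (Suc k))) z *
       \<bar>cell_integral W (r (Suc k)) (F (Suc k) z) s - cell_integral W (r k) (F k z) s\<bar> \<partial>lborel)} \<le> (1 / 2) ^ k"
    by (rule kernel_sequence_exists[OF n], rule that, assumption+)
  define y where "y k z s = cell_integral W (r k) (F k z) s" for k z s
  define Y where "Y z s = lim (\<lambda>k. y k z s)" for z s
  have ym: "(\<lambda>x. y k (fst x) (snd x)) \<in> borel_measurable (borel \<Otimes>\<^sub>M M)" for k unfolding y_def by (rule kernel_field_measurable[OF K])
  have yb: "(\<lambda>z. y k z s) \<in> borel_measurable borel" "\<exists>B. \<forall>z. \<bar>y k z s\<bar> \<le> B" for k s
    unfolding y_def by (rule kernel_field_borel[OF K], rule kernel_field_bounded[OF K])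
  have Ym: "(\<lambda>x. Y (fst x) (snd x)) \<in> borel_measurable (borel \<Otimes>\<^sub>M M)" unfolding Y_def by (rule borel_measurable_lim_metric[OF ym])
  define Z where "Z k s = (LBINT z. indicator (cball 0 (real (Suc k))) z * \<bar>y (Suc k) z s - y k z s\<bar>)" for k s
  have Zm: "Z k \<in> borel_measurable M" for k
  proof -
    have "(\<lambda>(s, z). indicator (cball 0 (real (Suc k))) z * \<bar>y (Suc k) z s - y k z s\<bar>) \<in> borel_measurable (M \<Otimes>\<^sub>M lborel)"
      unfolding split_beta by (intro borel_measurable_times borel_measurable_abs borel_measurable_diff measurable_compose[OF measurable_snd borel_measurable_indicator]
          measurable_swap_lborel[OF ym, unfolded fst_conv snd_conv]) simp
    then show ?thesis unfolding Z_def by simp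
  qed
  have AEs: "AE s in M. summable (\<lambda>k. Z k s)"
  proof (rule AE_summable_prob[where C=1, OF Zm])
    show "0 \<le> Z k s" for k s unfolding Z_def by simp
    show "prob {s\<in>space M. Z k s > (1 / 2) ^ k} \<le> 1 * (1 / 2) ^ k" for k unfolding Z_def y_def using small[of k] by simp
  qed
  note L = local_L1_limit[where y="\<lambda>k z. y k z s" for s, OF yb] local_L1_limit_ball[where y="\<lambda>k z. y k z s" for s, OF yb]
  show thesis
  proof (rule that[of Y])
    show "(\<lambda>(z, s). Y z s) \<in> borel_measurable (borel \<Otimes>\<^sub>M M)" unfolding split_beta by (rule Ym)
    show "AE s in M. locally_integrable (\<lambda>z. Y z s)" using AEs by (rule AE_mp) (intro AE_I2 impI, unfold Y_def Z_def, rule L(5))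
  next
    fix f :: "real \<times> (real^'n) => real" assume f: "f \<in> test_functions"
    obtain C where C: "C > 0" "\<And>z. \<bar>f z\<bar> \<le> C" by (rule test_functions_bounded[OF f], rule that, assumption+)
    obtain R where R: "\<And>z. f z \<noteq> 0 ==> norm z \<le> R" using f unfolding test_functions_iff by blast
    obtain N where N: "R \<le> real N" using real_arch_simple by blast
    have supp: "norm z \<le> real N" if "f z \<noteq> 0" for z using R[OF that] N by simp
    have supp': "norm z \<le> real (Suc (k + N))" if "f z \<noteq> 0" for z k using supp[OF that] by simp
    \<comment> \<open>From index N on the balls contain all points where \<open>f\<close> does not
      vanish.\<close>
    define c where "c k l = (LBINT z. F (k + N) z l * f z)" for k l
    note T = kernel_field_test[OF n K f C(2) supp' d(1) \<alpha>(1), folded c_def]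
    define t where "t k w = c k (r (k + N) w)" for k w
    have lab: "labelling (r k)" for k by (rule kernel_approxD(1)[OF K])
    have ts: "simple (t k)" for k unfolding t_def by (rule simple_cells[OF lab T(1)])
    have AEt: "AE s in M. \<forall>k. simple_stoch_integral W (t k) s = cell_integral W (r (k + N)) (c k) s"
      unfolding AE_all_countable by (intro allI simple_stoch_integral_coarse[OF lab ts]) (simp add: t_def)
    show "has_stoch_integral M \<alpha> W (\<lambda>w. LBINT v. wave_kernel v * f (w + v)) (\<lambda>s. LBINT z. Y z s * f z)"
    proof (rule has_stoch_integralI_AE[OF gL[OF f] ts])
      have "(\<lambda>k. C powr \<alpha> * (d (k + N) powr \<alpha> * measure lborel (cball (0 :: real \<times> (real^'n)) (3 * real (Suc (k + N)))))) \<longlonglongrightarrow> C powr \<alpha> * 0"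
        by (intro tendsto_mult tendsto_const LIMSEQ_ignore_initial_segment[OF dv])
      then have "(\<lambda>k. (C * d (k + N)) powr \<alpha> * measure lborel (cball (0 :: real \<times> (real^'n)) (3 * real (Suc (k + N))))) \<longlonglongrightarrow> 0"
        by (simp only: powr_mult mult.assoc mult_zero_right)
      then have "(\<lambda>k. ennreal ((C * d (k + N)) powr \<alpha> * measure lborel (cball (0 :: real \<times> (real^'n)) (3 * real (Suc (k + N)))))) \<longlonglongrightarrow> 0"
        by (simp only: ennreal_0[symmetric] tendsto_ennrealI)
      then show "(\<lambda>k. stable_norm \<alpha> (\<lambda>w. (LBINT v. wave_kernel v * f (w + v)) - t k w)) \<longlonglongrightarrow> 0"
        unfolding t_def by (rule tendsto_0_sandwich[rotated 2]) (rule zero_le, rule T(3))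
      have "(\<lambda>(s, z). Y z s * f z) \<in> borel_measurable (M \<Otimes>\<^sub>M lborel)"
        unfolding split_beta by (intro borel_measurable_times measurable_swap_lborel[OF Ym, unfolded fst_conv snd_conv]) (use test_functions_borel[OF f] in simp)
      then show "(\<lambda>s. LBINT z. Y z s * f z) \<in> borel_measurable M" by simp
      show "AE s in M. (\<lambda>k. simple_stoch_integral W (t k) s) \<longlonglongrightarrow> (LBINT z. Y z s * f z)" using AEs AEt
      proof eventually_elim
        case (elim s)
        have "(\<lambda>k. LBINT z. y k z s * f z) \<longlonglongrightarrow> (LBINT z. Y z s * f z)"
          unfolding Y_def by (rule L(3)[OF elim(1)[unfolded Z_def] test_functions_borel[OF f] C(2) supp])
        then have "(\<lambda>k. LBINT z. y (k + N) z s * f z) \<longlonglongrightarrow> (LBINT z. Y z s * f z)" by (rule LIMSEQ_ignore_initial_segment)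
        moreover have "(LBINT z. y (k + N) z s * f z) = simple_stoch_integral W (t k) s" for k unfolding y_def elim(2)[rule_format] by (rule T(2))
        ultimately show ?case by simp
      qed
    qed
  next
    have lab: "labelling (r k)" for k by (rule kernel_approxD(1)[OF K])
    \<comment> \<open>Convergence is known for almost every outcome at almost every point.
      Exchanging the two quantifiers, by the measurability \<open>Cm\<close>, yields almost sure
      convergence at almost every fixed z.\<close>
    have "AE s in M. AE z in lborel. Cauchy (\<lambda>k. y k z s)" using AEs by (rule AE_mp) (rule AE_I2, rule impI, unfold Z_def, rule L(4))
    moreover interpret Q: pair_sigma_finite lborel M ..
    have Cm: "{x\<in>space (lborel \<Otimes>\<^sub>M M). Cauchy (\<lambda>k. y k (fst x) (snd x))} \<in> sets (lborel \<Otimes>\<^sub>M M)"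
      by (rule sets_Collect_Cauchy) (use ym in \<open>simp cong: measurable_cong_sets sets_pair_measure_cong\<close>)
    ultimately have "AE z in lborel. AE s in M. Cauchy (\<lambda>k. y k z s)" using Q.AE_commute[OF Cm] by blast
    then show "AE z in lborel. has_stoch_integral M \<alpha> W (\<lambda>w. wave_kernel (z - w)) (Y z)"
    proof (rule AE_mp, intro AE_I2 impI)
      fix z assume ae: "AE s in M. Cauchy (\<lambda>k. y k z s)"
      obtain N where N: "norm z \<le> real N" using real_arch_simple by blast
      have z: "z \<in> cball 0 (real (Suc (k + N)))" for k using N by simp
      define t where "t k w = F (k + N) z (r (k + N) w)" for k w
      have ts: "simple (t k)" for k unfolding t_def by (rule simple_cells[OF lab kernel_approxD(9)[OF K]])
      have AEt: "AE s in M. \<forall>k. simple_stoch_integral W (t k) s = cell_integral W (r (k + N)) (F (k + N) z) s"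
        unfolding AE_all_countable by (intro allI simple_stoch_integral_coarse[OF lab ts]) (simp add: t_def)
      show "has_stoch_integral M \<alpha> W (\<lambda>w. wave_kernel (z - w)) (Y z)"
      proof (rule has_stoch_integralI_AE[OF wave_kernel_L_space[OF n \<alpha>] ts])
        have "(\<lambda>k. ennreal (d (k + N))) \<longlonglongrightarrow> ennreal 0" by (intro tendsto_ennrealI LIMSEQ_ignore_initial_segment[OF d(2)])
        then have "(\<lambda>k. ennreal (d (k + N))) \<longlonglongrightarrow> 0" by simp
        then show "(\<lambda>k. stable_norm \<alpha> (\<lambda>w. wave_kernel (z - w) - t k w)) \<longlonglongrightarrow> 0"
          unfolding t_def by (rule tendsto_0_sandwich[rotated 2]) (rule zero_le, rule kernel_approxD(6)[OF K z], simp)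
        show "Y z \<in> borel_measurable M" using measurable_compose[OF measurable_Pair1' Ym, of z] by simp
        show "AE s in M. (\<lambda>k. simple_stoch_integral W (t k) s) \<longlonglongrightarrow> Y z s" using ae AEt
        proof eventually_elim
          case (elim s)
          have "(\<lambda>k. y k z s) \<longlonglongrightarrow> Y z s" unfolding Y_def using elim(1) by (simp only: convergent_LIMSEQ_iff[symmetric] Cauchy_convergent_iff)
          then have "(\<lambda>k. y (k + N) z s) \<longlonglongrightarrow> Y z s" by (rule LIMSEQ_ignore_initial_segment)
          then show ?case unfolding y_def using elim(2) by simp
        qed
      qed
    qed
  qed
qed

end

section \<open>Uniqueness of the random field\<close>

definition rational_points :: "'a::euclidean_space set" where
  "rational_points = {x. \<forall>b\<in>Basis. x \<bullet> b \<in> \<rat>}"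

lemma countable_rational_points: "countable (rational_points :: 'a::euclidean_space set)"
proof -
  have "rational_points \<subseteq> (\<lambda>f. \<Sum>b\<in>Basis. f b *\<^sub>R b) ` (Basis \<rightarrow>\<^sub>E (\<rat> :: real set) :: ('a => real) set)"
  proof
    fix x assume "x \<in> rational_points"
    then have "(\<lambda>b\<in>Basis. x \<bullet> b) \<in> Basis \<rightarrow>\<^sub>E \<rat>" unfolding rational_points_def by auto
    moreover have "x = (\<Sum>b\<in>Basis. (\<lambda>b\<in>Basis. x \<bullet> b) b *\<^sub>R b)" by (rule trans[OF euclidean_representation[symmetric]]) (intro sum.cong, auto)
    ultimately show "x \<in> (\<lambda>f. \<Sum>b\<in>Basis. f b *\<^sub>R b) ` (Basis \<rightarrow>\<^sub>E (\<rat> :: real set))" by blast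
  qed
  then show ?thesis by (rule countable_subset) (intro countable_image countable_PiE countable_rat finite_Basis)
qed

text \<open>It is essential for the almost sure statements that countably many test functions suffice.\<close>

lemma locally_integrable_eq_AE:
  fixes f g :: "'a::euclidean_space => real"
  assumes f: "locally_integrable f" and g: "locally_integrable g"
    and eq: "\<And>l u n. l \<in> rational_points ==> u \<in> rational_points ==>
      (LBINT z. f z * box_bump l u (real n) z) = (LBINT z. g z * box_bump l u (real n) z)"
  shows "AE z in lborel. f z = g z"
proof -
  have [measurable]: "f \<in> borel_measurable borel" "g \<in> borel_measurable borel" using f g unfolding locally_integrable_def by auto
  define h where "h z = f z - g z" for z
  have [measurable]: "h \<in> borel_measurable borel" unfolding h_def by simp
  have bm[measurable]: "box_bump l u c \<in> borel_measurable borel" for l u and c by (rule test_functions_borel[OF box_bump_test])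
  have hi: "integrable lborel (\<lambda>z. h z * indicator (box l u) z)" for l u
  proof -
    have "set_integrable lborel (cbox l u) f" "set_integrable lborel (cbox l u) g" using f g unfolding locally_integrable_def by auto
    then have "integrable lborel (\<lambda>z. indicator (cbox l u) z *\<^sub>R f z - indicator (cbox l u) z *\<^sub>R g z)" unfolding set_integrable_def by simp
    then show ?thesis by (rule Bochner_Integration.integrable_bound) (use box_subset_cbox[of l u] in \<open>auto simp: indicator_def h_def\<close>)
  qed
  have hb: "(LBINT z. h z * box_bump l u (real n) z) = 0" if "l \<in> rational_points" "u \<in> rational_points" for l u n
    unfolding h_def left_diff_distrib using eq[OF that, of n]
      test_functions_locally_integrable_mult[OF f box_bump_test] test_functions_locally_integrable_mult[OF g box_bump_test] by simp
  have h0: "(LBINT z. h z * indicator (box l u) z) = 0" if lu: "l \<in> rational_points" "u \<in> rational_points" for l u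
  proof -
    have "(\<lambda>n. LBINT z. h z * box_bump l u (real n) z) \<longlonglongrightarrow> (LBINT z. h z * indicator (box l u) z)"
    proof (rule integral_dominated_convergence[OF _ _ integrable_abs[OF hi[of l u]]])
      show "AE z in lborel. (\<lambda>n. h z * box_bump l u (real n) z) \<longlonglongrightarrow> h z * indicator (box l u) z"
        by (intro AE_I2 tendsto_mult tendsto_const box_bump_tendsto)
      show "AE z in lborel. norm (h z * box_bump l u (real n) z) \<le> \<bar>h z * indicator (box l u) z\<bar>" for n
      proof (intro AE_I2)
        fix z
        show "norm (h z * box_bump l u (real n) z) \<le> \<bar>h z * indicator (box l u) z\<bar>"
          using box_bump_bounds[of l u "real n" z] box_bump_zero[of z l u "real n"]
          by (cases "z \<in> box l u") (auto simp: abs_mult intro!: mult_left_le)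
      qed
    qed measurable
    then show ?thesis unfolding hb[OF lu] using LIMSEQ_unique[OF tendsto_const[of 0]] by simp
  qed
  define E where "E = (\<lambda>(l, u). box l u) ` (rational_points \<times> rational_points :: ('a \<times> 'a) set)"
  \<comment> \<open>\<open>ennreal\<close> cuts off at 0, so \<open>pos\<close> and
    \<open>neg\<close> are the positive and the negative part of h. The rational boxes are closed
    under intersection, generate the Borel sets and have the same finite mass under both densities,
    which therefore coincide.\<close>
  define pos where "pos z = ennreal (h z)" for z
  define neg where "neg z = ennreal (- h z)" for z
  have [measurable]: "pos \<in> borel_measurable borel" "neg \<in> borel_measurable borel" unfolding pos_def neg_def by auto
  have cE: "countable E" unfolding E_def by (intro countable_image countable_SIGMA countable_rational_points)
  have U: "\<exists>I\<subseteq>E. S = \<Union>I" if S: "open S" for S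
  proof -
    let ?a = "\<lambda>f :: 'a => real \<times> real. (\<Sum>i\<in>Basis. fst (f i) *\<^sub>R i)"
    let ?b = "\<lambda>f :: 'a => real \<times> real. (\<Sum>i\<in>Basis. snd (f i) *\<^sub>R i)"
    let ?I = "{f\<in>Basis \<rightarrow>\<^sub>E \<rat> \<times> \<rat>. box (?a f) (?b f) \<subseteq> S}"
    have "S = (\<Union>f\<in>?I. box (?a f) (?b f))" by (rule open_UNION_box[OF S])
    moreover have "box (?a f) (?b f) \<in> E" if "f \<in> ?I" for f
    proof -
      have "f b \<in> \<rat> \<times> \<rat>" if "b \<in> Basis" for b using \<open>f \<in> ?I\<close> that by auto
      then have "?a f \<in> rational_points" "?b f \<in> rational_points" unfolding rational_points_def by (auto simp: mem_Times_iff)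
      then show ?thesis unfolding E_def by force
    qed
    ultimately show ?thesis by (intro exI[of _ "(\<lambda>f. box (?a f) (?b f)) ` ?I"]) blast
  qed
  have sig: "sets (borel :: 'a measure) = sigma_sets UNIV E"
  proof
    have "sigma_sets UNIV {S :: 'a set. open S} \<subseteq> sigma_sets UNIV E"
    proof (rule sigma_sets_mono, rule subsetI)
      fix S :: "'a set" assume "S \<in> {S. open S}"
      then obtain I where I: "I \<subseteq> E" "S = \<Union>I" using U by blast
      show "S \<in> sigma_sets UNIV E" unfolding I(2) by (rule sigma_sets_UNION[OF countable_subset[OF I(1) cE]]) (use I(1) in blast)
    qed
    then show "sets (borel :: 'a measure) \<subseteq> sigma_sets UNIV E" unfolding borel_def by simp
    have "E \<subseteq> sets borel" unfolding E_def by auto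
    then show "sigma_sets UNIV E \<subseteq> sets borel" using sets.sigma_sets_subset[of E borel] by simp
  qed
  have dens: "density lborel pos = density lborel neg"
  proof (rule measure_eqI_generator_eq_countable[where E=E and A=E and \<Omega>=UNIV])
    show "Int_stable E" unfolding Int_stable_def
    proof (intro ballI)
      fix A B assume "A \<in> E" "B \<in> E"
      then obtain a b c d where ab: "A = box a b" "B = box c d" "a \<in> rational_points" "b \<in> rational_points" "c \<in> rational_points" "d \<in> rational_points"
        unfolding E_def by auto
      have "A \<inter> B = box (\<Sum>i\<in>Basis. max (a \<bullet> i) (c \<bullet> i) *\<^sub>R i) (\<Sum>i\<in>Basis. min (b \<bullet> i) (d \<bullet> i) *\<^sub>R i)" unfolding ab(1,2) by (rule box_Int_box)
      moreover have "(\<Sum>i\<in>Basis. max (a \<bullet> i) (c \<bullet> i) *\<^sub>R i) \<in> rational_points" "(\<Sum>i\<in>Basis. min (b \<bullet> i) (d \<bullet> i) *\<^sub>R i) \<in> rational_points"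
        using ab(3-6) unfolding rational_points_def by (auto simp: max_def min_def)
      ultimately show "A \<inter> B \<in> E" unfolding E_def by force
    qed
    show "\<Union>E = UNIV" using U[OF open_UNIV] by blast
    have X: "emeasure (density lborel pos) X = emeasure (density lborel neg) X \<and> emeasure (density lborel pos) X \<noteq> \<infinity>" if XE: "X \<in> E" for X
    proof -
      obtain l u where lu: "l \<in> rational_points" "u \<in> rational_points" "X = box l u" using XE unfolding E_def by auto
      have [measurable]: "X \<in> sets borel" unfolding lu(3) by simp
      let ?h = "\<lambda>z. h z * indicator X z"
      have hX: "integrable lborel ?h" unfolding lu(3) by (rule hi)
      have ip: "integrable lborel (\<lambda>z. max 0 (?h z))" "integrable lborel (\<lambda>z. max 0 (- ?h z))" using hX by auto
      have p: "emeasure (density lborel pos) X = ennreal (LBINT z. max 0 (?h z))"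
      proof -
        have "emeasure (density lborel pos) X = (\<integral>\<^sup>+z. ennreal (max 0 (?h z)) \<partial>lborel)"
          by (subst emeasure_density, measurable) (intro nn_integral_cong, auto simp: pos_def indicator_def max_def ennreal_neg)
        also have "... = ennreal (LBINT z. max 0 (?h z))" by (rule nn_integral_eq_integral[OF ip(1)]) simp
        finally show ?thesis .
      qed
      have n: "emeasure (density lborel neg) X = ennreal (LBINT z. max 0 (- ?h z))"
      proof -
        have "emeasure (density lborel neg) X = (\<integral>\<^sup>+z. ennreal (max 0 (- ?h z)) \<partial>lborel)"
          by (subst emeasure_density, measurable) (intro nn_integral_cong, auto simp: neg_def indicator_def max_def ennreal_neg)
        also have "... = ennreal (LBINT z. max 0 (- ?h z))" by (rule nn_integral_eq_integral[OF ip(2)]) simp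
        finally show ?thesis .
      qed
      have "(LBINT z. max 0 (?h z)) - (LBINT z. max 0 (- ?h z)) = (LBINT z. max 0 (?h z) - max 0 (- ?h z))" using ip by simp
      also have "... = (LBINT z. ?h z)" by (intro Bochner_Integration.integral_cong) auto
      also have "... = 0" unfolding lu(3) by (rule h0[OF lu(1,2)])
      finally show ?thesis unfolding p n by simp
    qed
    show "emeasure (density lborel pos) X = emeasure (density lborel neg) X" if "X \<in> E" for X using X[OF that] by blast
    show "emeasure (density lborel pos) X \<noteq> \<infinity>" if "X \<in> E" for X using X[OF that] by blast
  qed (use cE sig in \<open>simp_all add: E_def\<close>)
  have "AE z in lborel. pos z = neg z" by (rule sigma_finite_measure.density_unique[OF sigma_finite_lborel _ _ dens]) measurable
  then show ?thesis
  proof eventually_elim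
    case (elim z)
    then have "ennreal (h z) = ennreal (- h z)" unfolding pos_def neg_def .
    then have "h z = 0" by (cases "h z \<ge> 0") (auto simp: ennreal_neg)
    then show ?case unfolding h_def by simp
  qed
qed

section \<open>Conclusions for dimensions one and two\<close>

lemma AE_reflect:
  fixes z :: "'a::euclidean_space"
  assumes ae: "AE v in lborel. P v" and P: "{v. P v} \<in> sets borel"
  shows "AE w in lborel. P (z - w)"
proof -
  have [measurable]: "Measurable.pred borel P" using P by (simp add: pred_def)
  have "(\<integral>\<^sup>+w. indicator {v. \<not> P v} (z - w) \<partial>lborel) = (\<integral>\<^sup>+w. indicator {v. \<not> P v} w \<partial>lborel)" by (rule nn_integral_reflect_translate(1)) measurable
  also have "... = 0" using ae AE_iff_nn_integral[of lborel P] P by simp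
  finally have "(\<integral>\<^sup>+w. indicator {w. \<not> P (z - w)} w \<partial>lborel) = 0" by (simp add: indicator_def)
  moreover have "{w. P (z - w)} \<in> sets lborel" by simp
  ultimately show ?thesis using AE_iff_nn_integral[of lborel "\<lambda>w. P (z - w)"] by simp
qed

lemma conv_check_wave_kernel:
  assumes "represented_by \<rho> wave_kernel" "f \<in> test_functions"
  shows "conv_check f \<rho> = (\<lambda>w. LBINT v. wave_kernel v * f (w + v))"
  using assms test_functions_shift[OF assms(2)] unfolding conv_check_def represented_by_def by auto

context stable_noise begin

lemma random_field_exists_low_dim:
  fixes \<rho> :: "(real \<times> (real^'n) => real) => real"
  assumes n: "CARD('n) \<le> 2" and \<rho>: "wave_fundamental_solution \<rho>"
  obtains Y where "random_field_representation M (u_gen M \<alpha> W \<rho>) Y"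
    "AE z in lborel. has_stoch_integral M \<alpha> W (\<lambda>w. wave_kernel (z - w)) (Y z)"
proof -
  have r: "represented_by \<rho> wave_kernel" by (rule wave_kernel_represents[OF \<rho> n])
  have gL: "(\<lambda>w. LBINT v. wave_kernel v * f (w + v)) \<in> L_space \<alpha>" if "f \<in> test_functions" for f :: "real \<times> (real^'n) => real"
    using wave_generalized_solution_exists[OF \<rho> \<alpha>(1)] that unfolding generalized_solution_exists_def conv_check_wave_kernel[OF r that, symmetric] by blast
  obtain Y :: "real \<times> (real^'n) => 'w => real" where Y: "(\<lambda>(z, x). Y z x) \<in> borel_measurable (borel \<Otimes>\<^sub>M M)" "AE x in M. locally_integrable (\<lambda>z. Y z x)"
    "\<And>f. f \<in> test_functions ==> has_stoch_integral M \<alpha> W (\<lambda>w. LBINT v. wave_kernel v * f (w + v)) (\<lambda>x. LBINT z. Y z x * f z)"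
    "AE z in lborel. has_stoch_integral M \<alpha> W (\<lambda>w. wave_kernel (z - w)) (Y z)"
    by (rule wave_field_exists[OF n gL], assumption, rule that, assumption+)
  show thesis
  proof (rule that[OF _ Y(4)])
    show "random_field_representation M (u_gen M \<alpha> W \<rho>) Y" unfolding random_field_representation_def
    proof (intro conjI ballI Y(1,2))
      fix f :: "real \<times> (real^'n) => real" assume f: "f \<in> test_functions"
      show "AE x in M. u_gen M \<alpha> W \<rho> f x = (LBINT z. Y z x * f z)"
        using stoch_integral_eq[OF Y(3)[OF f]] unfolding u_gen_def conv_check_wave_kernel[OF r f] by auto
    qed
  qed
qed

text \<open>Countably many bumps leave one null set of outcomes, off which the two paths agree
  almost everywhere. The order of outcome and point is then exchanged.\<close>

lemma random_field_unique:
  assumes X: "random_field_representation M u X" and Y: "random_field_representation M u Y"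
  shows "AE z in lborel. AE y in M. X z y = Y z y"
proof -
  have Xm: "(\<lambda>x. X (fst x) (snd x)) \<in> borel_measurable (borel \<Otimes>\<^sub>M M)" and Ym: "(\<lambda>x. Y (fst x) (snd x)) \<in> borel_measurable (borel \<Otimes>\<^sub>M M)"
    and loc: "AE y in M. locally_integrable (\<lambda>z. X z y)" "AE y in M. locally_integrable (\<lambda>z. Y z y)"
    and r: "\<And>f. f \<in> test_functions ==> AE y in M. u f y = (LBINT z. X z y * f z)" "\<And>f. f \<in> test_functions ==> AE y in M. u f y = (LBINT z. Y z y * f z)"
    using X Y unfolding random_field_representation_def by auto
  have "AE y in M. (LBINT z. X z y * f z) = (LBINT z. Y z y * f z)" if "f \<in> test_functions" for f using r(1)[OF that] r(2)[OF that] by auto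
  then have "AE y in M. \<forall>l\<in>rational_points. \<forall>u\<in>rational_points. \<forall>n.
      (LBINT z. X z y * box_bump l u (real n) z) = (LBINT z. Y z y * box_bump l u (real n) z)"
    by (intro AE_ball_countable' countable_rational_points) (simp add: AE_all_countable box_bump_test)
  then have "AE y in M. AE z in lborel. X z y = Y z y" using loc
  proof eventually_elim
    case (elim y)
    show ?case by (rule locally_integrable_eq_AE[OF elim(2,3)]) (use elim(1) in blast)
  qed
  moreover interpret Q: pair_sigma_finite lborel M ..
  have "{x\<in>space (borel \<Otimes>\<^sub>M M). X (fst x) (snd x) = Y (fst x) (snd x)} \<in> sets (borel \<Otimes>\<^sub>M M)" using Xm Ym by simp
  then have "{x\<in>space (lborel \<Otimes>\<^sub>M M). X (fst x) (snd x) = Y (fst x) (snd x)} \<in> sets (lborel \<Otimes>\<^sub>M M)" by (simp add: space_pair_measure)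
  from Q.AE_commute[OF this] have "(AE z in lborel. AE y in M. X z y = Y z y) \<longleftrightarrow> (AE y in M. AE z in lborel. X z y = Y z y)" .
  ultimately show ?thesis by blast
qed

text \<open>A function representing \<rho> equals \<open>wave_kernel\<close> almost everywhere, so
  after reflection at z the two integrands differ on a null set only. In this sense
  \<open>u_mild\<close> does not depend on the choice of \<open>f\<close>.\<close>

lemma u_mild_eq:
  fixes \<rho> :: "(real \<times> (real^'n) => real) => real"
  assumes n: "CARD('n) \<le> 2" and \<rho>: "wave_fundamental_solution \<rho>" and f: "represented_by \<rho> f"
    and X: "has_stoch_integral M \<alpha> W (\<lambda>w. wave_kernel (z - w)) X"
  shows "AE q in M. X q = u_mild M \<alpha> W f z q"
proof -
  have r: "represented_by \<rho> wave_kernel" by (rule wave_kernel_represents[OF \<rho> n])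
  have fm[measurable]: "f \<in> borel_measurable borel" using f unfolding represented_by_def locally_integrable_def by blast
  have rf: "\<rho> g = (LBINT z. f z * g z)" "\<rho> g = (LBINT z. wave_kernel z * g z)" if "g \<in> test_functions" for g
    using f r that unfolding represented_by_def by blast+
  have "AE v in lborel. f v = wave_kernel v"
  proof (rule locally_integrable_eq_AE)
    show "(LBINT z. f z * box_bump l u (real n) z) = (LBINT z. wave_kernel z * box_bump l u (real n) z)" for l u n using rf[OF box_bump_test] by simp
  qed (use f r in \<open>simp_all add: represented_by_def\<close>)
  then have ae: "AE w in lborel. f (z - w) = wave_kernel (z - w)" by (rule AE_reflect) measurable
  have m: "(\<lambda>w. f (z - w)) \<in> borel_measurable borel" by measurable
  have E: "(\<lambda>w. wave_kernel (z - w)) \<in> L_space \<alpha>" by (rule wave_kernel_L_space[OF n \<alpha>])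
  have "(\<integral>\<^sup>+w. ennreal (\<bar>f (z - w)\<bar> powr \<alpha>) * indicator half_space w \<partial>lborel) = (\<integral>\<^sup>+w. ennreal (\<bar>wave_kernel (z - w)\<bar> powr \<alpha>) * indicator half_space w \<partial>lborel)"
    by (rule nn_integral_cong_AE) (use ae in eventually_elim, simp)
  also have "... < \<infinity>" using L_space_finite[OF E] by (simp only: nn_integral_half_space)
  finally have L: "(\<lambda>w. f (z - w)) \<in> L_space \<alpha>" using L_space_borel[OF m] by blast
  have "AE w in restrict_space lborel half_space. wave_kernel (z - w) = f (z - w)"
    by (subst AE_restrict_space_iff) (simp, use ae in eventually_elim, simp)
  from stoch_integral_eq[OF has_stoch_integral_cong_AE[OF X L this]]
  have "AE q in M. X q = stoch_integral M \<alpha> W (\<lambda>w. f (z - w)) q" .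
  moreover have "u_mild M \<alpha> W f z = stoch_integral M \<alpha> W (\<lambda>w. f (z - w))"
  proof -
    obtain t x where z: "z = (t, x)" by (cases z)
    have "(\<lambda>(s, y). f (t - s, x - y)) = (\<lambda>w. f ((t, x) - w))" by auto
    then show ?thesis unfolding u_mild_def z by simp
  qed
  ultimately show ?thesis by simp
qed

end

theorem theorem6p11:
  fixes M :: "'w measure"
    and \<alpha> :: real
    and W :: "(real \<times> (real^'n)) set \<Rightarrow> 'w \<Rightarrow> real"
    and \<rho> :: "(real \<times> (real^'n) \<Rightarrow> real) \<Rightarrow> real"
  assumes "prob_space M"
    and "0 < \<alpha>" and "\<alpha> < 2"
    and "stable_white_noise M \<alpha> W"
    and "wave_fundamental_solution \<rho>"
  shows "generalized_solution_exists \<alpha> \<rho>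
    \<and> (mild_solution_exists \<alpha> \<rho> \<longleftrightarrow> CARD('n) \<le> 2)
    \<and> ((\<exists>Y. random_field_representation M (u_gen M \<alpha> W \<rho>) Y) \<longleftrightarrow> CARD('n) \<le> 2)
    \<and> (\<forall>Y f. random_field_representation M (u_gen M \<alpha> W \<rho>) Y \<and> represented_by \<rho> f \<longrightarrow>
         (AE z in lborel. z \<in> half_space \<longrightarrow> (AE \<omega> in M. Y z \<omega> = u_mild M \<alpha> W f z \<omega>)))"
proof -
  interpret prob_space M by fact
  interpret stable_noise M \<alpha> W by unfold_locales fact+
  note \<rho> = assms(5)
  have gen: "generalized_solution_exists \<alpha> \<rho>" by (rule wave_generalized_solution_exists[OF \<rho> assms(2)])
  show ?thesis
  proof (cases "CARD('n) \<le> 2")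
    case True
    obtain Y0 where Y0: "random_field_representation M (u_gen M \<alpha> W \<rho>) Y0"
      "AE z in lborel. has_stoch_integral M \<alpha> W (\<lambda>w. wave_kernel (z - w)) (Y0 z)"
      by (rule random_field_exists_low_dim[OF True \<rho>], rule that, assumption+)
    have "(\<lambda>(s, y). wave_kernel (t - s, x - y)) \<in> L_space \<alpha>" for t and x :: "real^'n"
    proof -
      have "(\<lambda>(s, y). wave_kernel (t - s, x - y)) = (\<lambda>w. wave_kernel ((t, x) - w))" by auto
      then show ?thesis using wave_kernel_L_space[OF True assms(2,3), of "(t, x)"] by simp
    qed
    then have mild: "mild_solution_exists \<alpha> \<rho>" unfolding mild_solution_exists_def using wave_kernel_represents[OF \<rho> True] by blast
    have "AE z in lborel. z \<in> half_space --> (AE \<omega> in M. Y z \<omega> = u_mild M \<alpha> W f z \<omega>)"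
      if Y: "random_field_representation M (u_gen M \<alpha> W \<rho>) Y" and f: "represented_by \<rho> f" for Y f using random_field_unique[OF Y Y0(1)] Y0(2)
    proof eventually_elim
      case (elim z)
      have "AE \<omega> in M. Y0 z \<omega> = u_mild M \<alpha> W f z \<omega>" by (rule u_mild_eq[OF True \<rho> f elim(2)])
      with elim(1) have "AE \<omega> in M. Y z \<omega> = u_mild M \<alpha> W f z \<omega>" by auto
      then show ?case by blast
    qed
    then show ?thesis using gen mild Y0(1) True by blast
  next
    \<comment> \<open>No field \<open>Y\<close> exists in this case, so the last claim is
      void.\<close>
    case False
    then have n: "CARD('n) \<ge> 3" by simp
    have "\<not> mild_solution_exists \<alpha> \<rho>" unfolding mild_solution_exists_def using no_function_high_dim[OF n \<rho>] by blast
    then show ?thesis using gen False no_random_field_high_dim[OF n \<rho>] by blast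
  qed
qed

end
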